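(* Let $\theta_1,\theta_2>0$, let $b_0\in\mathbb{R}\setminus\{0\}$, and let $\alpha>\frac12$. Then solutions to the Gross-Pitaevskii hierarchy on the two-dimensional torus $\Lambda_2$ are unique in the class $\widetilde{\mathcal{A}}(\alpha)$: if $(\widetilde\gamma^{(k)}(t))_{k\in\mathbb{N}}$ and $(\widetilde\sigma^{(k)}(t))_{k\in\mathbb{N}}$ are two solutions of the hierarchy, both belonging to $\widetilde{\mathcal{A}}(\alpha)$ and having the same initial data at $t=0$, then they are equal.
   Context: **Torus.** $\Lambda_2=(\mathbb{R}/\frac{2\pi}{\theta_1}\mathbb{Z})\times(\mathbb{R}/\frac{2\pi}{\theta_2}\mathbb{Z})$, where $\theta_1,\theta_2>0$ are arbitrary (their ratio may be irrational). **Density matrices.** A density matrix of order $k$ on $\Lambda_2$ is a complex-valued function $\gamma^{(k)}(\vec x_k;\vec x_k')$ on $\Lambda_2^k\times\Lambda_2^k$, with $\vec x_k=(x_1,\dots,x_k)$, $\vec x'_k=(x_1',\dots,x_k')$. Its Fourier transform is $$\widehat{\gamma}^{(k)}(\vec\xi_k;\vec\xi_k')=\int_{\Lambda_2^k\times\Lambda_2^k}\gamma^{(k)}(\vec x_k;\vec x_k')e^{-i\sum_j x_j\cdot\xi_j+i\sum_j x_j'\cdot\xi_j'}\,d\vec x_k\,d\vec x_k',\qquad \xi_j,\xi_j'\in\theta_1\mathbb{Z}\times\theta_2\mathbb{Z}.$$ For $\alpha\in\mathbb{R}$, $S^{(k,\alpha)}$ is the Fourier multiplier operator $$(S^{(k,\alpha)}\gamma^{(k)})\widehat{\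 }(\vec\xi_k;\vec\xi_k')=\prod_{j=1}^k\langle\xi_j\rangle^\alpha\prod_{j=1}^k\langle\xi'_j\rangle^\alpha\,\widehat\gamma^{(k)}(\vec\xi_k;\vec\xi_k'),\qquad \langle x\rangle=\sqrt{1+|x|^2}.$$ **Collision operator.** For $1\le j\le k$, $B_{j,k+1}$ maps density matrices of order $k+1$ to density matrices of order $k$: $$B_{j,k+1}\gamma^{(k+1)}(\vec x_k;\vec x_k')=\int_{\Lambda_2}dx_{k+1}\big(\delta(x_j-x_{k+1})-\delta(x_j'-x_{k+1})\big)\gamma^{(k+1)}(\vec x_k,x_{k+1};\vec x_k',x_{k+1}),$$ that is, formally, $\gamma^{(k+1)}(\vec x_k,x_j;\vec x_k',x_j)-\gamma^{(k+1)}(\vec x_k,x_j';\vec x_k',x_j')$. **Gross-Pitaevskii hierarchy on $\Lambda_2$.** For a sequence of time-dependent density matrices $\gamma^{(k)}=\gamma^{(k)}(t)$ of order $k$, $k\in\mathbb{N}$: $$i\partial_t\gamma^{(k)}+(\Delta_{\vec x_k}-\Delta_{\vec x_k'})\gamma^{(k)}=b_0\sum_{j=1}^kB_{j,k+1}(\gamma^{(k+1)}),\qquad \gamma^{(k)}|_{t=0}=\gamma_0^{(k)},$$ where $\Delta_{\vec x_k}=\sum_{j=1}^k\Delta_{x_j}$, $\Delta_{\vec x_k'}=\sum_{j=1}^k\Delta_{x_j'}$. The equation is understood in integrated (Duhamel) form: $$\gamma^{(k)}(t)=\mathcal U^{(k)}(t)\gamma_0^{(k)}-ib_0\int_0^t\mathcal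 U^{(k)}(t-s)\sum_{j=1}^kB_{j,k+1}(\gamma^{(k+1)}(s))\,ds,\qquad \mathcal U^{(k)}(t)\gamma^{(k)}=e^{it\Delta_{\vec x_k}}\gamma^{(k)}e^{-it\Delta_{\vec x_k'}},$$ i.e. $\mathcal U^{(k)}(t)$ multiplies the Fourier transform by $e^{-it\sum_j(|\xi_j|^2-|\xi_j'|^2)}$. **Class $\widetilde{\mathcal A}(\alpha)$.** The class of all time-dependent sequences $(\widetilde\gamma^{(k)}(t))_k$ with $\widetilde\gamma^{(k)}:\mathbb{R}_t\times\Lambda_2^k\times\Lambda_2^k\to\mathbb{C}$ such that: (i) for all $t$, all $x_1,\dots,x_k,x_1',\dots,x_k'\in\Lambda_2$, and all permutations $\sigma$ of $\{1,\dots,k\}$, $\widetilde\gamma^{(k)}(t,x_{\sigma(1)},\dots,x_{\sigma(k)};x'_{\sigma(1)},\dots,x'_{\sigma(k)})=\widetilde\gamma^{(k)}(t,x_1,\dots,x_k;x_1',\dots,x_k')$; (ii) there exist positive continuous functions $\widetilde f,\widetilde g:\mathbb{R}\to\mathbb{R}$, independent of $k$, such that for all $t\in\mathbb{R}$, all $k\in\mathbb{N}$ and all $j\in\{1,\dots,k\}$, $$\int_{t-\widetilde g(t)}^{t+\widetilde g(t)}\|S^{(k,\alpha)}B_{j,k+1}(\widetilde\gamma^{(k+1)})(s)\|_{L^2(\Lambda_2^k\times\Lambda_2^k)}\,ds\le\widetilde f(t)^{k+1}.$$ *)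

theory Defs
  imports "HOL-Analysis.Analysis"
begin

type_synonym point = "real \<times> real"

text \<open>Configurations of \<open>k\<close> particles, and \<open>k\<close>-tuples of frequencies, are functions supported on the
  index set \<open>{1..k}\<close> (extensional, as usual for \<^const>\<open>PiM\<close> and \<^const>\<open>PiE\<close>).\<close>

type_synonym config = "nat \<Rightarrow> point"
type_synonym density = "config \<Rightarrow> config \<Rightarrow> complex"

text \<open>A distribution on the \<open>2k\<close>-fold torus is identified with its Fourier transform.\<close>

type_synonym fourier_data = "config \<Rightarrow> config \<Rightarrow> complex"

text \<open>The torus is realised as its fundamental domain. Functions on the torus are the functions on
  this half-open box, and only the measure of the torus is used.\<close>

definition torus :: "real \<Rightarrow> real \<Rightarrow> point measure" where
  "torus \<theta>1 \<theta>2 = restrict_space lborel ({0..<2 * pi / \<theta>1} \<times> {0..<2 * pi / \<theta>2})"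

definition torus_power :: "real \<Rightarrow> real \<Rightarrow> nat \<Rightarrow> config measure" where
  "torus_power \<theta>1 \<theta>2 k = PiM {1..k} (\<lambda>_. torus \<theta>1 \<theta>2)"

definition phase_space :: "real \<Rightarrow> real \<Rightarrow> nat \<Rightarrow> (config \<times> config) measure" where
  "phase_space \<theta>1 \<theta>2 k = torus_power \<theta>1 \<theta>2 k \<Otimes>\<^sub>M torus_power \<theta>1 \<theta>2 k"

definition dual_lattice :: "real \<Rightarrow> real \<Rightarrow> point set" where
  "dual_lattice \<theta>1 \<theta>2 = {(\<theta>1 * of_int m, \<theta>2 * of_int n) | m n. True}"

definition frequencies :: "real \<Rightarrow> real \<Rightarrow> nat \<Rightarrow> config set" where
  "frequencies \<theta>1 \<theta>2 k = PiE {1..k} (\<lambda>_. dual_lattice \<theta>1 \<theta>2)"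

definition density_matrix :: "real \<Rightarrow> real \<Rightarrow> nat \<Rightarrow> density \<Rightarrow> bool" where
  "density_matrix \<theta>1 \<theta>2 k \<gamma> \<longleftrightarrow> integrable (phase_space \<theta>1 \<theta>2 k) (\<lambda>(x, x'). \<gamma> x x')"

definition fourier :: "real \<Rightarrow> real \<Rightarrow> nat \<Rightarrow> density \<Rightarrow> fourier_data" where
  "fourier \<theta>1 \<theta>2 k \<gamma> \<xi> \<xi>' =
    (\<integral>(x, x'). \<gamma> x x' * cis (- (\<Sum>j=1..k. x j \<bullet> \<xi> j) + (\<Sum>j=1..k. x' j \<bullet> \<xi>' j))
      \<partial>phase_space \<theta>1 \<theta>2 k)"

definition japanese :: "point \<Rightarrow> real" where
  "japanese x = sqrt (1 + (norm x)\<^sup>2)"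

definition S_op :: "nat \<Rightarrow> real \<Rightarrow> fourier_data \<Rightarrow> fourier_data" where
  "S_op k \<alpha> c \<xi> \<xi>' =
    of_real ((\<Prod>j=1..k. japanese (\<xi> j) powr \<alpha>) * (\<Prod>j=1..k. japanese (\<xi>' j) powr \<alpha>)) * c \<xi> \<xi>'"

definition U_op :: "nat \<Rightarrow> real \<Rightarrow> fourier_data \<Rightarrow> fourier_data" where
  "U_op k t c \<xi> \<xi>' = cis (- t * (\<Sum>j=1..k. (norm (\<xi> j))\<^sup>2 - (norm (\<xi>' j))\<^sup>2)) * c \<xi> \<xi>'"

text \<open>The \<open>L\<^sup>2\<close> norm of the function with the given Fourier transform. Such a function is unique up to
  null sets; if there is none in \<open>L\<^sup>2\<close>, the infimum is over the empty set and the norm is \<open>\<infinity>\<close>.\<close>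

definition L2_norm :: "real \<Rightarrow> real \<Rightarrow> nat \<Rightarrow> fourier_data \<Rightarrow> ennreal" where
  "L2_norm \<theta>1 \<theta>2 k c =
    (INF F \<in> {F :: density.
        (\<lambda>(x, x'). F x x') \<in> borel_measurable (phase_space \<theta>1 \<theta>2 k) \<and>
        integrable (phase_space \<theta>1 \<theta>2 k) (\<lambda>(x, x'). (cmod (F x x'))\<^sup>2) \<and>
        (\<forall>\<xi>\<in>frequencies \<theta>1 \<theta>2 k. \<forall>\<xi>'\<in>frequencies \<theta>1 \<theta>2 k.
          fourier \<theta>1 \<theta>2 k F \<xi> \<xi>' = c \<xi> \<xi>')}.
      ennreal (sqrt (\<integral>(x, x'). (cmod (F x x'))\<^sup>2 \<partial>phase_space \<theta>1 \<theta>2 k)))"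

text \<open>Elements of \<open>L\<^sup>1\<close> have no values on the diagonals, so the Dirac masses in the collision operator
  are replaced by the partial sums of their Fourier series. The collision operator is the limit in the
  sense of distributions, that is, coefficientwise on the Fourier side.

  The regularised kernel uses \<open>\<delta>(x\<^sub>j - y) \<delta>(x\<^sub>j - y')\<close> for the evaluation of both \<open>x\<^bsub>k+1\<^esub>\<close> and
  \<open>x'\<^bsub>k+1\<^esub>\<close> at \<open>x\<^sub>j\<close>, and correspondingly with \<open>x'\<^sub>j\<close>.\<close>

definition dirac_partial :: "real \<Rightarrow> real \<Rightarrow> nat \<Rightarrow> point \<Rightarrow> complex" where
  "dirac_partial \<theta>1 \<theta>2 N x =
    of_real (1 / ((2 * pi / \<theta>1) * (2 * pi / \<theta>2))) *
    (\<Sum>\<eta>\<in>{\<eta> \<in> dual_lattice \<theta>1 \<theta>2. norm \<eta> \<le> real N}. cis (x \<bullet> \<eta>))"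

definition collision_partial ::
  "real \<Rightarrow> real \<Rightarrow> nat \<Rightarrow> nat \<Rightarrow> nat \<Rightarrow> density \<Rightarrow> density" where
  "collision_partial \<theta>1 \<theta>2 N k j \<gamma> x x' =
    (\<integral>(y, y').
      (dirac_partial \<theta>1 \<theta>2 N (x j - y) * dirac_partial \<theta>1 \<theta>2 N (x j - y')
        - dirac_partial \<theta>1 \<theta>2 N (x' j - y) * dirac_partial \<theta>1 \<theta>2 N (x' j - y'))
      * \<gamma> (x(k + 1 := y)) (x'(k + 1 := y'))
      \<partial>(torus \<theta>1 \<theta>2 \<Otimes>\<^sub>M torus \<theta>1 \<theta>2))"

definition collision_defined :: "real \<Rightarrow> real \<Rightarrow> nat \<Rightarrow> nat \<Rightarrow> density \<Rightarrow> bool" where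
  "collision_defined \<theta>1 \<theta>2 k j \<gamma> \<longleftrightarrow>
    (\<forall>\<xi>\<in>frequencies \<theta>1 \<theta>2 k. \<forall>\<xi>'\<in>frequencies \<theta>1 \<theta>2 k.
      convergent (\<lambda>N. fourier \<theta>1 \<theta>2 k (collision_partial \<theta>1 \<theta>2 N k j \<gamma>) \<xi> \<xi>'))"

text \<open>The Fourier transform of \<open>B\<^bsub>j,k+1\<^esub> \<gamma>\<close>, for \<open>\<gamma>\<close> of order \<open>k + 1\<close>; meaningful under
  \<^const>\<open>collision_defined\<close>.\<close>

definition collision :: "real \<Rightarrow> real \<Rightarrow> nat \<Rightarrow> nat \<Rightarrow> density \<Rightarrow> fourier_data" where
  "collision \<theta>1 \<theta>2 k j \<gamma> \<xi> \<xi>' =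
    lim (\<lambda>N. fourier \<theta>1 \<theta>2 k (collision_partial \<theta>1 \<theta>2 N k j \<gamma>) \<xi> \<xi>')"

text \<open>Sequences are indexed by \<open>k \<ge> 1\<close>; the entry at \<open>0\<close> is irrelevant. Measurability in time is
  that of a curve in \<open>L\<^sup>1\<close>, tested on Fourier coefficients.\<close>

definition density_sequence :: "real \<Rightarrow> real \<Rightarrow> (nat \<Rightarrow> real \<Rightarrow> density) \<Rightarrow> bool" where
  "density_sequence \<theta>1 \<theta>2 \<gamma> \<longleftrightarrow>
    (\<forall>k\<ge>1. (\<forall>t. density_matrix \<theta>1 \<theta>2 k (\<gamma> k t)) \<and>
      (\<forall>\<xi>\<in>frequencies \<theta>1 \<theta>2 k. \<forall>\<xi>'\<in>frequencies \<theta>1 \<theta>2 k.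
        (\<lambda>t. fourier \<theta>1 \<theta>2 k (\<gamma> k t) \<xi> \<xi>') \<in> borel_measurable lborel))"

definition collisions_defined :: "real \<Rightarrow> real \<Rightarrow> (nat \<Rightarrow> real \<Rightarrow> density) \<Rightarrow> bool" where
  "collisions_defined \<theta>1 \<theta>2 \<gamma> \<longleftrightarrow>
    (\<forall>k\<ge>1. \<forall>j\<in>{1..k}. AE s in lborel. collision_defined \<theta>1 \<theta>2 k j (\<gamma> (k + 1) s))"

text \<open>The Duhamel formula is an identity between distributions, stated for their Fourier
  transforms. For \<open>t < 0\<close> the integral from \<open>0\<close> to \<open>t\<close> is the oriented one.\<close>

definition GP_solution ::
  "real \<Rightarrow> real \<Rightarrow> real \<Rightarrow> (nat \<Rightarrow> density) \<Rightarrow> (nat \<Rightarrow> real \<Rightarrow> density) \<Rightarrow> bool" where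
  "GP_solution \<theta>1 \<theta>2 b0 \<gamma>0 \<gamma> \<longleftrightarrow>
    density_sequence \<theta>1 \<theta>2 \<gamma> \<and> collisions_defined \<theta>1 \<theta>2 \<gamma> \<and>
    (\<forall>k\<ge>1. density_matrix \<theta>1 \<theta>2 k (\<gamma>0 k) \<and>
      (\<forall>t. \<forall>\<xi>\<in>frequencies \<theta>1 \<theta>2 k. \<forall>\<xi>'\<in>frequencies \<theta>1 \<theta>2 k.
        interval_lebesgue_integrable lborel (ereal 0) (ereal t)
          (\<lambda>s. U_op k (t - s) (\<lambda>\<zeta> \<zeta>'. \<Sum>j=1..k. collision \<theta>1 \<theta>2 k j (\<gamma> (k + 1) s) \<zeta> \<zeta>') \<xi> \<xi>') \<and>
        fourier \<theta>1 \<theta>2 k (\<gamma> k t) \<xi> \<xi>' =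
          U_op k t (fourier \<theta>1 \<theta>2 k (\<gamma>0 k)) \<xi> \<xi>'
          - \<i> * of_real b0 * (LBINT s=ereal 0..ereal t.
              U_op k (t - s) (\<lambda>\<zeta> \<zeta>'. \<Sum>j=1..k. collision \<theta>1 \<theta>2 k j (\<gamma> (k + 1) s) \<zeta> \<zeta>') \<xi> \<xi>')))"

definition class_A :: "real \<Rightarrow> real \<Rightarrow> real \<Rightarrow> (nat \<Rightarrow> real \<Rightarrow> density) set" where
  "class_A \<theta>1 \<theta>2 \<alpha> = {\<gamma>.
    density_sequence \<theta>1 \<theta>2 \<gamma> \<and> collisions_defined \<theta>1 \<theta>2 \<gamma> \<and>
    (\<forall>k\<ge>1. \<forall>t. \<forall>x\<in>space (torus_power \<theta>1 \<theta>2 k). \<forall>x'\<in>space (torus_power \<theta>1 \<theta>2 k).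
      \<forall>\<sigma>. \<sigma> permutes {1..k} \<longrightarrow> \<gamma> k t (x \<circ> \<sigma>) (x' \<circ> \<sigma>) = \<gamma> k t x x') \<and>
    (\<exists>f g :: real \<Rightarrow> real.
      continuous_on UNIV f \<and> continuous_on UNIV g \<and> (\<forall>t. f t > 0) \<and> (\<forall>t. g t > 0) \<and>
      (\<forall>t. \<forall>k\<ge>1. \<forall>j\<in>{1..k}.
        (\<integral>\<^sup>+s\<in>{t - g t..t + g t}.
            L2_norm \<theta>1 \<theta>2 k (S_op k \<alpha> (collision \<theta>1 \<theta>2 k j (\<gamma> (k + 1) s))) \<partial>lborel)
          \<le> ennreal (f t ^ (k + 1))))}"

end

theory Submission
  imports Defs "HOL-Probability.Probability" "HOL-Computational_Algebra.Primes"
begin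

text \<open>On the Fourier side the difference of two solutions is a hierarchy of coefficients, indexed by multisets of
  pairs of lattice points, with vanishing initial data. Iterating the Duhamel formula \<open>j\<close> times expands it
  into collision trees, and a time-ordering argument reduces the factorially many terms to at most \<open>2\<^sup>k 4\<^sup>j\<close>
  binary forests. A space-time estimate for a single collision controls each forest by \<open>(K T)\<^bsup>j/2\<^esup>\<close> times
  the class norm, so the difference vanishes on a short interval whose length depends continuously on the
  starting time; hence it vanishes for all times.

  The space-time estimate is a Schur test for a kernel that decays in the distance between two phases. It needs
  no arithmetic hypothesis on \<open>\<theta>1, \<theta>2\<close>: the phase is a sum of a multiple of \<open>u\<^sub>1 v\<^sub>1\<close> and a multiple of \<open>u\<^sub>2 v\<^sub>2\<close>
  with integers \<open>u\<^sub>i, v\<^sub>i\<close>, so after the choice of \<open>u\<^sub>1, v\<^sub>1\<close> the product \<open>u\<^sub>2 v\<^sub>2\<close> is almost determined, and the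
  divisor bound counts the remaining choices.\<close>

subsection \<open>Divisor sums\<close>

text \<open>The threshold alpha > 1/2 enters through 2 alpha = 1 + 2 d with d > 0: a weight splits
  into exponent 1 + d in one coordinate, summable over the integers, and exponent d in the other,
  which pays for the divisor bound.

  The class bounds the collision terms only, and only in L1 in time, so these terms are expanded
  rather than the solution; Cauchy-Schwarz in time turns the L2 estimate for a collision into an L1
  bound and produces the factor sqrt (K T).

  The collision operator is a mere coefficientwise limit of truncations, so it cannot be iterated as
  it stands. Each step uses the truncation at a common level N and leaves an error; since the
  space-time estimate is uniform in N, these errors tend to 0 in norm. N tends to infinity at fixed
  depth, and the depth afterwards.

  The factorial disappears because the amplitude of a timed forest does not depend on the order in
  which it was grown: the orders of growth occupy disjoint regions of the cube of node times, and
  their integrals add up to at most one integral per shape.\<close>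

lemma card_divisors_prime_power:
  fixes p m :: nat
  assumes "prime p" "m > 0"
  shows "card {d. d dvd p ^ e * m} \<le> (e + 1) * card {d. d dvd m}"
proof -
  have "{d. d dvd p ^ e * m} \<subseteq> (\<lambda>(i, d). p ^ i * d) ` ({..e} \<times> {d. d dvd m})"
  proof
    fix d assume "d \<in> {d. d dvd p ^ e * m}"
    then obtain b c where bc: "d = b * c" "b dvd p ^ e" "c dvd m"
      using division_decomp by blast
    obtain i where "i \<le> e" "b = p ^ i"
      using bc(2) divides_primepow_nat[OF assms(1)] by blast
    then show "d \<in> (\<lambda>(i, d). p ^ i * d) ` ({..e} \<times> {d. d dvd m})"
      using bc by (auto intro!: image_eqI[of _ _ "(i, c)"])
  qed
  moreover have fin: "finite ({..e} \<times> {d. d dvd m})" using assms by simp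
  ultimately have "card {d. d dvd p ^ e * m} \<le> card ({..e} \<times> {d. d dvd m})"
    by (meson card_image_le card_mono finite_imageI le_trans)
  then show ?thesis by (simp add: card_cartesian_product)
qed

text \<open>Primes are stripped off one at a time. A prime with p^eps >= 2 costs nothing, since e +
  1 <= 2^e <= p^(eps e). Only the primes below \<open>B\<close> violate this; each costs one factor
  \<open>K\<close>, and there are at most \<open>B\<close> of them.\<close>

lemma divisor_bound:
  assumes "\<epsilon> > (0::real)"
  shows "\<exists>C\<ge>1. \<forall>n::nat. n > 0 \<longrightarrow> real (card {d. d dvd n}) \<le> C * real n powr \<epsilon>"
proof -
  define B where "B = nat \<lceil>2 powr (1 / \<epsilon>)\<rceil>"
  \<comment> \<open>The price of a small prime: 1 + x <= exp x at x = e eps ln 2, multiplied by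
    \<open>K\<close>, gives e + 1 <= K 2^(eps e).\<close>
  define K where "K = max 1 (1 / (\<epsilon> * ln 2))"
  have K1: "K \<ge> 1" by (simp add: K_def)
  have Kpow: "real e + 1 \<le> K * (2 powr \<epsilon>) ^ e" for e
  proof -
    have "1 + real e * (\<epsilon> * ln 2) \<le> exp (real e * (\<epsilon> * ln 2))" by (rule exp_ge_add_one_self)
    also have "\<dots> = (2 powr \<epsilon>) ^ e"
      by (simp add: powr_def exp_of_nat_mult)
    finally have 1: "1 + real e * (\<epsilon> * ln 2) \<le> (2 powr \<epsilon>) ^ e" .
    have "1 \<le> K * (\<epsilon> * ln 2)"
      using assms by (simp add: K_def max_def field_simps)
    then have "real e * 1 \<le> real e * (K * (\<epsilon> * ln 2))" by (intro mult_left_mono) auto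
    then have "real e + 1 \<le> K * (1 + real e * (\<epsilon> * ln 2))" using K1 by (simp add: algebra_simps)
    also have "\<dots> \<le> K * (2 powr \<epsilon>) ^ e" using 1 K1 by (intro mult_left_mono) auto
    finally show ?thesis .
  qed
  \<comment> \<open>\<open>P\<close> is a budget of small primes. A prime leaves it when its factor
    \<open>K\<close> is charged, so the number of charges stays bounded while n shrinks to its
    cofactor m.\<close>
  have claim: "n > 0 \<Longrightarrow> finite P \<Longrightarrow> {p. prime p \<and> p < B \<and> p dvd n} \<subseteq> P \<Longrightarrow>
      real (card {d. d dvd n}) \<le> K ^ card P * real n powr \<epsilon>" for n P
  proof (induction n arbitrary: P rule: less_induct)
    case (less n)
    show ?case
    proof (cases "n = 1")
      case True
      then show ?thesis using K1 by simp
    next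
      case False
      then obtain p where p: "prime p" "p dvd n" using prime_factor_nat by blast
      obtain m where m: "n = p ^ multiplicity p n * m" "\<not> p dvd m"
        using less.prems p by (metis multiplicity_decompose' not_prime_unit gr0_conv_Suc nat.distinct(1))
      define e where "e = multiplicity p n"
      have e: "e > 0" using p less.prems unfolding e_def
        by (simp add: prime_multiplicity_gt_zero_iff)
      have n: "n = p ^ e * m" using m e_def by simp
      have "m > 0" using n less.prems by (cases m) auto
      have "p ^ e > 1" using p(1) e by (metis one_less_power prime_gt_1_nat)
      then have "m < n" using n \<open>m > 0\<close> by simp
      have pe: "real n powr \<epsilon> = (real p powr \<epsilon>) ^ e * real m powr \<epsilon>"
        using p(1) by (simp add: n powr_mult powr_power powr_powr mult.commute prime_gt_0_nat flip: powr_realpow)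
      have card: "real (card {d. d dvd n}) \<le> (real e + 1) * real (card {d. d dvd m})"
        using of_nat_mono[OF card_divisors_prime_power[OF p(1) \<open>m > 0\<close>, of e], where 'a=real]
        unfolding n[symmetric] by (simp only: of_nat_mult of_nat_add of_nat_1)
      show ?thesis
      proof (cases "p < B")
        case True
        then have pP: "p \<in> P" using less.prems p by auto
        have sub: "{q. prime q \<and> q < B \<and> q dvd m} \<subseteq> P - {p}"
          using less.prems(3) m(2) n by auto
        have IH: "real (card {d. d dvd m}) \<le> K ^ card (P - {p}) * real m powr \<epsilon>"
          using less.IH[OF \<open>m < n\<close> \<open>m > 0\<close> _ sub] less.prems by simp
        have "(2 powr \<epsilon>) ^ e \<le> (real p powr \<epsilon>) ^ e"
          using prime_ge_2_nat[OF p(1)] assms by (intro power_mono powr_mono2) auto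
        then have "real e + 1 \<le> K * (real p powr \<epsilon>) ^ e"
          using Kpow[of e] K1 by (meson mult_left_mono order_trans zero_le_one)
        then have "real (card {d. d dvd n}) \<le> (K * (real p powr \<epsilon>) ^ e) * (K ^ card (P - {p}) * real m powr \<epsilon>)"
          by (intro order_trans[OF card] mult_mono IH) (use K1 in auto)
        also have "\<dots> = K ^ card P * real n powr \<epsilon>"
          using card.remove[OF less.prems(2) pP] by (simp add: pe)
        finally show ?thesis .
      next
        case False
        have IH: "real (card {d. d dvd m}) \<le> K ^ card P * real m powr \<epsilon>"
        proof (rule less.IH[OF \<open>m < n\<close> \<open>m > 0\<close> less.prems(2)])
          have "q dvd n" if "q dvd m" for q using that by (simp add: n)
          then show "{q. prime q \<and> q < B \<and> q dvd m} \<subseteq> P" using less.prems(3) by blast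
        qed
        have "2 powr (1 / \<epsilon>) \<le> real p" using False unfolding B_def by linarith
        then have "(2 powr (1 / \<epsilon>)) powr \<epsilon> \<le> real p powr \<epsilon>"
          using assms by (intro powr_mono2) auto
        then have "2 \<le> real p powr \<epsilon>" using assms by (simp add: powr_powr)
        then have "2 ^ e \<le> (real p powr \<epsilon>) ^ e" by (intro power_mono) auto
        moreover have "real e + 1 \<le> 2 ^ e"
          using of_nat_mono[OF Suc_leI[OF less_exp[of e]], where 'a=real] by simp
        ultimately have "real e + 1 \<le> (real p powr \<epsilon>) ^ e" by linarith
        then have "real (card {d. d dvd n}) \<le> (real p powr \<epsilon>) ^ e * (K ^ card P * real m powr \<epsilon>)"
          by (intro order_trans[OF card] mult_mono IH) (use K1 in auto)
        then show ?thesis by (simp add: pe algebra_simps)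
      qed
    qed
  qed
  have "real (card {d. d dvd n}) \<le> K ^ B * real n powr \<epsilon>" if "n > 0" for n
    using claim[OF that, of "{..<B}"] by auto
  then show ?thesis using K1 by (intro exI[of _ "K ^ B"]) auto
qed

section \<open>Factorizations of a single integer\<close>

definition factor_pairs :: "int \<Rightarrow> (int \<times> int) set" where
  "factor_pairs p = {(u, v). u * v = p}"

lemma card_factor_pairs:
  assumes "p \<noteq> 0"
  shows "finite (factor_pairs p)" "card (factor_pairs p) \<le> 2 * card {d. d dvd nat \<bar>p\<bar>}"
proof -
  define D where "D = {d. d dvd nat \<bar>p\<bar>}"
  have finD: "finite D" unfolding D_def using assms by (intro finite_divisors_nat) simp
  have inj: "inj_on fst (factor_pairs p)"
    using assms by (auto simp: inj_on_def factor_pairs_def)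
  have sub: "fst ` factor_pairs p \<subseteq> int ` D \<union> (\<lambda>d. - int d) ` D"
  proof
    fix u assume "u \<in> fst ` factor_pairs p"
    then have "u dvd p" by (auto simp: factor_pairs_def)
    then have *: "nat \<bar>u\<bar> \<in> D" by (simp add: D_def nat_abs_dvd_iff)
    have "u = int (nat \<bar>u\<bar>) \<or> u = - int (nat \<bar>u\<bar>)" by auto
    then show "u \<in> int ` D \<union> (\<lambda>d. - int d) ` D" using * by blast
  qed
  have fin2: "finite (int ` D \<union> (\<lambda>d. - int d) ` D)" using finD by simp
  show "finite (factor_pairs p)"
    using finite_subset[OF sub fin2] inj by (simp add: finite_image_iff)
  have "card (factor_pairs p) = card (fst ` factor_pairs p)" using inj by (simp add: card_image)
  also have "\<dots> \<le> card (int ` D \<union> (\<lambda>d. - int d) ` D)" by (rule card_mono[OF fin2 sub])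
  also have "\<dots> \<le> card (int ` D) + card ((\<lambda>d. - int d) ` D)" by (rule card_Un_le)
  also have "\<dots> \<le> 2 * card D" using card_image_le[OF finD, of int] card_image_le[OF finD, of "\<lambda>d. - int d"] by simp
  finally show "card (factor_pairs p) \<le> 2 * card {d. d dvd nat \<bar>p\<bar>}" by (simp add: D_def)
qed

definition brk :: "real \<Rightarrow> int \<Rightarrow> real" where
  "brk s n = (1 + \<bar>real_of_int n\<bar>) powr (- s)"

lemma brk_nonneg [simp]: "0 \<le> brk s n" by (simp add: brk_def)
lemma brk_le_1: "s \<ge> 0 \<Longrightarrow> brk s n \<le> 1"
  unfolding brk_def using powr_mono[of "- s" 0 "1 + \<bar>real_of_int n\<bar>"] by (simp split: if_splits)

text \<open>Outside an exceptional set of at most four pairs, one of \<open>g1\<close>,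
  \<open>g2\<close> is at least (|p| / 16)^(1/4) in size, so the summand is O(|p|^(-d/4)). That
  cancels the divisor bound taken with exponent d/4, and the constant is uniform in p and in the two
  functions.\<close>

lemma factor_pairs_sum_le:
  assumes "d > 0"
  shows "\<exists>C. \<forall>p (g1 :: int \<times> int \<Rightarrow> int) (g2 :: int \<times> int \<Rightarrow> int).
    p \<noteq> 0 \<longrightarrow> card {z \<in> factor_pairs p. 16 * (max \<bar>g1 z\<bar> \<bar>g2 z\<bar>) ^ 4 < \<bar>p\<bar>} \<le> 4 \<longrightarrow>
    (\<Sum>z\<in>factor_pairs p. brk d (g1 z) * brk d (g2 z)) \<le> C"
proof -
  obtain C where C: "C \<ge> 1" "\<And>n::nat. n > 0 \<Longrightarrow> real (card {d. d dvd n}) \<le> C * real n powr (d / 4)"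
    using divisor_bound[of "d / 4"] assms by auto
  show ?thesis
  proof (intro exI allI impI)
    fix p and g1 g2 :: "int \<times> int \<Rightarrow> int"
    assume p: "p \<noteq> 0" and few: "card {z \<in> factor_pairs p. 16 * (max \<bar>g1 z\<bar> \<bar>g2 z\<bar>) ^ 4 < \<bar>p\<bar>} \<le> 4"
    define P where "P = factor_pairs p"
    define A where "A = {z \<in> P. 16 * (max \<bar>g1 z\<bar> \<bar>g2 z\<bar>) ^ 4 < \<bar>p\<bar>}"
    define q where "q = \<bar>real_of_int p\<bar>"
    have q: "q > 0" using p by (simp add: q_def)
    have finP: "finite P" unfolding P_def using card_factor_pairs p by blast
    have A: "A \<subseteq> P" by (auto simp: A_def)
    have le1: "brk d (g1 z) * brk d (g2 z) \<le> 1" for z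
      using brk_le_1[of d] assms by (simp add: mult_le_one)
    have big: "brk d (g1 z) * brk d (g2 z) \<le> (q / 16) powr (- (d / 4))" if "z \<in> P - A" for z
    proof -
      define M where "M = max \<bar>g1 z\<bar> \<bar>g2 z\<bar>"
      have "\<bar>p\<bar> \<le> 16 * M ^ 4" using that by (auto simp: A_def M_def)
      then have "real_of_int \<bar>p\<bar> \<le> real_of_int (16 * M ^ 4)" by (simp only: of_int_le_iff)
      then have "q \<le> 16 * real_of_int M ^ 4" by (simp add: q_def)
      moreover have "real_of_int M ^ 4 \<le> (1 + real_of_int M) ^ 4"
        by (intro power_mono) (auto simp: M_def)
      ultimately have "q / 16 \<le> (1 + real_of_int M) ^ 4" by simp
      then have "((1 + real_of_int M) ^ 4) powr (- (d / 4)) \<le> (q / 16) powr (- (d / 4))"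
        using q assms by (intro powr_mono2') auto
      moreover have "((1 + real_of_int M) ^ 4) powr (- (d / 4)) = (1 + real_of_int M) powr (- d)"
      proof -
        have "1 + real_of_int M > 0" by (auto simp: M_def)
        then have "(1 + real_of_int M) ^ 4 = (1 + real_of_int M) powr 4" by simp
        then show ?thesis by (simp add: powr_powr)
      qed
      moreover have "brk d (g1 z) * brk d (g2 z) \<le> (1 + real_of_int M) powr (- d)"
      proof (cases "\<bar>g1 z\<bar> \<ge> \<bar>g2 z\<bar>")
        case True
        then show ?thesis using mult_left_mono[OF brk_le_1[of d "g2 z"] brk_nonneg[of d "g1 z"]] assms
          by (simp add: M_def brk_def)
      next
        case False
        then show ?thesis using mult_right_mono[OF brk_le_1[of d "g1 z"] brk_nonneg[of d "g2 z"]] assms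
          by (simp add: M_def brk_def)
      qed
      ultimately show ?thesis by simp
    qed
    have cardP: "real (card P) \<le> 2 * (C * q powr (d / 4))"
    proof -
      have "card P \<le> 2 * card {d. d dvd nat \<bar>p\<bar>}" unfolding P_def using card_factor_pairs[OF p] by blast
      then have "real (card P) \<le> 2 * real (card {d. d dvd nat \<bar>p\<bar>})" by linarith
      also have "\<dots> \<le> 2 * (C * real (nat \<bar>p\<bar>) powr (d / 4))" using C(2)[of "nat \<bar>p\<bar>"] p by simp
      finally show ?thesis by (simp add: q_def)
    qed
    have "(\<Sum>z\<in>P. brk d (g1 z) * brk d (g2 z)) =
        (\<Sum>z\<in>A. brk d (g1 z) * brk d (g2 z)) + (\<Sum>z\<in>P - A. brk d (g1 z) * brk d (g2 z))"
      using sum.subset_diff[OF A finP, of "\<lambda>z. brk d (g1 z) * brk d (g2 z)"] by simp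
    also have "\<dots> \<le> (\<Sum>z\<in>A. 1) + (\<Sum>z\<in>P - A. (q / 16) powr (- (d / 4)))"
      by (intro add_mono sum_mono le1 big)
    also have "\<dots> \<le> 4 + real (card P) * (q / 16) powr (- (d / 4))"
      using few card_mono[OF finP, of "P - A"] unfolding A_def P_def[symmetric]
      by (auto intro!: add_mono mult_right_mono)
    also have "\<dots> \<le> 4 + 2 * (C * q powr (d / 4)) * (q / 16) powr (- (d / 4))"
      using cardP by (intro add_mono mult_right_mono) auto
    also have "\<dots> = 4 + 2 * C * 16 powr (d / 4)"
      using q by (simp add: powr_divide powr_minus field_simps)
    finally show "(\<Sum>z\<in>factor_pairs p. brk d (g1 z) * brk d (g2 z)) \<le> 4 + 2 * C * 16 powr (d / 4)"
      unfolding P_def .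
  qed
qed

lemma card_le_4I:
  assumes "\<And>z. z \<in> A \<Longrightarrow> \<exists>a b c d. A \<subseteq> {a, b, c, d}"
  shows "card A \<le> 4"
proof (cases "A = {}")
  case False
  then obtain a b c d where "A \<subseteq> {a, b, c, d}" using assms by blast
  then have "card A \<le> card {a, b, c, d}" by (intro card_mono) auto
  also have "\<dots> \<le> 4" using card_length[of "[a, b, c, d]"] by simp
  finally show ?thesis .
qed simp

text \<open>If both differences are at most M, then |u| <= 2 M. For two distinct pairs within M, the
  identity p (u' - u) = u u' (v - v') would force |p| <= 8 M^3 <= 16 M^4. So at most one pair is
  counted; the bound 4 is the one shared with \<open>few_factor_pairs_sep\<close>.\<close>

lemma few_factor_pairs_diff:
  assumes "p \<noteq> 0"
  shows "card {z \<in> factor_pairs p. 16 * (max \<bar>x - fst z - snd z\<bar> \<bar>x - snd z\<bar>) ^ 4 < \<bar>p\<bar>} \<le> 4" (is "card ?A \<le> 4")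
proof (rule card_le_4I)
  fix z assume z: "z \<in> ?A"
  have "z' = z" if z': "z' \<in> ?A" for z'
  proof (rule ccontr)
    assume ne: "z' \<noteq> z"
    obtain u v where zz: "z = (u, v)" by (cases z)
    obtain u' v' where zz': "z' = (u', v')" by (cases z')
    have uv: "u * v = p" "u' * v' = p" using z z' by (auto simp: zz zz' factor_pairs_def)
    have "u \<noteq> u'" using ne uv assms by (auto simp: zz zz')
    define M where "M = max (max \<bar>x - u - v\<bar> \<bar>x - v\<bar>) (max \<bar>x - u' - v'\<bar> \<bar>x - v'\<bar>)"
    have M0: "M \<ge> 0" by (auto simp: M_def)
    have M: "16 * M ^ 4 < \<bar>p\<bar>" using z z' unfolding zz zz' M_def max_def by auto
    have "\<bar>x - u - v\<bar> \<le> M" "\<bar>x - v\<bar> \<le> M" "\<bar>x - u' - v'\<bar> \<le> M" "\<bar>x - v'\<bar> \<le> M" unfolding M_def le_max_iff_disj by blast+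
    then have b: "\<bar>u\<bar> \<le> 2 * M" "\<bar>u'\<bar> \<le> 2 * M" "\<bar>v - v'\<bar> \<le> 2 * M" by linarith+
    have "u * u' * (v - v') = u * v * u' - u' * v' * u" by (simp add: algebra_simps)
    then have "p * (u' - u) = u * u' * (v - v')" by (simp add: uv right_diff_distrib)
    then have "\<bar>p\<bar> * \<bar>u' - u\<bar> = \<bar>u\<bar> * \<bar>u'\<bar> * \<bar>v - v'\<bar>" by (metis abs_mult)
    also have "\<dots> \<le> (2 * M) * (2 * M) * (2 * M)" using b M0 by (intro mult_mono) auto
    finally have "\<bar>p\<bar> * \<bar>u' - u\<bar> \<le> 8 * M ^ 3" by (simp add: power3_eq_cube)
    moreover have "\<bar>p\<bar> * 1 \<le> \<bar>p\<bar> * \<bar>u' - u\<bar>" using \<open>u \<noteq> u'\<close> by (intro mult_left_mono) auto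
    moreover have "8 * M ^ 3 \<le> 16 * M ^ 4"
    proof (cases "M = 0")
      case False
      then have "M ^ 3 * 1 \<le> M ^ 3 * M" using M0 by (intro mult_left_mono) auto
      moreover have "0 \<le> M ^ 3" using M0 by simp
      ultimately show ?thesis by (simp add: power_eq_if)
    qed simp
    ultimately show False using M by linarith
  qed
  then show "\<exists>a b c d. ?A \<subseteq> {a, b, c, d}" by blast
qed

text \<open>Both factors lie close to x, so u - v is small and (u + v)^2 = (u - v)^2 + 4 p is almost
  determined by p. Distinct squares s^2, s'^2 differ by at least s + s', which is too much when p >
  16 M^4. Hence two such pairs agree in u + v and u - v up to signs, which leaves four
  possibilities.\<close>

lemma few_factor_pairs_sep:
  assumes "p \<noteq> 0"
  shows "card {z \<in> factor_pairs p. 16 * (max \<bar>x - fst z\<bar> \<bar>x - snd z\<bar>) ^ 4 < \<bar>p\<bar>} \<le> 4" (is "card ?A \<le> 4")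
proof (rule card_le_4I)
  fix z assume z: "z \<in> ?A"
  obtain u v where zz: "z = (u, v)" by (cases z)
  have "z' \<in> {(u, v), (v, u), (- u, - v), (- v, - u)}" if z': "z' \<in> ?A" for z'
  proof -
    obtain u' v' where zz': "z' = (u', v')" by (cases z')
    have uv: "u * v = p" "u' * v' = p" using z z' by (auto simp: zz zz' factor_pairs_def)
    define M where "M = max (max \<bar>x - u\<bar> \<bar>x - v\<bar>) (max \<bar>x - u'\<bar> \<bar>x - v'\<bar>)"
    have M0: "M \<ge> 0" by (auto simp: M_def)
    have M: "16 * M ^ 4 < \<bar>p\<bar>" using z z' unfolding zz zz' M_def max_def by auto
    have "\<bar>x - u\<bar> \<le> M" "\<bar>x - v\<bar> \<le> M" "\<bar>x - u'\<bar> \<le> M" "\<bar>x - v'\<bar> \<le> M" unfolding M_def le_max_iff_disj by blast+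
    then have b: "\<bar>u - v\<bar> \<le> 2 * M" "\<bar>u' - v'\<bar> \<le> 2 * M" by linarith+
    have b2: "(u - v)\<^sup>2 \<le> 4 * M\<^sup>2" "(u' - v')\<^sup>2 \<le> 4 * M\<^sup>2"
      using power_mono[OF b(1), of 2] power_mono[OF b(2), of 2] by (auto simp: power_mult_distrib)
    have MM: "M\<^sup>2 \<le> M ^ 4"
    proof (cases "M = 0")
      case False
      then show ?thesis using M0 by (intro power_increasing) auto
    qed simp
    have S: "(u + v)\<^sup>2 = (u - v)\<^sup>2 + 4 * p" "(u' + v')\<^sup>2 = (u' - v')\<^sup>2 + 4 * p"
      using uv by (auto simp: power2_eq_square algebra_simps)
    \<comment> \<open>For negative p, nonnegativity of (u + v)^2 = (u - v)^2 + 4 p would give |p| <=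
      M^2.\<close>
    have pos: "p > 0"
    proof (rule ccontr)
      assume "\<not> p > 0"
      moreover have "4 * p + 4 * M\<^sup>2 \<ge> 0" using S(1) b2(1) zero_le_power2[of "u + v"] by linarith
      moreover have "M ^ 4 \<ge> 0" using M0 by simp
      ultimately show False using M MM by linarith
    qed
    have eq: "(u + v)\<^sup>2 = (u' + v')\<^sup>2"
    proof (rule ccontr)
      assume ne: "(u + v)\<^sup>2 \<noteq> (u' + v')\<^sup>2"
      define s s' where "s = \<bar>u + v\<bar>" and "s' = \<bar>u' + v'\<bar>"
      have "s \<noteq> s'" using ne by (metis power2_abs s_def s'_def)
      have "s\<^sup>2 - s'\<^sup>2 = (s - s') * (s + s')" by algebra
      then have "\<bar>s\<^sup>2 - s'\<^sup>2\<bar> = \<bar>s - s'\<bar> * (s + s')" by (simp add: abs_mult s_def s'_def)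
      moreover have "1 * (s + s') \<le> \<bar>s - s'\<bar> * (s + s')"
        using \<open>s \<noteq> s'\<close> by (intro mult_right_mono) (auto simp: s_def s'_def)
      ultimately have "s + s' \<le> \<bar>s\<^sup>2 - s'\<^sup>2\<bar>" by simp
      moreover have "\<bar>s\<^sup>2 - s'\<^sup>2\<bar> \<le> 4 * M\<^sup>2"
      proof -
        have "s\<^sup>2 - s'\<^sup>2 = (u - v)\<^sup>2 - (u' - v')\<^sup>2" using S by (simp add: s_def s'_def)
        then show ?thesis using b2 zero_le_power2[of "u - v"] zero_le_power2[of "u' - v'"] by linarith
      qed
      moreover have "s' \<ge> 0" by (simp add: s'_def)
      ultimately have "s \<le> 4 * M\<^sup>2" by linarith
      then have "s\<^sup>2 \<le> (4 * M\<^sup>2)\<^sup>2" by (intro power_mono) (auto simp: s_def)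
      then have "s\<^sup>2 \<le> 16 * M ^ 4" by (simp add: power_mult_distrib flip: power_mult)
      moreover have "s\<^sup>2 \<ge> 4 * p" using S(1) zero_le_power2[of "u - v"] by (simp add: s_def)
      ultimately show False using M pos by linarith
    qed
    then have "(u - v)\<^sup>2 = (u' - v')\<^sup>2" using S by linarith
    then have "u - v = u' - v' \<or> u - v = - (u' - v')" by (simp add: power2_eq_iff)
    moreover have "u + v = u' + v' \<or> u + v = - (u' + v')" using eq by (simp add: power2_eq_iff)
    ultimately have "(u' = u \<and> v' = v) \<or> (u' = v \<and> v' = u) \<or> (u' = - u \<and> v' = - v) \<or> (u' = - v \<and> v' = - u)"
      by (smt (verit))
    then show ?thesis by (auto simp: zz')
  qed
  then have "?A \<subseteq> {(u, v), (v, u), (- u, - v), (- v, - u)}" by blast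
  then show "\<exists>a b c d. ?A \<subseteq> {a, b, c, d}" by blast
qed

subsection \<open>Sums over lattices\<close>

abbreviation csum :: "('a \<Rightarrow> ennreal) \<Rightarrow> ennreal" where
  "csum f \<equiv> \<integral>\<^sup>+x. f x \<partial>count_space UNIV"

lemma csum_mono: "(\<And>x. f x \<le> g x) \<Longrightarrow> csum f \<le> csum g"
  by (intro nn_integral_mono) auto

lemma csum_reindex: "bij h \<Longrightarrow> csum (\<lambda>x. f (h x)) = csum f"
  using nn_integral_bij_count_space[of h UNIV UNIV f] by simp

lemma csum_prod: "csum (\<lambda>x. csum (\<lambda>y. f x y)) = csum (\<lambda>z. f (fst z) (snd z))"
  using nn_integral_fst_count_space[of "\<lambda>z. f (fst z) (snd z)"] by simp

lemma csum_swap: "csum (\<lambda>x. csum (\<lambda>y. f x y)) = csum (\<lambda>y. csum (\<lambda>x. f x y))"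
proof -
  have "csum (\<lambda>x. csum (\<lambda>y. f x y)) = csum (\<lambda>z. f (fst z) (snd z))" by (rule csum_prod)
  also have "\<dots> = csum (\<lambda>z. f (fst (prod.swap z)) (snd (prod.swap z)))"
    by (rule csum_reindex[symmetric]) (rule bij_swap)
  also have "\<dots> = csum (\<lambda>y. csum (\<lambda>x. f x y))"
    using csum_prod[of "\<lambda>y x. f x y"] by simp
  finally show ?thesis .
qed

lemma csum_cmult: "csum (\<lambda>x. c * f x) = c * csum f"
  by (rule nn_integral_cmult) auto

lemma csum_add: "csum (\<lambda>x. f x + g x) = csum f + csum g"
  by (rule nn_integral_add) auto

lemma csum_finite:
  assumes "finite A"
  shows "csum (\<lambda>x. f x * indicator A x) = sum f A"
proof -
  have "csum (\<lambda>x. f x * indicator A x) = (\<integral>\<^sup>+x. f x \<partial>count_space A)"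
    by (simp add: nn_integral_count_space_indicator)
  then show ?thesis using assms by (simp add: nn_integral_count_space_finite)
qed

lemma csum_single: "csum (\<lambda>x. f x * indicator {a} x) = f a"
  using csum_finite[of "{a}" f] by simp

lemma csum_nat: "csum f = (\<Sum>n::nat. f n)"
  by (rule nn_integral_count_space_nat)

lemma brk_sum_finite:
  assumes "s > 1"
  shows "\<exists>H\<ge>0. csum (\<lambda>n. ennreal (brk s n)) \<le> ennreal H"
proof -
  have le: "brk s (int_decode n) \<le> 2 powr s * (real (n + 1)) powr (- s)" for n
  proof -
    \<comment> \<open>\<open>int_decode\<close> alternates between the two signs, so its n-th value
      has modulus at least n / 2.\<close>
    have "real n + 1 \<le> 2 * (1 + \<bar>real_of_int (int_decode n)\<bar>)"
      by (auto simp: int_decode_def sum_decode_def)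
    then have "((real n + 1) / 2) \<le> 1 + \<bar>real_of_int (int_decode n)\<bar>" by simp
    then have "brk s (int_decode n) \<le> ((real n + 1) / 2) powr (- s)"
      unfolding brk_def using assms by (intro powr_mono2') auto
    then show ?thesis by (simp add: powr_divide powr_minus field_simps)
  qed
  have "summable (\<lambda>n. real n powr (- s))" using assms by (simp add: summable_real_powr_iff)
  then have sm: "summable (\<lambda>n. 2 powr s * real (n + 1) powr (- s))"
    by (intro summable_mult) (subst summable_iff_shift[of "\<lambda>n. real n powr (- s)" 1])
  have "csum (\<lambda>n. ennreal (brk s n)) = csum (\<lambda>n. ennreal (brk s (int_decode n)))"
    by (rule csum_reindex[symmetric]) (rule bij_int_decode)
  also have "\<dots> \<le> csum (\<lambda>n. ennreal (2 powr s * (real (n + 1)) powr (- s)))"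
    by (intro csum_mono ennreal_leI le)
  also have "\<dots> = ennreal (\<Sum>n. 2 powr s * (real (n + 1)) powr (- s))"
    unfolding csum_nat using sm by (intro suminf_ennreal2) auto
  finally show ?thesis using sm by (intro exI[of _ "\<Sum>n. 2 powr s * (real (n + 1)) powr (- s)"]) (auto intro!: suminf_nonneg)
qed

text \<open>The decay in the difference of two phases that survives the time integration in
  \<open>time_kernel\<close>.\<close>

definition lorentz :: "real \<Rightarrow> real" where
  "lorentz z = 1 / (1 + z\<^sup>2)"

lemma lorentz_nonneg [simp]: "0 \<le> lorentz z" by (simp add: lorentz_def)
lemma lorentz_le_1: "lorentz z \<le> 1" by (simp add: lorentz_def divide_le_eq add_pos_nonneg)

lemma lorentz_sum_finite:
  assumes "h > 0"
  shows "\<exists>K\<ge>0. \<forall>y. csum (\<lambda>p::int. ennreal (lorentz (y - h * real_of_int p))) \<le> ennreal K"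
proof -
  obtain H where H: "H \<ge> 0" "csum (\<lambda>n. ennreal (brk 2 n)) \<le> ennreal H"
    using brk_sum_finite[of 2] by auto
  \<comment> \<open>With b = y / h - p and a = p - floor (y / h) one has |a + b| <= 1, hence a^2 <=
    2 + 2 b^2 and (1 + |a|)^2 <= 2 (3 + 2 b^2). The constant converts b back to h b, independently
    of y.\<close>
  define c where "c = 2 * (3 + 2 / h\<^sup>2)"
  have c: "c \<ge> 0" by (simp add: c_def)
  have le: "lorentz (y - h * real_of_int p) \<le> c * brk 2 (p - \<lfloor>y / h\<rfloor>)" for y p
  proof -
    define n where "n = \<lfloor>y / h\<rfloor>"
    define a where "a = real_of_int (p - n)"
    define b where "b = y / h - real_of_int p"
    have "\<bar>a + b\<bar> \<le> 1" unfolding a_def b_def n_def by simp linarith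
    then have "(a + b)\<^sup>2 \<le> 1" by (simp add: abs_square_le_1)
    moreover have "a\<^sup>2 \<le> 2 * (a + b)\<^sup>2 + 2 * b\<^sup>2"
      using zero_le_power2[of "a + 2 * b"] by (simp add: power2_eq_square algebra_simps)
    ultimately have "a\<^sup>2 \<le> 2 + 2 * b\<^sup>2" by linarith
    moreover have "(1 + \<bar>a\<bar>)\<^sup>2 \<le> 2 * (1 + a\<^sup>2)"
      using zero_le_power2[of "1 - \<bar>a\<bar>"] by (simp add: power2_eq_square algebra_simps)
    moreover have "2 * (1 + a\<^sup>2) \<le> 2 * (3 + 2 * b\<^sup>2)" using \<open>a\<^sup>2 \<le> 2 + 2 * b\<^sup>2\<close> by simp
    ultimately have 1: "(1 + \<bar>a\<bar>)\<^sup>2 \<le> 2 * (3 + 2 * b\<^sup>2)" by (meson order_trans)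
    have z: "y - h * real_of_int p = h * b" using assms by (simp add: b_def field_simps)
    have "2 * (3 + 2 * b\<^sup>2) \<le> c * (1 + (h * b)\<^sup>2)"
      using assms by (simp add: c_def field_simps power_mult_distrib)
    then have "(1 + \<bar>a\<bar>)\<^sup>2 \<le> c * (1 + (h * b)\<^sup>2)" using 1 by linarith
    moreover have "(1 + \<bar>a\<bar>)\<^sup>2 > 0" by (simp add: add_pos_nonneg)
    ultimately have "1 / (1 + (h * b)\<^sup>2) \<le> c / (1 + \<bar>a\<bar>)\<^sup>2"
      by (simp add: divide_simps add_pos_nonneg)
    moreover have "brk 2 (p - n) = 1 / (1 + \<bar>a\<bar>)\<^sup>2"
      by (simp add: brk_def a_def powr_minus divide_inverse)
    ultimately show ?thesis by (simp add: lorentz_def z n_def)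
  qed
  have "csum (\<lambda>p::int. ennreal (lorentz (y - h * real_of_int p))) \<le> ennreal (c * H)" for y
  proof -
    have "csum (\<lambda>p::int. ennreal (lorentz (y - h * real_of_int p)))
      \<le> csum (\<lambda>p. ennreal c * ennreal (brk 2 (p - \<lfloor>y / h\<rfloor>)))"
      using le c by (intro csum_mono) (simp add: ennreal_leI flip: ennreal_mult')
    also have "\<dots> = ennreal c * csum (\<lambda>p. ennreal (brk 2 (p - \<lfloor>y / h\<rfloor>)))" by (rule csum_cmult)
    also have "csum (\<lambda>p. ennreal (brk 2 (p - \<lfloor>y / h\<rfloor>))) = csum (\<lambda>p. ennreal (brk 2 p))"
      by (rule csum_reindex[where h = "\<lambda>p. p - \<lfloor>y / h\<rfloor>"])
        (rule bij_betw_byWitness[where f' = "\<lambda>p. p + \<lfloor>y / h\<rfloor>"], auto)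
    also have "ennreal c * \<dots> \<le> ennreal c * ennreal H" using H by (intro mult_left_mono) auto
    finally show ?thesis using c by (simp add: ennreal_mult')
  qed
  then show ?thesis using c H by (intro exI[of _ "c * H"]) auto
qed

section \<open>Weights on the lattice\<close>

definition lsize :: "int \<times> int \<Rightarrow> real" where
  "lsize b = 1 + \<bar>real_of_int (fst b)\<bar> + \<bar>real_of_int (snd b)\<bar>"

definition lweight :: "real \<Rightarrow> int \<times> int \<Rightarrow> real" where
  "lweight \<alpha> b = lsize b powr (- (2 * \<alpha>))"

lemma lsize_pos: "lsize b > 0" by (simp add: lsize_def add_pos_nonneg)
lemma lweight_nonneg [simp]: "0 \<le> lweight \<alpha> b" by (simp add: lweight_def)
lemma lweight_pos: "0 < lweight \<alpha> b" using lsize_pos[of b] by (simp add: lweight_def)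

lemma brk_antimono:
  assumes "0 \<le> s" "0 < y" "1 + \<bar>real_of_int n\<bar> \<le> y"
  shows "y powr (- s) \<le> brk s n"
  unfolding brk_def using assms by (intro powr_mono2') auto

text \<open>\<open>lsize\<close> dominates 1 plus the modulus of either coordinate, so the total
  exponent 2 alpha = (1 + d) + d may be shared out at will. The coordinate with 1 + d can be summed
  freely; the other keeps d for the divisor estimate.\<close>

lemma lweight_le_split:
  assumes "d > 0" "2 * \<alpha> = 1 + 2 * d"
  shows "lweight \<alpha> b \<le> brk (1 + d) (fst b) * brk d (snd b)"
    and "lweight \<alpha> b \<le> brk (1 + d) (snd b) * brk d (fst b)"
proof -
  have eq: "lweight \<alpha> b = lsize b powr (- (1 + d)) * lsize b powr (- d)"
    using lsize_pos[of b] unfolding lweight_def assms(2) by (simp add: algebra_simps flip: powr_add)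
  show "lweight \<alpha> b \<le> brk (1 + d) (fst b) * brk d (snd b)"
    unfolding eq using assms lsize_pos[of b] by (intro mult_mono brk_antimono) (auto simp: lsize_def)
  show "lweight \<alpha> b \<le> brk (1 + d) (snd b) * brk d (fst b)"
    unfolding eq using assms lsize_pos[of b] by (intro mult_mono brk_antimono) (auto simp: lsize_def)
qed

lemma lweight_le_brk:
  assumes "d > 0" "2 * \<alpha> = 1 + 2 * d"
  shows "lweight \<alpha> b \<le> brk (1 + d) (fst b)" "lweight \<alpha> b \<le> brk (1 + d) (snd b)"
proof -
  have "brk (1 + d) (fst b) * brk d (snd b) \<le> brk (1 + d) (fst b) * 1"
       "brk (1 + d) (snd b) * brk d (fst b) \<le> brk (1 + d) (snd b) * 1"
    using assms by (intro mult_left_mono brk_le_1; simp)+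
  then show "lweight \<alpha> b \<le> brk (1 + d) (fst b)" "lweight \<alpha> b \<le> brk (1 + d) (snd b)"
    using lweight_le_split[OF assms, of b] by linarith+
qed

text \<open>Regroups two vectors into two coordinate pairs, because the phase is a sum of one
  product per coordinate.\<close>

lemma csum_shuffle:
  fixes F :: "int \<Rightarrow> int \<Rightarrow> int \<Rightarrow> int \<Rightarrow> ennreal"
  shows "csum (\<lambda>z. F (fst (fst z)) (snd (fst z)) (fst (snd z)) (snd (snd z))) =
    csum (\<lambda>a. csum (\<lambda>b. F (fst a) (fst b) (snd a) (snd b)))"
proof -
  let ?h = "\<lambda>w::(int \<times> int) \<times> int \<times> int. ((fst (fst w), fst (snd w)), (snd (fst w), snd (snd w)))"
  have "bij ?h" by (rule bij_betw_byWitness[where f' = ?h]) auto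
  then have "csum (\<lambda>z. F (fst (fst z)) (snd (fst z)) (fst (snd z)) (snd (snd z))) =
      csum (\<lambda>w. F (fst (fst (?h w))) (snd (fst (?h w))) (fst (snd (?h w))) (snd (snd (?h w))))"
    by (intro csum_reindex[symmetric])
  then show ?thesis
    using csum_prod[of "\<lambda>a b. F (fst a) (fst b) (snd a) (snd b)"] by simp
qed

lemma csum_prod_le:
  assumes "csum f \<le> A" "\<And>x. csum (g x) \<le> B"
  shows "csum (\<lambda>x. csum (\<lambda>y. f x * g x y)) \<le> A * B"
proof -
  have "csum (\<lambda>x. csum (\<lambda>y. f x * g x y)) = csum (\<lambda>x. f x * csum (g x))"
    by (simp add: csum_cmult)
  also have "\<dots> \<le> csum (\<lambda>x. B * f x)"
    by (intro csum_mono) (subst mult.commute, intro mult_right_mono assms, simp)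
  also have "\<dots> \<le> A * B" unfolding csum_cmult by (subst mult.commute, intro mult_right_mono assms, simp)
  finally show ?thesis .
qed

text \<open>After the triangle inequality two of three weights remain. \<open>g\<close> is the first
  of them in one coordinate, x - u - v or x - u; the second is x - v. The assumption
  \<open>factors\<close> is the only arithmetic input and concerns a single coordinate.\<close>

locale resonance_sum =
  fixes \<alpha> d c1 c2 H :: real and g :: "int \<Rightarrow> int \<Rightarrow> int \<Rightarrow> int"
  assumes d: "d > 0" "2 * \<alpha> = 1 + 2 * d" and c: "c1 > 0" "c2 > 0"
    and bij_g: "\<And>x v. bij (\<lambda>u. g x u v)"
    and factors: "\<exists>C. \<forall>x p. p \<noteq> 0 \<longrightarrow>
      (\<Sum>z\<in>factor_pairs p. brk d (g x (fst z) (snd z)) * brk d (x - snd z)) \<le> C"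
    and H: "H \<ge> 0" "csum (\<lambda>n. ennreal (brk (1 + d) n)) \<le> ennreal H"
begin

lemma bij_minus: "bij (\<lambda>v::int. x - v)"
  by (rule bij_betw_byWitness[where f' = "\<lambda>v. x - v"]) auto

lemma sum_minus: "csum (\<lambda>v. ennreal (brk (1 + d) (x - v))) \<le> ennreal H"
  using csum_reindex[OF bij_minus, of "\<lambda>n. ennreal (brk (1 + d) n)" x] H by simp

lemma sum_g: "csum (\<lambda>u. ennreal (brk (1 + d) (g x u v))) \<le> ennreal H"
  using csum_reindex[OF bij_g, of "\<lambda>n. ennreal (brk (1 + d) n)" x v] H by simp

lemma sum_pair:
  "csum (\<lambda>z. ennreal (brk (1 + d) (g x (fst z) (snd z)) * brk (1 + d) (x - snd z))) \<le> ennreal H * ennreal H"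
proof -
  have "csum (\<lambda>z. ennreal (brk (1 + d) (g x (fst z) (snd z)) * brk (1 + d) (x - snd z)))
    = csum (\<lambda>v. csum (\<lambda>u. ennreal (brk (1 + d) (x - v)) * ennreal (brk (1 + d) (g x u v))))"
    by (subst csum_swap, subst csum_prod) (simp add: ennreal_mult' mult.commute)
  also have "\<dots> \<le> ennreal H * ennreal H" by (intro csum_prod_le sum_minus sum_g)
  finally show ?thesis .
qed

lemma sum_diag_left:
  "csum (\<lambda>z. indicator {0::int} (fst z) * ennreal (brk (1 + d) (x - snd z))) \<le> ennreal H"
proof -
  have "csum (\<lambda>z. indicator {0::int} (fst z) * ennreal (brk (1 + d) (x - snd z)))
      = csum (\<lambda>u. csum (\<lambda>v. indicator {0} (u::int) * ennreal (brk (1 + d) (x - v))))"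
    by (simp add: csum_prod)
  also have "\<dots> \<le> 1 * ennreal H"
    by (intro csum_prod_le sum_minus) (use csum_single[of "\<lambda>_. 1" "0::int"] in simp)
  finally show ?thesis by simp
qed

lemma sum_diag_right:
  "csum (\<lambda>z. indicator {0::int} (snd z) * ennreal (brk (1 + d) (g x (fst z) (snd z)))) \<le> ennreal H"
proof -
  have "csum (\<lambda>z. indicator {0::int} (snd z) * ennreal (brk (1 + d) (g x (fst z) (snd z))))
      = csum (\<lambda>v. csum (\<lambda>u. indicator {0} (v::int) * ennreal (brk (1 + d) (g x u v))))"
    by (subst csum_swap) (simp add: csum_prod)
  also have "\<dots> \<le> 1 * ennreal H"
    by (intro csum_prod_le sum_g) (use csum_single[of "\<lambda>_. 1" "0::int"] in simp)
  finally show ?thesis by simp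
qed

definition res_term :: "real \<Rightarrow> int \<Rightarrow> real \<Rightarrow> int \<times> int \<Rightarrow> real" where
  "res_term c x y z = of_bool (fst z * snd z \<noteq> 0) * (brk d (g x (fst z) (snd z)) * brk d (x - snd z)
     * lorentz (y - c * real_of_int (fst z * snd z)))"

lemma res_term_nonneg [simp]: "0 \<le> res_term c x y z"
  by (simp add: res_term_def)

text \<open>Pairs are grouped by their product p. The divisor estimate bounds the weights over each
  fibre, on which the Lorentzian is constant, and the sum of the Lorentzians over p is bounded
  uniformly in the shift y.\<close>

lemma res_term_sum:
  assumes "c > 0"
  shows "\<exists>C\<ge>0. \<forall>x y. csum (\<lambda>z. ennreal (res_term c x y z)) \<le> ennreal C"
proof -
  obtain C where C: "\<And>x p. p \<noteq> 0 \<Longrightarrow>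
      (\<Sum>z\<in>factor_pairs p. brk d (g x (fst z) (snd z)) * brk d (x - snd z)) \<le> C"
    using factors by blast
  have C0: "C \<ge> 0" using C[of 1 0] by (meson order_trans sum_nonneg mult_nonneg_nonneg brk_nonneg one_neq_zero)
  obtain K where K: "K \<ge> 0" "\<And>y. csum (\<lambda>p::int. ennreal (lorentz (y - c * real_of_int p))) \<le> ennreal K"
    using lorentz_sum_finite[OF assms] by auto
  have "csum (\<lambda>z. ennreal (res_term c x y z)) \<le> ennreal (C * K)" for x y
  proof -
    \<comment> \<open>The indicator introduces p as an extra summation variable, so that the fibres
      arise by exchanging two sums.\<close>
    have "csum (\<lambda>z. ennreal (res_term c x y z)) =
        csum (\<lambda>z. csum (\<lambda>p. ennreal (res_term c x y z) * indicator {fst z * snd z} p))"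
      by (simp only: csum_single)
    also have "\<dots> = csum (\<lambda>p. csum (\<lambda>z. ennreal (res_term c x y z) * indicator {fst z * snd z} p))"
      by (rule csum_swap)
    also have "\<dots> \<le> csum (\<lambda>p. ennreal C * ennreal (lorentz (y - c * real_of_int p)))"
    proof (rule csum_mono)
      fix p :: int
      have ind: "indicator {fst z * snd z} p = (indicator (factor_pairs p) z :: ennreal)" for z
        by (auto simp: indicator_def factor_pairs_def)
      show "csum (\<lambda>z. ennreal (res_term c x y z) * indicator {fst z * snd z} p)
        \<le> ennreal C * ennreal (lorentz (y - c * real_of_int p))"
      proof (cases "p = 0")
        case True
        then have eq: "ennreal (res_term c x y z) * indicator {fst z * snd z} p = 0" for z
          by (auto simp: res_term_def indicator_def)
        show ?thesis unfolding eq by simp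
      next
        case False
        have fin: "finite (factor_pairs p)" using card_factor_pairs False by blast
        have "csum (\<lambda>z. ennreal (res_term c x y z) * indicator {fst z * snd z} p)
            = (\<Sum>z\<in>factor_pairs p. ennreal (res_term c x y z))"
          unfolding ind by (rule csum_finite[OF fin])
        also have "\<dots> = ennreal (\<Sum>z\<in>factor_pairs p. res_term c x y z)"
          by (simp add: sum_ennreal)
        also have "(\<Sum>z\<in>factor_pairs p. res_term c x y z) =
            (\<Sum>z\<in>factor_pairs p. brk d (g x (fst z) (snd z)) * brk d (x - snd z)) * lorentz (y - c * real_of_int p)"
          unfolding sum_distrib_right using False by (intro sum.cong) (auto simp: res_term_def factor_pairs_def)
        also have "ennreal \<dots> \<le> ennreal (C * lorentz (y - c * real_of_int p))"
          using C[OF False] by (intro ennreal_leI mult_right_mono) auto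
        finally show ?thesis using C0 by (simp add: ennreal_mult)
      qed
    qed
    also have "\<dots> \<le> ennreal C * ennreal K" unfolding csum_cmult using K by (intro mult_left_mono) auto
    finally show ?thesis using C0 by (simp add: ennreal_mult')
  qed
  then show ?thesis using C0 K by (intro exI[of _ "C * K"]) auto
qed

definition G :: "int \<times> int \<Rightarrow> int \<times> int \<Rightarrow> int \<times> int \<Rightarrow> int \<times> int" where
  "G x u v = (g (fst x) (fst u) (fst v), g (snd x) (snd u) (snd v))"

text \<open>If the product u_i v_i is nonzero in one coordinate, that coordinate is left to
  \<open>res_term_sum\<close> and the other is summed with exponent 1 + d. If both products vanish
  while u and v do not, then u and v lie on different axes: two free integers remain, each with a
  weight of exponent 1 + d, and no decay from the phase is needed.\<close>

lemma res_pointwise: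
  assumes "u \<noteq> 0" "v \<noteq> 0"
  shows "lweight \<alpha> (G x u v) * lweight \<alpha> (x - v) *
      lorentz (y - c1 * real_of_int (fst u * fst v) - c2 * real_of_int (snd u * snd v))
    \<le> brk (1 + d) (g (fst x) (fst u) (fst v)) * brk (1 + d) (fst x - fst v)
          * res_term c2 (snd x) (y - c1 * real_of_int (fst u * fst v)) (snd u, snd v)
      + brk (1 + d) (g (snd x) (snd u) (snd v)) * brk (1 + d) (snd x - snd v)
          * res_term c1 (fst x) (y - c2 * real_of_int (snd u * snd v)) (fst u, fst v)
      + indicator {0} (fst u) * brk (1 + d) (fst x - fst v) * (indicator {0} (snd v) * brk (1 + d) (g (snd x) (snd u) (snd v)))
      + indicator {0} (fst v) * brk (1 + d) (g (fst x) (fst u) (fst v)) * (indicator {0} (snd u) * brk (1 + d) (snd x - snd v))"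
    (is "?w1 * ?w2 * ?l \<le> ?t1 + ?t2 + ?t3 + ?t4")
proof -
  have t0: "?t1 \<ge> 0" "?t2 \<ge> 0" "?t3 \<ge> 0" "?t4 \<ge> 0" by (simp_all add: indicator_def)
  have w0: "?w1 \<ge> 0" "?w2 \<ge> 0" "?l \<ge> 0" by simp_all
  consider "snd u * snd v \<noteq> 0" | "fst u * fst v \<noteq> 0" | "fst u = 0" "snd v = 0" | "snd u = 0" "fst v = 0"
    using assms by (cases u; cases v) (auto simp: zero_prod_def)
  then show ?thesis
  proof cases
    case 1
    have "?w1 * ?w2 * ?l \<le> (brk (1 + d) (g (fst x) (fst u) (fst v)) * brk d (g (snd x) (snd u) (snd v))) *
        (brk (1 + d) (fst x - fst v) * brk d (snd x - snd v)) * ?l"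
      using lweight_le_split(1)[OF d, of "G x u v"] lweight_le_split(1)[OF d, of "x - v"]
      by (intro mult_right_mono mult_mono w0) (auto simp: G_def)
    also have "\<dots> = ?t1" using 1 by (simp add: res_term_def)
    finally show ?thesis using t0 by linarith
  next
    case 2
    have "?w1 * ?w2 * ?l \<le> (brk (1 + d) (g (snd x) (snd u) (snd v)) * brk d (g (fst x) (fst u) (fst v))) *
        (brk (1 + d) (snd x - snd v) * brk d (fst x - fst v)) * ?l"
      using lweight_le_split(2)[OF d, of "G x u v"] lweight_le_split(2)[OF d, of "x - v"]
      by (intro mult_right_mono mult_mono w0) (auto simp: G_def)
    also have "\<dots> = ?t2" using 2 by (simp add: res_term_def algebra_simps)
    finally show ?thesis using t0 by linarith
  next
    case 3
    have "?w1 * ?w2 * ?l \<le> ?w1 * ?w2 * 1" by (intro mult_left_mono lorentz_le_1) simp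
    also have "\<dots> \<le> brk (1 + d) (g (snd x) (snd u) (snd v)) * brk (1 + d) (fst x - fst v)"
      using lweight_le_brk(2)[OF d, of "G x u v"] lweight_le_brk(1)[OF d, of "x - v"]
      by (simp, intro mult_mono) (auto simp: G_def)
    also have "\<dots> = ?t3" using 3 by simp
    finally show ?thesis using t0 by linarith
  next
    case 4
    have "?w1 * ?w2 * ?l \<le> ?w1 * ?w2 * 1" by (intro mult_left_mono lorentz_le_1) simp
    also have "\<dots> \<le> brk (1 + d) (g (fst x) (fst u) (fst v)) * brk (1 + d) (snd x - snd v)"
      using lweight_le_brk(1)[OF d, of "G x u v"] lweight_le_brk(2)[OF d, of "x - v"]
      by (simp, intro mult_mono) (auto simp: G_def)
    also have "\<dots> = ?t4" using 4 by simp
    finally show ?thesis using t0 by linarith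
  qed
qed

text \<open>In the first two majorants the Lorentzian is shifted by the product from the coordinate
  pair summed last. The shift is harmless because \<open>res_term_sum\<close> is uniform in y, so
  every majorant sums like a product.\<close>

lemma res_sum:
  "\<exists>C\<ge>0. \<forall>x y. csum (\<lambda>z. ennreal (of_bool (fst z \<noteq> 0 \<and> snd z \<noteq> 0) *
      (lweight \<alpha> (G x (fst z) (snd z)) * lweight \<alpha> (x - snd z) *
      lorentz (y - c1 * real_of_int (fst (fst z) * fst (snd z)) - c2 * real_of_int (snd (fst z) * snd (snd z))))))
    \<le> ennreal C"
proof -
  obtain C1 where C1: "C1 \<ge> 0" "\<And>x y. csum (\<lambda>z. ennreal (res_term c1 x y z)) \<le> ennreal C1"
    using res_term_sum[OF c(1)] by auto
  obtain C2 where C2: "C2 \<ge> 0" "\<And>x y. csum (\<lambda>z. ennreal (res_term c2 x y z)) \<le> ennreal C2"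
    using res_term_sum[OF c(2)] by auto
  define h where "h = brk (1 + d)"
  have h0[simp]: "h n \<ge> 0" for n by (simp add: h_def)
  show ?thesis
  proof (rule exI[of _ "H * H * C2 + H * H * C1 + H * H + H * H"], intro conjI allI)
    show "0 \<le> H * H * C2 + H * H * C1 + H * H + H * H" using H C1 C2 by simp
    fix x y
    define T1 where "T1 = (\<lambda>u1 u2 v1 v2. ennreal (h (g (fst x) u1 v1) * h (fst x - v1))
       * ennreal (res_term c2 (snd x) (y - c1 * real_of_int (u1 * v1)) (u2, v2)))"
    define T2 where "T2 = (\<lambda>u1 u2 v1 v2. ennreal (h (g (snd x) u2 v2) * h (snd x - v2))
       * ennreal (res_term c1 (fst x) (y - c2 * real_of_int (u2 * v2)) (u1, v1)))"
    define T3 where "T3 = (\<lambda>u1 u2 v1 v2. (indicator {0::int} u1 * ennreal (h (fst x - v1))) *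
       (indicator {0::int} v2 * ennreal (h (g (snd x) u2 v2))))"
    define T4 where "T4 = (\<lambda>u1 u2 v1 v2. (indicator {0::int} v1 * ennreal (h (g (fst x) u1 v1))) *
       (indicator {0::int} u2 * ennreal (h (snd x - v2))))"
    let ?A = "\<lambda>T. csum (\<lambda>z. T (fst (fst z)) (snd (fst z)) (fst (snd z)) (snd (snd z)) :: ennreal)"
    have "csum (\<lambda>z. ennreal (of_bool (fst z \<noteq> 0 \<and> snd z \<noteq> 0) *
      (lweight \<alpha> (G x (fst z) (snd z)) * lweight \<alpha> (x - snd z) *
      lorentz (y - c1 * real_of_int (fst (fst z) * fst (snd z)) - c2 * real_of_int (snd (fst z) * snd (snd z))))))
      \<le> csum (\<lambda>z. T1 (fst (fst z)) (snd (fst z)) (fst (snd z)) (snd (snd z))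
         + T2 (fst (fst z)) (snd (fst z)) (fst (snd z)) (snd (snd z))
         + T3 (fst (fst z)) (snd (fst z)) (fst (snd z)) (snd (snd z))
         + T4 (fst (fst z)) (snd (fst z)) (fst (snd z)) (snd (snd z)))"
    proof (rule csum_mono)
      fix z :: "(int \<times> int) \<times> (int \<times> int)"
      show "ennreal (of_bool (fst z \<noteq> 0 \<and> snd z \<noteq> 0) *
      (lweight \<alpha> (G x (fst z) (snd z)) * lweight \<alpha> (x - snd z) *
      lorentz (y - c1 * real_of_int (fst (fst z) * fst (snd z)) - c2 * real_of_int (snd (fst z) * snd (snd z)))))
       \<le> T1 (fst (fst z)) (snd (fst z)) (fst (snd z)) (snd (snd z))
         + T2 (fst (fst z)) (snd (fst z)) (fst (snd z)) (snd (snd z))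
         + T3 (fst (fst z)) (snd (fst z)) (fst (snd z)) (snd (snd z))
         + T4 (fst (fst z)) (snd (fst z)) (fst (snd z)) (snd (snd z))"
      proof (cases "fst z \<noteq> 0 \<and> snd z \<noteq> 0")
        case True
        have ei: "(indicator A a :: ennreal) = ennreal (indicator A a)" for A :: "int set" and a
          by (auto simp: indicator_def)
        show ?thesis
          unfolding T1_def T2_def T3_def T4_def ei
          using True ennreal_leI[OF res_pointwise[of "fst z" "snd z" x y]]
          by (simp add: h_def flip: ennreal_mult' ennreal_plus)
      qed auto
    qed
    also have "\<dots> = ?A T1 + ?A T2 + ?A T3 + ?A T4" by (simp add: csum_add)
    also have "\<dots> \<le> ennreal H * ennreal H * ennreal C2 + ennreal H * ennreal H * ennreal C1
       + ennreal H * ennreal H + ennreal H * ennreal H"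
    proof (intro add_mono)
      show "?A T1 \<le> ennreal H * ennreal H * ennreal C2"
        unfolding csum_shuffle unfolding T1_def h_def
        by (intro csum_prod_le[OF sum_pair]) (simp add: C2)
      have "?A T2 = csum (\<lambda>b. csum (\<lambda>a. T2 (fst a) (fst b) (snd a) (snd b)))"
        unfolding csum_shuffle by (rule csum_swap)
      also have "\<dots> \<le> ennreal H * ennreal H * ennreal C1"
        unfolding T2_def h_def by (intro csum_prod_le[OF sum_pair]) (simp add: C1)
      finally show "?A T2 \<le> ennreal H * ennreal H * ennreal C1" .
      show "?A T3 \<le> ennreal H * ennreal H"
        unfolding csum_shuffle unfolding T3_def h_def by (intro csum_prod_le[OF sum_diag_left sum_diag_right])
      show "?A T4 \<le> ennreal H * ennreal H"
        unfolding csum_shuffle unfolding T4_def h_def by (intro csum_prod_le[OF sum_diag_right sum_diag_left])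
    qed
    also have "\<dots> = ennreal (H * H * C2 + H * H * C1 + H * H + H * H)"
      using H(1) C1(1) C2(1) by (simp flip: ennreal_mult ennreal_plus)
    finally show "csum (\<lambda>z. ennreal (of_bool (fst z \<noteq> 0 \<and> snd z \<noteq> 0) *
      (lweight \<alpha> (G x (fst z) (snd z)) * lweight \<alpha> (x - snd z) *
      lorentz (y - c1 * real_of_int (fst (fst z) * fst (snd z)) - c2 * real_of_int (snd (fst z) * snd (snd z))))))
      \<le> ennreal (H * H * C2 + H * H * C1 + H * H + H * H)" .
  qed
qed

end

section \<open>The resonance weight and its summation\<close>

lemma lsize_triangle: "lsize x \<le> lsize (x - u) + lsize (x - u - v) + lsize (x - v)"
  \<comment> \<open>Here x = (x - u) + (x - v) - (x - u - v).\<close>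
  unfolding lsize_def by simp

lemma lsize_powr_le:
  assumes "\<alpha> > 0"
  shows "lsize x powr (2 * \<alpha>) \<le> 3 powr (2 * \<alpha>) *
     (1 / lweight \<alpha> (x - u) + 1 / lweight \<alpha> (x - u - v) + 1 / lweight \<alpha> (x - v))"
proof -
  define m where "m = max (lsize (x - u)) (max (lsize (x - u - v)) (lsize (x - v)))"
  have inv: "1 / lweight \<alpha> b = lsize b powr (2 * \<alpha>)" for b
    by (simp add: lweight_def powr_minus divide_inverse)
  have "lsize x \<le> 3 * m" using lsize_triangle[of x u v] unfolding m_def by linarith
  then have "lsize x powr (2 * \<alpha>) \<le> (3 * m) powr (2 * \<alpha>)"
    using assms lsize_pos[of x] by (intro powr_mono2) auto
  also have "\<dots> = 3 powr (2 * \<alpha>) * m powr (2 * \<alpha>)"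
    using lsize_pos[of "x - u"] by (simp add: powr_mult m_def)
  also have "m powr (2 * \<alpha>) \<le> lsize (x - u) powr (2 * \<alpha>) + lsize (x - u - v) powr (2 * \<alpha>) + lsize (x - v) powr (2 * \<alpha>)"
    unfolding m_def max_def by (auto intro: add_nonneg_nonneg)
  finally show ?thesis by (simp add: inv mult_left_mono)
qed

text \<open>The weight of the Schur test: x is the outgoing frequency, and x - u, x - u - v, x - v
  are the three incoming ones.\<close>

definition res_weight :: "real \<Rightarrow> int \<times> int \<Rightarrow> int \<times> int \<Rightarrow> int \<times> int \<Rightarrow> real" where
  "res_weight \<alpha> x u v = lsize x powr (2 * \<alpha>) * (lweight \<alpha> (x - u) * lweight \<alpha> (x - u - v) * lweight \<alpha> (x - v))"

lemma res_weight_nonneg [simp]: "0 \<le> res_weight \<alpha> x u v" by (simp add: res_weight_def)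

text \<open>The largest incoming frequency absorbs the growth in x and cancels its own weight, which
  leaves a product of two weights.\<close>

lemma res_weight_le:
  assumes "\<alpha> > 0"
  shows "res_weight \<alpha> x u v \<le> 3 powr (2 * \<alpha>) *
    (lweight \<alpha> (x - u - v) * lweight \<alpha> (x - v) + lweight \<alpha> (x - u) * lweight \<alpha> (x - v)
      + lweight \<alpha> (x - u - v) * lweight \<alpha> (x - u))"
proof -
  let ?a = "lweight \<alpha> (x - u)" and ?b = "lweight \<alpha> (x - u - v)" and ?c = "lweight \<alpha> (x - v)"
  have p: "?a > 0" "?b > 0" "?c > 0" by (simp_all add: lweight_pos)
  have "res_weight \<alpha> x u v \<le> 3 powr (2 * \<alpha>) * (1 / ?a + 1 / ?b + 1 / ?c) * (?a * ?b * ?c)"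
    unfolding res_weight_def using lsize_powr_le[OF assms] p by (intro mult_right_mono) auto
  also have "\<dots> = 3 powr (2 * \<alpha>) * (?b * ?c + ?a * ?c + ?b * ?a)"
    using p by (simp add: field_simps)
  finally show ?thesis .
qed

text \<open>For u = 0 or v = 0 the phase vanishes and offers no decay. But then one incoming
  frequency equals x and cancels it exactly, and the squared weight that is left is summable over
  the lattice.\<close>

lemma res_weight_degenerate:
  "res_weight \<alpha> x 0 v = lweight \<alpha> (x - v) * lweight \<alpha> (x - v)"
  "res_weight \<alpha> x u 0 = lweight \<alpha> (x - u) * lweight \<alpha> (x - u)"
proof -
  have "lsize x powr (2 * \<alpha>) * lweight \<alpha> x = 1"
    using lsize_pos[of x] by (simp add: lweight_def flip: powr_add)
  then show "res_weight \<alpha> x 0 v = lweight \<alpha> (x - v) * lweight \<alpha> (x - v)"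
    "res_weight \<alpha> x u 0 = lweight \<alpha> (x - u) * lweight \<alpha> (x - u)"
    unfolding res_weight_def diff_zero by algebra+
qed

text \<open>The phase splits as a sum over the two coordinates. Once the first coordinates are chosen, the
  second product \<open>u\<^sub>2 v\<^sub>2\<close> is confined to boundedly many values, and the divisor bound controls the
  number of second coordinates. This works for arbitrary \<open>c1, c2\<close>, with no arithmetic hypothesis.\<close>

theorem resonance_bound:
  assumes "\<alpha> > 1 / 2" "c1 > 0" "c2 > 0"
  shows "\<exists>C\<ge>0. \<forall>x y. csum (\<lambda>z. ennreal (res_weight \<alpha> x (fst z) (snd z) *
      lorentz (y - c1 * real_of_int (fst (fst z) * fst (snd z)) - c2 * real_of_int (snd (fst z) * snd (snd z)))))
    \<le> ennreal C"
proof -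
  define d where "d = \<alpha> - 1 / 2"
  have d: "d > 0" "2 * \<alpha> = 1 + 2 * d" using assms by (auto simp: d_def)
  obtain H where H: "H \<ge> 0" "csum (\<lambda>n. ennreal (brk (1 + d) n)) \<le> ennreal H"
    using brk_sum_finite[of "1 + d"] d by auto
  obtain Cf where Cf: "\<And>p (g1 :: int \<times> int \<Rightarrow> int) g2. p \<noteq> 0 \<Longrightarrow>
      card {z \<in> factor_pairs p. 16 * (max \<bar>g1 z\<bar> \<bar>g2 z\<bar>) ^ 4 < \<bar>p\<bar>} \<le> 4 \<Longrightarrow>
      (\<Sum>z\<in>factor_pairs p. brk d (g1 z) * brk d (g2 z)) \<le> Cf"
    using factor_pairs_sum_le[OF d(1)] by blast
  interpret A: resonance_sum \<alpha> d c1 c2 H "\<lambda>x u v. x - u - v"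
  proof
    show "bij (\<lambda>u. x - u - v)" for x v :: int
      by (rule bij_betw_byWitness[where f' = "\<lambda>u. x - u - v"]) auto
    show "\<exists>C. \<forall>x p. p \<noteq> 0 \<longrightarrow> (\<Sum>z\<in>factor_pairs p. brk d (x - fst z - snd z) * brk d (x - snd z)) \<le> C"
      using Cf[OF _ few_factor_pairs_diff] by (intro exI[of _ Cf] allI impI)
  qed (use d assms H in auto)
  interpret B: resonance_sum \<alpha> d c1 c2 H "\<lambda>x u v. x - u"
  proof
    show "bij (\<lambda>u. x - u)" for x :: int
      by (rule bij_betw_byWitness[where f' = "\<lambda>u. x - u"]) auto
    show "\<exists>C. \<forall>x p. p \<noteq> 0 \<longrightarrow> (\<Sum>z\<in>factor_pairs p. brk d (x - fst z) * brk d (x - snd z)) \<le> C"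
      using Cf[OF _ few_factor_pairs_sep] by (intro exI[of _ Cf] allI impI)
  qed (use d assms H in auto)
  let ?l = "\<lambda>y u v. lorentz (y - c1 * real_of_int (fst u * fst v) - c2 * real_of_int (snd u * snd v))"
  obtain CA where CA: "CA \<ge> 0" "\<And>x y. csum (\<lambda>z. ennreal (of_bool (fst z \<noteq> 0 \<and> snd z \<noteq> 0) *
      (lweight \<alpha> (x - fst z - snd z) * lweight \<alpha> (x - snd z) * ?l y (fst z) (snd z)))) \<le> ennreal CA"
    using A.res_sum by (auto simp: A.G_def minus_prod_def)
  obtain CB where CB: "CB \<ge> 0" "\<And>x y. csum (\<lambda>z. ennreal (of_bool (fst z \<noteq> 0 \<and> snd z \<noteq> 0) *
      (lweight \<alpha> (x - fst z) * lweight \<alpha> (x - snd z) * ?l y (fst z) (snd z)))) \<le> ennreal CB"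
    using B.res_sum by (auto simp: B.G_def minus_prod_def)
  \<comment> \<open>\<open>TA\<close> carries the pair x - u - v, x - v, and \<open>TB\<close> the
    pair x - u, x - v. The third pair is \<open>TA\<close> with u and v exchanged, which does not
    change the phase. \<open>TD\<close> collects the degenerate terms with u = 0, and its swap those
    with v = 0.\<close>
  define TA where "TA = (\<lambda>x y z. ennreal (of_bool (fst z \<noteq> 0 \<and> snd z \<noteq> 0) *
      (lweight \<alpha> (x - fst z - snd z) * lweight \<alpha> (x - snd z) * ?l y (fst z) (snd z))))"
  define TB where "TB = (\<lambda>x y z. ennreal (of_bool (fst z \<noteq> 0 \<and> snd z \<noteq> 0) *
      (lweight \<alpha> (x - fst z) * lweight \<alpha> (x - snd z) * ?l y (fst z) (snd z))))"
  define TD where "TD = (\<lambda>x (z :: (int \<times> int) \<times> (int \<times> int)). indicator {0} (fst z) *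
      ennreal (lweight \<alpha> (x - snd z) * lweight \<alpha> (x - snd z)))"
  define c where "c = (3::real) powr (2 * \<alpha>)"
  have c0: "c \<ge> 0" by (simp add: c_def)
  have TC: "csum (\<lambda>z. TA x y (prod.swap z)) = csum (TA x y)" for x y by (rule csum_reindex) (rule bij_swap)
  have TD': "csum (\<lambda>z. TD x (prod.swap z)) = csum (TD x)" for x by (rule csum_reindex) (rule bij_swap)
  have TDle: "csum (TD x) \<le> ennreal H * ennreal H" for x
  proof -
    have "csum (TD x) = csum (\<lambda>u. csum (\<lambda>v. indicator {0} (u::int \<times> int) * ennreal (lweight \<alpha> (x - v) * lweight \<alpha> (x - v))))"
      by (simp add: csum_prod TD_def)
    also have "\<dots> \<le> 1 * (ennreal H * ennreal H)"
    proof (rule csum_prod_le)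
      show "csum (indicator {0 :: int \<times> int}) \<le> 1"
        using csum_single[of "\<lambda>_. 1" "0::int \<times> int"] by simp
      have "csum (\<lambda>v. ennreal (lweight \<alpha> (x - v) * lweight \<alpha> (x - v)))
          \<le> csum (\<lambda>v. ennreal (brk (1 + d) (fst x - fst v)) * ennreal (brk (1 + d) (snd x - snd v)))"
        using lweight_le_brk[OF d, of "x - v" for v]
        by (intro csum_mono) (auto simp flip: ennreal_mult' intro!: ennreal_leI mult_mono)
      also have "\<dots> = csum (\<lambda>m. csum (\<lambda>n. ennreal (brk (1 + d) (fst x - m)) * ennreal (brk (1 + d) (snd x - n))))"
        by (simp add: csum_prod)
      also have "\<dots> \<le> ennreal H * ennreal H" by (intro csum_prod_le A.sum_minus)
      finally show "csum (\<lambda>v. ennreal (lweight \<alpha> (x - v) * lweight \<alpha> (x - v))) \<le> ennreal H * ennreal H" .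
    qed
    finally show ?thesis by simp
  qed
  show ?thesis
  proof (rule exI[of _ "c * (CA + CB + CA) + H * H + H * H"], intro conjI allI)
    show "0 \<le> c * (CA + CB + CA) + H * H + H * H" using c0 CA CB H by simp
    fix x y
    have "csum (\<lambda>z. ennreal (res_weight \<alpha> x (fst z) (snd z) * ?l y (fst z) (snd z)))
      \<le> csum (\<lambda>z. ennreal c * (TA x y z + TB x y z + TA x y (prod.swap z)) + TD x z + TD x (prod.swap z))"
    proof (rule csum_mono)
      fix z :: "(int \<times> int) \<times> (int \<times> int)"
      obtain u v where z: "z = (u, v)" by (cases z)
      consider "u = 0" | "v = 0" | "u \<noteq> 0" "v \<noteq> 0" by blast
      then show "ennreal (res_weight \<alpha> x (fst z) (snd z) * ?l y (fst z) (snd z))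
        \<le> ennreal c * (TA x y z + TB x y z + TA x y (prod.swap z)) + TD x z + TD x (prod.swap z)"
      proof cases
        case 1
        have "ennreal (res_weight \<alpha> x u v * ?l y u v) \<le> ennreal (res_weight \<alpha> x u v * 1)"
          by (intro ennreal_leI mult_left_mono lorentz_le_1) auto
        also have "\<dots> = TD x z" using 1 by (simp add: TD_def z res_weight_degenerate)
        finally show ?thesis by (simp add: z add_increasing2 add_increasing)
      next
        case 2
        have "ennreal (res_weight \<alpha> x u v * ?l y u v) \<le> ennreal (res_weight \<alpha> x u v * 1)"
          by (intro ennreal_leI mult_left_mono lorentz_le_1) auto
        also have "\<dots> = TD x (prod.swap z)" using 2 by (simp add: TD_def z res_weight_degenerate)
        finally show ?thesis by (simp add: z add_increasing2 add_increasing)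
      next
        case 3
        have "res_weight \<alpha> x u v * ?l y u v \<le> c * (lweight \<alpha> (x - u - v) * lweight \<alpha> (x - v) + lweight \<alpha> (x - u) * lweight \<alpha> (x - v)
            + lweight \<alpha> (x - u - v) * lweight \<alpha> (x - u)) * ?l y u v"
          unfolding c_def using assms by (intro mult_right_mono res_weight_le) auto
        also have "\<dots> = c * (lweight \<alpha> (x - u - v) * lweight \<alpha> (x - v) * ?l y u v + lweight \<alpha> (x - u) * lweight \<alpha> (x - v) * ?l y u v
            + lweight \<alpha> (x - v - u) * lweight \<alpha> (x - u) * ?l y v u)"
          by (simp add: algebra_simps)
        finally have "ennreal (res_weight \<alpha> x u v * ?l y u v) \<le> ennreal c * (TA x y z + TB x y z + TA x y (prod.swap z))"
          using 3 c0 by (simp add: TA_def TB_def z ennreal_leI flip: ennreal_mult' ennreal_plus)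
        then show ?thesis by (simp add: z add_increasing2)
      qed
    qed
    also have "\<dots> = ennreal c * (csum (TA x y) + csum (TB x y) + csum (TA x y)) + csum (TD x) + csum (TD x)"
      by (simp add: csum_add csum_cmult TC TD')
    also have "\<dots> \<le> ennreal c * (ennreal CA + ennreal CB + ennreal CA) + ennreal H * ennreal H + ennreal H * ennreal H"
      using CA(2) CB(2) TDle by (intro add_mono mult_left_mono) (auto simp: TA_def TB_def)
    also have "\<dots> = ennreal (c * (CA + CB + CA) + H * H + H * H)"
      using c0 CA(1) CB(1) H(1) by (simp flip: ennreal_mult ennreal_plus)
    finally show "csum (\<lambda>z. ennreal (res_weight \<alpha> x (fst z) (snd z) * ?l y (fst z) (snd z)))
      \<le> ennreal (c * (CA + CB + CA) + H * H + H * H)" .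
  qed
qed

subsection \<open>The space-time estimate\<close>

text \<open>Stated on a bounded window with its boundary term, so that \<open>time_kernel\<close>
  can work with integrals over {0..R} and pass to R -> infinity afterwards.\<close>

lemma exp_cos_has_integral:
  assumes "0 \<le> R"
  shows "((\<lambda>t. exp (- t) * (2 * cos (t * \<Delta>))) has_integral
    2 * lorentz \<Delta> * (1 + exp (- R) * (\<Delta> * sin (R * \<Delta>) - cos (R * \<Delta>)))) {0..R}"
proof -
  define F where "F t = 2 * lorentz \<Delta> * (exp (- t) * (\<Delta> * sin (t * \<Delta>) - cos (t * \<Delta>)))" for t
  have l: "lorentz \<Delta> * (1 + \<Delta>\<^sup>2) = 1"
    unfolding lorentz_def by (simp add: add_nonneg_eq_0_iff)
  have "((\<lambda>t. exp (- t) * (2 * cos (t * \<Delta>))) has_integral (F R - F 0)) {0..R}"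
  proof (rule fundamental_theorem_of_calculus[OF assms])
    fix t assume "t \<in> {0..R}"
    have "(F has_real_derivative 2 * lorentz \<Delta> * ((- exp (- t)) * (\<Delta> * sin (t * \<Delta>) - cos (t * \<Delta>))
        + exp (- t) * (\<Delta> * (cos (t * \<Delta>) * \<Delta>) + sin (t * \<Delta>) * \<Delta>))) (at t within {0..R})"
      unfolding F_def by (auto intro!: derivative_eq_intros simp: algebra_simps)
    also have "2 * lorentz \<Delta> * ((- exp (- t)) * (\<Delta> * sin (t * \<Delta>) - cos (t * \<Delta>))
        + exp (- t) * (\<Delta> * (cos (t * \<Delta>) * \<Delta>) + sin (t * \<Delta>) * \<Delta>))
       = (lorentz \<Delta> * (1 + \<Delta>\<^sup>2)) * (exp (- t) * (2 * cos (t * \<Delta>)))"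
      by (simp add: algebra_simps power2_eq_square)
    finally show "(F has_vector_derivative exp (- t) * (2 * cos (t * \<Delta>))) (at t within {0..R})"
      by (simp add: l has_real_derivative_iff_has_vector_derivative)
  qed
  then show ?thesis by (simp add: F_def algebra_simps)
qed

lemma cmod_sum_squared:
  assumes "finite Z"
  shows "(cmod (\<Sum>m\<in>Z. a m * cis (t * \<phi> m)))\<^sup>2 =
    (\<Sum>m\<in>Z. \<Sum>m'\<in>Z. Re (a m * cnj (a m') * cis (t * (\<phi> m - \<phi> m'))))"
proof -
  let ?f = "\<Sum>m\<in>Z. a m * cis (t * \<phi> m)"
  have "complex_of_real ((cmod ?f)\<^sup>2) = ?f * cnj ?f" by (rule complex_norm_square)
  also have "\<dots> = (\<Sum>m\<in>Z. \<Sum>m'\<in>Z. a m * cnj (a m') * cis (t * (\<phi> m - \<phi> m')))"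
    by (simp add: sum_product cis_cnj cis_mult algebra_simps)
  finally have "Re (complex_of_real ((cmod ?f)\<^sup>2)) = Re \<dots>" by (rule arg_cong)
  then show ?thesis by simp
qed

text \<open>The weight \<open>exp (- \<bar>t\<bar>)\<close> has the nonnegative integrable Fourier transform \<open>2 * lorentz\<close>.\<close>

lemma time_kernel:
  fixes a :: "'m \<Rightarrow> complex" and \<phi> :: "'m \<Rightarrow> real"
  assumes "finite Z"
  shows "(\<integral>\<^sup>+t\<in>{0..1}. ennreal ((cmod (\<Sum>m\<in>Z. a m * cis (t * \<phi> m)))\<^sup>2) \<partial>lborel)
    \<le> ennreal (2 * exp 1 * (\<Sum>m\<in>Z. \<Sum>m'\<in>Z. cmod (a m) * cmod (a m') * lorentz (\<phi> m - \<phi> m')))"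
proof -
  define f where "f t = (cmod (\<Sum>m\<in>Z. a m * cis (t * \<phi> m)))\<^sup>2" for t
  define b where "b m m' = Re (a m * cnj (a m'))" for m m'
  define D where "D m m' = \<phi> m - \<phi> m'" for m m'
  have f0: "f t \<ge> 0" for t by (simp add: f_def)
  have cont: "continuous_on S f" for S
    unfolding f_def cis_conv_exp by (intro continuous_intros)
  \<comment> \<open>Adding the reflected value costs nothing, as f is nonnegative, and turns the
    exponentials into cosines with real coefficients.\<close>
  have ff: "f t + f (- t) = (\<Sum>m\<in>Z. \<Sum>m'\<in>Z. b m m' * (2 * cos (t * D m m')))" for t
  proof -
    have "Re (w * cis y) + Re (w * cis (- y)) = Re w * (2 * cos y)" for w y by (simp add: algebra_simps)
    then show ?thesis
      unfolding f_def cmod_sum_squared[OF assms]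
      unfolding sum.distrib[symmetric] D_def b_def minus_mult_left[symmetric]
      by (intro sum.cong refl)
  qed
  define E where "E R \<Delta> = exp (- R) * (\<Delta> * sin (R * \<Delta>) - cos (R * \<Delta>))" for R \<Delta> :: real
  have int_f: "f integrable_on {0..1}" by (intro integrable_continuous_interval cont)
  \<comment> \<open>On {0..1} the weight exp (- t) is at least exp (- 1), whence the factor
    \<open>exp 1\<close>; the window may then be enlarged because the integrand is
    nonnegative.\<close>
  have bound: "integral {0..1} f \<le> exp 1 * (\<Sum>m\<in>Z. \<Sum>m'\<in>Z. b m m' * (2 * lorentz (D m m') * (1 + E R (D m m'))))"
    if R: "R \<ge> 1" for R
  proof -
    have I: "((\<lambda>t. exp (- t) * (f t + f (- t))) has_integral
        (\<Sum>m\<in>Z. \<Sum>m'\<in>Z. b m m' * (2 * lorentz (D m m') * (1 + E R (D m m'))))) {0..R}"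
    proof -
      have eq: "exp (- t) * (f t + f (- t)) = (\<Sum>m\<in>Z. \<Sum>m'\<in>Z. b m m' * (exp (- t) * (2 * cos (t * D m m'))))" for t
        unfolding ff sum_distrib_left by (simp add: algebra_simps)
      show ?thesis unfolding eq E_def
        using R by (intro has_integral_sum assms has_integral_mult_right exp_cos_has_integral) auto
    qed
    have "integral {0..1} f \<le> integral {0..1} (\<lambda>t. exp 1 * (exp (- t) * (f t + f (- t))))"
    proof (rule integral_le[OF int_f])
      show "(\<lambda>t. exp 1 * (exp (- t) * (f t + f (- t)))) integrable_on {0..1}"
        by (intro integrable_continuous_interval continuous_intros cont
            continuous_on_compose2[OF cont[of UNIV]]) auto
      fix t :: real assume t: "t \<in> {0..1}"
      have "1 * f t \<le> exp (1 - t) * (f t + f (- t))"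
        using t f0[of t] f0[of "- t"] by (intro mult_mono) auto
      then show "f t \<le> exp 1 * (exp (- t) * (f t + f (- t)))"
        by (simp add: exp_diff exp_minus field_simps)
    qed
    also have "\<dots> \<le> integral {0..R} (\<lambda>t. exp 1 * (exp (- t) * (f t + f (- t))))"
      using R f0 by (intro integral_subset_le integrable_continuous_interval continuous_intros cont
            continuous_on_compose2[OF cont[of UNIV]]) (auto intro!: add_nonneg_nonneg mult_nonneg_nonneg)
    also have "\<dots> = exp 1 * (\<Sum>m\<in>Z. \<Sum>m'\<in>Z. b m m' * (2 * lorentz (D m m') * (1 + E R (D m m'))))"
      by (rule integral_unique) (rule has_integral_mult_right[OF I])
    finally show ?thesis .
  qed
  have E_lim: "((\<lambda>R. E R \<Delta>) \<longlongrightarrow> 0) at_top" for \<Delta>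
  proof (rule Lim_null_comparison)
    have "\<bar>\<Delta> * sin (R * \<Delta>) - cos (R * \<Delta>)\<bar> \<le> \<bar>\<Delta>\<bar> + 1" for R
    proof -
      have "\<bar>\<Delta> * sin (R * \<Delta>)\<bar> \<le> \<bar>\<Delta>\<bar> * 1" unfolding abs_mult by (intro mult_left_mono) auto
      moreover have "\<bar>cos (R * \<Delta>)\<bar> \<le> 1" by simp
      ultimately show ?thesis by linarith
    qed
    then show "\<forall>\<^sub>F R in at_top. norm (E R \<Delta>) \<le> exp (- R) * (\<bar>\<Delta>\<bar> + 1)"
      unfolding E_def by (intro always_eventually allI) (simp add: abs_mult)
    have "((\<lambda>R::real. exp (- R)) \<longlongrightarrow> 0) at_top"
      by (rule filterlim_compose[OF exp_at_bot filterlim_uminus_at_bot_at_top])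
    then show "((\<lambda>R. exp (- R) * (\<bar>\<Delta>\<bar> + 1)) \<longlongrightarrow> 0) at_top" by (rule tendsto_mult_left_zero)
  qed
  have "((\<lambda>R. exp 1 * (\<Sum>m\<in>Z. \<Sum>m'\<in>Z. b m m' * (2 * lorentz (D m m') * (1 + E R (D m m'))))) \<longlongrightarrow>
      exp 1 * (\<Sum>m\<in>Z. \<Sum>m'\<in>Z. b m m' * (2 * lorentz (D m m') * (1 + 0)))) at_top"
    by (intro tendsto_intros E_lim)
  then have "integral {0..1} f \<le> exp 1 * (\<Sum>m\<in>Z. \<Sum>m'\<in>Z. b m m' * (2 * lorentz (D m m') * (1 + 0)))"
    by (rule tendsto_lowerbound) (use bound in \<open>auto simp: eventually_at_top_linorder\<close>)
  \<comment> \<open>The limiting kernel is nonnegative, so only now may the coefficients be replaced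
    by their moduli.\<close>
  also have "\<dots> \<le> exp 1 * (\<Sum>m\<in>Z. \<Sum>m'\<in>Z. (cmod (a m) * cmod (a m')) * (2 * lorentz (D m m') * (1 + 0)))"
  proof (intro mult_left_mono sum_mono mult_right_mono)
    fix m m'
    show "b m m' \<le> cmod (a m) * cmod (a m')"
      unfolding b_def using complex_Re_le_cmod[of "a m * cnj (a m')"] by (simp add: norm_mult)
  qed auto
  also have "\<dots> = 2 * exp 1 * (\<Sum>m\<in>Z. \<Sum>m'\<in>Z. cmod (a m) * cmod (a m') * lorentz (\<phi> m - \<phi> m'))"
    unfolding sum_distrib_left D_def by (intro sum.cong) auto
  finally have "integral {0..1} f \<le> 2 * exp 1 * (\<Sum>m\<in>Z. \<Sum>m'\<in>Z. cmod (a m) * cmod (a m') * lorentz (\<phi> m - \<phi> m'))" .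
  moreover have "(\<integral>\<^sup>+t\<in>{0..1}. ennreal (f t) \<partial>lborel) = ennreal (integral {0..1} f)"
    using nn_integral_has_integral_lebesgue'[of "{0..1}" f] f0 int_f by (auto intro: integrable_integral)
  ultimately show ?thesis unfolding f_def by (simp add: ennreal_leI)
qed

text \<open>A weighted AM-GM inequality, 2 beta beta' <= beta^2 W / W' + beta'^2 W' / W, makes the
  quadratic form diagonal; by symmetry of k both halves are controlled by the same row sums.\<close>

lemma schur_test:
  fixes \<beta> W :: "'m \<Rightarrow> real" and k :: "'m \<Rightarrow> 'm \<Rightarrow> real"
  assumes "finite Z" and W: "\<And>m. W m > 0" and \<beta>: "\<And>m. \<beta> m \<ge> 0"
    and k0: "\<And>m m'. k m m' \<ge> 0" and sym: "\<And>m m'. k m m' = k m' m"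
    and sup: "\<And>m. m \<in> Z \<Longrightarrow> (\<Sum>m'\<in>Z. k m m' / W m') \<le> C"
  shows "(\<Sum>m\<in>Z. \<Sum>m'\<in>Z. \<beta> m * \<beta> m' * k m m') \<le> C * (\<Sum>m\<in>Z. (\<beta> m)\<^sup>2 * W m)"
proof -
  let ?A = "\<lambda>m m'. (\<beta> m)\<^sup>2 * W m * (k m m' / W m')"
  have le: "\<beta> m * \<beta> m' * k m m' \<le> (?A m m' + ?A m' m) / 2" for m m'
  proof -
    have "2 * (\<beta> m * \<beta> m') \<le> (\<beta> m)\<^sup>2 * W m / W m' + (\<beta> m')\<^sup>2 * W m' / W m"
    proof -
      define r where "r = W m / W m'"
      have r: "r > 0" using W by (simp add: r_def)
      have "0 \<le> (\<beta> m * r - \<beta> m')\<^sup>2 / r" using r by simp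
      also have "\<dots> = (\<beta> m)\<^sup>2 * r + (\<beta> m')\<^sup>2 / r - 2 * (\<beta> m * \<beta> m')"
        using r by (simp add: power2_eq_square field_simps)
      finally show ?thesis by (simp add: r_def)
    qed
    then have "2 * (\<beta> m * \<beta> m') * k m m' \<le> ((\<beta> m)\<^sup>2 * W m / W m' + (\<beta> m')\<^sup>2 * W m' / W m) * k m m'"
      using k0 by (intro mult_right_mono) auto
    then show ?thesis using sym[of m m'] by (simp add: algebra_simps)
  qed
  have "(\<Sum>m\<in>Z. \<Sum>m'\<in>Z. \<beta> m * \<beta> m' * k m m') \<le> (\<Sum>m\<in>Z. \<Sum>m'\<in>Z. (?A m m' + ?A m' m) / 2)"
    by (intro sum_mono le)
  also have "\<dots> = ((\<Sum>m\<in>Z. \<Sum>m'\<in>Z. ?A m m') + (\<Sum>m\<in>Z. \<Sum>m'\<in>Z. ?A m' m)) / 2"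
    by (simp only: sum.distrib sum_divide_distrib[symmetric])
  also have "(\<Sum>m\<in>Z. \<Sum>m'\<in>Z. ?A m' m) = (\<Sum>m\<in>Z. \<Sum>m'\<in>Z. ?A m m')" by (rule sum.swap)
  also have "((\<Sum>m\<in>Z. \<Sum>m'\<in>Z. ?A m m') + (\<Sum>m\<in>Z. \<Sum>m'\<in>Z. ?A m m')) / 2 = (\<Sum>m\<in>Z. \<Sum>m'\<in>Z. ?A m m')"
    by (rule field_sum_of_halves[unfolded add_divide_distrib[symmetric]])
  also have "\<dots> = (\<Sum>m\<in>Z. (\<beta> m)\<^sup>2 * W m * (\<Sum>m'\<in>Z. k m m' / W m'))"
    by (simp only: sum_distrib_left)
  also have "\<dots> \<le> (\<Sum>m\<in>Z. (\<beta> m)\<^sup>2 * W m * C)"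
    using W by (intro sum_mono mult_left_mono sup) (auto intro!: mult_nonneg_nonneg simp: less_imp_le)
  finally show ?thesis by (simp add: sum_distrib_left algebra_simps)
qed

text \<open>Here \<open>a = x + b - c\<close>, and the phase is \<open>\<bar>x\<bar>\<^sup>2 - \<bar>a\<bar>\<^sup>2 - \<bar>c\<bar>\<^sup>2 + \<bar>b\<bar>\<^sup>2\<close> in the norm with weights \<open>c1/2, c2/2\<close>.\<close>

definition phase :: "real \<Rightarrow> real \<Rightarrow> int \<times> int \<Rightarrow> (int \<times> int) \<times> (int \<times> int) \<Rightarrow> real" where
  "phase c1 c2 x m = c1 * real_of_int ((fst (snd m) - fst (fst m)) * (fst x - fst (snd m)))
     + c2 * real_of_int ((snd (snd m) - snd (fst m)) * (snd x - snd (snd m)))"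

lemma measurable_cis [measurable (raw)]: "f \<in> borel_measurable M \<Longrightarrow> (\<lambda>x. cis (f x)) \<in> borel_measurable M"
  unfolding cis_conv_exp by measurable

text \<open>The output x is fixed. \<open>time_kernel\<close> turns the time integral into a
  quadratic form in the incoming data with a Lorentzian kernel, and the row sums of the Schur test
  are the resonance sums. The argument x + fst m - snd m expresses conservation of momentum. The
  starting time t0 enters only through unimodular factors, and a direction s of modulus 1 leaves the
  even kernel unchanged.\<close>

theorem space_time_estimate:
  assumes "\<alpha> > 1 / 2" "c1 > 0" "c2 > 0"
  shows "\<exists>C\<ge>0. \<forall>t0 s Z (g :: int \<times> int \<Rightarrow> (int \<times> int) \<times> (int \<times> int) \<Rightarrow> complex).
    \<bar>s\<bar> = 1 \<longrightarrow> finite Z \<longrightarrow>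
    (\<integral>\<^sup>+t\<in>{0..1}. csum (\<lambda>x. ennreal (1 / lweight \<alpha> x *
        (cmod (\<Sum>m\<in>Z. cis ((t0 + s * t) * phase c1 c2 x m) * g (x + fst m - snd m) m))\<^sup>2)) \<partial>lborel)
    \<le> ennreal C * csum (\<lambda>a. csum (\<lambda>m. ennreal ((cmod (g a m))\<^sup>2 / (lweight \<alpha> a * lweight \<alpha> (fst m) * lweight \<alpha> (snd m)))))"
proof -
  obtain C where C: "C \<ge> 0" "\<And>x y. csum (\<lambda>z. ennreal (res_weight \<alpha> x (fst z) (snd z) *
      lorentz (y - c1 * real_of_int (fst (fst z) * fst (snd z)) - c2 * real_of_int (snd (fst z) * snd (snd z)))))
    \<le> ennreal C"
    using resonance_bound[OF assms] by auto
  show ?thesis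
  proof (rule exI[of _ "2 * exp 1 * C"], intro conjI allI impI)
    show "0 \<le> 2 * exp 1 * C" using C by simp
    fix t0 s :: real and Z :: "((int \<times> int) \<times> (int \<times> int)) set"
      and g :: "int \<times> int \<Rightarrow> (int \<times> int) \<times> (int \<times> int) \<Rightarrow> complex"
    assume s: "\<bar>s\<bar> = 1" and Z: "finite Z"
    define wt where "wt a m = lweight \<alpha> a * lweight \<alpha> (fst m) * lweight \<alpha> (snd m)" for a :: "int \<times> int" and m :: "(int \<times> int) \<times> (int \<times> int)"
    have wt: "wt a m > 0" for a m by (simp add: wt_def lweight_pos)
    let ?f = "\<lambda>x t. cmod (\<Sum>m\<in>Z. cis ((t0 + s * t) * phase c1 c2 x m) * g (x + fst m - snd m) m)"
    have one: "(\<integral>\<^sup>+t\<in>{0..1}. ennreal (1 / lweight \<alpha> x * (?f x t)\<^sup>2) \<partial>lborel)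
      \<le> ennreal (2 * exp 1 * C) * csum (\<lambda>m. ennreal ((cmod (g (x + fst m - snd m) m))\<^sup>2 / wt (x + fst m - snd m) m))" for x
    proof -
      define \<beta> where "\<beta> m = cmod (g (x + fst m - snd m) m)" for m
      define W where "W m = 1 / wt (x + fst m - snd m) m" for m
      define k where "k m m' = lorentz (phase c1 c2 x m - phase c1 c2 x m')" for m m'
      have W: "W m > 0" for m using wt by (simp add: W_def)
      have feq: "?f x t = cmod (\<Sum>m\<in>Z. (cis (t0 * phase c1 c2 x m) * g (x + fst m - snd m) m) * cis (t * (s * phase c1 c2 x m)))" for t
        by (intro arg_cong[of _ _ cmod] sum.cong refl) (simp add: cis_mult algebra_simps)
      have ks: "lorentz (s * phase c1 c2 x m - s * phase c1 c2 x m') = k m m'" for m m'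
      proof -
        have "s = 1 \<or> s = -1" using s by linarith
        then show ?thesis by (auto simp: k_def lorentz_def power2_commute)
      qed
      have sup: "(\<Sum>m'\<in>Z. k m m' / W m') \<le> C * lweight \<alpha> x" for m
      proof -
        \<comment> \<open>With m' = (b, c) this is u = c - b, v = x - c. Then x - u, x - u - v, x -
          v are a, b, c, and the phase becomes c1 u1 v1 + c2 u2 v2.\<close>
        let ?h = "\<lambda>m' :: (int \<times> int) \<times> (int \<times> int). (snd m' - fst m', x - snd m')"
        have bij: "bij ?h"
          by (rule bij_betw_byWitness[where f' = "\<lambda>z. (x - snd z - fst z, x - snd z)"]) auto
        have lx: "lsize x powr (2 * \<alpha>) = 1 / lweight \<alpha> x"
          by (simp add: lweight_def powr_minus divide_inverse)
        have "ennreal (\<Sum>m'\<in>Z. k m m' / W m' / lweight \<alpha> x) = (\<Sum>m'\<in>Z. ennreal (k m m' / W m' / lweight \<alpha> x))"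
          using W by (intro sum_ennreal[symmetric]) (auto simp: k_def less_imp_le)
        also have "\<dots> = csum (\<lambda>m'. ennreal (k m m' / W m' / lweight \<alpha> x) * indicator Z m')"
          by (rule csum_finite[OF Z, symmetric])
        also have "\<dots> \<le> csum (\<lambda>m'. ennreal (k m m' / W m' / lweight \<alpha> x))"
          by (intro csum_mono) (auto simp: indicator_def)
        also have "\<dots> = csum (\<lambda>m'. ennreal (res_weight \<alpha> x (fst (?h m')) (snd (?h m')) *
            lorentz (phase c1 c2 x m - c1 * real_of_int (fst (fst (?h m')) * fst (snd (?h m'))) - c2 * real_of_int (snd (fst (?h m')) * snd (snd (?h m'))))))"
        proof (intro nn_integral_cong arg_cong[of _ _ ennreal])
          fix m' :: "(int \<times> int) \<times> (int \<times> int)"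
          have a: "x - (snd m' - fst m') = x + fst m' - snd m'" "x + fst m' - snd m' - (x - snd m') = fst m'"
            "x - (x - snd m') = snd m'" by (simp_all add: algebra_simps)
          have p: "phase c1 c2 x m - c1 * real_of_int (fst (fst (?h m')) * fst (snd (?h m'))) - c2 * real_of_int (snd (fst (?h m')) * snd (snd (?h m')))
            = phase c1 c2 x m - phase c1 c2 x m'" by (simp add: phase_def)
          show "k m m' / W m' / lweight \<alpha> x = res_weight \<alpha> x (fst (?h m')) (snd (?h m')) *
            lorentz (phase c1 c2 x m - c1 * real_of_int (fst (fst (?h m')) * fst (snd (?h m'))) - c2 * real_of_int (snd (fst (?h m')) * snd (snd (?h m'))))"
            unfolding p unfolding fst_conv snd_conv res_weight_def a lx k_def W_def wt_def by simp
        qed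
        also have "\<dots> \<le> ennreal C"
          unfolding csum_reindex[OF bij, of "\<lambda>z. ennreal (res_weight \<alpha> x (fst z) (snd z) *
            lorentz (phase c1 c2 x m - c1 * real_of_int (fst (fst z) * fst (snd z)) - c2 * real_of_int (snd (fst z) * snd (snd z))))"]
          by (rule C)
        finally have "(\<Sum>m'\<in>Z. k m m' / W m' / lweight \<alpha> x) \<le> C" using C by (simp add: ennreal_le_iff)
        then have "(\<Sum>m'\<in>Z. k m m' / W m') / lweight \<alpha> x \<le> C" by (simp only: sum_divide_distrib)
        then show ?thesis using lweight_pos[of \<alpha> x] by (simp add: pos_divide_le_eq)
      qed
      have S: "(\<Sum>m\<in>Z. \<Sum>m'\<in>Z. \<beta> m * \<beta> m' * k m m') \<le> C * lweight \<alpha> x * (\<Sum>m\<in>Z. (\<beta> m)\<^sup>2 * W m)"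
      proof (rule schur_test[OF Z W])
        show "k m m' = k m' m" for m m' by (simp add: k_def lorentz_def power2_commute)
      qed (use sup in \<open>auto simp: \<beta>_def k_def\<close>)
      have "(\<integral>\<^sup>+t\<in>{0..1}. ennreal (1 / lweight \<alpha> x * (?f x t)\<^sup>2) \<partial>lborel)
        = ennreal (1 / lweight \<alpha> x) * (\<integral>\<^sup>+t\<in>{0..1}. ennreal ((?f x t)\<^sup>2) \<partial>lborel)"
        by (subst nn_integral_cmult[symmetric])
          (auto intro!: nn_integral_cong simp: mult.assoc[symmetric] simp flip: ennreal_mult')
      also have "\<dots> \<le> ennreal (1 / lweight \<alpha> x) * ennreal (2 * exp 1 * (\<Sum>m\<in>Z. \<Sum>m'\<in>Z. \<beta> m * \<beta> m' * k m m'))"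
        unfolding feq
        by (intro mult_left_mono order_trans[OF time_kernel[OF Z]])
          (simp_all add: norm_mult \<beta>_def ks)
      also have "\<dots> \<le> ennreal (1 / lweight \<alpha> x) * ennreal (2 * exp 1 * (C * lweight \<alpha> x * (\<Sum>m\<in>Z. (\<beta> m)\<^sup>2 * W m)))"
        using S by (intro mult_left_mono ennreal_leI) auto
      also have "\<dots> = ennreal (2 * exp 1 * C * (\<Sum>m\<in>Z. (\<beta> m)\<^sup>2 * W m))"
        using lweight_pos[of \<alpha> x] by (simp add: mult.assoc flip: ennreal_mult')
      also have "\<dots> = ennreal (2 * exp 1 * C) * (\<Sum>m\<in>Z. ennreal ((\<beta> m)\<^sup>2 * W m))"
        using C W by (subst sum_ennreal) (auto simp: less_imp_le simp flip: ennreal_mult')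
      also have "(\<Sum>m\<in>Z. ennreal ((\<beta> m)\<^sup>2 * W m)) = csum (\<lambda>m. ennreal ((\<beta> m)\<^sup>2 * W m) * indicator Z m)"
        by (rule csum_finite[OF Z, symmetric])
      also have "\<dots> \<le> csum (\<lambda>m. ennreal ((\<beta> m)\<^sup>2 * W m))"
        by (intro csum_mono) (auto simp: indicator_def)
      finally show ?thesis by (simp add: \<beta>_def W_def mult_left_mono)
    qed
    have "(\<integral>\<^sup>+t\<in>{0..1}. csum (\<lambda>x. ennreal (1 / lweight \<alpha> x * (?f x t)\<^sup>2)) \<partial>lborel)
      = (\<integral>\<^sup>+t. csum (\<lambda>x. ennreal (1 / lweight \<alpha> x * (?f x t)\<^sup>2) * indicator {0..1} t) \<partial>lborel)"
      by (simp add: nn_integral_multc)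
    also have "\<dots> = csum (\<lambda>x. \<integral>\<^sup>+t\<in>{0..1}. ennreal (1 / lweight \<alpha> x * (?f x t)\<^sup>2) \<partial>lborel)"
      by (rule nn_integral_count_space_nn_integral) auto
    also have "\<dots> \<le> csum (\<lambda>x. ennreal (2 * exp 1 * C) * csum (\<lambda>m. ennreal ((cmod (g (x + fst m - snd m) m))\<^sup>2 / wt (x + fst m - snd m) m)))"
      by (intro csum_mono one)
    also have "\<dots> = ennreal (2 * exp 1 * C) * csum (\<lambda>m. csum (\<lambda>x. ennreal ((cmod (g (x + fst m - snd m) m))\<^sup>2 / wt (x + fst m - snd m) m)))"
      unfolding csum_cmult by (subst csum_swap) simp
    also have "(\<lambda>m. csum (\<lambda>x. ennreal ((cmod (g (x + fst m - snd m) m))\<^sup>2 / wt (x + fst m - snd m) m)))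
      = (\<lambda>m. csum (\<lambda>a. ennreal ((cmod (g a m))\<^sup>2 / wt a m)))"
    proof
      fix m :: "(int \<times> int) \<times> (int \<times> int)"
      have "bij (\<lambda>x. x + fst m - snd m)"
        by (rule bij_betw_byWitness[where f' = "\<lambda>x. x - fst m + snd m"]) auto
      then show "csum (\<lambda>x. ennreal ((cmod (g (x + fst m - snd m) m))\<^sup>2 / wt (x + fst m - snd m) m)) =
          csum (\<lambda>a. ennreal ((cmod (g a m))\<^sup>2 / wt a m))"
        by (rule csum_reindex[of _ "\<lambda>a. ennreal ((cmod (g a m))\<^sup>2 / wt a m)"])
    qed
    also have "csum (\<lambda>m. csum (\<lambda>a. ennreal ((cmod (g a m))\<^sup>2 / wt a m))) = csum (\<lambda>a. csum (\<lambda>m. ennreal ((cmod (g a m))\<^sup>2 / wt a m)))"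
      by (rule csum_swap)
    finally show "(\<integral>\<^sup>+t\<in>{0..1}. csum (\<lambda>x. ennreal (1 / lweight \<alpha> x * (?f x t)\<^sup>2)) \<partial>lborel)
      \<le> ennreal (2 * exp 1 * C) * csum (\<lambda>a. csum (\<lambda>m. ennreal ((cmod (g a m))\<^sup>2 / (lweight \<alpha> a * lweight \<alpha> (fst m) * lweight \<alpha> (snd m)))))"
      by (simp add: wt_def)
  qed
qed

subsection \<open>Extended square roots and Minkowski's inequality\<close>

definition esqrt :: "ennreal \<Rightarrow> ennreal" where
  "esqrt x = (if x = top then top else ennreal (sqrt (enn2real x)))"

lemma esqrt_square: "(esqrt x)\<^sup>2 = x"
proof (cases x)
  case (real r)
  then show ?thesis by (simp add: esqrt_def ennreal_power)
qed (simp add: esqrt_def power2_eq_square ennreal_mult_top)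

lemma ennreal_square_le_iff: "x\<^sup>2 \<le> y\<^sup>2 \<longleftrightarrow> x \<le> (y::ennreal)"
proof
  assume "x\<^sup>2 \<le> y\<^sup>2"
  then show "x \<le> y"
    by (cases x; cases y) (auto simp: ennreal_power ennreal_le_iff power2_eq_square ennreal_mult_top top_unique
        abs_le_square_iff[unfolded power2_eq_square, symmetric] ennreal_mult[symmetric])
qed (rule power_mono; simp)

lemma esqrt_le_iff: "esqrt x \<le> y \<longleftrightarrow> x \<le> y\<^sup>2"
  using ennreal_square_le_iff[of "esqrt x" y] by (simp add: esqrt_square)

lemma esqrt_mono: "x \<le> y \<Longrightarrow> esqrt x \<le> esqrt y"
  by (simp add: esqrt_le_iff esqrt_square)

lemma esqrt_of_square [simp]: "esqrt (x\<^sup>2) = x"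
  by (metis antisym ennreal_square_le_iff esqrt_square order_refl)

lemma esqrt_mult: "esqrt (x * y) = esqrt x * esqrt y"
  by (metis esqrt_of_square esqrt_square power_mult_distrib)

lemma esqrt_0 [simp]: "esqrt 0 = 0" and esqrt_1 [simp]: "esqrt 1 = 1"
  using esqrt_of_square[of 0] esqrt_of_square[of 1] by simp_all

lemma esqrt_top_iff [simp]: "esqrt x = top \<longleftrightarrow> x = top"
  by (auto simp: esqrt_def)

lemma esqrt_ennreal: "0 \<le> r \<Longrightarrow> esqrt (ennreal r) = ennreal (sqrt r)"
  by (simp add: esqrt_def)

lemma borel_measurable_esqrt [measurable (raw)]:
  assumes [measurable]: "f \<in> borel_measurable M"
  shows "(\<lambda>x. esqrt (f x)) \<in> borel_measurable M"
  unfolding esqrt_def by measurable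

lemma borel_measurable_nn_integral_count_space:
  assumes X: "countable X" and f: "\<And>x. x \<in> X \<Longrightarrow> (\<lambda>s. f s x) \<in> borel_measurable M"
  shows "(\<lambda>s. \<integral>\<^sup>+x. f s x \<partial>count_space X) \<in> borel_measurable M"
proof -
  interpret sigma_finite_measure "count_space X" by (rule sigma_finite_measure_count_space_countable[OF X])
  have "(\<lambda>(x, s). f s x) \<in> borel_measurable (count_space X \<Otimes>\<^sub>M M)"
    using X f by (intro measurable_pair_measure_countable1) auto
  then have "(\<lambda>(s, x). f s x) \<in> borel_measurable (M \<Otimes>\<^sub>M count_space X)"
    using measurable_pair_swap by fastforce
  then show ?thesis by (rule borel_measurable_nn_integral)
qed

lemma esqrt_liminf: "esqrt (liminf a) \<le> liminf (\<lambda>n. esqrt (a n))"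
  unfolding esqrt_le_iff liminf_SUP_INF
proof (rule SUP_least)
  fix n :: nat
  have "esqrt (INF m\<in>{n..}. a m) \<le> (INF m\<in>{n..}. esqrt (a m))"
    by (intro INF_greatest esqrt_mono INF_lower)
  also have "\<dots> \<le> (SUP n. INF m\<in>{n..}. esqrt (a m))" by (intro SUP_upper) auto
  finally show "(INF m\<in>{n..}. a m) \<le> (SUP n. INF m\<in>{n..}. esqrt (a m))\<^sup>2" by (simp add: esqrt_le_iff)
qed

lemma esqrt_tendsto_0:
  assumes "a \<longlonglongrightarrow> 0"
  shows "(\<lambda>n. esqrt (a n)) \<longlonglongrightarrow> 0"
proof (rule order_tendstoI)
  fix e :: ennreal assume "0 < e"
  then have "0 < e\<^sup>2" by (simp add: zero_less_iff_neq_zero)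
  then have "\<forall>\<^sub>F n in sequentially. a n < e\<^sup>2" using assms by (rule order_tendstoD(2)[rotated])
  then show "\<forall>\<^sub>F n in sequentially. esqrt (a n) < e"
    by eventually_elim (metis esqrt_le_iff esqrt_square leD leI ennreal_square_le_iff)
qed simp

lemma nn_integral_Cauchy_Schwarz_esqrt:
  assumes [measurable]: "f \<in> borel_measurable M" "g \<in> borel_measurable M"
  shows "(\<integral>\<^sup>+x. f x * g x \<partial>M) \<le> esqrt (\<integral>\<^sup>+x. (f x)\<^sup>2 \<partial>M) * esqrt (\<integral>\<^sup>+x. (g x)\<^sup>2 \<partial>M)"
  using Cauchy_Schwarz_nn_integral[OF assms] unfolding esqrt_mult[symmetric]
  by (metis ennreal_square_le_iff esqrt_square)

definition wnorm :: "'x set \<Rightarrow> ('x \<Rightarrow> real) \<Rightarrow> ('x \<Rightarrow> complex) \<Rightarrow> ennreal" where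
  "wnorm X W G = esqrt (\<integral>\<^sup>+x. ennreal (W x * (cmod (G x))\<^sup>2) \<partial>count_space X)"

text \<open>The square of the integral is expanded into a double integral over s and s', and
  Cauchy-Schwarz is applied to each pair. Since the hypothesis is only a pointwise majorization of
  moduli, the result serves Bochner integrals as well as, over a counting measure, finite
  sums.\<close>

lemma wnorm_minkowski:
  fixes H :: "'s \<Rightarrow> 'x \<Rightarrow> complex"
  assumes X: "countable X" and W: "\<And>x. 0 \<le> W x"
    and H[measurable]: "\<And>x. x \<in> X \<Longrightarrow> (\<lambda>s. H s x) \<in> borel_measurable M"
    and le: "\<And>x. x \<in> X \<Longrightarrow> ennreal (cmod (G x)) \<le> (\<integral>\<^sup>+s. ennreal (cmod (H s x)) \<partial>M)"
  shows "wnorm X W G \<le> (\<integral>\<^sup>+s. wnorm X W (H s) \<partial>M)"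
proof -
  define h where "h s x = ennreal (cmod (H s x))" for s x
  define v where "v x = ennreal (W x)" for x
  have [measurable]: "\<And>x. x \<in> X \<Longrightarrow> (\<lambda>s. h s x) \<in> borel_measurable M" by (simp add: h_def)
  define J where "J x = (\<integral>\<^sup>+s. h s x \<partial>M)" for x
  have n: "wnorm X W (H s) = esqrt (\<integral>\<^sup>+x. v x * (h s x)\<^sup>2 \<partial>count_space X)" for s
    unfolding wnorm_def h_def v_def using W by (simp add: ennreal_mult ennreal_power)
  have cs: "(\<integral>\<^sup>+x. v x * h s x * h s' x \<partial>count_space X) \<le> wnorm X W (H s) * wnorm X W (H s')" for s s'
  proof -
    have "(\<integral>\<^sup>+x. v x * h s x * h s' x \<partial>count_space X) =
        (\<integral>\<^sup>+x. (esqrt (v x) * h s x) * (esqrt (v x) * h s' x) \<partial>count_space X)"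
      by (intro nn_integral_cong) (metis (no_types, opaque_lifting) esqrt_square mult.assoc mult.left_commute power2_eq_square)
    also have "\<dots> \<le> esqrt (\<integral>\<^sup>+x. (esqrt (v x) * h s x)\<^sup>2 \<partial>count_space X) * esqrt (\<integral>\<^sup>+x. (esqrt (v x) * h s' x)\<^sup>2 \<partial>count_space X)"
      by (intro nn_integral_Cauchy_Schwarz_esqrt) auto
    finally show ?thesis by (simp add: n power_mult_distrib esqrt_square)
  qed
  have "(\<integral>\<^sup>+x. ennreal (W x * (cmod (G x))\<^sup>2) \<partial>count_space X) \<le> (\<integral>\<^sup>+x. v x * (J x)\<^sup>2 \<partial>count_space X)"
  proof (rule nn_integral_mono)
    fix x assume "x \<in> space (count_space X)"
    then have "(ennreal (cmod (G x)))\<^sup>2 \<le> (J x)\<^sup>2"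
      using le by (intro power_mono) (auto simp: J_def h_def)
    then show "ennreal (W x * (cmod (G x))\<^sup>2) \<le> v x * (J x)\<^sup>2"
      using W by (simp add: v_def ennreal_mult ennreal_power mult_left_mono)
  qed
  also have "\<dots> = (\<integral>\<^sup>+x. \<integral>\<^sup>+s. v x * J x * h s x \<partial>M \<partial>count_space X)"
    by (intro nn_integral_cong) (simp add: nn_integral_cmult J_def power2_eq_square mult.assoc)
  also have "\<dots> = (\<integral>\<^sup>+s. \<integral>\<^sup>+x. v x * J x * h s x \<partial>count_space X \<partial>M)"
    by (rule nn_integral_count_space_nn_integral[symmetric]) (use X in auto)
  also have "\<dots> \<le> (\<integral>\<^sup>+s. wnorm X W (H s) * (\<integral>\<^sup>+s'. wnorm X W (H s') \<partial>M) \<partial>M)"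
  proof (rule nn_integral_mono)
    fix s
    have "(\<integral>\<^sup>+x. v x * J x * h s x \<partial>count_space X) = (\<integral>\<^sup>+x. \<integral>\<^sup>+s'. v x * h s x * h s' x \<partial>M \<partial>count_space X)"
      unfolding J_def by (intro nn_integral_cong, subst nn_integral_cmult) (auto simp: mult_ac)
    also have "\<dots> = (\<integral>\<^sup>+s'. \<integral>\<^sup>+x. v x * h s x * h s' x \<partial>count_space X \<partial>M)"
      by (rule nn_integral_count_space_nn_integral[symmetric]) (use X in auto)
    also have "\<dots> \<le> (\<integral>\<^sup>+s'. wnorm X W (H s) * wnorm X W (H s') \<partial>M)"
      by (intro nn_integral_mono cs)
    also have "\<dots> = wnorm X W (H s) * (\<integral>\<^sup>+s'. wnorm X W (H s') \<partial>M)"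
    proof (rule nn_integral_cmult)
      have "(\<lambda>s'. \<integral>\<^sup>+x. v x * (h s' x)\<^sup>2 \<partial>count_space X) \<in> borel_measurable M"
        by (intro borel_measurable_nn_integral_count_space X) auto
      then show "(\<lambda>s'. wnorm X W (H s')) \<in> borel_measurable M" unfolding n by measurable
    qed
    finally show "(\<integral>\<^sup>+x. v x * J x * h s x \<partial>count_space X) \<le> wnorm X W (H s) * (\<integral>\<^sup>+s'. wnorm X W (H s') \<partial>M)" .
  qed
  also have "\<dots> = (\<integral>\<^sup>+s. wnorm X W (H s) \<partial>M)\<^sup>2"
  proof (subst nn_integral_multc)
    have "(\<lambda>s'. \<integral>\<^sup>+x. v x * (h s' x)\<^sup>2 \<partial>count_space X) \<in> borel_measurable M"
      by (intro borel_measurable_nn_integral_count_space X) auto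
    then show "(\<lambda>s'. wnorm X W (H s')) \<in> borel_measurable M" unfolding n by measurable
  qed (simp add: power2_eq_square)
  finally show ?thesis unfolding wnorm_def[of X W G] esqrt_le_iff .
qed

lemma wnorm_sum:
  assumes "countable X" "\<And>x. 0 \<le> W x" "finite I" "\<And>x. x \<in> X \<Longrightarrow> cmod (G x) \<le> (\<Sum>i\<in>I. cmod (H i x))"
  shows "wnorm X W G \<le> (\<Sum>i\<in>I. wnorm X W (H i))"
proof -
  have "wnorm X W G \<le> (\<integral>\<^sup>+i. wnorm X W (H i) \<partial>count_space I)"
  proof (rule wnorm_minkowski[OF assms(1,2)])
    fix x assume "x \<in> X"
    then have "ennreal (cmod (G x)) \<le> ennreal (\<Sum>i\<in>I. cmod (H i x))" by (intro ennreal_leI assms)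
    then show "ennreal (cmod (G x)) \<le> (\<integral>\<^sup>+i. ennreal (cmod (H i x)) \<partial>count_space I)"
      using assms(3) by (simp add: nn_integral_count_space_finite sum_ennreal)
  qed simp
  then show ?thesis using assms(3) by (simp add: nn_integral_count_space_finite)
qed

lemma wnorm_measurable:
  assumes "countable X" "\<And>x. x \<in> X \<Longrightarrow> (\<lambda>s. H s x) \<in> borel_measurable M"
  shows "(\<lambda>s. wnorm X W (H s)) \<in> borel_measurable M"
proof -
  have "(\<lambda>s. \<integral>\<^sup>+x. ennreal (W x * (cmod (H s x))\<^sup>2) \<partial>count_space X) \<in> borel_measurable M"
    using assms by (intro borel_measurable_nn_integral_count_space) auto
  then show ?thesis unfolding wnorm_def by (rule borel_measurable_esqrt)
qed

subsection \<open>Binary forests\<close>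

text \<open>The node \<open>(i, l)\<close> lies in the \<open>i\<close>-th tree; \<open>l\<close> lists the turns taken from the root, the last one first.\<close>

type_synonym addr = "nat \<times> bool list"

definition child :: "addr \<Rightarrow> bool \<Rightarrow> addr" where
  "child a b = (fst a, b # snd a)"

definition roots :: "nat \<Rightarrow> addr set" where
  "roots k = (\<lambda>i. (i, [])) ` {..<k}"

text \<open>Sets of internal nodes of k binary trees: a set is admissible when it contains the
  parent of each of its non-root members. A node stands for a collision, and the leaves are the
  particles present after all of them.\<close>

definition shapes :: "nat \<Rightarrow> nat \<Rightarrow> addr set set" where
  "shapes k n = {S. finite S \<and> card S = n \<and> fst ` S \<subseteq> {..<k} \<and> (\<forall>i b l. (i, b # l) \<in> S \<longrightarrow> (i, l) \<in> S)}"

definition leaves :: "nat \<Rightarrow> addr set \<Rightarrow> addr set" where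
  "leaves k S = roots k \<union> (\<lambda>(a, b). child a b) ` (S \<times> UNIV) - S"

definition grow :: "addr \<Rightarrow> addr set \<Rightarrow> addr set" where
  "grow p A = insert (child p False) (insert (child p True) (A - {p}))"

lemma child_inject [simp]: "child a b = child a' b' \<longleftrightarrow> a = a' \<and> b = b'"
  by (cases a; cases a') (auto simp: child_def)

lemma child_neq [simp]: "child a b \<noteq> a" "a \<noteq> child a b"
  by (cases a; auto simp: child_def)+

lemma child_not_root [simp]: "child a b \<notin> roots k"
  by (auto simp: child_def roots_def)

lemma shapesD:
  assumes "S \<in> shapes k n"
  shows "finite S" "card S = n" "child a b \<in> S \<Longrightarrow> a \<in> S" "(i, l) \<in> S \<Longrightarrow> i < k"
  using assms by (cases a; auto simp: shapes_def child_def)+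

lemma finite_leaves: "finite S \<Longrightarrow> finite (leaves k S)"
  by (simp add: leaves_def roots_def)

lemma shapes_suffix:
  assumes "S \<in> shapes k n"
  shows "(i, l' @ l) \<in> S \<Longrightarrow> (i, l) \<in> S"
  by (induction l') (use assms in \<open>auto simp: shapes_def\<close>)

lemma shapes_subset: "S \<in> shapes k n \<Longrightarrow> S \<subseteq> roots k \<union> (\<lambda>(a, b). child a b) ` (S \<times> UNIV)"
proof
  fix a assume S: "S \<in> shapes k n" and "a \<in> S"
  obtain i l where a: "a = (i, l)" by (cases a)
  show "a \<in> roots k \<union> (\<lambda>(a, b). child a b) ` (S \<times> UNIV)"
  proof (cases l)
    case Nil
    then show ?thesis using shapesD(4)[OF S, of i l] \<open>a \<in> S\<close> a by (auto simp: roots_def)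
  next
    case (Cons b l')
    then have "a = child (i, l') b" by (simp add: a child_def)
    then show ?thesis using shapesD(3)[OF S, of "(i, l')" b] \<open>a \<in> S\<close> by force
  qed
qed

text \<open>Candidates for leaves are the k roots and 2 n children, and exactly n of these are
  nodes.\<close>

lemma card_leaves:
  assumes S: "S \<in> shapes k n"
  shows "card (leaves k S) = k + n"
proof -
  have fin: "finite S" using shapesD[OF S] by blast
  let ?C = "(\<lambda>(a, b). child a b) ` (S \<times> UNIV)"
  have "card ?C = card (S \<times> (UNIV :: bool set))" by (intro card_image) (auto simp: inj_on_def)
  then have C: "card ?C = 2 * n" using shapesD[OF S] by (simp add: card_cartesian_product)
  have r: "card (roots k) = k" unfolding roots_def by (subst card_image) (auto simp: inj_on_def)
  have "roots k \<inter> ?C = {}" by auto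
  then have "card (roots k \<union> ?C) = k + 2 * n"
    using C r fin by (subst card_Un_disjoint) (auto simp: roots_def)
  then show ?thesis unfolding leaves_def
    using shapes_subset[OF S] fin shapesD(2)[OF S] by (subst card_Diff_subset) auto
qed

lemma leaf_not_node: "p \<in> leaves k S \<Longrightarrow> p \<notin> S"
  by (simp add: leaves_def)

lemma leaves_grow:
  assumes S: "S \<in> shapes k n" and p: "p \<in> leaves k S"
  shows "insert p S \<in> shapes k (Suc n)" "leaves k (insert p S) = grow p (leaves k S)"
    "child p b \<notin> leaves k S" "child p b \<notin> S"
proof -
  show c: "child p b \<notin> S" for b using shapesD(3)[OF S, of p b] leaf_not_node[OF p] by blast
  show c': "child p b \<notin> leaves k S" for b
    using leaf_not_node[OF p] by (auto simp: leaves_def)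
  show "leaves k (insert p S) = grow p (leaves k S)"
    using c c' unfolding leaves_def grow_def by (auto simp: UNIV_bool)
  have "fst p < k"
    using p shapesD(4)[OF S] by (auto simp: leaves_def roots_def child_def)
  moreover have "(i, l) \<in> insert p S" if "p = (i, b # l)" for i b l
  proof -
    from p have "p \<in> roots k \<or> (\<exists>a b. a \<in> S \<and> p = child a b)" by (auto simp: leaves_def)
    then show ?thesis using that by (auto simp: roots_def child_def)
  qed
  ultimately show "insert p S \<in> shapes k (Suc n)"
    using S leaf_not_node[OF p] unfolding shapes_def by auto
qed

text \<open>A node of maximal depth has no child in the forest, so its removal preserves closure
  under parents.\<close>

lemma shapes_remove:
  assumes S: "S \<in> shapes k (Suc n)"
  shows "\<exists>p\<in>S. S - {p} \<in> shapes k n \<and> p \<in> leaves k (S - {p})"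
proof -
  have fin: "finite S" "S \<noteq> {}" using shapesD[OF S] by auto
  define m where "m = Max ((\<lambda>a. length (snd a)) ` S)"
  have m: "length (snd a) \<le> m" if "a \<in> S" for a using that fin by (simp add: m_def)
  have "m \<in> (\<lambda>a. length (snd a)) ` S" unfolding m_def using fin by (intro Max_in) auto
  then obtain p where p: "p \<in> S" "length (snd p) = m" by auto
  have nc: "child p b \<notin> S" for b using m[of "child p b"] p by (auto simp: child_def)
  have 1: "S - {p} \<in> shapes k n"
  proof -
    have "(i, l) \<in> S - {p}" if "(i, b # l) \<in> S - {p}" for i b l
    proof -
      have "(i, l) \<in> S" using S that by (auto simp: shapes_def)
      moreover have "(i, l) \<noteq> p" using nc[of b] that by (auto simp: child_def)
      ultimately show ?thesis by simp
    qed
    moreover have "card (S - {p}) = n" using shapesD(2)[OF S] p by (simp add: card_Diff_singleton)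
    moreover have "fst ` (S - {p}) \<subseteq> {..<k}" using S unfolding shapes_def by blast
    ultimately show ?thesis using fin(1) unfolding shapes_def by blast
  qed
  moreover have "p \<in> leaves k (S - {p})"
  proof -
    have "p \<in> roots k \<union> (\<lambda>(a, b). child a b) ` (S \<times> UNIV)" using shapes_subset[OF S] p by blast
    then show ?thesis by (auto simp: leaves_def)
  qed
  ultimately show ?thesis using p by blast
qed

lemma shapes_0: "shapes k 0 = {{}}"
  by (auto simp: shapes_def)

lemma leaves_empty: "leaves k {} = roots k"
  by (simp add: leaves_def)

definition trees :: "nat \<Rightarrow> bool list set set" where
  "trees d = {S. (\<forall>l\<in>S. length l < d) \<and> (\<forall>b l. b # l \<in> S \<longrightarrow> l \<in> S)}"

lemma finite_trees: "finite (trees d)"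
proof -
  have "trees d \<subseteq> Pow {l. set l \<subseteq> UNIV \<and> length l \<le> d}" by (auto simp: trees_def)
  moreover have "finite (Pow {l :: bool list. set l \<subseteq> UNIV \<and> length l \<le> d})"
    using finite_lists_length_le[of "UNIV :: bool set" d] by simp
  ultimately show ?thesis by (rule finite_subset)
qed

lemma finite_tree: "S \<in> trees d \<Longrightarrow> finite S"
  by (rule finite_subset[OF _ finite_lists_length_le[of "UNIV :: bool set" d]]) (auto simp: trees_def)

text \<open>Splitting at the root turns the generating function with weight 1/4 per node into the
  recursion X -> 1 + X^2 / 4, whose fixed point is 2. The depth bound keeps the sums finite and
  carries the induction.\<close>

lemma trees_weight: "(\<Sum>S\<in>trees d. (1 / 4 :: real) ^ card S) \<le> 2"
proof (induction d)
  case 0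
  have "trees 0 = {{}}" by (auto simp: trees_def)
  then show ?case by simp
next
  case (Suc d)
  \<comment> \<open>The turn at the root is the last entry of an address, so a subtree is attached
    by appending at the end.\<close>
  define graft :: "bool list set \<times> bool list set \<Rightarrow> bool list set"
    where "graft = (\<lambda>(A, B). insert [] ((\<lambda>l. l @ [False]) ` A \<union> (\<lambda>l. l @ [True]) ` B))"
  have sub: "trees (Suc d) \<subseteq> insert {} (graft ` (trees d \<times> trees d))"
  proof
    fix S assume S: "S \<in> trees (Suc d)"
    show "S \<in> insert {} (graft ` (trees d \<times> trees d))"
    proof (cases "S = {}")
      case False
      have suf: "l' @ l \<in> S \<Longrightarrow> l \<in> S" for l l'
        by (induction l') (use S in \<open>auto simp: trees_def\<close>)
      have nil: "[] \<in> S" using False suf[of _ "[]"] by auto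
      define A where "A b = {l. l @ [b] \<in> S}" for b
      have A: "A b \<in> trees d" for b
        using S unfolding A_def trees_def by (auto simp flip: append_Cons)
      have "S = graft (A False, A True)"
      proof (rule set_eqI)
        fix l show "l \<in> S \<longleftrightarrow> l \<in> graft (A False, A True)"
        proof (cases l rule: rev_cases)
          case (snoc l' b)
          then show ?thesis by (cases b) (auto simp: graft_def A_def)
        qed (use nil in \<open>simp add: graft_def\<close>)
      qed
      then show ?thesis using A by blast
    qed simp
  qed
  have card: "card (graft (A, B)) = 1 + card A + card B" if "A \<in> trees d" "B \<in> trees d" for A B
  proof -
    have "card ((\<lambda>l. l @ [False]) ` A \<union> (\<lambda>l. l @ [True]) ` B) = card A + card B"
      using finite_tree that by (subst card_Un_disjoint) (auto simp: card_image inj_on_def)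
    moreover have "[] \<notin> (\<lambda>l. l @ [False]) ` A \<union> (\<lambda>l. l @ [True]) ` B" by auto
    ultimately show ?thesis using finite_tree that by (simp add: graft_def)
  qed
  have fin: "finite (graft ` (trees d \<times> trees d))" by (simp add: finite_trees)
  have "(\<Sum>S\<in>trees (Suc d). (1 / 4 :: real) ^ card S) \<le> (\<Sum>S\<in>insert {} (graft ` (trees d \<times> trees d)). (1 / 4) ^ card S)"
    using sub fin by (intro sum_mono2) auto
  also have "\<dots> \<le> 1 + (\<Sum>S\<in>graft ` (trees d \<times> trees d). (1 / 4) ^ card S)"
    using fin by (subst sum.insert) (auto simp: graft_def)
  also have "(\<Sum>S\<in>graft ` (trees d \<times> trees d). (1 / 4 :: real) ^ card S) \<le> (\<Sum>z\<in>trees d \<times> trees d. (1 / 4) ^ card (graft z))"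
    using sum_image_le[of "trees d \<times> trees d" "\<lambda>S. (1 / 4 :: real) ^ card S" graft] by (simp add: finite_trees)
  also have "\<dots> = (\<Sum>A\<in>trees d. \<Sum>B\<in>trees d. (1 / 4) * ((1 / 4) ^ card A * (1 / 4) ^ card B))"
    unfolding sum.cartesian_product by (intro sum.cong) (auto simp: card power_add)
  also have "\<dots> = (1 / 4) * ((\<Sum>A\<in>trees d. (1 / 4) ^ card A) * (\<Sum>B\<in>trees d. (1 / 4) ^ card B))"
    by (subst sum_product) (simp only: sum_distrib_left)
  also have "\<dots> \<le> (1 / 4) * (2 * 2)"
    using Suc by (intro mult_left_mono mult_mono sum_nonneg) auto
  finally show ?case by simp
qed

lemma length_less_card:
  assumes S: "S \<in> shapes k n" and l: "(i, l) \<in> S"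
  shows "length l < n"
proof -
  have "(i, drop j l) \<in> S" for j using shapes_suffix[OF S, of i "take j l" "drop j l"] l by simp
  then have "(\<lambda>j. (i, drop j l)) ` {..length l} \<subseteq> S" by blast
  then have "card ((\<lambda>j. (i, drop j l)) ` {..length l}) \<le> card S"
    using shapesD[OF S] by (intro card_mono)
  moreover have "inj_on (\<lambda>j. (i, drop j l)) {..length l}"
  proof (rule inj_onI)
    fix j j' assume "j \<in> {..length l}" "j' \<in> {..length l}" "(i, drop j l) = (i, drop j' l)"
    then have "length l - j = length l - j'" by (metis length_drop prod.inject)
    then show "j = j'" using \<open>j \<in> _\<close> \<open>j' \<in> _\<close> by auto
  qed
  ultimately show ?thesis using shapesD[OF S] by (simp add: card_image)
qed

text \<open>A forest is a k-tuple of trees, and the weight 4^(-n) is multiplicative over them. Each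
  tree contributes at most 2 by \<open>trees_weight\<close>, which gives 2^k 4^n without counting
  trees exactly.\<close>

lemma card_shapes: "finite (shapes k n)" "real (card (shapes k n)) \<le> 2 ^ k * 4 ^ n"
proof -
  define f where "f S = (\<lambda>i\<in>{..<k}. {l. (i, l) \<in> S})" for S :: "addr set"
  have inj: "inj_on f (shapes k n)"
  proof (rule inj_onI)
    fix S S' assume S: "S \<in> shapes k n" "S' \<in> shapes k n" and eq: "f S = f S'"
    have "(i, l) \<in> S \<longleftrightarrow> (i, l) \<in> S'" for i l
    proof (cases "i < k")
      case True
      then show ?thesis using fun_cong[OF eq, of i] by (auto simp: f_def)
    next
      case False
      then show ?thesis using shapesD(4)[OF S(1)] shapesD(4)[OF S(2)] by blast
    qed
    then show "S = S'" by auto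
  qed
  have im: "f ` shapes k n \<subseteq> PiE {..<k} (\<lambda>_. trees n)"
  proof (rule image_subsetI)
    fix S assume S: "S \<in> shapes k n"
    have "{l. (i, l) \<in> S} \<in> trees n" for i
      using length_less_card[OF S] S by (auto simp: trees_def shapes_def)
    then show "f S \<in> PiE {..<k} (\<lambda>_. trees n)" by (auto simp: f_def)
  qed
  have fin: "finite (PiE {..<k} (\<lambda>_. trees n))" by (intro finite_PiE) (auto simp: finite_trees)
  show "finite (shapes k n)" using inj im fin by (meson finite_imageD finite_subset)
  have w: "(1 / 4 :: real) ^ n = (\<Prod>i<k. (1 / 4) ^ card (f S i))" if S: "S \<in> shapes k n" for S
  proof -
    have Seq: "S = Sigma {..<k} (f S)" using shapesD(4)[OF S] by (auto simp: f_def)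
    have finS: "finite (f S i)" if "i < k" for i
    proof -
      have "f S i \<subseteq> snd ` S" using that by (force simp: f_def)
      then show ?thesis using shapesD(1)[OF S] by (meson finite_imageI finite_subset)
    qed
    have "n = (\<Sum>i<k. card (f S i))"
      using card_SigmaI[of "{..<k}" "f S"] finS Seq shapesD(2)[OF S] by simp
    then show ?thesis by (simp add: power_sum)
  qed
  have "real (card (shapes k n)) * (1 / 4) ^ n = (\<Sum>S\<in>shapes k n. \<Prod>i<k. (1 / 4) ^ card (f S i))"
    by (subst sum.cong[OF refl w[symmetric]]) auto
  also have "\<dots> = (\<Sum>g\<in>f ` shapes k n. \<Prod>i<k. (1 / 4) ^ card (g i))"
    by (simp add: sum.reindex[OF inj])
  also have "\<dots> \<le> (\<Sum>g\<in>PiE {..<k} (\<lambda>_. trees n). \<Prod>i<k. (1 / 4) ^ card (g i))"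
    using fin im by (intro sum_mono2) (auto intro!: prod_nonneg)
  also have "\<dots> = (\<Prod>i<k. \<Sum>S\<in>trees n. (1 / 4) ^ card S)"
    by (rule prod_sum_PiE[symmetric]) (auto simp: finite_trees)
  also have "\<dots> \<le> (\<Prod>i<k. 2)"
    using trees_weight by (intro prod_mono) (auto intro!: sum_nonneg)
  finally have "real (card (shapes k n)) * (1 / 4) ^ n \<le> 2 ^ k" by simp
  then show "real (card (shapes k n)) \<le> 2 ^ k * 4 ^ n"
    by (simp add: power_one_over field_simps)
qed

subsection \<open>Iterated collision operators\<close>

abbreviation cfg :: "'i set \<Rightarrow> ('i \<Rightarrow> 'q) set" where
  "cfg A \<equiv> PiE A (\<lambda>_. UNIV)"

lemma countable_cfg: "finite A \<Longrightarrow> countable (cfg A :: ('i \<Rightarrow> 'q::countable) set)"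
  by (rule countable_PiE) auto

lemma nn_integral_cfg_insert:
  fixes f :: "('i \<Rightarrow> 'q::countable) \<Rightarrow> ennreal"
  assumes "finite B" "p \<notin> B"
  shows "(\<integral>\<^sup>+q. f q \<partial>count_space (cfg (insert p B))) = (\<integral>\<^sup>+y. csum (\<lambda>x. f (y(p := x))) \<partial>count_space (cfg B))"
proof -
  interpret product_sigma_finite "\<lambda>_::'i. count_space (UNIV :: 'q set)"
    by (simp add: product_sigma_finite_def sigma_finite_measure_count_space_countable)
  have eq: "count_space (cfg A) = PiM A (\<lambda>_. count_space (UNIV :: 'q set))" if "finite A" for A :: "'i set"
    using that by (rule count_space_PiM_finite[symmetric]) auto
  have "f \<in> borel_measurable (PiM (insert p B) (\<lambda>_. count_space (UNIV :: 'q set)))"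
    by (subst eq[symmetric]) (use assms in auto)
  then show ?thesis
    unfolding eq[OF assms(1)] eq[OF finite.insertI[OF assms(1)]]
    using assms by (intro product_nn_integral_insert)
qed

text \<open>A collision with index z replaces a particle q by \<open>lft q z\<close> and
  \<open>rgt z\<close>, with the oscillating coefficient \<open>om\<close> at time r. The
  truncations \<open>Z N\<close> are finite. That they can be recognized from the new particle
  alone, through \<open>R N\<close>, is what later turns a truncation error into a tail.
  \<open>collision_L2\<close> is the space-time estimate for one collision, uniform in N.\<close>

locale branching =
  fixes w :: "'q::countable \<Rightarrow> real" and lft :: "'q \<Rightarrow> 'z \<Rightarrow> 'q" and rgt :: "'z \<Rightarrow> 'q"
    and om :: "real \<Rightarrow> 'q \<Rightarrow> 'z \<Rightarrow> complex" and Z :: "nat \<Rightarrow> 'z set" and R :: "nat \<Rightarrow> 'q set" and T K :: real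
  assumes w_pos: "\<And>q. w q > 0" and finite_Z: "\<And>N. finite (Z N)"
    and Z_R: "\<And>N N' z. N \<le> N' \<Longrightarrow> z \<in> Z N \<longleftrightarrow> z \<in> Z N' \<and> rgt z \<in> R N"
    and R_exhaust: "\<And>q. \<exists>N0. \<forall>N\<ge>N0. q \<in> R N"
    and om_measurable [measurable]: "\<And>q z. (\<lambda>r. om r q z) \<in> borel_measurable borel"
    and T: "0 \<le> T" and K: "0 \<le> K"
    and collision_L2: "\<And>N G. (\<integral>\<^sup>+r. csum (\<lambda>q. ennreal ((w q)\<^sup>2 * (cmod (\<Sum>z\<in>Z N. om r q z * G (lft q z) (rgt z)))\<^sup>2))
         \<partial>restrict_space lborel {0..T})
       \<le> ennreal K * csum (\<lambda>q1. csum (\<lambda>q2. ennreal ((w q1 * w q2)\<^sup>2 * (cmod (G q1 q2))\<^sup>2)))"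
begin

abbreviation LT :: "real measure" where "LT \<equiv> restrict_space lborel {0..T}"

lemma finite_measure_LT: "finite_measure LT"
  using T by (intro finite_measureI) (simp add: emeasure_restrict_space space_restrict_space)

sublocale LT: finite_measure LT by (rule finite_measure_LT)

sublocale PLT: product_sigma_finite "\<lambda>_::addr. LT"
  by (simp add: product_sigma_finite_def LT.sigma_finite_measure_axioms)

lemma borel_LT: "f \<in> borel_measurable borel \<Longrightarrow> f \<in> borel_measurable LT"
  by (intro measurable_restrict_space1) simp

lemma om_LT [measurable]: "(\<lambda>r. om r q z) \<in> borel_measurable LT"
  by (rule borel_LT) simp

lemma emeasure_LT: "emeasure LT (space LT) = ennreal T"
  using T by (simp add: emeasure_restrict_space space_restrict_space)

text \<open>Frequencies are computed downwards: the data at the roots and the collision indices at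
  the nodes determine the particle at every node and leaf.\<close>

primrec part :: "(addr \<Rightarrow> 'q) \<Rightarrow> (addr \<Rightarrow> 'z) \<Rightarrow> nat \<Rightarrow> bool list \<Rightarrow> 'q" where
  "part \<xi> z i [] = \<xi> (i, [])"
| "part \<xi> z i (b # l) = (if b then rgt (z (i, l)) else lft (part \<xi> z i l) (z (i, l)))"

definition pt :: "(addr \<Rightarrow> 'q) \<Rightarrow> (addr \<Rightarrow> 'z) \<Rightarrow> addr \<Rightarrow> 'q" where
  "pt \<xi> z a = part \<xi> z (fst a) (snd a)"

lemma pt_child: "pt \<xi> z (child a b) = (if b then rgt (z a) else lft (pt \<xi> z a) (z a))"
  by (simp add: pt_def child_def)

lemma pt_root: "a \<in> roots k \<Longrightarrow> pt \<xi> z a = \<xi> a"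
  by (auto simp: pt_def roots_def)

lemma pt_cong:
  assumes S: "S \<in> shapes k n" and eq: "\<And>a. a \<in> S \<Longrightarrow> z a = z' a"
  shows "a \<in> S \<union> leaves k S \<Longrightarrow> pt \<xi> z a = pt \<xi> z' a"
proof (induction "snd a" arbitrary: a)
  case Nil
  then show ?case by (simp add: pt_def flip: Nil(1))
next
  case (Cons b l)
  define a' where "a' = (fst a, l)"
  have a: "a = child a' b" using Cons(2) by (cases a) (simp add: a'_def child_def)
  have a': "a' \<in> S"
    using Cons.prems shapesD(3)[OF S, of a' b] by (auto simp: a leaves_def)
  then have "pt \<xi> z a' = pt \<xi> z' a'" using Cons(1)[of a'] by (simp add: a'_def)
  then show ?case using eq[OF a'] by (simp add: a pt_child)
qed

text \<open>The amplitude of a whole forest, summed over the collision indices at its nodes. It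
  depends on the shape and the node times, but not on an order of growth.\<close>

definition E :: "nat \<Rightarrow> nat \<Rightarrow> addr set \<Rightarrow> (addr \<Rightarrow> real) \<Rightarrow> ((addr \<Rightarrow> 'q) \<Rightarrow> complex) \<Rightarrow> (addr \<Rightarrow> 'q) \<Rightarrow> complex" where
  "E N k S t G \<xi> = (\<Sum>z\<in>PiE S (\<lambda>_. Z N). (\<Prod>a\<in>S. om (t a) (pt \<xi> z a) (z a)) * G (restrict (pt \<xi> z) (leaves k S)))"

definition Bp :: "nat \<Rightarrow> addr \<Rightarrow> addr set \<Rightarrow> real \<Rightarrow> ((addr \<Rightarrow> 'q) \<Rightarrow> complex) \<Rightarrow> (addr \<Rightarrow> 'q) \<Rightarrow> complex" where
  "Bp N p A r G q = (\<Sum>y\<in>Z N. om r (q p) y *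
     G (restrict (q(child p False := lft (q p) y, child p True := rgt y)) (grow p A)))"

lemma E_empty: "\<xi> \<in> cfg (roots k) \<Longrightarrow> E N k {} t G \<xi> = G \<xi>"
proof -
  assume "\<xi> \<in> cfg (roots k)"
  then have "restrict (pt \<xi> z) (roots k) a = \<xi> a" for z a
    by (cases "a \<in> roots k") (simp_all add: pt_root PiE_arb[of \<xi>])
  then have "restrict (pt \<xi> z) (roots k) = \<xi>" for z by blast
  then show ?thesis by (simp add: E_def leaves_empty)
qed

lemma E_cong: "(\<And>a. a \<in> S \<Longrightarrow> t a = t' a) \<Longrightarrow> E N k S t G \<xi> = E N k S t' G \<xi>"
  by (simp add: E_def)

text \<open>The particle at p is already determined by the indices at the nodes of S, so the new
  collision is the innermost factor and may be moved onto the argument.\<close>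

lemma E_grow:
  assumes S: "S \<in> shapes k n" and p: "p \<in> leaves k S"
  shows "E N k (insert p S) t G \<xi> = E N k S t (Bp N p (leaves k S) (t p) G) \<xi>"
proof -
  have pS: "p \<notin> S" using leaf_not_node[OF p] .
  have fin: "finite S" using shapesD[OF S] by blast
  have ptS: "pt \<xi> (g(p := y)) a = pt \<xi> g a" if "a \<in> S \<union> leaves k S" for g y a
    by (rule pt_cong[OF S _ that]) (use pS in auto)
  have sum: "(\<Sum>z\<in>PiE (insert p S) (\<lambda>_. Z N). f z) = (\<Sum>g\<in>PiE S (\<lambda>_. Z N). \<Sum>y\<in>Z N. f (g(p := y)))"
    for f :: "(addr \<Rightarrow> 'z) \<Rightarrow> complex"
  proof -
    have "(\<Sum>z\<in>PiE (insert p S) (\<lambda>_. Z N). f z) = (\<Sum>(y, g)\<in>Z N \<times> PiE S (\<lambda>_. Z N). f (g(p := y)))"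
      unfolding PiE_insert_eq by (subst sum.reindex[OF inj_combinator[OF pS]]) (auto intro: sum.cong)
    also have "\<dots> = (\<Sum>y\<in>Z N. \<Sum>g\<in>PiE S (\<lambda>_. Z N). f (g(p := y)))" by (simp add: sum.cartesian_product)
    finally show ?thesis by (subst (asm) sum.swap)
  qed
  have "(\<Prod>a\<in>insert p S. om (t a) (pt \<xi> (g(p := y)) a) ((g(p := y)) a)) *
        G (restrict (pt \<xi> (g(p := y))) (leaves k (insert p S)))
      = (\<Prod>a\<in>S. om (t a) (pt \<xi> g a) (g a)) * (om (t p) (restrict (pt \<xi> g) (leaves k S) p) y *
        G (restrict ((restrict (pt \<xi> g) (leaves k S))(child p False := lft (restrict (pt \<xi> g) (leaves k S) p) y, child p True := rgt y))
            (grow p (leaves k S))))" for g y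
  proof -
    have "(\<Prod>a\<in>insert p S. om (t a) (pt \<xi> (g(p := y)) a) ((g(p := y)) a)) =
        om (t p) (pt \<xi> g p) y * (\<Prod>a\<in>S. om (t a) (pt \<xi> (g(p := y)) a) ((g(p := y)) a))"
      using pS fin ptS[of p g y] p by simp
    also have "(\<Prod>a\<in>S. om (t a) (pt \<xi> (g(p := y)) a) ((g(p := y)) a)) = (\<Prod>a\<in>S. om (t a) (pt \<xi> g a) (g a))"
      using pS by (intro prod.cong refl) (auto simp: ptS)
    finally have 1: "(\<Prod>a\<in>insert p S. om (t a) (pt \<xi> (g(p := y)) a) ((g(p := y)) a)) =
      om (t p) (pt \<xi> g p) y * (\<Prod>a\<in>S. om (t a) (pt \<xi> g a) (g a))" .
    have 2: "restrict (pt \<xi> (g(p := y))) (leaves k (insert p S)) =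
       restrict ((restrict (pt \<xi> g) (leaves k S))(child p False := lft (restrict (pt \<xi> g) (leaves k S) p) y, child p True := rgt y))
            (grow p (leaves k S))" (is "?l = ?r")
    proof
      fix a
      consider "a = child p False" | "a = child p True" | "a \<in> leaves k S - {p}" "a \<noteq> child p False" "a \<noteq> child p True"
        | "a \<notin> grow p (leaves k S)" unfolding grow_def by blast
      then show "?l a = ?r a"
      proof cases
        case 3
        then show ?thesis unfolding leaves_grow(2)[OF S p] using ptS[of a g y] by (simp add: grow_def)
      next
        case 4
        then show ?thesis unfolding leaves_grow(2)[OF S p] by simp
      qed (use p ptS[of p g y] in \<open>simp_all add: leaves_grow(2)[OF S p] grow_def pt_child\<close>)
    qed
    show ?thesis unfolding 1 2 using p by simp
  qed
  then show ?thesis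
    unfolding E_def Bp_def sum by (simp only: sum_distrib_left)
qed

definition wgt :: "'i set \<Rightarrow> ('i \<Rightarrow> 'q) \<Rightarrow> real" where
  "wgt A q = (\<Prod>a\<in>A. (w (q a))\<^sup>2)"

lemma wgt_nonneg: "0 \<le> wgt A q"
  by (simp add: wgt_def prod_nonneg)

lemma wgt_pos: "finite A \<Longrightarrow> 0 < wgt A q"
  unfolding wgt_def by (intro prod_pos zero_less_power w_pos)

definition nrm :: "'i set \<Rightarrow> (('i \<Rightarrow> 'q) \<Rightarrow> complex) \<Rightarrow> ennreal" where
  "nrm A G = wnorm (cfg A) (wgt A) G"

lemma nrm_square: "(nrm A G)\<^sup>2 = (\<integral>\<^sup>+q. ennreal (wgt A q * (cmod (G q))\<^sup>2) \<partial>count_space (cfg A))"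
  by (simp add: nrm_def wnorm_def esqrt_square)

lemma nrm_minkowski:
  assumes "finite A" "\<And>q. q \<in> cfg A \<Longrightarrow> (\<lambda>s. H s q) \<in> borel_measurable M"
    "\<And>q. q \<in> cfg A \<Longrightarrow> ennreal (cmod (G q)) \<le> (\<integral>\<^sup>+s. ennreal (cmod (H s q)) \<partial>M)"
  shows "nrm A G \<le> (\<integral>\<^sup>+s. nrm A (H s) \<partial>M)"
  unfolding nrm_def using assms by (intro wnorm_minkowski countable_cfg wgt_nonneg)

lemma nrm_measurable:
  assumes "finite A" "\<And>q. q \<in> cfg A \<Longrightarrow> (\<lambda>s. H s q) \<in> borel_measurable M"
  shows "(\<lambda>s. nrm A (H s)) \<in> borel_measurable M"
  unfolding nrm_def using assms by (intro wnorm_measurable countable_cfg)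

lemma nrm_mono:
  assumes "\<And>q. q \<in> cfg A \<Longrightarrow> cmod (G q) \<le> cmod (H q)"
  shows "nrm A G \<le> nrm A H"
  unfolding nrm_def wnorm_def using assms
  by (intro esqrt_mono nn_integral_mono ennreal_leI mult_left_mono power_mono wgt_nonneg) auto

lemma Bp_measurable [measurable]: "(\<lambda>r. Bp N p A r G q) \<in> borel_measurable LT"
  unfolding Bp_def by measurable

lemma Bp_L2:
  assumes A: "finite A" "p \<in> A" "child p False \<notin> A" "child p True \<notin> A"
  shows "(\<integral>\<^sup>+r. (nrm A (Bp N p A r G))\<^sup>2 \<partial>LT) \<le> ennreal K * (nrm (grow p A) G)\<^sup>2"
proof -
  define B where "B = A - {p}"
  define p0 p1 where "p0 = child p False" and "p1 = child p True"
  have AB: "A = insert p B" "p \<notin> B" "finite B" using A by (auto simp: B_def)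
  have p01: "p0 \<notin> B" "p1 \<notin> B" "p0 \<noteq> p1" using A by (auto simp: p0_def p1_def B_def)
  have g: "grow p A = insert p1 (insert p0 B)" by (auto simp: grow_def B_def p0_def p1_def)
  define H where "H y q1 q2 = G (y(p0 := q1, p1 := q2))" for y q1 q2
  have Bp: "Bp N p A r G (y(p := x)) = (\<Sum>z\<in>Z N. om r x z * H y (lft x z) (rgt z))" if "y \<in> cfg B" for y x r
  proof -
    have "restrict ((y(p := x))(p0 := lft x z, p1 := rgt z)) (grow p A) = y(p0 := lft x z, p1 := rgt z)" for z
    proof
      fix a
      show "restrict ((y(p := x))(p0 := lft x z, p1 := rgt z)) (grow p A) a = (y(p0 := lft x z, p1 := rgt z)) a"
      proof (cases "a \<in> B")
        case True
        then have "a \<noteq> p" "a \<noteq> p0" "a \<noteq> p1" using AB(2) p01 by blast+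
        then show ?thesis using True by (simp add: g)
      next
        case False
        then have "y a = undefined" by (rule PiE_arb[OF that])
        then show ?thesis using False p01(3) by (cases "a = p1"; cases "a = p0") (simp_all add: g)
      qed
    qed
    then show ?thesis by (simp add: Bp_def H_def p0_def p1_def)
  qed
  have wA: "wgt A (y(p := x)) = wgt B y * (w x)\<^sup>2" for y x
  proof -
    have "(\<Prod>a\<in>B. (w ((y(p := x)) a))\<^sup>2) = (\<Prod>a\<in>B. (w (y a))\<^sup>2)"
      using AB(2) by (intro prod.cong) auto
    then show ?thesis unfolding AB(1) wgt_def using AB(2,3) by simp
  qed
  have wG: "wgt (grow p A) (y(p0 := q1, p1 := q2)) = wgt B y * (w q1 * w q2)\<^sup>2" for y q1 q2
  proof -
    have "(\<Prod>a\<in>B. (w ((y(p0 := q1, p1 := q2)) a))\<^sup>2) = (\<Prod>a\<in>B. (w (y a))\<^sup>2)"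
      using p01 by (intro prod.cong) auto
    then show ?thesis unfolding g wgt_def using AB(3) p01 by (simp add: power_mult_distrib)
  qed
  have "(\<integral>\<^sup>+r. (nrm A (Bp N p A r G))\<^sup>2 \<partial>LT) =
     (\<integral>\<^sup>+r. \<integral>\<^sup>+y. csum (\<lambda>x. ennreal (wgt B y * (w x)\<^sup>2 * (cmod (Bp N p A r G (y(p := x))))\<^sup>2)) \<partial>count_space (cfg B) \<partial>LT)"
    unfolding nrm_square by (subst nn_integral_cfg_insert[OF AB(3,2), folded AB(1)]) (simp only: wA)
  also have "\<dots> = (\<integral>\<^sup>+y. \<integral>\<^sup>+r. csum (\<lambda>x. ennreal (wgt B y * (w x)\<^sup>2 * (cmod (Bp N p A r G (y(p := x))))\<^sup>2)) \<partial>LT \<partial>count_space (cfg B))"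
    by (intro nn_integral_count_space_nn_integral countable_cfg AB borel_measurable_nn_integral_count_space) auto
  also have "\<dots> \<le> (\<integral>\<^sup>+y. ennreal K * csum (\<lambda>q1. csum (\<lambda>q2. ennreal (wgt B y * (w q1 * w q2)\<^sup>2 * (cmod (H y q1 q2))\<^sup>2))) \<partial>count_space (cfg B))"
  proof (rule nn_integral_mono)
    fix y :: "addr \<Rightarrow> 'q" assume "y \<in> space (count_space (cfg B))"
    then have y: "y \<in> cfg B" by simp
    have "(\<integral>\<^sup>+r. csum (\<lambda>x. ennreal (wgt B y * (w x)\<^sup>2 * (cmod (Bp N p A r G (y(p := x))))\<^sup>2)) \<partial>LT)
       = (\<integral>\<^sup>+r. ennreal (wgt B y) * csum (\<lambda>x. ennreal ((w x)\<^sup>2 * (cmod (\<Sum>z\<in>Z N. om r x z * H y (lft x z) (rgt z)))\<^sup>2)) \<partial>LT)"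
      unfolding Bp[OF y] by (subst csum_cmult[symmetric]) (simp add: wgt_nonneg mult.assoc flip: ennreal_mult')
    also have "\<dots> = ennreal (wgt B y) * (\<integral>\<^sup>+r. csum (\<lambda>x. ennreal ((w x)\<^sup>2 * (cmod (\<Sum>z\<in>Z N. om r x z * H y (lft x z) (rgt z)))\<^sup>2)) \<partial>LT)"
      by (intro nn_integral_cmult borel_measurable_nn_integral_count_space) auto
    also have "\<dots> \<le> ennreal (wgt B y) * (ennreal K * csum (\<lambda>q1. csum (\<lambda>q2. ennreal ((w q1 * w q2)\<^sup>2 * (cmod (H y q1 q2))\<^sup>2))))"
      by (intro mult_left_mono collision_L2) auto
    also have "\<dots> = ennreal K * csum (\<lambda>q1. csum (\<lambda>q2. ennreal (wgt B y) * ennreal ((w q1 * w q2)\<^sup>2 * (cmod (H y q1 q2))\<^sup>2)))"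
      by (simp only: csum_cmult mult_ac)
    also have "\<dots> = ennreal K * csum (\<lambda>q1. csum (\<lambda>q2. ennreal (wgt B y * (w q1 * w q2)\<^sup>2 * (cmod (H y q1 q2))\<^sup>2)))"
      by (simp add: wgt_nonneg mult.assoc flip: ennreal_mult')
    finally show "(\<integral>\<^sup>+r. csum (\<lambda>x. ennreal (wgt B y * (w x)\<^sup>2 * (cmod (Bp N p A r G (y(p := x))))\<^sup>2)) \<partial>LT)
      \<le> ennreal K * csum (\<lambda>q1. csum (\<lambda>q2. ennreal (wgt B y * (w q1 * w q2)\<^sup>2 * (cmod (H y q1 q2))\<^sup>2)))" .
  qed
  also have "\<dots> = ennreal K * (\<integral>\<^sup>+y. csum (\<lambda>q1. csum (\<lambda>q2. ennreal (wgt B y * (w q1 * w q2)\<^sup>2 * (cmod (H y q1 q2))\<^sup>2))) \<partial>count_space (cfg B))"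
    by (rule nn_integral_cmult) simp
  also have "(\<integral>\<^sup>+y. csum (\<lambda>q1. csum (\<lambda>q2. ennreal (wgt B y * (w q1 * w q2)\<^sup>2 * (cmod (H y q1 q2))\<^sup>2))) \<partial>count_space (cfg B))
     = (nrm (grow p A) G)\<^sup>2"
  proof -
    have "finite (insert p0 B)" "p1 \<notin> insert p0 B" using AB(3) p01 by auto
    note ins = nn_integral_cfg_insert[OF this, folded g]
    show ?thesis
      unfolding nrm_square ins by (simp add: nn_integral_cfg_insert[OF AB(3) p01(1)] wG[symmetric] H_def)
  qed
  finally show ?thesis .
qed

definition \<kappa> :: ennreal where "\<kappa> = ennreal (sqrt (K * T))"

text \<open>Cauchy-Schwarz on a time interval of length T. This gain of sqrt (K T) per collision is
  what makes short times useful.\<close>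

lemma Bp_L1:
  assumes A: "finite A" "p \<in> A" "child p False \<notin> A" "child p True \<notin> A"
  shows "(\<integral>\<^sup>+r. nrm A (Bp N p A r G) \<partial>LT) \<le> \<kappa> * nrm (grow p A) G"
proof -
  have [measurable]: "(\<lambda>r. nrm A (Bp N p A r G)) \<in> borel_measurable LT"
    by (rule nrm_measurable[OF A(1)]) simp
  have "(\<integral>\<^sup>+r. nrm A (Bp N p A r G) \<partial>LT) = (\<integral>\<^sup>+r. nrm A (Bp N p A r G) * 1 \<partial>LT)" by simp
  also have "\<dots> \<le> esqrt (\<integral>\<^sup>+r. (nrm A (Bp N p A r G))\<^sup>2 \<partial>LT) * esqrt (\<integral>\<^sup>+r. 1\<^sup>2 \<partial>LT)"
    by (rule nn_integral_Cauchy_Schwarz_esqrt) auto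
  also have "\<dots> \<le> esqrt (ennreal K * (nrm (grow p A) G)\<^sup>2) * esqrt (ennreal T)"
    using emeasure_LT by (intro mult_mono esqrt_mono Bp_L2[OF A]) auto
  also have "\<dots> = esqrt (ennreal K) * esqrt (ennreal T) * nrm (grow p A) G"
    unfolding esqrt_mult esqrt_of_square by (simp only: mult_ac)
  also have "esqrt (ennreal K) * esqrt (ennreal T) = \<kappa>"
    using T K by (simp add: \<kappa>_def esqrt_ennreal real_sqrt_mult flip: ennreal_mult)
  finally show ?thesis .
qed

lemma E_measurable:
  assumes "S \<in> shapes k n"
    and f: "\<And>a. a \<in> S \<Longrightarrow> (\<lambda>x. \<tau> x a) \<in> M \<rightarrow>\<^sub>M LT"
    and G: "\<And>q. q \<in> cfg (leaves k S) \<Longrightarrow> (\<lambda>x. G x q) \<in> borel_measurable M"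
  shows "(\<lambda>x. E N k S (\<tau> x) (G x) \<xi>) \<in> borel_measurable M"
proof -
  have 1: "(\<lambda>x. om (\<tau> x a) q z) \<in> borel_measurable M" if "a \<in> S" for a q z
    using measurable_compose[OF f[OF that] om_LT[of q z]] .
  show ?thesis unfolding E_def
    by (intro borel_measurable_sum borel_measurable_times borel_measurable_prod 1 G) auto
qed

text \<open>A deepest node is peeled off, and its time is the outer integration variable. The node
  times fill the whole cube: their ordering matters for counting terms, not for estimating
  them.\<close>

lemma nrm_E_L1:
  assumes "S \<in> shapes k n"
  shows "(\<integral>\<^sup>+t. nrm (roots k) (E N k S t G) \<partial>PiM S (\<lambda>_. LT)) \<le> \<kappa> ^ n * nrm (leaves k S) G"
  using assms
proof (induction n arbitrary: S G)
  case 0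
  then have S: "S = {}" by (simp add: shapes_0)
  have "(\<integral>\<^sup>+t. nrm (roots k) (E N k {} t G) \<partial>PiM {} (\<lambda>_. LT)) = nrm (roots k) (E N k {} (\<lambda>_. undefined) G)"
    by (rule PLT.nn_integral_empty) simp
  also have "\<dots> \<le> nrm (roots k) G"
    by (rule nrm_mono) (simp add: E_empty)
  finally show ?case by (simp add: S leaves_empty)
next
  case (Suc n)
  obtain p where p: "p \<in> S" "S - {p} \<in> shapes k n" "p \<in> leaves k (S - {p})"
    using shapes_remove[OF Suc.prems] by blast
  define S0 where "S0 = S - {p}"
  have S: "S = insert p S0" "p \<notin> S0" using p by (auto simp: S0_def)
  have S0: "S0 \<in> shapes k n" "p \<in> leaves k S0" using p by (auto simp: S0_def)
  have fin: "finite S0" using shapesD[OF S0(1)] by blast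
  have finr: "finite (roots k)" by (simp add: roots_def)
  note lg = leaves_grow[OF S0]
  have eq: "E N k (insert p S0) (t(p := r)) G = E N k S0 t (Bp N p (leaves k S0) r G)" for t r
  proof
    fix \<xi>
    show "E N k (insert p S0) (t(p := r)) G \<xi> = E N k S0 t (Bp N p (leaves k S0) r G) \<xi>"
      unfolding E_grow[OF S0] using S(2) by (simp, intro E_cong) auto
  qed
  have "(\<integral>\<^sup>+t. nrm (roots k) (E N k S t G) \<partial>PiM S (\<lambda>_. LT)) =
      (\<integral>\<^sup>+r. (\<integral>\<^sup>+t. nrm (roots k) (E N k S0 t (Bp N p (leaves k S0) r G)) \<partial>PiM S0 (\<lambda>_. LT)) \<partial>LT)"
    unfolding S(1)
  proof (subst PLT.product_nn_integral_insert_rev[OF fin S(2)])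
    show "(\<lambda>t. nrm (roots k) (E N k (insert p S0) t G)) \<in> borel_measurable (PiM (insert p S0) (\<lambda>_. LT))"
      by (intro nrm_measurable finr E_measurable[OF lg(1)] measurable_component_singleton) auto
  qed (simp add: eq)
  also have "\<dots> \<le> (\<integral>\<^sup>+r. \<kappa> ^ n * nrm (leaves k S0) (Bp N p (leaves k S0) r G) \<partial>LT)"
    by (intro nn_integral_mono Suc.IH S0)
  also have "\<dots> = \<kappa> ^ n * (\<integral>\<^sup>+r. nrm (leaves k S0) (Bp N p (leaves k S0) r G) \<partial>LT)"
    by (intro nn_integral_cmult nrm_measurable finite_leaves fin) simp
  also have "\<dots> \<le> \<kappa> ^ n * (\<kappa> * nrm (grow p (leaves k S0)) G)"
    by (intro mult_left_mono Bp_L1 finite_leaves fin S0 lg) simp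
  finally show ?case by (simp add: S(1) lg(2) mult_ac)
qed

end

subsection \<open>Coefficients indexed by multisets\<close>

text \<open>Indistinguishable particles make a coefficient a function of a multiset. It can then be
  read on any finite index set, in particular on the leaves of any forest.\<close>

definition lift :: "'i set \<Rightarrow> ('q multiset \<Rightarrow> complex) \<Rightarrow> ('i \<Rightarrow> 'q) \<Rightarrow> complex" where
  "lift A F q = F (image_mset q (mset_set A))"

lemma ex_cfg_image_mset:
  assumes "finite A"
  shows "size M = card A \<Longrightarrow> \<exists>q\<in>cfg A. image_mset q (mset_set A) = M"
  using assms
proof (induction A arbitrary: M rule: finite_induct)
  case empty
  then show ?case by auto
next
  case (insert a A)
  then obtain x M' where M: "M = add_mset x M'" by (metis card_insert_disjoint size_eq_Suc_imp_eq_union)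
  then obtain q where q: "q \<in> cfg A" "image_mset q (mset_set A) = M'" using insert by auto
  have "image_mset (q(a := x)) (mset_set A) = image_mset q (mset_set A)"
    using insert by (intro image_mset_cong) auto
  then have "image_mset (q(a := x)) (mset_set (insert a A)) = M"
    using insert.hyps q(2) by (simp add: M del: fun_upd_apply) simp
  moreover have "q(a := x) \<in> cfg (insert a A)" using q(1) by (auto simp: PiE_iff extensional_def)
  ultimately show ?case by blast
qed

lemma finite_roots [simp]: "finite (roots k)" and card_roots [simp]: "card (roots k) = k"
  by (simp_all add: roots_def card_image inj_on_def)

context branching
begin

lemma nrm_lift_card:
  fixes A :: "'i set" and B :: "'j set"
  assumes "finite A" "finite B" "card A = card B"
  shows "nrm A (lift A F) = nrm B (lift B F)"
proof -
  obtain h where h: "bij_betw h A B" using finite_same_card_bij[OF assms] by blast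
  define \<Phi> where "\<Phi> q = (\<lambda>a\<in>A. q (h a))" for q :: "'j \<Rightarrow> 'q"
  have bij: "bij_betw \<Phi> (cfg B) (cfg A)"
  proof (rule bij_betw_byWitness[where f' = "\<lambda>q. \<lambda>b\<in>B. q (inv_into A h b)"])
    show "\<forall>q\<in>cfg B. (\<lambda>b\<in>B. \<Phi> q (inv_into A h b)) = q"
    proof (intro ballI ext)
      fix q :: "'j \<Rightarrow> 'q" and b assume q: "q \<in> cfg B"
      show "(\<lambda>b\<in>B. \<Phi> q (inv_into A h b)) b = q b"
      proof (cases "b \<in> B")
        case True
        then have "inv_into A h b \<in> A" using bij_betw_inv_into[OF h] by (auto simp: bij_betw_def)
        then show ?thesis using True bij_betw_inv_into_right[OF h True] by (simp add: \<Phi>_def)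
      qed (simp add: PiE_arb[OF q])
    qed
    show "\<forall>q\<in>cfg A. \<Phi> (\<lambda>b\<in>B. q (inv_into A h b)) = q"
    proof (intro ballI ext)
      fix q :: "'i \<Rightarrow> 'q" and a assume q: "q \<in> cfg A"
      show "\<Phi> (\<lambda>b\<in>B. q (inv_into A h b)) a = q a"
      proof (cases "a \<in> A")
        case True
        then show ?thesis using bij_betw_inv_into_left[OF h True] bij_betwE[OF h] by (simp add: \<Phi>_def)
      qed (simp add: \<Phi>_def PiE_arb[OF q])
    qed
  qed (auto simp: \<Phi>_def)
  have w: "wgt A (\<Phi> q) = wgt B q" for q
    unfolding wgt_def using prod.reindex_bij_betw[OF h, of "\<lambda>b. (w (q b))\<^sup>2"] by (simp add: \<Phi>_def)
  have l: "lift A F (\<Phi> q) = lift B F q" for q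
  proof -
    have "image_mset (\<Phi> q) (mset_set A) = image_mset (\<lambda>a. q (h a)) (mset_set A)"
      using assms by (intro image_mset_cong) (simp add: \<Phi>_def)
    also have "\<dots> = image_mset q (image_mset h (mset_set A))" by (simp add: image_mset.compositionality comp_def)
    also have "image_mset h (mset_set A) = mset_set B"
      using h by (simp add: image_mset_mset_set bij_betw_def)
    finally show ?thesis by (simp add: lift_def)
  qed
  have "(\<integral>\<^sup>+q. ennreal (wgt A q * (cmod (lift A F q))\<^sup>2) \<partial>count_space (cfg A)) =
     (\<integral>\<^sup>+q. ennreal (wgt A (\<Phi> q) * (cmod (lift A F (\<Phi> q)))\<^sup>2) \<partial>count_space (cfg B))"
    by (rule nn_integral_bij_count_space[OF bij, symmetric])
  then show ?thesis by (simp add: nrm_def wnorm_def w l)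
qed

text \<open>\<open>roots m\<close> is just a convenient index set with m elements; by
  \<open>nrm_lift_card\<close> any other gives the same value.\<close>

definition nk :: "nat \<Rightarrow> ('q multiset \<Rightarrow> complex) \<Rightarrow> ennreal" where
  "nk m F = nrm (roots m) (lift (roots m) F)"

lemma nrm_lift: "finite A \<Longrightarrow> card A = m \<Longrightarrow> nrm A (lift A F) = nk m F"
  unfolding nk_def by (rule nrm_lift_card) auto

lemma nrm_sum:
  assumes "finite A" "finite I" "\<And>q. q \<in> cfg A \<Longrightarrow> cmod (G q) \<le> (\<Sum>i\<in>I. cmod (H i q))"
  shows "nrm A G \<le> (\<Sum>i\<in>I. nrm A (H i))"
  unfolding nrm_def using assms by (intro wnorm_sum countable_cfg wgt_nonneg)

lemma nrm_add:
  assumes "finite A" "\<And>q. q \<in> cfg A \<Longrightarrow> cmod (G q) \<le> cmod (G1 q) + cmod (G2 q)"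
  shows "nrm A G \<le> nrm A G1 + nrm A G2"
  using nrm_sum[OF assms(1), of "UNIV :: bool set" G "\<lambda>b. if b then G1 else G2"] assms(2)
  by (auto simp: UNIV_bool add.commute)

lemma nrm_cmult: "nrm A (\<lambda>q. a * G q) = ennreal (cmod a) * nrm A G"
proof -
  have "ennreal (wgt A q * (cmod (a * G q))\<^sup>2) = (ennreal (cmod a))\<^sup>2 * ennreal (wgt A q * (cmod (G q))\<^sup>2)" for q
    by (simp add: norm_mult power_mult_distrib ennreal_power algebra_simps flip: ennreal_mult')
  then show ?thesis
    by (simp add: nrm_def wnorm_def nn_integral_cmult esqrt_mult)
qed

lemma nrm_ge:
  assumes "q \<in> cfg A"
  shows "ennreal (sqrt (wgt A q) * cmod (G q)) \<le> nrm A G"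
proof -
  have "ennreal (wgt A q * (cmod (G q))\<^sup>2) \<le> (nrm A G)\<^sup>2"
    unfolding nrm_square using nn_integral_ge_point[OF assms] .
  moreover have "ennreal (wgt A q * (cmod (G q))\<^sup>2) = (ennreal (sqrt (wgt A q) * cmod (G q)))\<^sup>2"
    by (simp add: ennreal_power power_mult_distrib wgt_nonneg)
  ultimately show ?thesis by (simp add: ennreal_square_le_iff)
qed

definition Bop :: "nat \<Rightarrow> real \<Rightarrow> ('q multiset \<Rightarrow> complex) \<Rightarrow> 'q multiset \<Rightarrow> complex" where
  "Bop N r D M = (\<Sum>q\<in>#M. \<Sum>z\<in>Z N. om r q z * D (add_mset (lft q z) (add_mset (rgt z) (M - {#q#}))))"

text \<open>Members of a multiset, counted with multiplicity, become leaves, so the symmetric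
  operator is the sum of the collisions at the individual leaves.\<close>

lemma lift_Bop:
  assumes A: "finite A" "\<And>p b. p \<in> A \<Longrightarrow> child p b \<notin> A"
  shows "lift A (Bop N r D) q = (\<Sum>p\<in>A. Bp N p A r (lift (grow p A) D) q)"
proof -
  have "lift A (Bop N r D) q = (\<Sum>p\<in>A. \<Sum>z\<in>Z N. om r (q p) z *
      D (add_mset (lft (q p) z) (add_mset (rgt z) (image_mset q (mset_set A) - {#q p#}))))"
    by (simp add: lift_def Bop_def sum_unfold_sum_mset multiset.map_comp comp_def)
  also have "\<dots> = (\<Sum>p\<in>A. Bp N p A r (lift (grow p A) D) q)"
  proof (intro sum.cong refl)
    fix p assume p: "p \<in> A"
    have "image_mset (restrict (q(child p False := lft (q p) y, child p True := rgt y)) (grow p A)) (mset_set (grow p A))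
        = add_mset (lft (q p) y) (add_mset (rgt y) (image_mset q (mset_set A) - {#q p#}))" for y
    proof -
      have "image_mset (restrict (q(child p False := lft (q p) y, child p True := rgt y)) (grow p A)) (mset_set (A - {p}))
        = image_mset q (mset_set (A - {p}))"
        using A(1) A(2)[OF p, of False] A(2)[OF p, of True] by (intro image_mset_cong) (auto simp: grow_def)
      moreover have "mset_set (grow p A) = add_mset (child p False) (add_mset (child p True) (mset_set (A - {p})))"
        using A p by (simp add: grow_def)
      moreover have "image_mset q (mset_set A) - {#q p#} = image_mset q (mset_set (A - {p}))"
        using A p by (simp add: mset_set.remove)
      ultimately show ?thesis by (simp add: grow_def)
    qed
    then show "(\<Sum>z\<in>Z N. om r (q p) z * D (add_mset (lft (q p) z) (add_mset (rgt z) (image_mset q (mset_set A) - {#q p#}))))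
       = Bp N p A r (lift (grow p A) D) q"
      by (simp add: Bp_def lift_def)
  qed
  finally show ?thesis .
qed

lemma E_cong_arg:
  assumes "\<And>q. q \<in> cfg (leaves k S) \<Longrightarrow> G q = G' q"
  shows "E N k S t G \<xi> = E N k S t G' \<xi>"
  unfolding E_def using assms by (intro sum.cong refl arg_cong2[of _ _ _ _ "(*)"]) auto

lemma E_add: "E N k S t (\<lambda>q. G q + G' q) \<xi> = E N k S t G \<xi> + E N k S t G' \<xi>"
  by (simp add: E_def sum.distrib distrib_left)

lemma E_cmult: "E N k S t (\<lambda>q. a * G q) \<xi> = a * E N k S t G \<xi>"
  by (simp add: E_def sum_distrib_left algebra_simps)

lemma E_sum: "E N k S t (\<lambda>q. \<Sum>i\<in>I. G i q) \<xi> = (\<Sum>i\<in>I. E N k S t (G i) \<xi>)"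
  unfolding E_def sum_distrib_left by (rule sum.swap)

lemma E_integral:
  assumes "\<And>q. q \<in> cfg (leaves k S) \<Longrightarrow> integrable M (\<lambda>s. H s q)"
  shows "integrable M (\<lambda>s. E N k S t (H s) \<xi>)"
    "E N k S t (\<lambda>q. LINT s|M. H s q) \<xi> = (LINT s|M. E N k S t (H s) \<xi>)"
  unfolding E_def using assms by (auto simp: Bochner_Integration.integral_sum)

lemma Bp_integral:
  assumes "\<And>q. q \<in> cfg (grow p A) \<Longrightarrow> integrable M (\<lambda>s. H s q)"
  shows "integrable M (\<lambda>s. Bp N p A r (H s) q)"
    "Bp N p A r (\<lambda>q. LINT s|M. H s q) q = (LINT s|M. Bp N p A r (H s) q)"
  unfolding Bp_def using assms by (auto simp: Bochner_Integration.integral_sum)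

end

text \<open>\<open>c k\<close> is the collision term of order k in the interaction picture, and
  \<open>lam\<close> times its time integral is the solution; \<open>c_lim\<close> is the hierarchy
  written for the collision terms alone. In \<open>small\<close>, 4 is the growth rate of the number
  of forests, the square root is the gain per collision, and \<open>Kc\<close> is the growth of the
  class bound in k.\<close>

locale hierarchy = branching w lft rgt om Z R T K
  for w :: "'q::countable \<Rightarrow> real" and lft :: "'q \<Rightarrow> 'z \<Rightarrow> 'q" and rgt :: "'z \<Rightarrow> 'q"
    and om :: "real \<Rightarrow> 'q \<Rightarrow> 'z \<Rightarrow> complex" and Z :: "nat \<Rightarrow> 'z set" and R :: "nat \<Rightarrow> 'q set" and T K :: real +
  fixes c :: "nat \<Rightarrow> real \<Rightarrow> 'q multiset \<Rightarrow> complex" and lam :: complex and Kc :: real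
  assumes c_measurable [measurable]: "\<And>k M. (\<lambda>r. c k r M) \<in> borel_measurable borel"
    and c_bound: "\<And>k. k \<ge> 1 \<Longrightarrow> (\<integral>\<^sup>+r. nk k (c k r) \<partial>LT) \<le> ennreal (Kc ^ (k + 1))"
    and Kc: "0 \<le> Kc"
    and c_lim: "\<And>k. k \<ge> 1 \<Longrightarrow> AE r in LT. \<forall>M. size M = k \<longrightarrow>
      (\<lambda>N. lam * Bop N r (\<lambda>M'. LINT s|LT. indicator {..<r} s *\<^sub>R c (k + 1) s M') M) \<longlonglongrightarrow> c k r M"
    and small: "4 * cmod lam * sqrt (K * T) * Kc < 1"
begin

section \<open>The Duhamel expansion over timed forests\<close>

definition Dint :: "nat \<Rightarrow> real \<Rightarrow> 'q multiset \<Rightarrow> complex" where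
  "Dint k r M = (LINT s|LT. indicator {..<r} s *\<^sub>R c k s M)"

lemma c_LT [measurable]: "(\<lambda>r. c k r M) \<in> borel_measurable LT"
  by (rule borel_LT) simp

lemma lift_c_LT [measurable]: "(\<lambda>r. lift A (c k r) q) \<in> borel_measurable LT"
  by (simp add: lift_def)

lemma ident_LT [measurable]: "(\<lambda>x. x) \<in> borel_measurable LT"
  by (rule borel_LT) simp

lemma integrable_c:
  assumes "k \<ge> 1" "size M = k"
  shows "integrable LT (\<lambda>s. c k s M)"
proof (rule integrableI_bounded)
  obtain q where q: "q \<in> cfg (roots k)" "image_mset q (mset_set (roots k)) = M"
    using ex_cfg_image_mset[of "roots k" M] assms by auto
  define s where "s = sqrt (wgt (roots k) q)"
  have s: "s > 0" using wgt_pos[of "roots k" q] by (simp add: s_def)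
  have "ennreal (cmod (c k r M)) \<le> ennreal (1 / s) * nk k (c k r)" for r
  proof -
    have "ennreal s * ennreal (cmod (c k r M)) \<le> nk k (c k r)"
      using nrm_ge[OF q(1), of "lift (roots k) (c k r)"] s by (simp add: lift_def q(2) nk_def s_def ennreal_mult')
    then have "ennreal (1 / s) * (ennreal s * ennreal (cmod (c k r M))) \<le> ennreal (1 / s) * nk k (c k r)"
      by (intro mult_left_mono) auto
    then show ?thesis using s by (simp flip: ennreal_mult' mult.assoc)
  qed
  then have "(\<integral>\<^sup>+r. ennreal (cmod (c k r M)) \<partial>LT) \<le> (\<integral>\<^sup>+r. ennreal (1 / s) * nk k (c k r) \<partial>LT)"
    by (intro nn_integral_mono)
  also have "\<dots> = ennreal (1 / s) * (\<integral>\<^sup>+r. nk k (c k r) \<partial>LT)"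
    unfolding nk_def by (intro nn_integral_cmult nrm_measurable) auto
  also have "\<dots> \<le> ennreal (1 / s) * ennreal (Kc ^ (k + 1))"
    using c_bound[OF assms(1)] by (intro mult_left_mono) auto
  also have "\<dots> < \<infinity>" by (simp add: ennreal_mult_less_top)
  finally show "(\<integral>\<^sup>+r. ennreal (cmod (c k r M)) \<partial>LT) < \<infinity>" .
qed simp

lemma integrable_cut:
  assumes "finite A" "card A = k" "k \<ge> 1"
  shows "integrable LT (\<lambda>s. indicator {..<r} s *\<^sub>R lift A (c k s) q)"
proof -
  have "integrable LT (\<lambda>s. lift A (c k s) q)" unfolding lift_def using assms by (intro integrable_c) auto
  moreover have "{..<r} \<inter> space LT \<in> sets LT"
    by (auto simp: space_restrict_space sets_restrict_space)
  ultimately have "integrable LT (\<lambda>s. indicator ({..<r} \<inter> space LT) s *\<^sub>R lift A (c k s) q)"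
    by (rule integrable_mult_indicator[rotated])
  moreover have "integrable LT (\<lambda>s. indicator ({..<r} \<inter> space LT) s *\<^sub>R lift A (c k s) q) =
      integrable LT (\<lambda>s. indicator {..<r} s *\<^sub>R lift A (c k s) q)"
    by (intro Bochner_Integration.integrable_cong refl) (auto simp: indicator_def)
  ultimately show ?thesis by simp
qed

lemma lift_Dint: "lift A (Dint k r) q = (LINT s|LT. indicator {..<r} s *\<^sub>R lift A (c k s) q)"
  by (simp add: lift_def Dint_def)

lemma Dint_measurable [measurable]: "(\<lambda>r. Dint k r M) \<in> borel_measurable LT"
proof -
  have "(\<lambda>(r, s). (if s < r then 1 else 0) *\<^sub>R c k s M) \<in> borel_measurable (LT \<Otimes>\<^sub>M LT)"
    by measurable
  then have "(\<lambda>(r, s). indicator {..<r} s *\<^sub>R c k s M) \<in> borel_measurable (LT \<Otimes>\<^sub>M LT)"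
    by (simp add: indicator_def lessThan_def of_bool_def)
  then show ?thesis unfolding Dint_def by (rule LT.borel_measurable_lebesgue_integral)
qed

lemma Bop_Dint_measurable [measurable]: "(\<lambda>r. Bop N r (Dint k r) M) \<in> borel_measurable LT"
proof -
  have "(\<lambda>r. \<Sum>q\<in>#M'. \<Sum>z\<in>Z N. om r q z * Dint k r (add_mset (lft q z) (add_mset (rgt z) (M - {#q#})))) \<in> borel_measurable LT" for M'
    by (induction M') auto
  then show ?thesis unfolding Bop_def .
qed

text \<open>The hierarchy holds for a truncated collision operator only up to this defect.\<close>

definition err :: "nat \<Rightarrow> nat \<Rightarrow> real \<Rightarrow> 'q multiset \<Rightarrow> complex" where
  "err N k r M = c k r M - lam * Bop N r (Dint (k + 1) r) M"

lemma err_measurable [measurable]: "(\<lambda>r. err N k r M) \<in> borel_measurable LT"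
  unfolding err_def by measurable

definition \<Phi> :: "nat \<Rightarrow> nat \<Rightarrow> addr set \<Rightarrow> (addr \<Rightarrow> real) \<Rightarrow> ('q multiset \<Rightarrow> complex) \<Rightarrow> ennreal" where
  "\<Phi> N k S t F = nrm (roots k) (E N k S t (lift (leaves k S) F))"

text \<open>One Duhamel step: the collision term at the leaves is replaced by a collision at some
  leaf p at time r, acting on a time integral over s < r. Linearity and Minkowski's inequality take
  that integral out of the norm, and the truncation error is kept aside.\<close>

lemma \<Phi>_step:
  assumes S: "S \<in> shapes k j" and k: "k \<ge> 1"
  shows "\<Phi> N k S t (c (k + j) r) \<le> ennreal (cmod lam) * (\<Sum>p\<in>leaves k S.
      \<integral>\<^sup>+s. indicator {..<r} s * \<Phi> N k (insert p S) (t(p := r)) (c (k + Suc j) s) \<partial>LT)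
    + \<Phi> N k S t (err N (k + j) r)"
proof -
  define L where "L = leaves k S"
  have finL: "finite L" unfolding L_def using finite_leaves shapesD(1)[OF S] .
  let ?D = "Dint (k + Suc j) r"
  have Elift: "E N k S t (lift L (c (k + j) r)) \<xi> =
      lam * (\<Sum>p\<in>L. E N k (insert p S) (t(p := r)) (lift (leaves k (insert p S)) ?D) \<xi>) + E N k S t (lift L (err N (k + j) r)) \<xi>" for \<xi>
  proof -
    have "E N k S t (lift L (c (k + j) r)) \<xi> =
       E N k S t (\<lambda>q. lam * lift L (Bop N r ?D) q + lift L (err N (k + j) r) q) \<xi>"
      by (rule E_cong_arg) (simp add: lift_def err_def)
    also have "\<dots> = lam * E N k S t (lift L (Bop N r ?D)) \<xi> + E N k S t (lift L (err N (k + j) r)) \<xi>"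
      by (simp add: E_add E_cmult)
    also have "E N k S t (lift L (Bop N r ?D)) \<xi> = (\<Sum>p\<in>L. E N k S t (Bp N p L r (lift (grow p L) ?D)) \<xi>)"
      unfolding E_sum[symmetric]
      by (rule E_cong_arg, rule lift_Bop[OF finL]) (use leaves_grow(3)[OF S] in \<open>auto simp: L_def\<close>)
    also have "\<dots> = (\<Sum>p\<in>L. E N k (insert p S) (t(p := r)) (lift (leaves k (insert p S)) ?D) \<xi>)"
    proof (intro sum.cong refl)
      fix p assume p: "p \<in> L"
      have "E N k S t G \<xi> = E N k S (t(p := r)) G \<xi>" for G
        by (rule E_cong) (use p leaf_not_node in \<open>auto simp: L_def\<close>)
      then show "E N k S t (Bp N p L r (lift (grow p L) ?D)) \<xi> =
          E N k (insert p S) (t(p := r)) (lift (leaves k (insert p S)) ?D) \<xi>"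
        using E_grow[OF S, of p N "t(p := r)"] leaves_grow(2)[OF S, of p] p by (simp add: L_def)
    qed
    finally show ?thesis .
  qed
  have "\<Phi> N k S t (c (k + j) r) \<le> nrm (roots k) (\<lambda>\<xi>. lam * (\<Sum>p\<in>L. E N k (insert p S) (t(p := r)) (lift (leaves k (insert p S)) ?D) \<xi>))
     + \<Phi> N k S t (err N (k + j) r)"
    unfolding \<Phi>_def L_def[symmetric] by (rule nrm_add) (simp_all only: Elift finite_roots norm_triangle_ineq)
  also have "nrm (roots k) (\<lambda>\<xi>. lam * (\<Sum>p\<in>L. E N k (insert p S) (t(p := r)) (lift (leaves k (insert p S)) ?D) \<xi>))
    \<le> ennreal (cmod lam) * (\<Sum>p\<in>L. nrm (roots k) (E N k (insert p S) (t(p := r)) (lift (leaves k (insert p S)) ?D)))"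
    unfolding nrm_cmult by (intro mult_left_mono nrm_sum finL) (auto intro: norm_sum)
  also have "(\<Sum>p\<in>L. nrm (roots k) (E N k (insert p S) (t(p := r)) (lift (leaves k (insert p S)) ?D)))
    \<le> (\<Sum>p\<in>L. \<integral>\<^sup>+s. indicator {..<r} s * \<Phi> N k (insert p S) (t(p := r)) (c (k + Suc j) s) \<partial>LT)"
  proof (rule sum_mono)
    fix p assume p: "p \<in> L"
    define S' where "S' = insert p S"
    have S': "S' \<in> shapes k (Suc j)" using leaves_grow(1)[OF S] p by (auto simp: S'_def L_def)
    define L' where "L' = leaves k S'"
    have L': "finite L'" "card L' = k + Suc j"
      unfolding L'_def using finite_leaves shapesD(1)[OF S'] card_leaves[OF S'] by auto
    have int: "integrable LT (\<lambda>s. indicator {..<r} s *\<^sub>R lift L' (c (k + Suc j) s) q)" for q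
      using L' by (intro integrable_cut) auto
    define H where "H s q = (indicator {..<r} s *\<^sub>R lift L' (c (k + Suc j) s) q :: complex)" for s q
    have "nrm (roots k) (E N k S' (t(p := r)) (lift L' ?D)) \<le>
        (\<integral>\<^sup>+s. nrm (roots k) (E N k S' (t(p := r)) (H s)) \<partial>LT)"
    proof (rule nrm_minkowski)
      fix \<xi> :: "addr \<Rightarrow> 'q"
      have eq: "E N k S' (t(p := r)) (lift L' ?D) \<xi> = (LINT s|LT. E N k S' (t(p := r)) (H s) \<xi>)"
        unfolding E_integral(2)[of k S' LT H, OF int[folded H_def], symmetric]
        by (rule E_cong_arg) (simp add: lift_Dint H_def)
      have i: "integrable LT (\<lambda>s. E N k S' (t(p := r)) (H s) \<xi>)"
        by (rule E_integral(1)[of k S' LT H, OF int[folded H_def]])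
      then show "(\<lambda>s. E N k S' (t(p := r)) (H s) \<xi>) \<in> borel_measurable LT" by simp
      show "ennreal (cmod (E N k S' (t(p := r)) (lift L' ?D) \<xi>)) \<le> (\<integral>\<^sup>+s. ennreal (cmod (E N k S' (t(p := r)) (H s) \<xi>)) \<partial>LT)"
        unfolding eq using integral_norm_bound_ennreal[OF i] .
    qed simp
    also have "\<dots> = (\<integral>\<^sup>+s. indicator {..<r} s * \<Phi> N k S' (t(p := r)) (c (k + Suc j) s) \<partial>LT)"
    proof (rule nn_integral_cong)
      fix s
      have "nrm (roots k) (E N k S' (t(p := r)) (H s)) =
          nrm (roots k) (\<lambda>\<xi>. complex_of_real (indicator {..<r} s) * E N k S' (t(p := r)) (lift L' (c (k + Suc j) s)) \<xi>)"
      proof -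
        have "H s = (\<lambda>q. complex_of_real (indicator {..<r} s) * lift L' (c (k + Suc j) s) q)"
          by (rule ext) (simp add: H_def scaleR_conv_of_real)
        then show ?thesis
          by (intro arg_cong[of _ _ "nrm (roots k)"] ext) (simp only: E_cmult)
      qed
      then show "nrm (roots k) (E N k S' (t(p := r)) (H s)) = indicator {..<r} s * \<Phi> N k S' (t(p := r)) (c (k + Suc j) s)"
        unfolding nrm_cmult by (simp add: \<Phi>_def L'_def indicator_def)
    qed
    finally show "nrm (roots k) (E N k (insert p S) (t(p := r)) (lift (leaves k (insert p S)) ?D)) \<le>
      (\<integral>\<^sup>+s. indicator {..<r} s * \<Phi> N k (insert p S) (t(p := r)) (c (k + Suc j) s) \<partial>LT)"
      by (simp add: S'_def L'_def)
  qed
  finally show ?thesis by (simp add: L_def add_mono mult_left_mono)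
qed

lemma component_LT:
  assumes "a \<in> S"
  shows "(\<lambda>t. t a) \<in> borel_measurable (PiM S (\<lambda>_. LT))"
  using measurable_compose[OF measurable_component_singleton[OF assms] ident_LT] .

lemma \<Phi>_measurable:
  assumes S: "S \<in> shapes k j" and F: "\<And>M. (\<lambda>r. F r M) \<in> borel_measurable LT"
  shows "(\<lambda>x. \<Phi> N k S (fst x) (F (snd x))) \<in> borel_measurable (PiM S (\<lambda>_. LT) \<Otimes>\<^sub>M LT)"
  unfolding \<Phi>_def
proof (intro nrm_measurable finite_roots E_measurable[OF S])
  show "(\<lambda>x. fst x a) \<in> PiM S (\<lambda>_. LT) \<Otimes>\<^sub>M LT \<rightarrow>\<^sub>M LT" if "a \<in> S" for a
    using measurable_compose[OF measurable_fst measurable_component_singleton[OF that]] .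
  show "(\<lambda>x. lift (leaves k S) (F (snd x)) q) \<in> borel_measurable (PiM S (\<lambda>_. LT) \<Otimes>\<^sub>M LT)" for q
    unfolding lift_def using measurable_compose[OF measurable_snd F] .
qed

lemma \<Phi>_bound:
  assumes S: "S \<in> shapes k j" and F: "\<And>M. (\<lambda>r. F r M) \<in> borel_measurable LT"
  shows "(\<integral>\<^sup>+t. \<integral>\<^sup>+r. \<Phi> N k S t (F r) \<partial>LT \<partial>PiM S (\<lambda>_. LT)) \<le> \<kappa> ^ j * (\<integral>\<^sup>+r. nk (k + j) (F r) \<partial>LT)"
proof -
  have fin: "finite S" using shapesD[OF S] by blast
  interpret P: sigma_finite_measure "PiM S (\<lambda>_. LT)" by (rule PLT.sigma_finite[OF fin])
  interpret PP: pair_sigma_finite "PiM S (\<lambda>_. LT)" LT by standard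
  have "(\<integral>\<^sup>+t. \<integral>\<^sup>+r. \<Phi> N k S t (F r) \<partial>LT \<partial>PiM S (\<lambda>_. LT)) = (\<integral>\<^sup>+r. \<integral>\<^sup>+t. \<Phi> N k S t (F r) \<partial>PiM S (\<lambda>_. LT) \<partial>LT)"
    using PP.Fubini'[of "\<lambda>t r. \<Phi> N k S t (F r)"] \<Phi>_measurable[OF S F] by (simp add: case_prod_beta')
  also have "\<dots> \<le> (\<integral>\<^sup>+r. \<kappa> ^ j * nk (k + j) (F r) \<partial>LT)"
  proof (rule nn_integral_mono)
    fix r
    show "(\<integral>\<^sup>+t. \<Phi> N k S t (F r) \<partial>PiM S (\<lambda>_. LT)) \<le> \<kappa> ^ j * nk (k + j) (F r)"
      using nrm_E_L1[OF S, of N "lift (leaves k S) (F r)"] finite_leaves[OF fin] card_leaves[OF S]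
      by (simp add: \<Phi>_def nrm_lift)
  qed
  also have "\<dots> = \<kappa> ^ j * (\<integral>\<^sup>+r. nk (k + j) (F r) \<partial>LT)"
    unfolding nk_def using F by (intro nn_integral_cmult nrm_measurable) (auto simp: lift_def)
  finally show ?thesis .
qed

text \<open>Only the time r of the current collision term has to precede all node times. The node
  times are otherwise unordered, and this is why there is one summand per shape and not one per
  history of growth.\<close>

definition W :: "nat \<Rightarrow> nat \<Rightarrow> nat \<Rightarrow> ennreal" where
  "W N k j = (\<Sum>S\<in>shapes k j. \<integral>\<^sup>+t. \<integral>\<^sup>+r. indicator {r. \<forall>p\<in>S. r < t p} r * \<Phi> N k S t (c (k + j) r) \<partial>LT \<partial>PiM S (\<lambda>_. LT))"

text \<open>Growing a leaf \<open>p\<close> at a time before all others gives a forest in which \<open>p\<close> is the node of least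
  time, so that no timed forest is produced twice.\<close>

definition last_at :: "nat \<Rightarrow> nat \<Rightarrow> nat \<Rightarrow> addr set \<Rightarrow> addr \<Rightarrow> ennreal" where
  "last_at N k m S p = (\<integral>\<^sup>+t. \<integral>\<^sup>+s. (if (\<forall>q\<in>S - {p}. t p < t q) \<and> s < t p then \<Phi> N k S t (c m s) else 0) \<partial>LT \<partial>PiM S (\<lambda>_. LT))"

lemma if_\<Phi>_measurable:
  assumes S: "S \<in> shapes k j" and p: "p \<in> S"
  shows "(\<lambda>x. if (\<forall>q\<in>S - {p}. fst x p < fst x q) \<and> snd x < fst x p then \<Phi> N k S (fst x) (c m (snd x)) else 0)
    \<in> borel_measurable (PiM S (\<lambda>_. LT) \<Otimes>\<^sub>M LT)"
proof -
  have fin: "finite (S - {p})" using shapesD[OF S] by blast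
  have [measurable]: "(\<lambda>x. fst x a) \<in> borel_measurable (PiM S (\<lambda>_. LT) \<Otimes>\<^sub>M LT)" if "a \<in> S" for a
    using measurable_compose[OF measurable_fst component_LT[OF that]] .
  have [measurable]: "(\<lambda>x. snd x) \<in> borel_measurable (PiM S (\<lambda>_. LT) \<Otimes>\<^sub>M LT)"
    using measurable_compose[OF measurable_snd ident_LT] .
  have [measurable]: "(\<lambda>x. \<Phi> N k S (fst x) (c m (snd x))) \<in> borel_measurable (PiM S (\<lambda>_. LT) \<Otimes>\<^sub>M LT)"
    by (rule \<Phi>_measurable[OF S]) simp
  have [measurable]: "Measurable.pred (PiM S (\<lambda>_. LT) \<Otimes>\<^sub>M LT) (\<lambda>x. \<forall>q\<in>S - {p}. fst x p < fst x q)"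
    using p by (intro pred_intros_finite(3)[OF fin]) auto
  have [measurable]: "Measurable.pred (PiM S (\<lambda>_. LT) \<Otimes>\<^sub>M LT) (\<lambda>x. snd x < fst x p)"
    using p by measurable
  show ?thesis by measurable
qed

text \<open>The time r of the collision at p becomes the p-coordinate of the product
  measure.\<close>

lemma last_at_insert:
  assumes S: "S \<in> shapes k j" and p: "p \<in> leaves k S"
  shows "(\<integral>\<^sup>+t. \<integral>\<^sup>+r. indicator {r. \<forall>q\<in>S. r < t q} r * (\<integral>\<^sup>+s. indicator {..<r} s * \<Phi> N k (insert p S) (t(p := r)) (c m s) \<partial>LT) \<partial>LT \<partial>PiM S (\<lambda>_. LT))
    = last_at N k m (insert p S) p"
proof -
  have fin: "finite S" and pS: "p \<notin> S" using shapesD[OF S] leaf_not_node[OF p] by auto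
  define f where "f t = (\<integral>\<^sup>+s. (if (\<forall>q\<in>insert p S - {p}. t p < t q) \<and> s < t p then \<Phi> N k (insert p S) t (c m s) else 0) \<partial>LT)" for t
  have "f \<in> borel_measurable (PiM (insert p S) (\<lambda>_. LT))"
    unfolding f_def using if_\<Phi>_measurable[OF leaves_grow(1)[OF S p], of p N m]
    by (intro LT.borel_measurable_nn_integral) (simp add: case_prod_beta')
  then have "last_at N k m (insert p S) p = (\<integral>\<^sup>+t. \<integral>\<^sup>+r. f (t(p := r)) \<partial>LT \<partial>PiM S (\<lambda>_. LT))"
    unfolding last_at_def f_def[symmetric] by (rule PLT.product_nn_integral_insert[OF fin pS])
  also have "\<dots> = (\<integral>\<^sup>+t. \<integral>\<^sup>+r. indicator {r. \<forall>q\<in>S. r < t q} r * (\<integral>\<^sup>+s. indicator {..<r} s * \<Phi> N k (insert p S) (t(p := r)) (c m s) \<partial>LT) \<partial>LT \<partial>PiM S (\<lambda>_. LT))"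
  proof (intro nn_integral_cong)
    fix t :: "addr \<Rightarrow> real" and r
    have iff: "(\<forall>q\<in>insert p S - {p}. (t(p := r)) p < (t(p := r)) q) \<longleftrightarrow> (\<forall>q\<in>S. r < t q)" using pS by auto
    show "f (t(p := r)) = indicator {r. \<forall>q\<in>S. r < t q} r * (\<integral>\<^sup>+s. indicator {..<r} s * \<Phi> N k (insert p S) (t(p := r)) (c m s) \<partial>LT)"
    proof (cases "\<forall>q\<in>S. r < t q")
      case True
      then have eq: "(\<forall>q\<in>S. r < t q) \<longleftrightarrow> True" by blast
      show ?thesis unfolding f_def iff eq mem_Collect_eq indicator_def
        by (auto intro!: nn_integral_cong)
    next
      case False
      then have eq: "(\<forall>q\<in>S. r < t q) \<longleftrightarrow> False" by blast
      show ?thesis unfolding f_def iff eq mem_Collect_eq indicator_def by simp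
    qed
  qed
  finally show ?thesis by simp
qed

text \<open>At most one node can have the strictly least time, so for each choice of times at most
  one summand survives. There s precedes the least time and hence all of them.\<close>

lemma sum_last_at:
  assumes S: "S \<in> shapes k j"
  shows "(\<Sum>p\<in>S. last_at N k m S p) \<le> (\<integral>\<^sup>+t. \<integral>\<^sup>+s. indicator {s. \<forall>q\<in>S. s < t q} s * \<Phi> N k S t (c m s) \<partial>LT \<partial>PiM S (\<lambda>_. LT))"
proof -
  have fin: "finite S" using shapesD[OF S] by blast
  let ?f = "\<lambda>p t s. (if (\<forall>q\<in>S - {p}. t p < t q) \<and> s < t p then \<Phi> N k S t (c m s) else 0)"
  have m: "(\<lambda>t. \<integral>\<^sup>+s. ?f p t s \<partial>LT) \<in> borel_measurable (PiM S (\<lambda>_. LT))" if "p \<in> S" for p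
    using if_\<Phi>_measurable[OF S that, of N m] by (intro LT.borel_measurable_nn_integral) (simp add: case_prod_beta')
  have "(\<Sum>p\<in>S. last_at N k m S p) = (\<integral>\<^sup>+t. (\<Sum>p\<in>S. \<integral>\<^sup>+s. ?f p t s \<partial>LT) \<partial>PiM S (\<lambda>_. LT))"
    unfolding last_at_def by (rule nn_integral_sum[symmetric]) (rule m)
  also have "\<dots> \<le> (\<integral>\<^sup>+t. \<integral>\<^sup>+s. indicator {s. \<forall>q\<in>S. s < t q} s * \<Phi> N k S t (c m s) \<partial>LT \<partial>PiM S (\<lambda>_. LT))"
  proof (rule nn_integral_mono)
    fix t assume t: "t \<in> space (PiM S (\<lambda>_. LT))"
    have "(\<Sum>p\<in>S. \<integral>\<^sup>+s. ?f p t s \<partial>LT) = (\<integral>\<^sup>+s. (\<Sum>p\<in>S. ?f p t s) \<partial>LT)"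
    proof (rule nn_integral_sum[symmetric])
      fix p assume p: "p \<in> S"
      show "(\<lambda>s. ?f p t s) \<in> borel_measurable LT"
        using measurable_compose[OF measurable_Pair1'[OF t] if_\<Phi>_measurable[OF S p, of N m]]
        unfolding fst_conv snd_conv .
    qed
    also have "\<dots> \<le> (\<integral>\<^sup>+s. indicator {s. \<forall>q\<in>S. s < t q} s * \<Phi> N k S t (c m s) \<partial>LT)"
    proof (rule nn_integral_mono)
      fix s
      show "(\<Sum>p\<in>S. ?f p t s) \<le> indicator {s. \<forall>q\<in>S. s < t q} s * \<Phi> N k S t (c m s)"
      proof (cases "\<exists>p\<in>S. (\<forall>q\<in>S - {p}. t p < t q) \<and> s < t p")
        case True
        then obtain p where p: "p \<in> S" "\<forall>q\<in>S - {p}. t p < t q" "s < t p" by blast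
        have "?f q t s = 0" if "q \<in> S - {p}" for q
        proof -
          have "t p < t q" "p \<in> S - {q}" using p that by blast+
          then have "\<not> ((\<forall>q'\<in>S - {q}. t q < t q') \<and> s < t q)" by (meson less_asym)
          then show ?thesis by (rule if_not_P)
        qed
        then have "(\<Sum>q\<in>S. ?f q t s) = ?f p t s"
          using sum.remove[OF fin p(1), of "\<lambda>q. ?f q t s"] by (simp add: sum.neutral)
        also have "\<dots> = \<Phi> N k S t (c m s)" using p by simp
        moreover have "\<forall>q\<in>S. s < t q" using p by (metis DiffI order.strict_trans singletonD)
        ultimately show ?thesis by simp
      next
        case False
        then have "(\<Sum>q\<in>S. ?f q t s) = 0" by (intro sum.neutral) auto
        then show ?thesis by simp
      qed
    qed
    finally show "(\<Sum>p\<in>S. \<integral>\<^sup>+s. ?f p t s \<partial>LT) \<le> (\<integral>\<^sup>+s. indicator {s. \<forall>q\<in>S. s < t q} s * \<Phi> N k S t (c m s) \<partial>LT)" .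
  qed
  finally show ?thesis .
qed

text \<open>After \<open>\<Phi>_step\<close>, each pair of a shape and a leaf is a larger shape with
  a marked earliest node. By \<open>sum_last_at\<close> the marking costs nothing, so a step costs
  only the modulus of \<open>lam\<close> and not the number k + j of leaves.\<close>

lemma W_step:
  assumes k: "k \<ge> 1"
  shows "W N k j \<le> ennreal (cmod lam) * W N k (Suc j) +
    of_nat (card (shapes k j)) * \<kappa> ^ j * (\<integral>\<^sup>+r. nk (k + j) (err N (k + j) r) \<partial>LT)"
proof -
  let ?ind = "\<lambda>S t r. indicator {r. \<forall>q\<in>S. r < t q} r :: ennreal"
  let ?I = "\<lambda>S t p r. \<integral>\<^sup>+s. indicator {..<r} s * \<Phi> N k (insert p S) (t(p := r)) (c (k + Suc j) s) \<partial>LT"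
  have one: "(\<integral>\<^sup>+t. \<integral>\<^sup>+r. ?ind S t r * \<Phi> N k S t (c (k + j) r) \<partial>LT \<partial>PiM S (\<lambda>_. LT))
    \<le> ennreal (cmod lam) * (\<Sum>p\<in>leaves k S. last_at N k (k + Suc j) (insert p S) p)
      + \<kappa> ^ j * (\<integral>\<^sup>+r. nk (k + j) (err N (k + j) r) \<partial>LT)" if S: "S \<in> shapes k j" for S
  proof -
    have fin: "finite S" using shapesD[OF S] by blast
    have compS: "(\<lambda>x. fst x a) \<in> borel_measurable (PiM S (\<lambda>_. LT) \<Otimes>\<^sub>M LT)" if "a \<in> S" for a
      using measurable_compose[OF measurable_fst component_LT[OF that]] .
    have sndm[measurable]: "(\<lambda>x. snd x) \<in> borel_measurable (PiM S (\<lambda>_. LT) \<Otimes>\<^sub>M LT)"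
      using measurable_compose[OF measurable_snd ident_LT] .
    have predS: "Measurable.pred (PiM S (\<lambda>_. LT) \<Otimes>\<^sub>M LT) (\<lambda>x. \<forall>q\<in>S. snd x < fst x q)"
      using compS by (intro pred_intros_finite(3)[OF fin]) auto
    have indm: "(\<lambda>x. ?ind S (fst x) (snd x)) \<in> borel_measurable (PiM S (\<lambda>_. LT) \<Otimes>\<^sub>M LT)"
    proof -
      have "(\<lambda>x. if (\<forall>q\<in>S. snd x < fst x q) then 1 else (0::ennreal)) \<in> borel_measurable (PiM S (\<lambda>_. LT) \<Otimes>\<^sub>M LT)"
        using predS by measurable
      then show ?thesis by (simp add: indicator_def of_bool_def)
    qed
    have Im: "(\<lambda>x. ?I S (fst x) p (snd x)) \<in> borel_measurable (PiM S (\<lambda>_. LT) \<Otimes>\<^sub>M LT)" if p: "p \<in> leaves k S" for p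
    proof -
      have S': "insert p S \<in> shapes k (Suc j)" using leaves_grow(1)[OF S p] .
      have 1: "(\<lambda>y. (fst (fst y))(p := snd (fst y))) \<in> (PiM S (\<lambda>_. LT) \<Otimes>\<^sub>M LT) \<Otimes>\<^sub>M LT \<rightarrow>\<^sub>M PiM (insert p S) (\<lambda>_. LT)"
        by (rule measurable_fun_upd[where J = S]) auto
      have 2: "(\<lambda>y. ((fst (fst y))(p := snd (fst y)), snd y)) \<in> (PiM S (\<lambda>_. LT) \<Otimes>\<^sub>M LT) \<Otimes>\<^sub>M LT \<rightarrow>\<^sub>M PiM (insert p S) (\<lambda>_. LT) \<Otimes>\<^sub>M LT"
        using 1 by measurable
      have 3[measurable]: "(\<lambda>y. \<Phi> N k (insert p S) ((fst (fst y))(p := snd (fst y))) (c (k + Suc j) (snd y))) \<in>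
        borel_measurable ((PiM S (\<lambda>_. LT) \<Otimes>\<^sub>M LT) \<Otimes>\<^sub>M LT)"
        using measurable_compose[OF 2 \<Phi>_measurable[OF S', of "c (k + Suc j)" N]] by simp
      have [measurable]: "(\<lambda>y. snd (fst y)) \<in> borel_measurable ((PiM S (\<lambda>_. LT) \<Otimes>\<^sub>M LT) \<Otimes>\<^sub>M LT)"
        using measurable_compose[OF measurable_fst sndm] .
      have [measurable]: "(\<lambda>y. snd y) \<in> borel_measurable ((PiM S (\<lambda>_. LT) \<Otimes>\<^sub>M LT) \<Otimes>\<^sub>M LT)"
        using measurable_compose[OF measurable_snd ident_LT] .
      have "(\<lambda>y. if snd y < snd (fst y) then \<Phi> N k (insert p S) ((fst (fst y))(p := snd (fst y))) (c (k + Suc j) (snd y)) else 0) \<in>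
        borel_measurable ((PiM S (\<lambda>_. LT) \<Otimes>\<^sub>M LT) \<Otimes>\<^sub>M LT)" by measurable
      then have "(\<lambda>y. indicator {..<snd (fst y)} (snd y) * \<Phi> N k (insert p S) ((fst (fst y))(p := snd (fst y))) (c (k + Suc j) (snd y))) \<in>
        borel_measurable ((PiM S (\<lambda>_. LT) \<Otimes>\<^sub>M LT) \<Otimes>\<^sub>M LT)"
        by (rule measurable_cong[THEN iffD1, rotated]) (auto simp: indicator_def)
      then show ?thesis by (intro LT.borel_measurable_nn_integral) (simp add: case_prod_beta')
    qed
    have sec: "(\<lambda>r. f (t, r)) \<in> borel_measurable LT"
      if "f \<in> borel_measurable (PiM S (\<lambda>_. LT) \<Otimes>\<^sub>M LT)" "t \<in> space (PiM S (\<lambda>_. LT))" for f :: "_ \<Rightarrow> ennreal" and t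
      using measurable_compose[OF measurable_Pair1'[OF that(2)] that(1)] .
    let ?X = "\<lambda>t p r. ?ind S t r * ?I S t p r"
    have Xm: "(\<lambda>x. ?X (fst x) p (snd x)) \<in> borel_measurable (PiM S (\<lambda>_. LT) \<Otimes>\<^sub>M LT)" if "p \<in> leaves k S" for p
      using indm Im[OF that] by (rule borel_measurable_times_ennreal)
    have em: "(\<lambda>x. \<Phi> N k S (fst x) (err N (k + j) (snd x))) \<in> borel_measurable (PiM S (\<lambda>_. LT) \<Otimes>\<^sub>M LT)"
      by (rule \<Phi>_measurable[OF S]) simp
    have Sm: "(\<lambda>x. \<Sum>p\<in>leaves k S. ?X (fst x) p (snd x)) \<in> borel_measurable (PiM S (\<lambda>_. LT) \<Otimes>\<^sub>M LT)"
      by (intro borel_measurable_sum Xm)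
    have im: "(\<lambda>t. \<integral>\<^sup>+r. f (t, r) \<partial>LT) \<in> borel_measurable (PiM S (\<lambda>_. LT))"
      if "f \<in> borel_measurable (PiM S (\<lambda>_. LT) \<Otimes>\<^sub>M LT)" for f :: "_ \<Rightarrow> ennreal"
      using that by (intro LT.borel_measurable_nn_integral) simp
    have "(\<integral>\<^sup>+t. \<integral>\<^sup>+r. ?ind S t r * \<Phi> N k S t (c (k + j) r) \<partial>LT \<partial>PiM S (\<lambda>_. LT))
      \<le> (\<integral>\<^sup>+t. \<integral>\<^sup>+r. ennreal (cmod lam) * (\<Sum>p\<in>leaves k S. ?X t p r) + \<Phi> N k S t (err N (k + j) r) \<partial>LT \<partial>PiM S (\<lambda>_. LT))"
    proof (intro nn_integral_mono)
      fix t r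
      show "?ind S t r * \<Phi> N k S t (c (k + j) r) \<le> ennreal (cmod lam) * (\<Sum>p\<in>leaves k S. ?X t p r) + \<Phi> N k S t (err N (k + j) r)"
        using \<Phi>_step[OF S k, of N t r] by (cases "\<forall>q\<in>S. r < t q") auto
    qed
    also have "\<dots> = (\<integral>\<^sup>+t. ennreal (cmod lam) * (\<integral>\<^sup>+r. (\<Sum>p\<in>leaves k S. ?X t p r) \<partial>LT) + (\<integral>\<^sup>+r. \<Phi> N k S t (err N (k + j) r) \<partial>LT) \<partial>PiM S (\<lambda>_. LT))"
    proof (rule nn_integral_cong)
      fix t assume t: "t \<in> space (PiM S (\<lambda>_. LT))"
      have a: "(\<lambda>r. \<Sum>p\<in>leaves k S. ?X t p r) \<in> borel_measurable LT" using sec[OF Sm t] by simp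
      have b: "(\<lambda>r. \<Phi> N k S t (err N (k + j) r)) \<in> borel_measurable LT" using sec[OF em t] by simp
      show "(\<integral>\<^sup>+r. ennreal (cmod lam) * (\<Sum>p\<in>leaves k S. ?X t p r) + \<Phi> N k S t (err N (k + j) r) \<partial>LT) =
        ennreal (cmod lam) * (\<integral>\<^sup>+r. (\<Sum>p\<in>leaves k S. ?X t p r) \<partial>LT) + (\<integral>\<^sup>+r. \<Phi> N k S t (err N (k + j) r) \<partial>LT)"
        using a b by (subst nn_integral_add) (auto simp: nn_integral_cmult)
    qed
    also have "\<dots> = ennreal (cmod lam) * (\<integral>\<^sup>+t. \<integral>\<^sup>+r. (\<Sum>p\<in>leaves k S. ?X t p r) \<partial>LT \<partial>PiM S (\<lambda>_. LT))
        + (\<integral>\<^sup>+t. \<integral>\<^sup>+r. \<Phi> N k S t (err N (k + j) r) \<partial>LT \<partial>PiM S (\<lambda>_. LT))"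
      using im[OF Sm] im[OF em] by (subst nn_integral_add) (auto simp: nn_integral_cmult)
    also have "(\<integral>\<^sup>+t. \<integral>\<^sup>+r. (\<Sum>p\<in>leaves k S. ?X t p r) \<partial>LT \<partial>PiM S (\<lambda>_. LT)) =
        (\<Sum>p\<in>leaves k S. \<integral>\<^sup>+t. \<integral>\<^sup>+r. ?X t p r \<partial>LT \<partial>PiM S (\<lambda>_. LT))"
    proof (subst nn_integral_sum[symmetric])
      fix p assume "p \<in> leaves k S"
      then show "(\<lambda>t. \<integral>\<^sup>+r. ?X t p r \<partial>LT) \<in> borel_measurable (PiM S (\<lambda>_. LT))" using im[OF Xm] by simp
    next
      show "(\<integral>\<^sup>+t. \<integral>\<^sup>+r. (\<Sum>p\<in>leaves k S. ?X t p r) \<partial>LT \<partial>PiM S (\<lambda>_. LT)) =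
        (\<integral>\<^sup>+t. (\<Sum>p\<in>leaves k S. \<integral>\<^sup>+r. ?X t p r \<partial>LT) \<partial>PiM S (\<lambda>_. LT))"
      proof (rule nn_integral_cong)
        fix t assume t: "t \<in> space (PiM S (\<lambda>_. LT))"
        show "(\<integral>\<^sup>+r. (\<Sum>p\<in>leaves k S. ?X t p r) \<partial>LT) = (\<Sum>p\<in>leaves k S. \<integral>\<^sup>+r. ?X t p r \<partial>LT)"
          using sec[OF Xm t] by (intro nn_integral_sum) simp
      qed
    qed
    also have "\<dots> = (\<Sum>p\<in>leaves k S. last_at N k (k + Suc j) (insert p S) p)"
      by (intro sum.cong refl last_at_insert[OF S])
    finally show ?thesis
      by (rule order_trans) (intro add_left_mono \<Phi>_bound[OF S] err_measurable)
  qed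
  have "W N k j \<le> (\<Sum>S\<in>shapes k j. ennreal (cmod lam) * (\<Sum>p\<in>leaves k S. last_at N k (k + Suc j) (insert p S) p)
      + \<kappa> ^ j * (\<integral>\<^sup>+r. nk (k + j) (err N (k + j) r) \<partial>LT))"
    unfolding W_def by (intro sum_mono one)
  also have "\<dots> = ennreal (cmod lam) * (\<Sum>S\<in>shapes k j. \<Sum>p\<in>leaves k S. last_at N k (k + Suc j) (insert p S) p)
      + of_nat (card (shapes k j)) * \<kappa> ^ j * (\<integral>\<^sup>+r. nk (k + j) (err N (k + j) r) \<partial>LT)"
    by (simp add: sum.distrib sum_distrib_left mult.assoc)
  also have "(\<Sum>S\<in>shapes k j. \<Sum>p\<in>leaves k S. last_at N k (k + Suc j) (insert p S) p) \<le> W N k (Suc j)"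
  proof -
    \<comment> \<open>The marked node recovers the smaller shape, since a leaf p is not a member of
      S. Hence no pair is counted twice.\<close>
    let ?g = "\<lambda>(S, p). (insert p S, p :: addr)"
    have inj: "inj_on ?g (Sigma (shapes k j) (leaves k))"
    proof (rule inj_onI)
      fix x y assume "x \<in> Sigma (shapes k j) (leaves k)" "y \<in> Sigma (shapes k j) (leaves k)" "?g x = ?g y"
      moreover obtain A a B b where "x = (A, a)" "y = (B, b)" by (metis surj_pair)
      ultimately have "a = b" "a \<notin> A" "a \<notin> B" "insert a A = insert b B" "x = (A, a)" "y = (B, b)"
        by (auto dest: leaf_not_node)
      then show "x = y" using insert_ident[of a A B] by simp
    qed
    have im: "?g ` Sigma (shapes k j) (leaves k) \<subseteq> Sigma (shapes k (Suc j)) (\<lambda>S. S)"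
      by (auto intro: leaves_grow(1))
    have finS: "finite (Sigma (shapes k (Suc j)) (\<lambda>S. S))"
      using card_shapes(1) shapesD(1) by blast
    have "(\<Sum>S\<in>shapes k j. \<Sum>p\<in>leaves k S. last_at N k (k + Suc j) (insert p S) p) =
       (\<Sum>(S, p)\<in>Sigma (shapes k j) (leaves k). last_at N k (k + Suc j) (insert p S) p)"
      using card_shapes(1) finite_leaves shapesD(1) by (intro sum.Sigma) blast+
    also have "\<dots> = (\<Sum>(S, p)\<in>?g ` Sigma (shapes k j) (leaves k). last_at N k (k + Suc j) S p)"
      by (subst sum.reindex[OF inj]) (auto intro: sum.cong)
    also have "\<dots> \<le> (\<Sum>(S, p)\<in>Sigma (shapes k (Suc j)) (\<lambda>S. S). last_at N k (k + Suc j) S p)"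
      by (rule sum_mono2[OF finS im]) auto
    also have "\<dots> = (\<Sum>S\<in>shapes k (Suc j). \<Sum>p\<in>S. last_at N k (k + Suc j) S p)"
      using card_shapes(1) shapesD(1) by (intro sum.Sigma[symmetric]) blast+
    also have "\<dots> \<le> W N k (Suc j)"
      unfolding W_def by (intro sum_mono sum_last_at)
    finally show ?thesis .
  qed
  finally show ?thesis by (simp add: add_right_mono mult_left_mono)
qed

end

section \<open>Removing the truncation\<close>

context hierarchy
begin

definition tail :: "nat \<Rightarrow> addr \<Rightarrow> ((addr \<Rightarrow> 'q) \<Rightarrow> complex) \<Rightarrow> (addr \<Rightarrow> 'q) \<Rightarrow> complex" where
  "tail N p G q = (if q (child p True) \<in> R N then 0 else G q)"

text \<open>The indices missing at level N are exactly those whose new particle lies outside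
  \<open>R N\<close>. The difference of two truncations is therefore a truncated collision applied
  to the tail of the argument.\<close>

lemma Bp_diff:
  assumes "N \<le> N'" "p \<in> A"
  shows "Bp N' p A r G q - Bp N p A r G q = Bp N' p A r (tail N p G) q"
proof -
  let ?h = "\<lambda>y. om r (q p) y * G (restrict (q(child p False := lft (q p) y, child p True := rgt y)) (grow p A))"
  have "Z N \<subseteq> Z N'" using Z_R[OF assms(1)] by blast
  then have "Bp N' p A r G q - Bp N p A r G q = (\<Sum>y\<in>Z N' - Z N. ?h y)"
    unfolding Bp_def using sum.subset_diff[of "Z N" "Z N'" ?h] finite_Z by simp
  also have "\<dots> = (\<Sum>y\<in>Z N'. if y \<in> Z N then 0 else ?h y)"
    using finite_Z by (simp add: sum.If_cases Diff_eq)
  also have "\<dots> = Bp N' p A r (tail N p G) q"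
    unfolding Bp_def using Z_R[OF assms(1)] by (intro sum.cong) (auto simp: tail_def grow_def)
  finally show ?thesis .
qed

definition \<rho> :: "nat \<Rightarrow> nat \<Rightarrow> real \<Rightarrow> ennreal" where
  "\<rho> N k s = (\<Sum>p\<in>roots k. nrm (grow p (roots k)) (tail N p (lift (grow p (roots k)) (c (k + 1) s))))"

lemma grow_roots:
  assumes "p \<in> roots k"
  shows "finite (grow p (roots k))" "card (grow p (roots k)) = k + 1"
proof -
  show "finite (grow p (roots k))" by (simp add: grow_def)
  have "k > 0" using assms by (auto simp: roots_def)
  then show "card (grow p (roots k)) = k + 1" using assms by (simp add: grow_def card_Diff_singleton)
qed

text \<open>By \<open>Bp_diff\<close> the difference is a collision acting on a tail, and
  \<open>Bp_L1\<close> bounds it uniformly in the larger level N'. Only the tail of the collision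
  term of order k + 1 remains, with no convergence rate assumed.\<close>

lemma err_Cauchy:
  assumes k: "k \<ge> 1" and N: "N \<le> N'"
  shows "(\<integral>\<^sup>+r. nk k (\<lambda>M. lam * Bop N' r (Dint (k + 1) r) M - lam * Bop N r (Dint (k + 1) r) M) \<partial>LT)
    \<le> ennreal (cmod lam) * \<kappa> * (\<integral>\<^sup>+s. \<rho> N k s \<partial>LT)"
proof -
  let ?A = "roots k"
  let ?L = "\<lambda>p s. lift (grow p ?A) (c (k + 1) s)"
  have one: "nk k (\<lambda>M. lam * Bop N' r (Dint (k + 1) r) M - lam * Bop N r (Dint (k + 1) r) M)
    \<le> ennreal (cmod lam) * (\<Sum>p\<in>?A. \<integral>\<^sup>+s. nrm ?A (Bp N' p ?A r (tail N p (?L p s))) \<partial>LT)" for r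
  proof -
    let ?D = "\<lambda>p. lift (grow p ?A) (Dint (k + 1) r)"
    have eq: "lift ?A (\<lambda>M. lam * Bop N' r (Dint (k + 1) r) M - lam * Bop N r (Dint (k + 1) r) M) q
      = lam * (\<Sum>p\<in>?A. Bp N' p ?A r (tail N p (?D p)) q)" for q
    proof -
      have "lift ?A (\<lambda>M. lam * Bop N' r (Dint (k + 1) r) M - lam * Bop N r (Dint (k + 1) r) M) q
        = lam * (lift ?A (Bop N' r (Dint (k + 1) r)) q - lift ?A (Bop N r (Dint (k + 1) r)) q)"
        by (simp add: lift_def right_diff_distrib)
      also have "\<dots> = lam * (\<Sum>p\<in>?A. Bp N' p ?A r (?D p) q - Bp N p ?A r (?D p) q)"
        by (subst (1 2) lift_Bop) (auto simp: sum_subtractf)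
      finally show ?thesis using Bp_diff[OF N] by simp
    qed
    have "nk k (\<lambda>M. lam * Bop N' r (Dint (k + 1) r) M - lam * Bop N r (Dint (k + 1) r) M)
      = nrm ?A (\<lambda>q. lam * (\<Sum>p\<in>?A. Bp N' p ?A r (tail N p (?D p)) q))"
      unfolding nk_def by (intro arg_cong[of _ _ "nrm ?A"] ext eq)
    also have "\<dots> \<le> ennreal (cmod lam) * (\<Sum>p\<in>?A. nrm ?A (Bp N' p ?A r (tail N p (?D p))))"
      unfolding nrm_cmult by (intro mult_left_mono nrm_sum) (auto intro: norm_sum)
    also have "\<dots> \<le> ennreal (cmod lam) * (\<Sum>p\<in>?A. \<integral>\<^sup>+s. nrm ?A (Bp N' p ?A r (tail N p (?L p s))) \<partial>LT)"
    proof (intro mult_left_mono sum_mono)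
      fix p assume p: "p \<in> ?A"
      define H where "H s q = (indicator {..<r} s *\<^sub>R tail N p (?L p s) q :: complex)" for s q
      have int: "integrable LT (\<lambda>s. H s q)" for q
        using integrable_cut[OF grow_roots[OF p], of r q] 
        by (cases "q (child p True) \<in> R N") (simp_all add: H_def tail_def)
      have tD: "tail N p (?D p) q = (LINT s|LT. H s q)" for q
        by (auto simp: H_def tail_def lift_Dint)
      have "nrm ?A (Bp N' p ?A r (tail N p (?D p))) \<le> (\<integral>\<^sup>+s. nrm ?A (Bp N' p ?A r (H s)) \<partial>LT)"
      proof (rule nrm_minkowski)
        fix q :: "addr \<Rightarrow> 'q"
        have i: "integrable LT (\<lambda>s. Bp N' p ?A r (H s) q)" by (rule Bp_integral(1)[OF int])
        then show "(\<lambda>s. Bp N' p ?A r (H s) q) \<in> borel_measurable LT" by simp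
        have "Bp N' p ?A r (tail N p (?D p)) q = (LINT s|LT. Bp N' p ?A r (H s) q)"
          unfolding tD[abs_def] by (rule Bp_integral(2)[OF int])
        then show "ennreal (cmod (Bp N' p ?A r (tail N p (?D p)) q)) \<le> (\<integral>\<^sup>+s. ennreal (cmod (Bp N' p ?A r (H s) q)) \<partial>LT)"
          using integral_norm_bound_ennreal[OF i] by simp
      qed simp
      also have "\<dots> \<le> (\<integral>\<^sup>+s. nrm ?A (Bp N' p ?A r (tail N p (?L p s))) \<partial>LT)"
      proof (intro nn_integral_mono nrm_mono)
        fix s q
        have "Bp N' p ?A r (H s) q = complex_of_real (indicator {..<r} s) * Bp N' p ?A r (tail N p (?L p s)) q"
          by (simp add: Bp_def H_def scaleR_conv_of_real sum_distrib_left algebra_simps)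
        then show "cmod (Bp N' p ?A r (H s) q) \<le> cmod (Bp N' p ?A r (tail N p (?L p s)) q)"
          by (simp add: norm_mult indicator_def)
      qed
      finally show "nrm ?A (Bp N' p ?A r (tail N p (?D p))) \<le> (\<integral>\<^sup>+s. nrm ?A (Bp N' p ?A r (tail N p (?L p s))) \<partial>LT)" .
    qed simp
    finally show ?thesis .
  qed
  have m: "(\<lambda>x. nrm ?A (Bp N' p ?A (fst x) (tail N p (?L p (snd x))))) \<in> borel_measurable (LT \<Otimes>\<^sub>M LT)" for p
  proof (rule nrm_measurable)
    fix q :: "addr \<Rightarrow> 'q"
    have 1: "(\<lambda>x. om (fst x) a z) \<in> borel_measurable (LT \<Otimes>\<^sub>M LT)" for a z
      using measurable_compose[OF measurable_fst om_LT] .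
    have 2: "(\<lambda>x. tail N p (?L p (snd x)) q') \<in> borel_measurable (LT \<Otimes>\<^sub>M LT)" for q'
      unfolding tail_def using measurable_compose[OF measurable_snd lift_c_LT] by (cases "q' (child p True) \<in> R N") auto
    show "(\<lambda>x. Bp N' p ?A (fst x) (tail N p (?L p (snd x))) q) \<in> borel_measurable (LT \<Otimes>\<^sub>M LT)"
      unfolding Bp_def by (intro borel_measurable_sum borel_measurable_times 1 2)
  qed simp
  have m1: "(\<lambda>r. \<integral>\<^sup>+s. nrm ?A (Bp N' p ?A r (tail N p (?L p s))) \<partial>LT) \<in> borel_measurable LT" for p
    using m by (intro LT.borel_measurable_nn_integral) (simp add: case_prod_beta')
  have m2: "(\<lambda>s. nrm (grow p ?A) (tail N p (?L p s))) \<in> borel_measurable LT" if "p \<in> ?A" for p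
    using grow_roots[OF that] by (intro nrm_measurable) (auto simp: tail_def)
  interpret PP: pair_sigma_finite LT LT by standard
  have "(\<integral>\<^sup>+r. nk k (\<lambda>M. lam * Bop N' r (Dint (k + 1) r) M - lam * Bop N r (Dint (k + 1) r) M) \<partial>LT)
    \<le> (\<integral>\<^sup>+r. ennreal (cmod lam) * (\<Sum>p\<in>?A. \<integral>\<^sup>+s. nrm ?A (Bp N' p ?A r (tail N p (?L p s))) \<partial>LT) \<partial>LT)"
    by (intro nn_integral_mono one)
  also have "\<dots> = ennreal (cmod lam) * (\<Sum>p\<in>?A. \<integral>\<^sup>+r. \<integral>\<^sup>+s. nrm ?A (Bp N' p ?A r (tail N p (?L p s))) \<partial>LT \<partial>LT)"
    using m1 by (simp add: nn_integral_cmult nn_integral_sum)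
  also have "\<dots> \<le> ennreal (cmod lam) * (\<Sum>p\<in>?A. \<kappa> * (\<integral>\<^sup>+s. nrm (grow p ?A) (tail N p (?L p s)) \<partial>LT))"
  proof (intro mult_left_mono sum_mono)
    fix p assume p: "p \<in> ?A"
    have "(\<integral>\<^sup>+r. \<integral>\<^sup>+s. nrm ?A (Bp N' p ?A r (tail N p (?L p s))) \<partial>LT \<partial>LT)
      = (\<integral>\<^sup>+s. \<integral>\<^sup>+r. nrm ?A (Bp N' p ?A r (tail N p (?L p s))) \<partial>LT \<partial>LT)"
      using PP.Fubini'[of "\<lambda>r s. nrm ?A (Bp N' p ?A r (tail N p (?L p s)))"] m by (simp add: case_prod_beta')
    also have "\<dots> \<le> (\<integral>\<^sup>+s. \<kappa> * nrm (grow p ?A) (tail N p (?L p s)) \<partial>LT)"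
      using p by (intro nn_integral_mono Bp_L1) auto
    also have "\<dots> = \<kappa> * (\<integral>\<^sup>+s. nrm (grow p ?A) (tail N p (?L p s)) \<partial>LT)"
      by (rule nn_integral_cmult[OF m2[OF p]])
    finally show "(\<integral>\<^sup>+r. \<integral>\<^sup>+s. nrm ?A (Bp N' p ?A r (tail N p (?L p s))) \<partial>LT \<partial>LT)
      \<le> \<kappa> * (\<integral>\<^sup>+s. nrm (grow p ?A) (tail N p (?L p s)) \<partial>LT)" .
  qed simp
  also have "\<dots> = ennreal (cmod lam) * \<kappa> * (\<integral>\<^sup>+s. \<rho> N k s \<partial>LT)"
    unfolding \<rho>_def by (subst nn_integral_sum[OF m2]) (auto simp: sum_distrib_left mult.assoc)
  finally show ?thesis .
qed

text \<open>N' tends to infinity in \<open>err_Cauchy\<close>: Fatou's lemma is applied first to the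
  sum over configurations at almost every time, then to the time integral.\<close>

lemma err_le:
  assumes k: "k \<ge> 1"
  shows "(\<integral>\<^sup>+r. nk k (err N k r) \<partial>LT) \<le> ennreal (cmod lam) * \<kappa> * (\<integral>\<^sup>+s. \<rho> N k s \<partial>LT)"
proof -
  define d where "d N' r = (\<lambda>M. lam * Bop N' r (Dint (k + 1) r) M - lam * Bop N r (Dint (k + 1) r) M)" for N' r
  have dm: "(\<lambda>r. d N' r M) \<in> borel_measurable LT" for N' M unfolding d_def by measurable
  have nm: "(\<lambda>r. nk k (d N' r)) \<in> borel_measurable LT" for N'
    unfolding nk_def by (intro nrm_measurable) (auto simp: lift_def dm)
  have "AE r in LT. nk k (err N k r) \<le> liminf (\<lambda>N'. nk k (d N' r))"
    using c_lim[OF k]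
  proof eventually_elim
    case (elim r)
    have lim: "(\<lambda>N'. d N' r M) \<longlonglongrightarrow> err N k r M" if "size M = k" for M
      unfolding d_def err_def using elim[rule_format, OF that] unfolding Dint_def by (intro tendsto_diff) auto
    let ?f = "\<lambda>F q. ennreal (wgt (roots k) q * (cmod (lift (roots k) F q))\<^sup>2)"
    have "(\<integral>\<^sup>+q. ?f (err N k r) q \<partial>count_space (cfg (roots k))) =
        (\<integral>\<^sup>+q. liminf (\<lambda>N'. ?f (d N' r) q) \<partial>count_space (cfg (roots k)))"
    proof (rule nn_integral_cong)
      fix q :: "addr \<Rightarrow> 'q"
      have "(\<lambda>N'. ?f (d N' r) q) \<longlonglongrightarrow> ?f (err N k r) q"
        unfolding lift_def by (intro tendsto_intros lim) simp
      then show "?f (err N k r) q = liminf (\<lambda>N'. ?f (d N' r) q)" by (simp add: lim_imp_Liminf)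
    qed
    also have "\<dots> \<le> liminf (\<lambda>N'. \<integral>\<^sup>+q. ?f (d N' r) q \<partial>count_space (cfg (roots k)))"
      by (rule nn_integral_liminf) simp
    finally have "nk k (err N k r) \<le> esqrt (liminf (\<lambda>N'. \<integral>\<^sup>+q. ?f (d N' r) q \<partial>count_space (cfg (roots k))))"
      unfolding nk_def nrm_def wnorm_def by (rule esqrt_mono)
    also have "\<dots> \<le> liminf (\<lambda>N'. nk k (d N' r))"
      unfolding nk_def nrm_def wnorm_def by (rule esqrt_liminf)
    finally show ?case .
  qed
  then have "(\<integral>\<^sup>+r. nk k (err N k r) \<partial>LT) \<le> (\<integral>\<^sup>+r. liminf (\<lambda>N'. nk k (d N' r)) \<partial>LT)"
    by (rule nn_integral_mono_AE)
  also have "\<dots> \<le> liminf (\<lambda>N'. \<integral>\<^sup>+r. nk k (d N' r) \<partial>LT)"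
    by (rule nn_integral_liminf[OF nm])
  also have "\<dots> \<le> limsup (\<lambda>N'. \<integral>\<^sup>+r. nk k (d N' r) \<partial>LT)" by (rule Liminf_le_Limsup) simp
  also have "\<dots> \<le> ennreal (cmod lam) * \<kappa> * (\<integral>\<^sup>+s. \<rho> N k s \<partial>LT)"
    using err_Cauchy[OF k, of N] unfolding d_def
    by (intro Limsup_bounded) (auto simp: eventually_sequentially)
  finally show ?thesis .
qed

text \<open>Dominated convergence twice: over configurations at each time of finite norm, because
  \<open>R N\<close> eventually contains any given particle, and then in time with the class bound
  as majorant.\<close>

lemma \<rho>_tendsto:
  assumes k: "k \<ge> 1"
  shows "(\<lambda>N. \<integral>\<^sup>+s. \<rho> N k s \<partial>LT) \<longlonglongrightarrow> 0"
proof -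
  let ?A = "roots k"
  have nkm: "(\<lambda>s. nk (k + 1) (c (k + 1) s)) \<in> borel_measurable LT"
    unfolding nk_def by (intro nrm_measurable) auto
  have fin: "(\<integral>\<^sup>+s. nk (k + 1) (c (k + 1) s) \<partial>LT) < \<infinity>"
    using c_bound[of "k + 1"] by (auto simp: le_less_trans)
  have le: "nrm (grow p ?A) (tail N p (lift (grow p ?A) (c (k + 1) s))) \<le> nk (k + 1) (c (k + 1) s)" if "p \<in> ?A" for N p s
    using nrm_mono[of "grow p ?A" "tail N p (lift (grow p ?A) (c (k + 1) s))" "lift (grow p ?A) (c (k + 1) s)"]
      nrm_lift[OF grow_roots[OF that]] by (auto simp: tail_def)
  have "(\<lambda>N. \<integral>\<^sup>+s. nrm (grow p ?A) (tail N p (lift (grow p ?A) (c (k + 1) s))) \<partial>LT) \<longlonglongrightarrow> (\<integral>\<^sup>+s. 0 \<partial>LT)" if p: "p \<in> ?A" for p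
  proof (rule nn_integral_dominated_convergence[where w = "\<lambda>s. nk (k + 1) (c (k + 1) s)"])
    show "(\<lambda>s. nrm (grow p ?A) (tail N p (lift (grow p ?A) (c (k + 1) s)))) \<in> borel_measurable LT" for N
      using grow_roots[OF p] by (intro nrm_measurable) (auto simp: tail_def)
    have "AE s in LT. nk (k + 1) (c (k + 1) s) \<noteq> \<infinity>"
      using nn_integral_PInf_AE[OF nkm] fin by simp
    then show "AE s in LT. (\<lambda>N. nrm (grow p ?A) (tail N p (lift (grow p ?A) (c (k + 1) s)))) \<longlonglongrightarrow> 0"
    proof eventually_elim
      case (elim s)
      define G where "G = lift (grow p ?A) (c (k + 1) s)"
      have G: "nrm (grow p ?A) G \<noteq> \<infinity>" using elim nrm_lift[OF grow_roots[OF p]] by (simp add: G_def)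
      have "(\<lambda>N. \<integral>\<^sup>+q. ennreal (wgt (grow p ?A) q * (cmod (tail N p G q))\<^sup>2) \<partial>count_space (cfg (grow p ?A)))
        \<longlonglongrightarrow> (\<integral>\<^sup>+q. 0 \<partial>count_space (cfg (grow p ?A) :: (addr \<Rightarrow> 'q) set))"
      proof (rule nn_integral_dominated_convergence[where w = "\<lambda>q. ennreal (wgt (grow p ?A) q * (cmod (G q))\<^sup>2)"])
        show "(\<integral>\<^sup>+q. ennreal (wgt (grow p ?A) q * (cmod (G q))\<^sup>2) \<partial>count_space (cfg (grow p ?A))) < \<infinity>"
          using G by (simp add: nrm_def wnorm_def top.not_eq_extremum)
        show "AE q in count_space (cfg (grow p ?A)). (\<lambda>N. ennreal (wgt (grow p ?A) q * (cmod (tail N p G q))\<^sup>2)) \<longlonglongrightarrow> 0"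
        proof (rule AE_I2)
          fix q :: "addr \<Rightarrow> 'q"
          obtain N0 where "\<And>N. N \<ge> N0 \<Longrightarrow> q (child p True) \<in> R N" using R_exhaust by blast
          then have "\<forall>\<^sub>F N in sequentially. ennreal (wgt (grow p ?A) q * (cmod (tail N p G q))\<^sup>2) = 0"
            by (auto simp: eventually_sequentially tail_def)
          then show "(\<lambda>N. ennreal (wgt (grow p ?A) q * (cmod (tail N p G q))\<^sup>2)) \<longlonglongrightarrow> 0"
            by (rule tendsto_eventually)
        qed
        show "AE q in count_space (cfg (grow p ?A)). ennreal (wgt (grow p ?A) q * (cmod (tail N p G q))\<^sup>2)
            \<le> ennreal (wgt (grow p ?A) q * (cmod (G q))\<^sup>2)" for N
          by (intro AE_I2 ennreal_leI mult_left_mono wgt_nonneg) (simp add: tail_def)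
      qed auto
      then have "(\<lambda>N. esqrt (\<integral>\<^sup>+q. ennreal (wgt (grow p ?A) q * (cmod (tail N p G q))\<^sup>2) \<partial>count_space (cfg (grow p ?A)))) \<longlonglongrightarrow> 0"
        by (intro esqrt_tendsto_0) simp
      then show ?case by (simp add: nrm_def wnorm_def G_def)
    qed
  qed (use le[OF p] fin nkm in auto)
  then have "(\<lambda>N. \<Sum>p\<in>?A. \<integral>\<^sup>+s. nrm (grow p ?A) (tail N p (lift (grow p ?A) (c (k + 1) s))) \<partial>LT) \<longlonglongrightarrow> (\<Sum>p\<in>?A. \<integral>\<^sup>+s. 0 \<partial>LT)"
    by (intro tendsto_sum)
  moreover have "(\<Sum>p\<in>?A. \<integral>\<^sup>+s. nrm (grow p ?A) (tail N p (lift (grow p ?A) (c (k + 1) s))) \<partial>LT) = (\<integral>\<^sup>+s. \<rho> N k s \<partial>LT)" for N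
    unfolding \<rho>_def using grow_roots by (intro nn_integral_sum[symmetric] nrm_measurable) (auto simp: tail_def)
  ultimately show ?thesis by simp
qed

lemma err_tendsto:
  assumes k: "k \<ge> 1"
  shows "(\<lambda>N. \<integral>\<^sup>+r. nk k (err N k r) \<partial>LT) \<longlonglongrightarrow> 0"
proof (rule tendsto_sandwich[of "\<lambda>_. 0"])
  have "ennreal (cmod lam) * \<kappa> < top" by (simp add: \<kappa>_def ennreal_mult_less_top)
  then show "(\<lambda>N. ennreal (cmod lam) * \<kappa> * (\<integral>\<^sup>+s. \<rho> N k s \<partial>LT)) \<longlonglongrightarrow> 0"
    using ennreal_tendsto_cmult[OF _ \<rho>_tendsto[OF k]] by simp
qed (use err_le[OF k] in auto)

section \<open>Summing the expansion\<close>

lemma W_iterate: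
  assumes k: "k \<ge> 1"
  shows "W N k 0 \<le> ennreal (cmod lam) ^ n * W N k n +
    (\<Sum>j<n. ennreal (cmod lam) ^ j * (of_nat (card (shapes k j)) * \<kappa> ^ j * (\<integral>\<^sup>+r. nk (k + j) (err N (k + j) r) \<partial>LT)))"
proof (induction n)
  case (Suc n)
  let ?e = "\<lambda>j. of_nat (card (shapes k j)) * \<kappa> ^ j * (\<integral>\<^sup>+r. nk (k + j) (err N (k + j) r) \<partial>LT)"
  have "W N k 0 \<le> ennreal (cmod lam) ^ n * (ennreal (cmod lam) * W N k (Suc n) + ?e n) + (\<Sum>j<n. ennreal (cmod lam) ^ j * ?e j)"
    by (rule order_trans[OF Suc]) (intro add_right_mono mult_left_mono W_step[OF k], simp)
  then show ?case by (simp add: distrib_left mult_ac add_ac)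
qed simp

lemma W_0: "W N k 0 = (\<integral>\<^sup>+r. nk k (c k r) \<partial>LT)"
proof -
  have "W N k 0 = (\<integral>\<^sup>+t. \<integral>\<^sup>+r. \<Phi> N k {} t (c k r) \<partial>LT \<partial>PiM {} (\<lambda>_. LT))"
    by (simp add: W_def shapes_0)
  also have "\<dots> = (\<integral>\<^sup>+r. \<Phi> N k {} (\<lambda>_. undefined) (c k r) \<partial>LT)"
    by (rule PLT.nn_integral_empty) simp
  also have "\<dots> = (\<integral>\<^sup>+r. nk k (c k r) \<partial>LT)"
  proof (rule nn_integral_cong)
    fix r
    have "\<Phi> N k {} (\<lambda>_. undefined) (c k r) \<le> nk k (c k r)" "nk k (c k r) \<le> \<Phi> N k {} (\<lambda>_. undefined) (c k r)"
      unfolding \<Phi>_def nk_def leaves_empty by (intro nrm_mono; simp add: E_empty)+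
    then show "\<Phi> N k {} (\<lambda>_. undefined) (c k r) = nk k (c k r)" by simp
  qed
  finally show ?thesis .
qed

lemma W_le:
  assumes k: "k \<ge> 1"
  shows "W N k n \<le> of_nat (card (shapes k n)) * \<kappa> ^ n * ennreal (Kc ^ (k + n + 1))"
proof -
  have "W N k n \<le> (\<Sum>S\<in>shapes k n. \<kappa> ^ n * ennreal (Kc ^ (k + n + 1)))"
    unfolding W_def
  proof (rule sum_mono)
    fix S assume S: "S \<in> shapes k n"
    have "(\<integral>\<^sup>+t. \<integral>\<^sup>+r. indicator {r. \<forall>p\<in>S. r < t p} r * \<Phi> N k S t (c (k + n) r) \<partial>LT \<partial>PiM S (\<lambda>_. LT))
      \<le> (\<integral>\<^sup>+t. \<integral>\<^sup>+r. \<Phi> N k S t (c (k + n) r) \<partial>LT \<partial>PiM S (\<lambda>_. LT))"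
      by (intro nn_integral_mono) (simp add: indicator_def)
    also have "\<dots> \<le> \<kappa> ^ n * (\<integral>\<^sup>+r. nk (k + n) (c (k + n) r) \<partial>LT)"
      by (rule \<Phi>_bound[OF S]) simp
    also have "\<dots> \<le> \<kappa> ^ n * ennreal (Kc ^ (k + n + 1))"
      using c_bound[of "k + n"] k by (intro mult_left_mono) auto
    finally show "(\<integral>\<^sup>+t. \<integral>\<^sup>+r. indicator {r. \<forall>p\<in>S. r < t p} r * \<Phi> N k S t (c (k + n) r) \<partial>LT \<partial>PiM S (\<lambda>_. LT))
      \<le> \<kappa> ^ n * ennreal (Kc ^ (k + n + 1))" .
  qed
  then show ?thesis by (simp add: mult.assoc)
qed

text \<open>At fixed depth n the errors form a finite sum and vanish as N grows. What remains decays
  geometrically in n.\<close>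

theorem norm_zero:
  assumes k: "k \<ge> 1"
  shows "(\<integral>\<^sup>+r. nk k (c k r) \<partial>LT) = 0"
proof -
  define s where "s = sqrt (K * T)"
  have s: "s \<ge> 0" using K T by (simp add: s_def)
  \<comment> \<open>One collision contributes \<open>lam\<close>, the factor 4 from the number of
    forests, s = sqrt (K T), and one more power of \<open>Kc\<close>.\<close>
  define x where "x = 4 * cmod lam * s * Kc"
  have x: "0 \<le> x" "x < 1" using small s Kc by (auto simp: x_def s_def)
  have bound: "(\<integral>\<^sup>+r. nk k (c k r) \<partial>LT) \<le> ennreal (2 ^ k * Kc ^ (k + 1) * x ^ n)" for n
  proof -
    let ?B = "ennreal (cmod lam) ^ n * (of_nat (card (shapes k n)) * \<kappa> ^ n * ennreal (Kc ^ (k + n + 1)))"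
    let ?e = "\<lambda>N. \<Sum>j<n. ennreal (cmod lam) ^ j * (of_nat (card (shapes k j)) * \<kappa> ^ j * (\<integral>\<^sup>+r. nk (k + j) (err N (k + j) r) \<partial>LT))"
    have le: "(\<integral>\<^sup>+r. nk k (c k r) \<partial>LT) \<le> ?B + ?e N" for N
      unfolding W_0[of N k, symmetric]
      by (rule order_trans[OF W_iterate[OF k, of N n]]) (intro add_right_mono mult_left_mono W_le[OF k], simp)
    have "?e \<longlonglongrightarrow> (\<Sum>j<n. 0)"
    proof (intro tendsto_sum)
      fix j
      have f: "ennreal (cmod lam) ^ j * (of_nat (card (shapes k j)) * \<kappa> ^ j) < top"
        by (simp add: \<kappa>_def ennreal_mult_less_top power_less_top_ennreal of_nat_less_top)
      have "(\<lambda>N. ennreal (cmod lam) ^ j * (of_nat (card (shapes k j)) * \<kappa> ^ j) * (\<integral>\<^sup>+r. nk (k + j) (err N (k + j) r) \<partial>LT)) \<longlonglongrightarrow>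
        ennreal (cmod lam) ^ j * (of_nat (card (shapes k j)) * \<kappa> ^ j) * 0"
        using k by (intro ennreal_tendsto_cmult f err_tendsto) simp
      then show "(\<lambda>N. ennreal (cmod lam) ^ j * (of_nat (card (shapes k j)) * \<kappa> ^ j * (\<integral>\<^sup>+r. nk (k + j) (err N (k + j) r) \<partial>LT))) \<longlonglongrightarrow> 0"
        by (simp add: mult.assoc)
    qed
    then have "(\<lambda>N. ?B + ?e N) \<longlonglongrightarrow> ?B + 0" by (intro tendsto_add tendsto_const) simp
    then have "(\<integral>\<^sup>+r. nk k (c k r) \<partial>LT) \<le> ?B + 0"
      by (rule tendsto_lowerbound) (use le in auto)
    also have "\<dots> = ennreal (cmod lam ^ n * (real (card (shapes k n)) * s ^ n * Kc ^ (k + n + 1)))"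
      using s Kc by (simp add: \<kappa>_def s_def ennreal_power ennreal_of_nat_eq_real_of_nat flip: ennreal_mult')
    also have "\<dots> \<le> ennreal (cmod lam ^ n * (2 ^ k * 4 ^ n * s ^ n * Kc ^ (k + n + 1)))"
      using s Kc card_shapes(2)[of k n] by (intro ennreal_leI mult_left_mono mult_right_mono) auto
    also have "cmod lam ^ n * (2 ^ k * 4 ^ n * s ^ n * Kc ^ (k + n + 1)) = 2 ^ k * Kc ^ (k + 1) * x ^ n"
      by (simp add: x_def power_mult_distrib power_add algebra_simps)
    finally show ?thesis .
  qed
  have "(\<lambda>n. ennreal (2 ^ k * Kc ^ (k + 1) * x ^ n)) \<longlonglongrightarrow> ennreal (2 ^ k * Kc ^ (k + 1) * 0)"
    using x by (intro tendsto_ennrealI tendsto_mult tendsto_const LIMSEQ_power_zero) simp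
  then have "(\<integral>\<^sup>+r. nk k (c k r) \<partial>LT) \<le> ennreal (2 ^ k * Kc ^ (k + 1) * 0)"
    by (rule tendsto_lowerbound) (use bound in auto)
  then show ?thesis by simp
qed

theorem hierarchy_zero:
  assumes "size M = k" "k \<ge> 1"
  shows "AE r in LT. c k r M = 0"
proof -
  have "(\<lambda>r. nk k (c k r)) \<in> borel_measurable LT" unfolding nk_def by (intro nrm_measurable) auto
  then have "AE r in LT. nk k (c k r) = 0"
    using norm_zero[OF assms(2)] nn_integral_0_iff_AE by blast
  then show ?thesis
  proof eventually_elim
    case (elim r)
    obtain q where q: "q \<in> cfg (roots k)" "image_mset q (mset_set (roots k)) = M"
      using ex_cfg_image_mset[of "roots k" M] assms by auto
    have "ennreal (sqrt (wgt (roots k) q) * cmod (c k r M)) \<le> 0"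
      using nrm_ge[OF q(1), of "lift (roots k) (c k r)"] elim by (simp add: lift_def q(2) nk_def)
    moreover have "sqrt (wgt (roots k) q) > 0" using wgt_pos[of "roots k" q] by simp
    ultimately show ?case by (simp add: ennreal_eq_0_iff mult_le_0_iff)
  qed
qed

end

subsection \<open>Characters of the torus\<close>

lemma integral_pair_mult:
  fixes f :: "'a \<Rightarrow> complex" and g :: "'b \<Rightarrow> complex"
  assumes M: "sigma_finite_measure M1" "sigma_finite_measure M2"
    and f[measurable]: "integrable M1 f" and g[measurable]: "integrable M2 g"
  shows "integrable (M1 \<Otimes>\<^sub>M M2) (\<lambda>z. f (fst z) * g (snd z))"
    "(\<integral>z. f (fst z) * g (snd z) \<partial>(M1 \<Otimes>\<^sub>M M2)) = (\<integral>x. f x \<partial>M1) * (\<integral>y. g y \<partial>M2)"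
proof -
  interpret pair_sigma_finite M1 M2 using M by (simp add: pair_sigma_finite_def)
  have [measurable]: "f \<in> borel_measurable M1" "g \<in> borel_measurable M2" using f g by auto
  show int: "integrable (M1 \<Otimes>\<^sub>M M2) (\<lambda>z. f (fst z) * g (snd z))"
  proof (rule Fubini_integrable)
    show "integrable M1 (\<lambda>x. \<integral>y. norm (f (fst (x, y)) * g (snd (x, y))) \<partial>M2)"
      using f by (simp add: norm_mult)
    show "AE x in M1. integrable M2 (\<lambda>y. f (fst (x, y)) * g (snd (x, y)))"
      using g by simp
  qed simp
  show "(\<integral>z. f (fst z) * g (snd z) \<partial>(M1 \<Otimes>\<^sub>M M2)) = (\<integral>x. f x \<partial>M1) * (\<integral>y. g y \<partial>M2)"
    using integral_fst'[OF int] by simp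
qed

lemma nn_integral_count_space_le:
  fixes f :: "'a \<Rightarrow> ennreal"
  assumes "countable X" and B: "\<And>Q. finite Q \<Longrightarrow> Q \<subseteq> X \<Longrightarrow> sum f Q \<le> B"
  shows "(\<integral>\<^sup>+x. f x \<partial>count_space X) \<le> B"
proof (cases "finite X")
  case True
  then show ?thesis using B[of X] by (simp add: nn_integral_count_space_finite)
next
  case False
  have bij: "bij_betw (from_nat_into X) UNIV X" by (rule bij_betw_from_nat_into[OF assms(1) False])
  then have "(\<integral>\<^sup>+x. f x \<partial>count_space X) = (\<Sum>n. f (from_nat_into X n))"
    by (simp add: nn_integral_bij_count_space[symmetric] nn_integral_count_space_nat)
  also have "\<dots> \<le> B"
    unfolding suminf_eq_SUP
  proof (rule SUP_least)
    fix n
    have "(\<Sum>i<n. f (from_nat_into X i)) = sum f (from_nat_into X ` {..<n})"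
      using bij by (subst sum.reindex) (auto simp: bij_betw_def intro: inj_on_subset)
    then show "(\<Sum>i<n. f (from_nat_into X i)) \<le> B"
      using B[of "from_nat_into X ` {..<n}"] bij by (auto simp: bij_betw_def)
  qed
  finally show ?thesis .
qed

lemma measurable_cnj [measurable (raw)]: "f \<in> borel_measurable M \<Longrightarrow> (\<lambda>x. cnj (f x)) \<in> borel_measurable M"
  by (rule borel_measurable_continuous_on[where f = cnj]) (auto intro: continuous_intros)

lemma integral_circle:
  assumes "\<theta> > 0"
  shows "integrable lborel (\<lambda>t. indicator {0..<2 * pi / \<theta>} t *\<^sub>R cis (\<theta> * of_int m * t))"
    "(LINT t|lborel. indicator {0..<2 * pi / \<theta>} t *\<^sub>R cis (\<theta> * of_int m * t)) = (if m = 0 then of_real (2 * pi / \<theta>) else 0)"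
proof -
  define L where "L = 2 * pi / \<theta>"
  have L: "L > 0" using assms by (simp add: L_def)
  have cont: "continuous_on {0..L} (\<lambda>t. cis (\<theta> * of_int m * t))"
    unfolding cis_conv_exp by (intro continuous_intros)
  have "integrable lborel (\<lambda>t. indicator {0..L} t *\<^sub>R cis (\<theta> * of_int m * t))"
    by (rule borel_integrable_compact[OF compact_Icc cont])
  then have I: "set_integrable lborel {0..L} (\<lambda>t. cis (\<theta> * of_int m * t))" by (simp add: set_integrable_def)
  then have I': "set_integrable lborel {0..<L} (\<lambda>t. cis (\<theta> * of_int m * t))"
    by (rule set_integrable_subset) auto
  then show "integrable lborel (\<lambda>t. indicator {0..<2 * pi / \<theta>} t *\<^sub>R cis (\<theta> * of_int m * t))"
    by (simp add: set_integrable_def L_def)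
  have "(LINT t|lborel. indicator {0..<L} t *\<^sub>R cis (\<theta> * of_int m * t)) =
      (LINT t|lborel. indicator {0..L} t *\<^sub>R cis (\<theta> * of_int m * t))"
  proof (rule integral_cong_AE)
    have "AE t in lborel. t \<noteq> L" by (rule AE_lborel_singleton)
    then show "AE t in lborel. indicator {0..<L} t *\<^sub>R cis (\<theta> * of_int m * t) = indicator {0..L} t *\<^sub>R cis (\<theta> * of_int m * t)"
      by eventually_elim (auto simp: indicator_def)
  qed (use I I' in \<open>auto simp: set_integrable_def\<close>)
  also have "\<dots> = integral {0..L} (\<lambda>t. cis (\<theta> * of_int m * t))"
    using set_borel_integral_eq_integral(2)[OF I] by (simp add: set_lebesgue_integral_def)
  also have "\<dots> = (if m = 0 then of_real L else 0)"
  proof (cases "m = 0")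
    case True
    then show ?thesis using L by (simp add: scaleR_conv_of_real)
  next
    case False
    define a where "a = \<theta> * of_int m"
    have a: "a \<noteq> 0" using False assms by (simp add: a_def)
    have "((\<lambda>t. cis (a * t)) has_integral (cis (a * L) / (\<i> * of_real a) - cis (a * 0) / (\<i> * of_real a))) {0..L}"
    proof (rule fundamental_theorem_of_calculus)
      fix t
      have "((\<lambda>t. exp (\<i> * of_real (a * t)) / (\<i> * of_real a)) has_vector_derivative exp (\<i> * of_real (a * t))) (at t within {0..L})"
      proof -
        have "((\<lambda>z. exp (\<i> * of_real a * z) / (\<i> * of_real a)) has_field_derivative exp (\<i> * of_real a * of_real t)) (at (of_real t))"
          using a by (auto intro!: derivative_eq_intros)
        then have "((\<lambda>t. exp (\<i> * of_real a * of_real t) / (\<i> * of_real a)) has_vector_derivative exp (\<i> * of_real a * of_real t)) (at t within {0..L})"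
          by (rule has_vector_derivative_real_field)
        then show ?thesis by (simp add: mult.assoc)
      qed
      then show "((\<lambda>t. cis (a * t) / (\<i> * of_real a)) has_vector_derivative cis (a * t)) (at t within {0..L})"
        by (simp add: cis_conv_exp)
    qed (use L in simp)
    moreover have "cis (a * L) = 1"
    proof -
      have "a * L = 2 * pi * of_int m" using assms by (simp add: a_def L_def)
      then show ?thesis by (simp add: cis_multiple_2pi)
    qed
    ultimately show ?thesis using False by (simp add: a_def integral_unique)
  qed
  finally show "(LINT t|lborel. indicator {0..<2 * pi / \<theta>} t *\<^sub>R cis (\<theta> * of_int m * t)) = (if m = 0 then of_real (2 * pi / \<theta>) else 0)"
    by (simp add: L_def)
qed

section \<open>Lattice points, characters and Bessel's inequality\<close>

definition lat :: "real \<Rightarrow> real \<Rightarrow> int \<times> int \<Rightarrow> point" where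
  "lat \<theta>1 \<theta>2 n = (\<theta>1 * of_int (fst n), \<theta>2 * of_int (snd n))"

lemma dual_lattice_eq: "dual_lattice \<theta>1 \<theta>2 = range (lat \<theta>1 \<theta>2)"
  by (auto simp: dual_lattice_def lat_def image_iff)

lemma lat_add: "lat \<theta>1 \<theta>2 (m + n) = lat \<theta>1 \<theta>2 m + lat \<theta>1 \<theta>2 n"
  and lat_diff: "lat \<theta>1 \<theta>2 (m - n) = lat \<theta>1 \<theta>2 m - lat \<theta>1 \<theta>2 n"
  and lat_minus: "lat \<theta>1 \<theta>2 (- n) = - lat \<theta>1 \<theta>2 n"
  and lat_0 [simp]: "lat \<theta>1 \<theta>2 0 = 0"
  by (auto simp: lat_def algebra_simps zero_prod_def)

locale torus_params =
  fixes \<theta>1 \<theta>2 :: real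
  assumes \<theta>1: "\<theta>1 > 0" and \<theta>2: "\<theta>2 > 0"
begin

abbreviation "TT \<equiv> torus \<theta>1 \<theta>2"
abbreviation "TP \<equiv> torus_power \<theta>1 \<theta>2"
abbreviation "PS \<equiv> phase_space \<theta>1 \<theta>2"
abbreviation "freq \<equiv> frequencies \<theta>1 \<theta>2"
abbreviation "la \<equiv> lat \<theta>1 \<theta>2"

definition V :: real where "V = (2 * pi / \<theta>1) * (2 * pi / \<theta>2)"

lemma V_pos: "V > 0" using \<theta>1 \<theta>2 by (simp add: V_def)

lemma la_inject [simp]: "la m = la n \<longleftrightarrow> m = n"
  using \<theta>1 \<theta>2 by (auto simp: lat_def prod_eq_iff)

lemma box_measurable: "{0..<2 * pi / \<theta>1} \<times> {0..<2 * pi / \<theta>2} \<in> sets (borel :: point measure)"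
  by (intro borel_Times) auto

lemma space_TT: "space TT = {0..<2 * pi / \<theta>1} \<times> {0..<2 * pi / \<theta>2}"
  by (simp add: torus_def space_restrict_space)

lemma borel_TT: "f \<in> borel_measurable borel \<Longrightarrow> f \<in> borel_measurable TT"
  unfolding torus_def by (intro measurable_restrict_space1) simp

lemma id_TT [measurable]: "(\<lambda>x. x) \<in> TT \<rightarrow>\<^sub>M borel"
  by (rule borel_TT) simp

lemma emeasure_TT: "emeasure TT (space TT) = ennreal V"
proof -
  have "emeasure TT (space TT) = emeasure (lborel \<Otimes>\<^sub>M lborel) ({0..<2 * pi / \<theta>1} \<times> {0..<2 * pi / \<theta>2})"
    using box_measurable unfolding space_TT
    by (simp add: torus_def emeasure_restrict_space lborel_prod)
  also have "\<dots> = ennreal (2 * pi / \<theta>1) * ennreal (2 * pi / \<theta>2)"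
    using \<theta>1 \<theta>2 by (subst lborel.emeasure_pair_measure_Times) auto
  finally show ?thesis unfolding V_def using \<theta>1 \<theta>2 by (subst ennreal_mult) auto
qed

lemma finite_measure_TT: "finite_measure TT"
  by (rule finite_measureI) (simp add: emeasure_TT)

sublocale TT: finite_measure TT by (rule finite_measure_TT)

sublocale P: product_sigma_finite "\<lambda>_::nat. TT"
  by (simp add: product_sigma_finite_def TT.sigma_finite_measure_axioms)

lemma finite_measure_TP: "finite_measure (TP k)"
proof (rule finite_measureI)
  have "emeasure (TP k) (space (TP k)) = (\<Prod>i\<in>{1..k}. emeasure TT (space TT))"
    unfolding torus_power_def space_PiM by (rule P.emeasure_PiM) auto
  then show "emeasure (TP k) (space (TP k)) \<noteq> \<infinity>"
    using V_pos by (simp add: emeasure_TT ennreal_power)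
qed

sublocale TP: finite_measure "TP k" for k by (rule finite_measure_TP)

lemma finite_measure_PS: "finite_measure (PS k)"
  unfolding phase_space_def by (intro finite_measure_pair_measure finite_measure_TP)

sublocale PS: finite_measure "PS k" for k by (rule finite_measure_PS)

lemma component_TP: "j \<in> {1..k} \<Longrightarrow> (\<lambda>x. x j) \<in> TP k \<rightarrow>\<^sub>M borel"
  unfolding torus_power_def by (rule measurable_compose[OF measurable_component_singleton[where M = "\<lambda>_. TT"] id_TT])

lemma integral_TT_char:
  "(\<integral>x. cis (x \<bullet> la n) \<partial>TT) = (if n = 0 then of_real V else 0)"
proof -
  obtain a b where n: "n = (a, b)" by (cases n)
  let ?f = "\<lambda>\<theta> m t. indicator {0..<2 * pi / \<theta>} t *\<^sub>R cis (\<theta> * of_int m * t)"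
  have sf: "sigma_finite_measure (lborel :: real measure)" by (rule lborel.sigma_finite_measure_axioms)
  have "(\<integral>x. cis (x \<bullet> la n) \<partial>TT) = (\<integral>x. indicator ({0..<2 * pi / \<theta>1} \<times> {0..<2 * pi / \<theta>2}) x *\<^sub>R cis (x \<bullet> la n) \<partial>lborel)"
    unfolding torus_def by (subst integral_restrict_space) (use box_measurable in auto)
  also have "\<dots> = (\<integral>z. ?f \<theta>1 a (fst z) * ?f \<theta>2 b (snd z) \<partial>(lborel \<Otimes>\<^sub>M lborel))"
    unfolding lborel_prod
    by (intro Bochner_Integration.integral_cong refl) (auto simp: indicator_def n lat_def inner_prod_def cis_mult algebra_simps split: prod.splits)
  also have "\<dots> = (\<integral>t. ?f \<theta>1 a t \<partial>lborel) * (\<integral>t. ?f \<theta>2 b t \<partial>lborel)"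
    by (rule integral_pair_mult(2)[OF sf sf integral_circle(1)[OF \<theta>1] integral_circle(1)[OF \<theta>2]])
  also have "\<dots> = (if n = 0 then of_real V else 0)"
    unfolding integral_circle(2)[OF \<theta>1] integral_circle(2)[OF \<theta>2] by (auto simp: n V_def zero_prod_def)
  finally show ?thesis .
qed

definition xi :: "nat \<Rightarrow> (nat \<Rightarrow> (int \<times> int) \<times> (int \<times> int)) \<Rightarrow> config" where
  "xi k q = (\<lambda>j\<in>{1..k}. la (fst (q j)))"

definition xi' :: "nat \<Rightarrow> (nat \<Rightarrow> (int \<times> int) \<times> (int \<times> int)) \<Rightarrow> config" where
  "xi' k q = (\<lambda>j\<in>{1..k}. la (snd (q j)))"

lemma xi_freq: "xi k q \<in> freq k" "xi' k q \<in> freq k"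
  by (auto simp: xi_def xi'_def frequencies_def dual_lattice_eq)

definition chr :: "nat \<Rightarrow> config \<Rightarrow> config \<Rightarrow> config \<times> config \<Rightarrow> complex" where
  "chr k \<xi> \<xi>' z = cis (- (\<Sum>j=1..k. fst z j \<bullet> \<xi> j) + (\<Sum>j=1..k. snd z j \<bullet> \<xi>' j))"

lemma norm_chr [simp]: "cmod (chr k \<xi> \<xi>' z) = 1" by (simp add: chr_def)

lemma chr_measurable [measurable]: "chr k \<xi> \<xi>' \<in> borel_measurable (PS k)"
proof -
  have [measurable]: "(\<lambda>z. fst z j) \<in> borel_measurable (PS k)" "(\<lambda>z. snd z j) \<in> borel_measurable (PS k)" if "j \<in> {1..k}" for j
    unfolding phase_space_def
    using measurable_compose[OF measurable_fst component_TP[OF that]] measurable_compose[OF measurable_snd component_TP[OF that]] by auto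
  show ?thesis unfolding chr_def by measurable
qed

lemma fourier_chr: "fourier \<theta>1 \<theta>2 k \<gamma> \<xi> \<xi>' = (\<integral>z. \<gamma> (fst z) (snd z) * chr k \<xi> \<xi>' z \<partial>PS k)"
  by (simp add: fourier_def chr_def case_prod_beta')

lemma integrable_chr_mult:
  assumes "integrable (PS k) f"
  shows "integrable (PS k) (\<lambda>z. f z * chr k \<xi> \<xi>' z)"
proof (rule Bochner_Integration.integrable_bound[OF assms])
  show "(\<lambda>z. f z * chr k \<xi> \<xi>' z) \<in> borel_measurable (PS k)"
    using borel_measurable_integrable[OF assms] by measurable
qed (simp add: norm_mult)

lemma integral_TP_char:
  "(\<integral>x. cis (\<Sum>j=1..k. x j \<bullet> la (n j)) \<partial>TP k) = (if \<forall>j\<in>{1..k}. n j = 0 then of_real (V ^ k) else 0)"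
proof -
  have prod: "cis (\<Sum>j\<in>A. f j) = (\<Prod>j\<in>A. cis (f j))" for f :: "nat \<Rightarrow> real" and A
    by (induction A rule: infinite_finite_induct) (auto simp: cis_mult[symmetric])
  have int: "integrable TT (\<lambda>x. cis (x \<bullet> la (n j)))" for j
    by (rule TT.integrable_const_bound[of _ 1]) auto
  have "(\<integral>x. cis (\<Sum>j=1..k. x j \<bullet> la (n j)) \<partial>TP k) = (\<Prod>j=1..k. \<integral>x. cis (x \<bullet> la (n j)) \<partial>TT)"
    unfolding prod torus_power_def by (rule P.product_integral_prod) (use int in auto)
  also have "\<dots> = (if \<forall>j\<in>{1..k}. n j = 0 then of_real (V ^ k) else 0)"
    unfolding integral_TT_char by (cases "\<forall>j\<in>{1..k}. n j = 0") (auto simp: prod_zero_iff)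
  finally show ?thesis .
qed

lemma chr_orthogonal:
  assumes "q \<in> cfg {1..k}" "r \<in> cfg {1..k}"
  shows "(\<integral>z. chr k (xi k q) (xi' k q) z * cnj (chr k (xi k r) (xi' k r) z) \<partial>PS k) = (if q = r then of_real (V ^ (2 * k)) else 0)"
proof -
  define m where "m j = fst (r j) - fst (q j)" for j
  define n where "n j = snd (q j) - snd (r j)" for j
  let ?c = "\<lambda>n x. cis (\<Sum>j=1..k. x j \<bullet> la (n j))"
  have eq: "chr k (xi k q) (xi' k q) z * cnj (chr k (xi k r) (xi' k r) z) = ?c m (fst z) * ?c n (snd z)" for z
    unfolding chr_def m_def n_def cis_cnj cis_mult lat_diff inner_diff_right sum_subtractf
    by (simp add: xi_def xi'_def algebra_simps)
  have comp[measurable]: "(\<lambda>x. x j) \<in> borel_measurable (TP k)" if "j \<in> {1..k}" for j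
    using component_TP[OF that] .
  have int: "integrable (TP k) (?c n)" for n
    by (rule TP.integrable_const_bound[of _ 1]) auto
  have "(\<integral>z. chr k (xi k q) (xi' k q) z * cnj (chr k (xi k r) (xi' k r) z) \<partial>PS k) = (\<integral>x. ?c m x \<partial>TP k) * (\<integral>x. ?c n x \<partial>TP k)"
    unfolding eq phase_space_def
    by (rule integral_pair_mult(2)[OF TP.sigma_finite_measure_axioms TP.sigma_finite_measure_axioms int int])
  also have "\<dots> = (if (\<forall>j\<in>{1..k}. m j = 0) \<and> (\<forall>j\<in>{1..k}. n j = 0) then of_real (V ^ k * V ^ k) else 0)"
    unfolding integral_TP_char by auto
  also have "(\<forall>j\<in>{1..k}. m j = 0) \<and> (\<forall>j\<in>{1..k}. n j = 0) \<longleftrightarrow> (\<forall>j\<in>{1..k}. q j = r j)"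
    by (auto simp: m_def n_def prod_eq_iff)
  also have "(\<forall>j\<in>{1..k}. q j = r j) \<longleftrightarrow> q = r" using assms by (metis PiE_ext)
  finally show ?thesis by (simp add: mult_2 power_add)
qed

text \<open>The characters are not normalized: their squared norm is the volume V^(2 k) of phase
  space. With g the projection of F onto their span, the inequality is the nonnegativity of the
  squared norm of F - g.\<close>

lemma bessel:
  assumes F: "F \<in> borel_measurable (PS k)" "integrable (PS k) (\<lambda>z. (cmod (F z))\<^sup>2)"
    and Q: "finite Q" "Q \<subseteq> cfg {1..k}"
  shows "(\<Sum>q\<in>Q. (cmod (\<integral>z. F z * chr k (xi k q) (xi' k q) z \<partial>PS k))\<^sup>2) \<le> V ^ (2 * k) * (\<integral>z. (cmod (F z))\<^sup>2 \<partial>PS k)"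
proof -
  define e where "e q = chr k (xi k q) (xi' k q)" for q
  define a where "a q = (\<integral>z. F z * e q z \<partial>PS k)" for q
  have aa: "a q * cnj (a q) = (complex_of_real (cmod (a q)))\<^sup>2" for q
    by (metis complex_norm_square of_real_power)
  define U where "U = V ^ (2 * k)"
  have U: "U > 0" using V_pos by (simp add: U_def)
  have em[measurable]: "e q \<in> borel_measurable (PS k)" for q unfolding e_def by simp
  have Fm[measurable]: "F \<in> borel_measurable (PS k)" by fact
  have intF: "integrable (PS k) F"
  proof (rule Bochner_Integration.integrable_bound)
    show "integrable (PS k) (\<lambda>z. 1 + (cmod (F z))\<^sup>2)" using F(2) by auto
    have "cmod (F z) \<le> 1 + (cmod (F z))\<^sup>2" for z
    proof -
      have "0 \<le> (cmod (F z) - 1 / 2)\<^sup>2" by simp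
      then show ?thesis unfolding power2_diff by (simp add: power2_eq_square)
    qed
    then show "AE z in PS k. norm (F z) \<le> norm (1 + (cmod (F z))\<^sup>2)" by (auto intro: order_trans)
  qed simp
  have intFe: "integrable (PS k) (\<lambda>z. F z * e q z)" for q
    unfolding e_def by (rule integrable_chr_mult[OF intF])
  have intee: "integrable (PS k) (\<lambda>z. cnj (e q z) * e r z)" for q r
    by (rule PS.integrable_const_bound[of _ 1]) (auto simp: norm_mult e_def)
  have ortho: "(\<integral>z. cnj (e q z) * e r z \<partial>PS k) = (if q = r then of_real U else 0)" if "q \<in> Q" "r \<in> Q" for q r
  proof -
    have "r \<in> cfg {1..k}" "q \<in> cfg {1..k}" using that Q by blast+
    from chr_orthogonal[OF this] show ?thesis by (auto simp: e_def U_def mult.commute)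
  qed
  define g where "g z = (\<Sum>q\<in>Q. a q * cnj (e q z)) / of_real U" for z
  have gm[measurable]: "g \<in> borel_measurable (PS k)" unfolding g_def by measurable
  let ?A = "\<Sum>q\<in>Q. (cmod (a q))\<^sup>2"
  have cross: "integrable (PS k) (\<lambda>z. F z * cnj (g z))" "(\<integral>z. F z * cnj (g z) \<partial>PS k) = of_real (?A / U)"
  proof -
    have eq: "F z * cnj (g z) = (\<Sum>q\<in>Q. cnj (a q) / of_real U * (F z * e q z))" for z
      by (simp add: g_def sum_distrib_left sum_divide_distrib algebra_simps)
    show "integrable (PS k) (\<lambda>z. F z * cnj (g z))" unfolding eq using intFe by auto
    have "(\<integral>z. F z * cnj (g z) \<partial>PS k) = (\<Sum>q\<in>Q. cnj (a q) / of_real U * a q)"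
      unfolding eq using intFe by (subst Bochner_Integration.integral_sum) (auto simp: a_def)
    also have "\<dots> = of_real (?A / U)"
      by (simp add: sum_divide_distrib aa mult.commute[of "cnj _"])
    finally show "(\<integral>z. F z * cnj (g z) \<partial>PS k) = of_real (?A / U)" .
  qed
  have gg: "integrable (PS k) (\<lambda>z. g z * cnj (g z))" "(\<integral>z. g z * cnj (g z) \<partial>PS k) = of_real (?A / U)"
  proof -
    have eq: "g z * cnj (g z) = (\<Sum>q\<in>Q. \<Sum>r\<in>Q. a q * cnj (a r) / (of_real U)\<^sup>2 * (cnj (e q z) * e r z))" for z
      by (simp add: g_def sum_product sum_divide_distrib power2_eq_square algebra_simps)
    show "integrable (PS k) (\<lambda>z. g z * cnj (g z))" unfolding eq using intee by auto
    have "(\<integral>z. g z * cnj (g z) \<partial>PS k) = (\<Sum>q\<in>Q. \<Sum>r\<in>Q. a q * cnj (a r) / (of_real U)\<^sup>2 * (\<integral>z. cnj (e q z) * e r z \<partial>PS k))"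
      unfolding eq using intee by (subst Bochner_Integration.integral_sum; simp)+
    also have "\<dots> = (\<Sum>q\<in>Q. \<Sum>r\<in>Q. if r = q then a q * cnj (a q) / of_real U else 0)"
      using U by (intro sum.cong refl) (auto simp: ortho power2_eq_square)
    also have "\<dots> = of_real (?A / U)"
      using Q(1) by (simp add: sum_divide_distrib aa)
    finally show "(\<integral>z. g z * cnj (g z) \<partial>PS k) = of_real (?A / U)" .
  qed
  have sq: "(cmod (F z - g z))\<^sup>2 = (cmod (F z))\<^sup>2 - 2 * Re (F z * cnj (g z)) + Re (g z * cnj (g z))" for z
    unfolding cmod_power2 by (simp add: power2_eq_square algebra_simps)
  have "0 \<le> (\<integral>z. (cmod (F z - g z))\<^sup>2 \<partial>PS k)" by simp
  also have "\<dots> = (\<integral>z. (cmod (F z))\<^sup>2 \<partial>PS k) - 2 * Re (\<integral>z. F z * cnj (g z) \<partial>PS k) + Re (\<integral>z. g z * cnj (g z) \<partial>PS k)"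
    unfolding sq using F(2) integrable_Re[OF cross(1)] integrable_Re[OF gg(1)] integral_Re[OF cross(1)] integral_Re[OF gg(1)]
    by (simp del: times_complex.sel)
  also have "\<dots> = (\<integral>z. (cmod (F z))\<^sup>2 \<partial>PS k) - ?A / U"
    unfolding cross(2) gg(2) by simp
  finally have "?A / U \<le> (\<integral>z. (cmod (F z))\<^sup>2 \<partial>PS k)" by simp
  then show ?thesis using U by (simp add: field_simps a_def e_def U_def)
qed

text \<open>Bessel's inequality holds for every candidate F in the infimum. The factor V^k is first
  moved to the left, where the infimum can be taken, and back again.\<close>

lemma L2_norm_ge:
  "esqrt (\<integral>\<^sup>+q. ennreal ((cmod (c (xi k q) (xi' k q)))\<^sup>2) \<partial>count_space (cfg {1..k})) \<le> ennreal (V ^ k) * L2_norm \<theta>1 \<theta>2 k c"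
proof -
  let ?l = "\<integral>\<^sup>+q. ennreal ((cmod (c (xi k q) (xi' k q)))\<^sup>2) \<partial>count_space (cfg {1..k})"
  have Vk: "V ^ k > 0" using V_pos by simp
  have one: "esqrt ?l \<le> ennreal (V ^ k) * ennreal (sqrt (\<integral>(x, x'). (cmod (F x x'))\<^sup>2 \<partial>PS k))"
    if F: "(\<lambda>(x, x'). F x x') \<in> borel_measurable (PS k)" "integrable (PS k) (\<lambda>(x, x'). (cmod (F x x'))\<^sup>2)"
      "\<And>\<xi> \<xi>'. \<xi> \<in> freq k \<Longrightarrow> \<xi>' \<in> freq k \<Longrightarrow> fourier \<theta>1 \<theta>2 k F \<xi> \<xi>' = c \<xi> \<xi>'" for F
  proof -
    define I where "I = (\<integral>z. (cmod (F (fst z) (snd z)))\<^sup>2 \<partial>PS k)"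
    have I: "I \<ge> 0" by (simp add: I_def)
    have "?l \<le> ennreal (V ^ (2 * k) * I)"
    proof (rule nn_integral_count_space_le)
      fix Q :: "(nat \<Rightarrow> (int \<times> int) \<times> (int \<times> int)) set"
      assume Q: "finite Q" "Q \<subseteq> cfg {1..k}"
      have "c (xi k q) (xi' k q) = (\<integral>z. F (fst z) (snd z) * chr k (xi k q) (xi' k q) z \<partial>PS k)" for q
        using F(3)[OF xi_freq, of q q] by (simp add: fourier_chr)
      then have "(\<Sum>q\<in>Q. (cmod (c (xi k q) (xi' k q)))\<^sup>2) \<le> V ^ (2 * k) * I"
        using bessel[of "\<lambda>z. F (fst z) (snd z)" k Q] F Q by (simp add: I_def case_prod_beta')
      then show "(\<Sum>q\<in>Q. ennreal ((cmod (c (xi k q) (xi' k q)))\<^sup>2)) \<le> ennreal (V ^ (2 * k) * I)"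
        by (simp add: sum_ennreal ennreal_leI)
    qed (rule countable_cfg, simp)
    also have "\<dots> = (ennreal (V ^ k * sqrt I))\<^sup>2"
      using I Vk by (simp add: ennreal_power power_mult_distrib power_mult[symmetric] mult.commute)
    finally have "esqrt ?l \<le> ennreal (V ^ k * sqrt I)" by (simp add: esqrt_le_iff)
    then show ?thesis using I Vk by (simp add: I_def case_prod_beta' ennreal_mult')
  qed
  have inv: "ennreal (1 / V ^ k) * (ennreal (V ^ k) * y) = y" for y
    using Vk V_pos by (simp flip: ennreal_mult' mult.assoc)
  have "ennreal (1 / V ^ k) * esqrt ?l \<le> L2_norm \<theta>1 \<theta>2 k c"
    unfolding L2_norm_def
  proof (rule INF_greatest, elim CollectE conjE)
    fix F
    assume "(\<lambda>(x, x'). F x x') \<in> borel_measurable (PS k)" "integrable (PS k) (\<lambda>(x, x'). (cmod (F x x'))\<^sup>2)"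
      "\<forall>\<xi>\<in>freq k. \<forall>\<xi>'\<in>freq k. fourier \<theta>1 \<theta>2 k F \<xi> \<xi>' = c \<xi> \<xi>'"
    from mult_left_mono[OF one[OF this(1,2)], of "ennreal (1 / V ^ k)"] this(3)
    show "ennreal (1 / V ^ k) * esqrt ?l \<le> ennreal (sqrt (\<integral>(x, x'). (cmod (F x x'))\<^sup>2 \<partial>PS k))"
      unfolding inv by simp
  qed
  then have "ennreal (V ^ k) * (ennreal (1 / V ^ k) * esqrt ?l) \<le> ennreal (V ^ k) * L2_norm \<theta>1 \<theta>2 k c"
    by (rule mult_left_mono) simp
  moreover have "ennreal (V ^ k) * (ennreal (1 / V ^ k) * esqrt ?l) = esqrt ?l"
    using inv[of "esqrt ?l"] by (simp add: mult.left_commute)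
  ultimately show ?thesis by simp
qed

end

subsection \<open>Uniqueness of Fourier coefficients\<close>

text \<open>On \<open>[0, 2\<pi>)\<close> the set \<open>{u \<le> b}\<close> is the superlevel set \<open>{cos (u - b/2) \<ge> cos (b/2)}\<close> of a trigonometric
  polynomial.\<close>

lemma arc_cos:
  assumes "0 \<le> u" "u < 2 * pi" "0 \<le> b" "b < 2 * pi"
  shows "cos (b / 2) \<le> cos (u - b / 2) \<longleftrightarrow> u \<le> b"
proof -
  have eq: "cos (u - b / 2) - cos (b / 2) = 2 * sin (u / 2) * sin ((b - u) / 2)"
  proof -
    have "cos (u - b / 2) - cos (b / 2) = 2 * sin ((u - b / 2 + b / 2) / 2) * sin ((b / 2 - (u - b / 2)) / 2)"
      by (rule cos_diff_cos)
    also have "(b / 2 - (u - b / 2)) / 2 = (b - u) / 2" by (simp add: field_simps)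
    finally show ?thesis by simp
  qed
  show ?thesis
  proof (cases "u = 0")
    case False
    then have s: "sin (u / 2) > 0" using assms by (intro sin_gt_zero) auto
    show ?thesis
    proof (cases "u \<le> b")
      case True
      then have "sin ((b - u) / 2) \<ge> 0" using assms by (intro sin_ge_zero) auto
      then have "0 \<le> 2 * sin (u / 2) * sin ((b - u) / 2)" using s by simp
      then show ?thesis using eq True by linarith
    next
      case False
      then have "sin ((u - b) / 2) > 0" using assms by (intro sin_gt_zero) auto
      moreover have "sin ((b - u) / 2) = - sin ((u - b) / 2)"
        by (metis minus_diff_eq minus_divide_left sin_minus)
      ultimately have "2 * sin (u / 2) * sin ((b - u) / 2) < 0" using s by (simp add: mult_pos_neg)
      then show ?thesis using eq False by linarith
    qed
  qed (use assms in simp)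
qed

context torus_params
begin

abbreviation "ch k q \<equiv> chr k (xi k q) (xi' k q)"

lemma chr_shift:
  assumes "j \<in> {1..k}"
  shows "cis (fst z j \<bullet> la m + snd z j \<bullet> la n) * ch k q z = ch k (q(j := (fst (q j) - m, snd (q j) + n))) z"
proof -
  let ?q = "q(j := (fst (q j) - m, snd (q j) + n))"
  have "(\<Sum>i=1..k. fst z i \<bullet> xi k ?q i) = (\<Sum>i=1..k. fst z i \<bullet> xi k q i - (if i = j then fst z j \<bullet> la m else 0))"
    by (intro sum.cong refl) (auto simp: xi_def lat_diff inner_diff_right)
  then have 1: "(\<Sum>i=1..k. fst z i \<bullet> xi k ?q i) = (\<Sum>i=1..k. fst z i \<bullet> xi k q i) - fst z j \<bullet> la m"
    using assms by (simp add: sum_subtractf)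
  have "(\<Sum>i=1..k. snd z i \<bullet> xi' k ?q i) = (\<Sum>i=1..k. snd z i \<bullet> xi' k q i + (if i = j then snd z j \<bullet> la n else 0))"
    by (intro sum.cong refl) (auto simp: xi'_def lat_add inner_add_right)
  then have 2: "(\<Sum>i=1..k. snd z i \<bullet> xi' k ?q i) = (\<Sum>i=1..k. snd z i \<bullet> xi' k q i) + snd z j \<bullet> la n"
    using assms by (simp add: sum.distrib)
  show ?thesis unfolding chr_def 1 2 cis_mult by (simp add: algebra_simps)
qed

lemma component_PS:
  assumes "j \<in> {1..k}"
  shows "(\<lambda>z. fst z j) \<in> PS k \<rightarrow>\<^sub>M borel" "(\<lambda>z. snd z j) \<in> PS k \<rightarrow>\<^sub>M borel"
  unfolding phase_space_def
  using measurable_compose[OF measurable_fst component_TP[OF assms]] measurable_compose[OF measurable_snd component_TP[OF assms]] by auto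

lemma space_PS_bounds:
  assumes "z \<in> space (PS k)" "j \<in> {1..k}"
  shows "fst z j \<in> {0..<2 * pi / \<theta>1} \<times> {0..<2 * pi / \<theta>2}" "snd z j \<in> {0..<2 * pi / \<theta>1} \<times> {0..<2 * pi / \<theta>2}"
  using assms by (auto simp: phase_space_def space_pair_measure torus_power_def space_PiM space_TT PiE_iff)

end

locale null_coefficients = torus_params +
  fixes k :: nat and h :: "config \<times> config \<Rightarrow> complex"
  assumes h: "integrable (PS k) h"
    and null: "\<And>q. (\<integral>z. h z * ch k q z \<partial>PS k) = 0"
begin

declare split_paired_All [simp del] split_paired_Ex [simp del]

text \<open>Multipliers that keep all Fourier coefficients of h equal to zero. Quantifying over
  every q makes the class stable under multiplication by trigonometric polynomials; the aim is to
  reach all indicators of measurable sets.\<close>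

definition test :: "(config \<times> config \<Rightarrow> real) \<Rightarrow> bool" where
  "test \<phi> \<longleftrightarrow> \<phi> \<in> borel_measurable (PS k) \<and> (\<forall>z. \<bar>\<phi> z\<bar> \<le> 1) \<and>
    (\<forall>q. (\<integral>z. h z * of_real (\<phi> z) * ch k q z \<partial>PS k) = 0)"

lemma test_bound: "test \<phi> \<Longrightarrow> \<bar>\<phi> z\<bar> \<le> 1"
  unfolding test_def by blast

lemma h_measurable [measurable]: "h \<in> borel_measurable (PS k)"
  using h by simp

lemma integrable_test:
  assumes [measurable]: "\<phi> \<in> borel_measurable (PS k)" and "\<And>z. \<bar>\<phi> z\<bar> \<le> 1"
  shows "integrable (PS k) (\<lambda>z. h z * of_real (\<phi> z) * ch k q z)"
proof (rule Bochner_Integration.integrable_bound[OF h])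
  show "AE z in PS k. cmod (h z * of_real (\<phi> z) * ch k q z) \<le> cmod (h z)"
    using assms(2) by (intro AE_I2) (simp add: norm_mult mult_left_le)
qed simp

lemma test_1: "test (\<lambda>_. 1)"
  using null by (simp add: test_def)

lemma test_limit:
  assumes f: "\<And>n. test (f n)" and lim: "\<And>z. z \<in> space (PS k) \<Longrightarrow> (\<lambda>n. f n z) \<longlonglongrightarrow> g z"
    and g: "\<And>z. \<bar>g z\<bar> \<le> 1"
  shows "test g"
  unfolding test_def
proof (intro conjI allI)
  show gm[measurable]: "g \<in> borel_measurable (PS k)"
    using f by (intro borel_measurable_LIMSEQ_real[OF lim]) (auto simp: test_def)
  show "\<bar>g z\<bar> \<le> 1" for z by (rule g)
  fix q
  have "(\<lambda>n. \<integral>z. h z * of_real (f n z) * ch k q z \<partial>PS k) \<longlonglongrightarrow> (\<integral>z. h z * of_real (g z) * ch k q z \<partial>PS k)"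
  proof (rule integral_dominated_convergence[where w = "\<lambda>z. cmod (h z)"])
    show "(\<lambda>z. h z * of_real (g z) * ch k q z) \<in> borel_measurable (PS k)" by measurable
    show "(\<lambda>z. h z * of_real (f n z) * ch k q z) \<in> borel_measurable (PS k)" for n
      using f[of n] integrable_test[of "f n" q] by (auto simp: test_def)
    show "integrable (PS k) (\<lambda>z. cmod (h z))" using h by simp
    show "AE z in PS k. (\<lambda>n. h z * of_real (f n z) * ch k q z) \<longlonglongrightarrow> h z * of_real (g z) * ch k q z"
      by (intro AE_I2 tendsto_intros lim)
    show "AE z in PS k. cmod (h z * of_real (f n z) * ch k q z) \<le> cmod (h z)" for n
      using test_bound[OF f] by (intro AE_I2) (simp add: norm_mult mult_left_le)
  qed
  moreover have "(\<integral>z. h z * of_real (f n z) * ch k q z \<partial>PS k) = 0" for n using f[of n] by (simp add: test_def)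
  ultimately show "(\<integral>z. h z * of_real (g z) * ch k q z \<partial>PS k) = 0" by (simp add: LIMSEQ_const_iff)
qed

text \<open>One real coordinate of phase space, scaled to the circle; multiplication by exp (i u) or
  exp (- i u) merely shifts the index of a character.\<close>

definition slot :: "(config \<times> config \<Rightarrow> real) \<Rightarrow> bool" where
  "slot u \<longleftrightarrow> u \<in> borel_measurable (PS k) \<and> (\<forall>z\<in>space (PS k). 0 \<le> u z \<and> u z < 2 * pi) \<and>
    (\<forall>q. \<exists>q1 q2. \<forall>z. cis (u z) * ch k q z = ch k q1 z \<and> cis (- u z) * ch k q z = ch k q2 z)"

text \<open>A shifted cosine combines exp (i u) and exp (- i u) linearly, so one factor turns a
  coefficient into a combination of two other coefficients, both zero.\<close>

lemma test_cos_power: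
  assumes \<phi>: "test \<phi>" and u: "slot u"
  shows "test (\<lambda>z. \<phi> z * cos (u z - \<beta>) ^ n)"
proof (induction n)
  case (Suc n)
  let ?\<psi> = "\<lambda>z. \<phi> z * cos (u z - \<beta>) ^ n"
  have [measurable]: "?\<psi> \<in> borel_measurable (PS k)" "u \<in> borel_measurable (PS k)" using Suc u by (auto simp: test_def slot_def)
  have b: "\<bar>?\<psi> z\<bar> \<le> 1" for z using test_bound[OF Suc] .
  have eq: "\<phi> z * cos (u z - \<beta>) ^ Suc n = ?\<psi> z * cos (u z - \<beta>)" for z by (simp add: algebra_simps)
  show ?case unfolding test_def eq
  proof (intro conjI allI)
    show "\<bar>?\<psi> z * cos (u z - \<beta>)\<bar> \<le> 1" for z
      using b[of z] abs_cos_le_one[of "u z - \<beta>"] unfolding abs_mult[of "?\<psi> z"] by (intro mult_le_one) auto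
    fix q
    obtain q1 q2 where q: "\<And>z. cis (u z) * ch k q z = ch k q1 z" "\<And>z. cis (- u z) * ch k q z = ch k q2 z"
      using u unfolding slot_def by metis
    have c: "of_real (cos (u z - \<beta>)) * ch k q z = cis (- \<beta>) / 2 * ch k q1 z + cis \<beta> / 2 * ch k q2 z" for z
    proof -
      have cc: "complex_of_real (cos (u z - \<beta>)) = (cis (- \<beta>) * cis (u z) + cis \<beta> * cis (- u z)) / 2"
        by (simp add: complex_eq_iff cos_diff)
      show ?thesis unfolding cc q[symmetric] by (simp add: field_simps)
    qed
    have "h z * of_real (?\<psi> z * cos (u z - \<beta>)) * ch k q z =
      cis (- \<beta>) / 2 * (h z * of_real (?\<psi> z) * ch k q1 z) + cis \<beta> / 2 * (h z * of_real (?\<psi> z) * ch k q2 z)" for z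
    proof -
      have "h z * of_real (?\<psi> z * cos (u z - \<beta>)) * ch k q z = h z * of_real (?\<psi> z) * (of_real (cos (u z - \<beta>)) * ch k q z)"
        by (simp add: algebra_simps)
      then show ?thesis unfolding c by (simp add: algebra_simps)
    qed
    moreover have "(\<integral>z. h z * of_real (?\<psi> z) * ch k q z \<partial>PS k) = 0" for q using Suc by (simp add: test_def)
    ultimately show "(\<integral>z. h z * of_real (?\<psi> z * cos (u z - \<beta>)) * ch k q z \<partial>PS k) = 0"
      using integrable_test[of ?\<psi>, OF _ b] by (simp del: of_real_mult of_real_power)
  qed measurable
qed (use \<phi> in simp)

text \<open>Polynomials in the cosine are covered by \<open>test_cos_power\<close>, and Weierstrass
  approximation on {-1..1} carries the vanishing over to f with an error bounded by a multiple of
  the L1 norm of h.\<close>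

lemma test_cos_continuous:
  assumes \<phi>: "test \<phi>" and u: "slot u" and f: "continuous_on UNIV f" "\<And>x. \<bar>f x\<bar> \<le> 1"
  shows "test (\<lambda>z. \<phi> z * f (cos (u z - \<beta>)))"
  unfolding test_def
proof (intro conjI allI)
  have [measurable]: "\<phi> \<in> borel_measurable (PS k)" "u \<in> borel_measurable (PS k)" "f \<in> borel_measurable borel"
    using \<phi> u f by (auto simp: test_def slot_def intro: borel_measurable_continuous_onI)
  show "(\<lambda>z. \<phi> z * f (cos (u z - \<beta>))) \<in> borel_measurable (PS k)" by measurable
  have b: "\<bar>\<phi> z\<bar> \<le> 1" for z using test_bound[OF \<phi>] .
  show b2: "\<bar>\<phi> z * f (cos (u z - \<beta>))\<bar> \<le> 1" for z
    unfolding abs_mult using b f by (intro mult_le_one) auto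
  fix q
  let ?I = "\<integral>z. h z * of_real (\<phi> z * f (cos (u z - \<beta>))) * ch k q z \<partial>PS k"
  have le: "cmod ?I \<le> e * (\<integral>z. cmod (h z) \<partial>PS k)" if e: "e > 0" for e
  proof -
    obtain g where g: "real_polynomial_function g" "\<And>x. x \<in> {-1..1} \<Longrightarrow> \<bar>f x - g x\<bar> < e"
      using Stone_Weierstrass_real_polynomial_function[of "{-1..1::real}" f e] e f(1)
      by (metis compact_Icc continuous_on_subset subset_UNIV)
    obtain a n where a: "g = (\<lambda>x. \<Sum>i\<le>n. a i * x ^ i)" using g(1) real_polynomial_function_iff_sum by blast
    let ?t = "\<lambda>i z. h z * of_real (\<phi> z * cos (u z - \<beta>) ^ i) * ch k q z"
    have int: "integrable (PS k) (?t i)" for i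
      using test_cos_power[OF \<phi> u, of \<beta> i] by (intro integrable_test) (auto simp: test_def)
    have eq: "h z * of_real (\<phi> z * g (cos (u z - \<beta>))) * ch k q z = (\<Sum>i\<le>n. of_real (a i) * ?t i z)" for z
      by (simp add: a sum_distrib_left sum_distrib_right algebra_simps)
    have int2: "integrable (PS k) (\<lambda>z. h z * of_real (\<phi> z * g (cos (u z - \<beta>))) * ch k q z)"
      unfolding eq using int by auto
    have "(\<integral>z. h z * of_real (\<phi> z * g (cos (u z - \<beta>))) * ch k q z \<partial>PS k) = (\<Sum>i\<le>n. of_real (a i) * (\<integral>z. ?t i z \<partial>PS k))"
      unfolding eq using int by (subst Bochner_Integration.integral_sum) auto
    also have "\<dots> = 0" using test_cos_power[OF \<phi> u, of \<beta>] by (intro sum.neutral) (simp add: test_def)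
    finally have "?I = (\<integral>z. h z * of_real (\<phi> z * f (cos (u z - \<beta>))) * ch k q z - h z * of_real (\<phi> z * g (cos (u z - \<beta>))) * ch k q z \<partial>PS k)"
      using int2 integrable_test[OF _ b2] by (subst Bochner_Integration.integral_diff) auto
    also have "cmod \<dots> \<le> (\<integral>z. e * cmod (h z) \<partial>PS k)"
    proof (rule order_trans[OF integral_norm_bound integral_mono], rule integrable_norm)
      show "integrable (PS k) (\<lambda>z. h z * of_real (\<phi> z * f (cos (u z - \<beta>))) * ch k q z - h z * of_real (\<phi> z * g (cos (u z - \<beta>))) * ch k q z)"
        using int2 integrable_test[OF _ b2] by (intro Bochner_Integration.integrable_diff) auto
      show "integrable (PS k) (\<lambda>z. e * cmod (h z))" using h by auto
      fix z
      have "h z * of_real (\<phi> z * f (cos (u z - \<beta>))) * ch k q z - h z * of_real (\<phi> z * g (cos (u z - \<beta>))) * ch k q z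
        = h z * of_real (\<phi> z) * of_real (f (cos (u z - \<beta>)) - g (cos (u z - \<beta>))) * ch k q z"
        by (simp add: algebra_simps)
      also have "cmod \<dots> = cmod (h z) * (\<bar>\<phi> z\<bar> * \<bar>f (cos (u z - \<beta>)) - g (cos (u z - \<beta>))\<bar>)"
        by (simp add: norm_mult del: of_real_diff)
      also have "\<dots> \<le> cmod (h z) * (1 * e)"
        using b g(2)[of "cos (u z - \<beta>)"] by (intro mult_left_mono mult_mono) (auto simp: less_imp_le)
      finally show "cmod (h z * of_real (\<phi> z * f (cos (u z - \<beta>))) * ch k q z - h z * of_real (\<phi> z * g (cos (u z - \<beta>))) * ch k q z) \<le> e * cmod (h z)"
        by (simp add: mult.commute)
    qed
    also have "\<dots> = e * (\<integral>z. cmod (h z) \<partial>PS k)" by simp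
    finally show ?thesis .
  qed
  have "cmod ?I \<le> 0"
  proof (rule tendsto_lowerbound)
    show "((\<lambda>e. e * (\<integral>z. cmod (h z) \<partial>PS k)) \<longlongrightarrow> 0) (at_right 0)"
      by (intro tendsto_eq_intros) auto
    show "\<forall>\<^sub>F e in at_right 0. cmod ?I \<le> e * (\<integral>z. cmod (h z) \<partial>PS k)"
      using le by (auto simp: eventually_at_right_field intro!: exI[of _ 1])
  qed simp
  then show "?I = 0" by simp
qed

lemma test_atMost:
  assumes \<phi>: "test \<phi>" and u: "slot u"
  shows "test (\<lambda>z. \<phi> z * indicator {..b} (u z))"
proof -
  have b1: "\<bar>\<phi> z\<bar> \<le> 1" for z using test_bound[OF \<phi>] .
  have ub: "0 \<le> u z" "u z < 2 * pi" if "z \<in> space (PS k)" for z using u that by (auto simp: slot_def)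
  consider "b < 0" | "b \<ge> 2 * pi" | "0 \<le> b" "b < 2 * pi" by linarith
  then show ?thesis
  proof cases
    case 1
    have "test (\<lambda>z. \<phi> z * (\<lambda>_. 0) (cos (u z - 0)))" by (rule test_cos_continuous[OF \<phi> u]) auto
    then have "test (\<lambda>_. 0)" by simp
    then show ?thesis
    proof (rule test_limit[where f = "\<lambda>_ _. 0"])
      fix z assume "z \<in> space (PS k)"
      then have "\<not> u z \<le> b" using ub[of z] 1 by linarith
      then show "(\<lambda>_. 0) \<longlonglongrightarrow> \<phi> z * indicator {..b} (u z)" by simp
    qed (use b1 in \<open>simp add: indicator_def\<close>)
  next
    case 2
    show ?thesis
    proof (rule test_limit[where f = "\<lambda>_. \<phi>"])
      fix z assume "z \<in> space (PS k)"
      then have "u z \<le> b" using ub[of z] 2 by linarith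
      then show "(\<lambda>_. \<phi> z) \<longlonglongrightarrow> \<phi> z * indicator {..b} (u z)" by simp
    qed (use \<phi> b1 in \<open>simp_all add: indicator_def\<close>)
  next
    case 3
    define c where "c = cos (b / 2)"
    \<comment> \<open>Continuous ramps: f n is 1 from c upwards and 0 below c - 1 / n, so it
      converges to the indicator of a superlevel set of the cosine, which \<open>arc_cos\<close>
      identifies with {u <= b}.\<close>
    define f where "f n y = max 0 (1 - real n * max 0 (c - y))" for n y
    have "test (\<lambda>z. \<phi> z * f n (cos (u z - b / 2)))" for n
      by (rule test_cos_continuous[OF \<phi> u]) (auto simp: f_def intro!: continuous_intros)
    then show ?thesis
    proof (rule test_limit)
      fix z assume z: "z \<in> space (PS k)"
      have iff: "c \<le> cos (u z - b / 2) \<longleftrightarrow> u z \<le> b" unfolding c_def using ub[OF z] 3 by (intro arc_cos)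
      have "(\<lambda>n. f n y) \<longlonglongrightarrow> of_bool (c \<le> y)" for y
      proof (cases "c \<le> y")
        case True
        then have "f n y = 1" for n by (simp add: f_def)
        then show ?thesis using True by simp
      next
        case False
        obtain n0 :: nat where n0: "1 / (c - y) < real n0" using reals_Archimedean2 by blast
        have "f n y = 0" if "n \<ge> n0" for n
        proof -
          have "1 / (c - y) < real n" using n0 that by linarith
          then have "1 < real n * (c - y)" using False by (simp add: field_simps)
          then show ?thesis using False by (simp add: f_def)
        qed
        then have "\<forall>\<^sub>F n in sequentially. f n y = 0" by (auto simp: eventually_sequentially)
        then show ?thesis using False by (simp add: tendsto_eventually)
      qed
      from tendsto_mult_left[OF this]
      show "(\<lambda>n. \<phi> z * f n (cos (u z - b / 2))) \<longlonglongrightarrow> \<phi> z * indicator {..b} (u z)"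
        unfolding indicator_def atMost_iff iff[symmetric] .
    qed (use b1 in \<open>auto simp: indicator_def abs_mult\<close>)
  qed
qed

text \<open>The pi-lambda argument with an earlier test function as a factor. This lets coordinates
  be adjoined one at a time, the indicators already obtained being absorbed into that
  factor.\<close>

lemma test_dynkin:
  assumes \<phi>: "test \<phi>" and G: "Int_stable G" "G \<subseteq> Pow \<Omega>" and g: "\<And>z. z \<in> space (PS k) \<Longrightarrow> g z \<in> \<Omega>"
    and basic: "\<And>A. A \<in> G \<Longrightarrow> test (\<lambda>z. \<phi> z * indicator A (g z))"
    and A: "A \<in> sigma_sets \<Omega> G"
  shows "test (\<lambda>z. \<phi> z * indicator A (g z))"
  using G A
proof (induction rule: sigma_sets_induct_disjoint)
  have b1: "\<bar>\<phi> z * indicator B (g z)\<bar> \<le> 1" for z B using test_bound[OF \<phi>, of z] by (simp add: indicator_def)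
  have z0: "test (\<lambda>_. 0)" by (simp add: test_def)
  {
    case (basic A)
    then show ?case using assms(5) by blast
  next
    case empty
    show ?case using z0 by simp
  next
    case (compl A)
    have [measurable]: "\<phi> \<in> borel_measurable (PS k)" "(\<lambda>z. \<phi> z * indicator A (g z)) \<in> borel_measurable (PS k)"
      using \<phi> compl by (auto simp: test_def)
    have "test (\<lambda>z. \<phi> z - \<phi> z * indicator A (g z))"
      unfolding test_def
    proof (intro conjI allI)
      show "\<bar>\<phi> z - \<phi> z * indicator A (g z)\<bar> \<le> 1" for z using test_bound[OF \<phi>, of z] by (simp add: indicator_def)
      fix q
      have "(\<integral>z. h z * of_real (\<phi> z - \<phi> z * indicator A (g z)) * ch k q z \<partial>PS k) =
          (\<integral>z. h z * of_real (\<phi> z) * ch k q z - h z * of_real (\<phi> z * indicator A (g z)) * ch k q z \<partial>PS k)"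
        by (simp add: algebra_simps)
      also have "\<dots> = (\<integral>z. h z * of_real (\<phi> z) * ch k q z \<partial>PS k) - (\<integral>z. h z * of_real (\<phi> z * indicator A (g z)) * ch k q z \<partial>PS k)"
        using b1 \<phi> by (intro Bochner_Integration.integral_diff integrable_test) (auto simp: test_def)
      also have "\<dots> = 0" using compl \<phi> by (simp add: test_def)
      finally show "(\<integral>z. h z * of_real (\<phi> z - \<phi> z * indicator A (g z)) * ch k q z \<partial>PS k) = 0" .
    qed measurable
    then show ?case
      by (rule test_limit[where f = "\<lambda>_ z. \<phi> z - \<phi> z * indicator A (g z)"]) (auto simp: g indicator_def intro!: test_bound[OF \<phi>])
  next
    case (union A)
    have sum: "(\<Sum>i<n. \<phi> z * indicator (A i) (g z)) = \<phi> z * indicator (\<Union>i<n. A i) (g z)" for n z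
    proof -
      have "disjoint_family_on A {..<n}" using union(1) by (auto simp: disjoint_family_on_def)
      then show ?thesis by (simp add: sum_distrib_left[symmetric] indicator_UN_disjoint)
    qed
    have "test (\<lambda>z. \<Sum>i<n. \<phi> z * indicator (A i) (g z))" for n
      unfolding test_def
    proof (intro conjI allI)
      have m: "(\<lambda>z. \<phi> z * indicator (A i) (g z)) \<in> borel_measurable (PS k)" for i using union(3) by (simp add: test_def)
      then show "(\<lambda>z. \<Sum>i<n. \<phi> z * indicator (A i) (g z)) \<in> borel_measurable (PS k)" by (intro borel_measurable_sum)
      show "\<bar>\<Sum>i<n. \<phi> z * indicator (A i) (g z)\<bar> \<le> 1" for z unfolding sum by (rule b1)
      fix q
      have "(\<integral>z. h z * of_real (\<Sum>i<n. \<phi> z * indicator (A i) (g z)) * ch k q z \<partial>PS k) =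
         (\<integral>z. (\<Sum>i<n. h z * of_real (\<phi> z * indicator (A i) (g z)) * ch k q z) \<partial>PS k)"
        by (simp only: of_real_sum sum_distrib_left sum_distrib_right)
      also have "\<dots> = (\<Sum>i<n. \<integral>z. h z * of_real (\<phi> z * indicator (A i) (g z)) * ch k q z \<partial>PS k)"
        by (intro Bochner_Integration.integral_sum integrable_test m b1)
      also have "\<dots> = 0" using union(3) by (intro sum.neutral) (simp add: test_def)
      finally show "(\<integral>z. h z * of_real (\<Sum>i<n. \<phi> z * indicator (A i) (g z)) * ch k q z \<partial>PS k) = 0" .
    qed
    then show ?case
    proof (rule test_limit)
      fix z
      have "(\<lambda>n. indicator (\<Union>i<n. A i) (g z) :: real) \<longlonglongrightarrow> indicator (\<Union>i. A i) (g z)"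
        by (rule LIMSEQ_indicator_UN)
      then show "(\<lambda>n. \<Sum>i<n. \<phi> z * indicator (A i) (g z)) \<longlonglongrightarrow> \<phi> z * indicator (\<Union>i. A i) (g z)"
        unfolding sum by (rule tendsto_mult_left)
    qed (rule b1)
  }
qed

lemma test_borel:
  assumes \<phi>: "test \<phi>" and u: "slot (\<lambda>z. \<theta> * u z)" "\<theta> > 0" and B: "B \<in> sets borel"
  shows "test (\<lambda>z. \<phi> z * indicator B (u z :: real))"
proof (rule test_dynkin[OF \<phi>, where \<Omega> = UNIV and G = "range atMost"])
  show "Int_stable (range (atMost :: real \<Rightarrow> _))"
    by (auto simp: Int_stable_def)
  show "B \<in> sigma_sets UNIV (range atMost)"
    using B unfolding borel_eq_atMost by simp
  fix A assume "A \<in> range (atMost :: real \<Rightarrow> _)"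
  then obtain b where A: "A = {..b}" by blast
  have eq: "(indicator A (u z) :: real) = indicator {..\<theta> * b} (\<theta> * u z)" for z
    using u(2) by (simp add: A indicator_def)
  show "test (\<lambda>z. \<phi> z * indicator A (u z))" unfolding eq by (rule test_atMost[OF \<phi> u(1)])
qed auto

lemma slots:
  assumes j: "j \<in> {1..k}"
  shows "slot (\<lambda>z. \<theta>1 * fst (fst z j))" "slot (\<lambda>z. \<theta>2 * snd (fst z j))"
    "slot (\<lambda>z. \<theta>1 * fst (snd z j))" "slot (\<lambda>z. \<theta>2 * snd (snd z j))"
proof -
  note [measurable] = component_PS[OF j]
  have meas: "(\<lambda>z. \<theta>1 * fst (fst z j)) \<in> borel_measurable (PS k)" "(\<lambda>z. \<theta>2 * snd (fst z j)) \<in> borel_measurable (PS k)"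
    "(\<lambda>z. \<theta>1 * fst (snd z j)) \<in> borel_measurable (PS k)" "(\<lambda>z. \<theta>2 * snd (snd z j)) \<in> borel_measurable (PS k)"
    using borel_measurable_continuous_on[OF continuous_on_fst[OF continuous_on_id], OF component_PS(1)[OF j]]
      borel_measurable_continuous_on[OF continuous_on_snd[OF continuous_on_id], OF component_PS(1)[OF j]]
      borel_measurable_continuous_on[OF continuous_on_fst[OF continuous_on_id], OF component_PS(2)[OF j]]
      borel_measurable_continuous_on[OF continuous_on_snd[OF continuous_on_id], OF component_PS(2)[OF j]] by auto
  have bounds: "0 \<le> \<theta>1 * fst p \<and> \<theta>1 * fst p < 2 * pi" "0 \<le> \<theta>2 * snd p \<and> \<theta>2 * snd p < 2 * pi"
    if "p \<in> {0..<2 * pi / \<theta>1} \<times> {0..<2 * pi / \<theta>2}" for p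
    using that \<theta>1 \<theta>2 by (cases p; auto simp: field_simps)+
  have sh: "\<exists>q1 q2. \<forall>z. cis (fst z j \<bullet> la m + snd z j \<bullet> la n) * ch k q z = ch k q1 z \<and> cis (- (fst z j \<bullet> la m + snd z j \<bullet> la n)) * ch k q z = ch k q2 z" for m n q
    using chr_shift[OF j, of _ m n q] chr_shift[OF j, of _ "- m" "- n" q] by (fastforce simp: lat_minus)
  show "slot (\<lambda>z. \<theta>1 * fst (fst z j))"
    unfolding slot_def using meas bounds(1)[OF space_PS_bounds(1)[OF _ j]] sh[of "(1, 0)" 0]
    by (simp add: lat_def inner_prod_def mult.commute zero_prod_def)
  show "slot (\<lambda>z. \<theta>2 * snd (fst z j))"
    unfolding slot_def using meas bounds(2)[OF space_PS_bounds(1)[OF _ j]] sh[of "(0, 1)" 0]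
    by (simp add: lat_def inner_prod_def mult.commute zero_prod_def)
  show "slot (\<lambda>z. \<theta>1 * fst (snd z j))"
    unfolding slot_def using meas bounds(1)[OF space_PS_bounds(2)[OF _ j]] sh[of 0 "(1, 0)"]
    by (simp add: lat_def inner_prod_def mult.commute zero_prod_def)
  show "slot (\<lambda>z. \<theta>2 * snd (snd z j))"
    unfolding slot_def using meas bounds(2)[OF space_PS_bounds(2)[OF _ j]] sh[of 0 "(0, 1)"]
    by (simp add: lat_def inner_prod_def mult.commute zero_prod_def)
qed

lemma test_point:
  assumes \<phi>: "test \<phi>" and s: "slot (\<lambda>z. \<theta>1 * fst (x z))" "slot (\<lambda>z. \<theta>2 * snd (x z))" and A: "A \<in> sets (borel :: point measure)"
  shows "test (\<lambda>z. \<phi> z * indicator A (x z))"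
proof (rule test_dynkin[OF \<phi>, where \<Omega> = UNIV and G = "{a \<times> b | a b. a \<in> sets (borel :: real measure) \<and> b \<in> sets (borel :: real measure)}"])
  show "A \<in> sigma_sets UNIV {a \<times> b | a b. a \<in> sets (borel :: real measure) \<and> b \<in> sets (borel :: real measure)}"
    using A unfolding borel_prod[symmetric] sets_pair_measure by simp
  fix B assume "B \<in> {a \<times> b | a b. a \<in> sets (borel :: real measure) \<and> b \<in> sets (borel :: real measure)}"
  then obtain a b where B: "B = a \<times> b" "a \<in> sets borel" "b \<in> sets borel" by blast
  have eq: "\<phi> z * indicator B (x z) = \<phi> z * indicator a (fst (x z)) * indicator b (snd (x z))" for z
    by (cases "x z") (simp add: B indicator_def)
  show "test (\<lambda>z. \<phi> z * indicator B (x z))"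
    unfolding eq by (intro test_borel[OF _ s(2) \<theta>2] test_borel[OF \<phi> s(1) \<theta>1] B)
qed (use Int_stable_pair_measure_generator in auto)

lemma test_TP:
  assumes \<phi>: "test \<phi>" and s: "\<And>j. j \<in> {1..k} \<Longrightarrow> slot (\<lambda>z. \<theta>1 * fst (x z j)) \<and> slot (\<lambda>z. \<theta>2 * snd (x z j))"
    and x: "\<And>z. z \<in> space (PS k) \<Longrightarrow> x z \<in> space (TP k)" and A: "A \<in> sets (TP k)"
  shows "test (\<lambda>z. \<phi> z * indicator A (x z))"
proof (rule test_dynkin[OF \<phi> Int_stable_prod_algebra prod_algebra_sets_into_space])
  show "x z \<in> (\<Pi>\<^sub>E i\<in>{1..k}. space TT)" if "z \<in> space (PS k)" for z
    using x[OF that] by (simp add: torus_power_def space_PiM)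
  show "A \<in> sigma_sets (\<Pi>\<^sub>E i\<in>{1..k}. space TT) (prod_algebra {1..k} (\<lambda>_. TT))"
    using A by (simp add: torus_power_def sets_PiM)
  fix B assume "B \<in> prod_algebra {1..k} (\<lambda>_. TT)"
  then obtain X where "B = PiE {1..k} X" "X \<in> (\<Pi> j\<in>{1..k}. sets TT)"
    unfolding prod_algebra_eq_finite[OF finite_atLeastAtMost] by blast
  then have X: "B = PiE {1..k} X" "\<And>j. j \<in> {1..k} \<Longrightarrow> X j \<in> sets TT" by auto
  have Xb: "X j \<in> sets borel" if "j \<in> {1..k}" for j
    using X(2)[OF that] box_measurable unfolding torus_def by (subst (asm) sets_restrict_space_iff) auto
  have "test (\<lambda>z. \<phi> z * (\<Prod>j\<in>J. indicator (X j) (x z j)))" if "finite J" "J \<subseteq> {1..k}" for J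
    using that
  proof (induction J rule: finite_induct)
    case (insert j J)
    then have "test (\<lambda>z. \<phi> z * (\<Prod>j\<in>J. indicator (X j) (x z j)) * indicator (X j) (x z j))"
      using s Xb by (intro test_point) auto
    then show ?case using insert by (simp add: mult_ac)
  qed (use \<phi> in simp)
  from this[of "{1..k}"] have "test (\<lambda>z. \<phi> z * (\<Prod>j\<in>{1..k}. indicator (X j) (x z j)))" by simp
  then show "test (\<lambda>z. \<phi> z * indicator B (x z))"
  proof (rule test_limit[where f = "\<lambda>_. _"])
    fix z assume z: "z \<in> space (PS k)"
    have "(\<Prod>j\<in>{1..k}. indicator (X j) (x z j) :: real) = indicator B (x z)"
      using x[OF z] unfolding X(1)
      by (auto simp: indicator_def torus_power_def space_PiM PiE_iff)
    then show "(\<lambda>_. \<phi> z * (\<Prod>j\<in>{1..k}. indicator (X j) (x z j))) \<longlonglongrightarrow> \<phi> z * indicator B (x z)" by simp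
  qed (use test_bound[OF \<phi>] in \<open>simp add: indicator_def\<close>)
qed

text \<open>For the zero index the character is 1, so h integrates to zero over every measurable
  set.\<close>

theorem null_AE: "AE z in PS k. h z = 0"
proof (rule PS.density_zero[OF h])
  fix A assume A: "A \<in> sets (PS k)"
  have "test (\<lambda>z. 1 * indicator A z)"
  proof (rule test_dynkin[OF test_1 Int_stable_pair_measure_generator[of "TP k" "TP k"], where \<Omega> = "space (TP k) \<times> space (TP k)" and g = "\<lambda>z. z"])
    show "A \<in> sigma_sets (space (TP k) \<times> space (TP k)) {a \<times> b | a b. a \<in> sets (TP k) \<and> b \<in> sets (TP k)}"
      using A by (simp add: phase_space_def sets_pair_measure)
    fix B assume "B \<in> {a \<times> b | a b. a \<in> sets (TP k) \<and> b \<in> sets (TP k)}"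
    then obtain a b where B: "B = a \<times> b" "a \<in> sets (TP k)" "b \<in> sets (TP k)" by blast
    have eq: "1 * indicator B z = (1 * indicator a (fst z) * indicator b (snd z) :: real)" for z :: "config \<times> config"
      by (cases z) (simp add: B indicator_def)
    show "test (\<lambda>z. 1 * indicator B z)"
      unfolding eq
      by (rule test_TP[OF test_TP[OF test_1]]) (use slots B in \<open>auto simp: phase_space_def space_pair_measure\<close>)
  qed (use sets.sets_into_space[of _ "TP k"] in \<open>auto simp: phase_space_def space_pair_measure\<close>)
  then have "(\<integral>z. h z * of_real (indicator A z) * ch k (\<lambda>_. 0) z \<partial>PS k) = 0" by (simp add: test_def)
  moreover have "ch k (\<lambda>_. 0) z = 1" for z by (simp add: chr_def xi_def xi'_def)
  ultimately show "set_lebesgue_integral (PS k) A h = 0"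
    by (simp add: set_lebesgue_integral_def scaleR_conv_of_real mult.commute)
qed

end

subsection \<open>The collision operator on Fourier coefficients\<close>

type_synonym particle = "(int \<times> int) \<times> (int \<times> int)"
type_synonym collision_index = "bool \<times> (int \<times> int) \<times> (int \<times> int)"

text \<open>A collision index is a sign, for the two terms of the collision operator, and the two frequencies of
  the Dirac kernels.\<close>

definition lft :: "particle \<Rightarrow> collision_index \<Rightarrow> particle" where
  "lft q z = (if fst z then (fst q - (fst (snd z) + snd (snd z)), snd q) else (fst q, snd q + (fst (snd z) + snd (snd z))))"

text \<open>The sign of the second entry comes from the conjugate characters carried by the primed
  variables.\<close>

definition rgt :: "collision_index \<Rightarrow> particle" where
  "rgt z = (fst (snd z), - snd (snd z))"

definition sg :: "collision_index \<Rightarrow> complex" where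
  "sg z = (if fst z then 1 else - 1)"

context torus_params
begin

definition coef :: "nat \<Rightarrow> density \<Rightarrow> (nat \<Rightarrow> particle) \<Rightarrow> complex" where
  "coef k \<gamma> q = fourier \<theta>1 \<theta>2 k \<gamma> (xi k q) (xi' k q)"

lemma coef_chr: "coef k \<gamma> q = (\<integral>z. \<gamma> (fst z) (snd z) * ch k q z \<partial>PS k)"
  by (simp add: coef_def fourier_chr)

lemma distr_PS:
  assumes f: "f \<in> TP k \<rightarrow>\<^sub>M TP k" and d: "distr (TP k) (TP k) f = TP k"
  shows "distr (PS k) (PS k) (\<lambda>z. (f (fst z), f (snd z))) = PS k"
proof -
  have "TP k \<Otimes>\<^sub>M TP k = distr (TP k) (TP k) f \<Otimes>\<^sub>M distr (TP k) (TP k) f" by (simp add: d)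
  also have "\<dots> = distr (TP k \<Otimes>\<^sub>M TP k) (TP k \<Otimes>\<^sub>M TP k) (\<lambda>(x, y). (f x, f y))"
    by (rule pair_measure_distr[OF f f]) (simp add: d TP.sigma_finite_measure_axioms)
  finally show ?thesis by (simp add: phase_space_def case_prod_beta')
qed

lemma distr_permute:
  assumes \<sigma>: "\<sigma> permutes {1..k}"
  shows "(\<lambda>x. x \<circ> \<sigma>) \<in> TP k \<rightarrow>\<^sub>M TP k" "distr (TP k) (TP k) (\<lambda>x. x \<circ> \<sigma>) = TP k"
proof -
  have in_iff: "\<sigma> i \<in> {1..k} \<longleftrightarrow> i \<in> {1..k}" for i by (rule permutes_in_image[OF \<sigma>])
  show m: "(\<lambda>x. x \<circ> \<sigma>) \<in> TP k \<rightarrow>\<^sub>M TP k"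
    unfolding torus_power_def
  proof (rule measurable_PiM_single')
    fix i assume "i \<in> {1..k}"
    then show "(\<lambda>x. (x \<circ> \<sigma>) i) \<in> PiM {1..k} (\<lambda>_. TT) \<rightarrow>\<^sub>M TT"
      using measurable_component_singleton[of "\<sigma> i" "{1..k}" "\<lambda>_. TT"] in_iff by simp
  next
    show "(\<lambda>x. x \<circ> \<sigma>) \<in> space (PiM {1..k} (\<lambda>_. TT)) \<rightarrow> (\<Pi>\<^sub>E i\<in>{1..k}. space TT)"
    proof
      fix x assume x: "x \<in> space (PiM {1..k} (\<lambda>_. TT))"
      show "x \<circ> \<sigma> \<in> (\<Pi>\<^sub>E i\<in>{1..k}. space TT)"
      proof (rule PiE_I)
        fix i assume "i \<in> {1..k}"
        then show "(x \<circ> \<sigma>) i \<in> space TT" using x in_iff[of i] unfolding space_PiM comp_def by blast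
      next
        fix i assume "i \<notin> {1..k}"
        then show "(x \<circ> \<sigma>) i = undefined" using x in_iff[of i] by (simp add: space_PiM PiE_arb[of x])
      qed
    qed
  qed
  show "distr (TP k) (TP k) (\<lambda>x. x \<circ> \<sigma>) = TP k"
    unfolding torus_power_def
  proof (rule P.PiM_eqI)
    fix A assume A: "\<And>i. i \<in> {1..k} \<Longrightarrow> A i \<in> sets TT"
    have box: "PiE {1..k} A \<in> sets (PiM {1..k} (\<lambda>_. TT))" using A by (intro sets_PiM_I_finite) auto
    have inv: "inv \<sigma> i \<in> {1..k} \<longleftrightarrow> i \<in> {1..k}" for i by (rule permutes_in_image[OF permutes_inv[OF \<sigma>]])
    have pre: "(\<lambda>x. x \<circ> \<sigma>) -` PiE {1..k} A \<inter> space (PiM {1..k} (\<lambda>_. TT)) = PiE {1..k} (\<lambda>i. A (inv \<sigma> i))"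
    proof (intro set_eqI iffI)
      fix x assume x: "x \<in> (\<lambda>x. x \<circ> \<sigma>) -` PiE {1..k} A \<inter> space (PiM {1..k} (\<lambda>_. TT))"
      show "x \<in> PiE {1..k} (\<lambda>i. A (inv \<sigma> i))"
      proof (rule PiE_I)
        fix i assume "i \<in> {1..k}"
        then have "inv \<sigma> i \<in> {1..k}" using inv[of i] by blast
        moreover have "x \<circ> \<sigma> \<in> PiE {1..k} A" using x by blast
        ultimately have "(x \<circ> \<sigma>) (inv \<sigma> i) \<in> A (inv \<sigma> i)" by (rule PiE_mem[rotated])
        then show "x i \<in> A (inv \<sigma> i)" using permutes_inverses(1)[OF \<sigma>] by simp
      next
        fix i assume "i \<notin> {1..k}"
        moreover have "x \<in> (\<Pi>\<^sub>E i\<in>{1..k}. space TT)" using x unfolding space_PiM by blast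
        ultimately show "x i = undefined" by (rule PiE_arb[rotated])
      qed
    next
      fix x assume x: "x \<in> PiE {1..k} (\<lambda>i. A (inv \<sigma> i))"
      have "x \<in> (\<Pi>\<^sub>E i\<in>{1..k}. space TT)"
        using x by (rule PiE_mono[THEN subsetD, rotated]) (use A inv sets.sets_into_space in blast)
      moreover have "x \<circ> \<sigma> \<in> PiE {1..k} A"
      proof (rule PiE_I)
        fix i assume "i \<in> {1..k}"
        then have "x (\<sigma> i) \<in> A (inv \<sigma> (\<sigma> i))" using x in_iff[of i] by (intro PiE_mem[OF x]) auto
        then show "(x \<circ> \<sigma>) i \<in> A i" using permutes_inverses(2)[OF \<sigma>] by simp
      next
        fix i assume "i \<notin> {1..k}"
        then have "\<sigma> i \<notin> {1..k}" using in_iff by blast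
        then show "(x \<circ> \<sigma>) i = undefined" unfolding comp_def by (rule PiE_arb[OF x])
      qed
      ultimately show "x \<in> (\<lambda>x. x \<circ> \<sigma>) -` PiE {1..k} A \<inter> space (PiM {1..k} (\<lambda>_. TT))" by (simp add: space_PiM)
    qed
    have "emeasure (distr (PiM {1..k} (\<lambda>_. TT)) (PiM {1..k} (\<lambda>_. TT)) (\<lambda>x. x \<circ> \<sigma>)) (PiE {1..k} A) =
       emeasure (PiM {1..k} (\<lambda>_. TT)) (PiE {1..k} (\<lambda>i. A (inv \<sigma> i)))"
      unfolding emeasure_distr[OF m[unfolded torus_power_def] box] pre ..
    also have "\<dots> = (\<Prod>i\<in>{1..k}. emeasure TT (A (inv \<sigma> i)))"
      using A inv by (intro P.emeasure_PiM) auto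
    also have "\<dots> = (\<Prod>i\<in>{1..k}. emeasure TT (A i))"
      by (rule prod.permute[OF permutes_inv[OF \<sigma>], symmetric, unfolded comp_def])
    finally show "emeasure (distr (PiM {1..k} (\<lambda>_. TT)) (PiM {1..k} (\<lambda>_. TT)) (\<lambda>x. x \<circ> \<sigma>)) (PiE {1..k} A) =
      (\<Prod>i\<in>{1..k}. emeasure TT (A i))" .
  qed auto
qed

lemma coef_permute:
  assumes \<sigma>: "\<sigma> permutes {1..k}" and \<gamma>: "density_matrix \<theta>1 \<theta>2 k \<gamma>"
    and sym: "\<And>x x'. x \<in> space (TP k) \<Longrightarrow> x' \<in> space (TP k) \<Longrightarrow> \<gamma> (x \<circ> \<sigma>) (x' \<circ> \<sigma>) = \<gamma> x x'"
  shows "coef k \<gamma> (q \<circ> \<sigma>) = coef k \<gamma> q"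
proof -
  let ?T = "\<lambda>z :: config \<times> config. (fst z \<circ> \<sigma>, snd z \<circ> \<sigma>)"
  note d = distr_permute[OF \<sigma>]
  have m: "?T \<in> PS k \<rightarrow>\<^sub>M PS k"
    unfolding phase_space_def using d(1) by measurable
  have gm: "(\<lambda>z. \<gamma> (fst z) (snd z)) \<in> borel_measurable (PS k)"
    using \<gamma> unfolding density_matrix_def by (simp add: case_prod_beta' borel_measurable_integrable)
  have ch: "ch k (q \<circ> \<sigma>) (?T z) = ch k q z" for z
  proof -
    have "(\<Sum>j=1..k. fst (?T z) j \<bullet> xi k (q \<circ> \<sigma>) j) = (\<Sum>j=1..k. ((\<lambda>j. fst z j \<bullet> la (fst (q j))) \<circ> \<sigma>) j)"
      by (intro sum.cong) (auto simp: xi_def)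
    also have "\<dots> = (\<Sum>j=1..k. fst z j \<bullet> la (fst (q j)))" by (rule sum.permute[OF \<sigma>, symmetric])
    finally have 1: "(\<Sum>j=1..k. fst (?T z) j \<bullet> xi k (q \<circ> \<sigma>) j) = (\<Sum>j=1..k. fst z j \<bullet> xi k q j)"
      by (simp add: xi_def)
    have "(\<Sum>j=1..k. snd (?T z) j \<bullet> xi' k (q \<circ> \<sigma>) j) = (\<Sum>j=1..k. ((\<lambda>j. snd z j \<bullet> la (snd (q j))) \<circ> \<sigma>) j)"
      by (intro sum.cong) (auto simp: xi'_def)
    also have "\<dots> = (\<Sum>j=1..k. snd z j \<bullet> la (snd (q j)))" by (rule sum.permute[OF \<sigma>, symmetric])
    finally have 2: "(\<Sum>j=1..k. snd (?T z) j \<bullet> xi' k (q \<circ> \<sigma>) j) = (\<Sum>j=1..k. snd z j \<bullet> xi' k q j)"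
      by (simp add: xi'_def)
    show ?thesis unfolding chr_def 1 2 ..
  qed
  have "coef k \<gamma> (q \<circ> \<sigma>) = (\<integral>z. \<gamma> (fst z) (snd z) * ch k (q \<circ> \<sigma>) z \<partial>distr (PS k) (PS k) ?T)"
    unfolding distr_PS[OF d] by (rule coef_chr)
  also have "\<dots> = (\<integral>z. \<gamma> (fst (?T z)) (snd (?T z)) * ch k (q \<circ> \<sigma>) (?T z) \<partial>PS k)"
    by (rule integral_distr[OF m]) (use gm in measurable)
  also have "\<dots> = (\<integral>z. \<gamma> (fst z) (snd z) * ch k q z \<partial>PS k)"
    unfolding ch by (intro Bochner_Integration.integral_cong refl)
      (auto simp: phase_space_def space_pair_measure sym)
  finally show ?thesis by (simp add: coef_chr)
qed

section \<open>Adjoining a particle\<close>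

definition join :: "nat \<Rightarrow> (config \<times> config) \<times> (point \<times> point) \<Rightarrow> config \<times> config" where
  "join k w = ((fst (fst w))(k + 1 := fst (snd w)), (snd (fst w))(k + 1 := snd (snd w)))"

lemma nn_integral_TP_Suc:
  assumes "f \<in> borel_measurable (TP (k + 1))"
  shows "(\<integral>\<^sup>+x. f x \<partial>TP (k + 1)) = (\<integral>\<^sup>+x. \<integral>\<^sup>+y. f (x(k + 1 := y)) \<partial>TT \<partial>TP k)"
proof -
  have eq: "{1..k + 1} = insert (k + 1) {1..k}" by auto
  show ?thesis
    using assms unfolding torus_power_def eq by (intro P.product_nn_integral_insert) auto
qed

lemma upd_TP: "(\<lambda>w. (fst w)(k + 1 := snd w)) \<in> TP k \<Otimes>\<^sub>M TT \<rightarrow>\<^sub>M TP (k + 1)"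
proof -
  have eq: "{1..k + 1} = insert (k + 1) {1..k}" by auto
  show ?thesis unfolding torus_power_def eq
    by (rule measurable_fun_upd[where J = "{1..k}"]) auto
qed

lemma join_measurable: "join k \<in> PS k \<Otimes>\<^sub>M (TT \<Otimes>\<^sub>M TT) \<rightarrow>\<^sub>M PS (k + 1)"
proof -
  have 1: "(\<lambda>w. (fst (fst w), fst (snd w))) \<in> PS k \<Otimes>\<^sub>M (TT \<Otimes>\<^sub>M TT) \<rightarrow>\<^sub>M TP k \<Otimes>\<^sub>M TT"
    "(\<lambda>w. (snd (fst w), snd (snd w))) \<in> PS k \<Otimes>\<^sub>M (TT \<Otimes>\<^sub>M TT) \<rightarrow>\<^sub>M TP k \<Otimes>\<^sub>M TT"
    unfolding phase_space_def by measurable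
  show ?thesis
    unfolding join_def phase_space_def[of _ _ "k + 1"]
    using measurable_compose[OF 1(1) upd_TP] measurable_compose[OF 1(2) upd_TP]
    by (intro measurable_Pair) auto
qed

text \<open>The variables arrive in the order x, x', y, y' but are needed as x, y, x', y'; apart
  from this exchange the lemma is Tonelli's theorem.\<close>

lemma distr_join: "distr (PS k \<Otimes>\<^sub>M (TT \<Otimes>\<^sub>M TT)) (PS (k + 1)) (join k) = PS (k + 1)"
proof (rule measure_eqI)
  fix A assume "A \<in> sets (distr (PS k \<Otimes>\<^sub>M (TT \<Otimes>\<^sub>M TT)) (PS (k + 1)) (join k))"
  then have A: "A \<in> sets (PS (k + 1))" by simp
  let ?f = "indicator A :: config \<times> config \<Rightarrow> ennreal"
  have fm: "?f \<in> borel_measurable (TP (k + 1) \<Otimes>\<^sub>M TP (k + 1))" using A by (simp add: phase_space_def)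
  have fin: "finite_measure (TT \<Otimes>\<^sub>M TT)" by (rule finite_measure_pair_measure) (rule finite_measure_TT)+
  interpret T2: finite_measure "TT \<Otimes>\<^sub>M TT" by (rule fin)
  interpret Q: pair_sigma_finite TT "TP k" by standard
  have jm: "(\<lambda>w. ?f (join k w)) \<in> borel_measurable (PS k \<Otimes>\<^sub>M (TT \<Otimes>\<^sub>M TT))"
    using measurable_compose[OF join_measurable, of ?f] A by simp
  have "emeasure (distr (PS k \<Otimes>\<^sub>M (TT \<Otimes>\<^sub>M TT)) (PS (k + 1)) (join k)) A = (\<integral>\<^sup>+w. ?f (join k w) \<partial>(PS k \<Otimes>\<^sub>M (TT \<Otimes>\<^sub>M TT)))"
    using A by (subst nn_integral_distr[OF join_measurable, symmetric]) auto
  also have "\<dots> = (\<integral>\<^sup>+z. \<integral>\<^sup>+v. ?f (join k (z, v)) \<partial>(TT \<Otimes>\<^sub>M TT) \<partial>PS k)"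
    by (rule T2.nn_integral_fst[OF jm, symmetric])
  also have "\<dots> = (\<integral>\<^sup>+x. \<integral>\<^sup>+x'. \<integral>\<^sup>+v. ?f (join k ((x, x'), v)) \<partial>(TT \<Otimes>\<^sub>M TT) \<partial>TP k \<partial>TP k)"
    unfolding phase_space_def
    by (rule TP.nn_integral_fst[symmetric]) (rule T2.borel_measurable_nn_integral_fst, use jm in \<open>simp add: phase_space_def\<close>)
  also have "\<dots> = (\<integral>\<^sup>+x. \<integral>\<^sup>+x'. \<integral>\<^sup>+y. \<integral>\<^sup>+y'. ?f (join k ((x, x'), (y, y'))) \<partial>TT \<partial>TT \<partial>TP k \<partial>TP k)"
  proof (intro nn_integral_cong)
    fix x x' assume "x \<in> space (TP k)" "x' \<in> space (TP k)"
    then have "(x, x') \<in> space (PS k)" by (simp add: phase_space_def space_pair_measure)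
    from measurable_compose[OF measurable_Pair1'[OF this] jm]
    show "(\<integral>\<^sup>+v. ?f (join k ((x, x'), v)) \<partial>(TT \<Otimes>\<^sub>M TT)) = (\<integral>\<^sup>+y. \<integral>\<^sup>+y'. ?f (join k ((x, x'), (y, y'))) \<partial>TT \<partial>TT)"
      by (rule TT.nn_integral_fst[symmetric])
  qed
  also have "\<dots> = (\<integral>\<^sup>+x. \<integral>\<^sup>+y. \<integral>\<^sup>+x'. \<integral>\<^sup>+y'. ?f (join k ((x, x'), (y, y'))) \<partial>TT \<partial>TP k \<partial>TT \<partial>TP k)"
  proof (rule nn_integral_cong)
    fix x assume x: "x \<in> space (TP k)"
    have "(\<lambda>w. ((x, snd (fst w)), (fst (fst w), snd w))) \<in> (TT \<Otimes>\<^sub>M TP k) \<Otimes>\<^sub>M TT \<rightarrow>\<^sub>M PS k \<Otimes>\<^sub>M (TT \<Otimes>\<^sub>M TT)"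
      unfolding phase_space_def using x by measurable
    from measurable_compose[OF this jm]
    have "(\<lambda>v. \<integral>\<^sup>+y'. ?f (join k ((x, snd v), (fst v, y'))) \<partial>TT) \<in> borel_measurable (TT \<Otimes>\<^sub>M TP k)"
      by (intro TT.borel_measurable_nn_integral) (simp add: case_prod_beta')
    then show "(\<integral>\<^sup>+x'. \<integral>\<^sup>+y. \<integral>\<^sup>+y'. ?f (join k ((x, x'), (y, y'))) \<partial>TT \<partial>TT \<partial>TP k) =
      (\<integral>\<^sup>+y. \<integral>\<^sup>+x'. \<integral>\<^sup>+y'. ?f (join k ((x, x'), (y, y'))) \<partial>TT \<partial>TP k \<partial>TT)"
      using Q.Fubini'[of "\<lambda>y x'. \<integral>\<^sup>+y'. ?f (join k ((x, x'), (y, y'))) \<partial>TT"] by (simp add: case_prod_beta')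
  qed
  also have "\<dots> = (\<integral>\<^sup>+x. \<integral>\<^sup>+y. \<integral>\<^sup>+x'. ?f (x(k + 1 := y), x') \<partial>TP (k + 1) \<partial>TT \<partial>TP k)"
  proof (intro nn_integral_cong)
    fix x y assume xy: "x \<in> space (TP k)" "y \<in> space TT"
    have "x(k + 1 := y) \<in> space (TP (k + 1))"
      using measurable_space[OF upd_TP, of "(x, y)" k] xy by (simp add: space_pair_measure)
    from measurable_compose[OF measurable_Pair1'[OF this] fm]
    show "(\<integral>\<^sup>+x'. \<integral>\<^sup>+y'. ?f (join k ((x, x'), (y, y'))) \<partial>TT \<partial>TP k) = (\<integral>\<^sup>+x'. ?f (x(k + 1 := y), x') \<partial>TP (k + 1))"
      by (subst nn_integral_TP_Suc) (auto simp: join_def)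
  qed
  also have "\<dots> = (\<integral>\<^sup>+x. \<integral>\<^sup>+x'. ?f (x, x') \<partial>TP (k + 1) \<partial>TP (k + 1))"
    by (rule nn_integral_TP_Suc[symmetric]) (rule TP.borel_measurable_nn_integral_fst[OF fm])
  also have "\<dots> = (\<integral>\<^sup>+z. ?f z \<partial>PS (k + 1))"
    unfolding phase_space_def by (rule TP.nn_integral_fst[OF fm])
  finally show "emeasure (distr (PS k \<Otimes>\<^sub>M (TT \<Otimes>\<^sub>M TT)) (PS (k + 1)) (join k)) A = emeasure (PS (k + 1)) A"
    using A by simp
qed simp

definition LN :: "nat \<Rightarrow> (int \<times> int) set" where
  "LN N = {n. norm (la n) \<le> real N}"

lemma LN_minus: "- n \<in> LN N \<longleftrightarrow> n \<in> LN N"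
  by (simp add: LN_def lat_minus)

lemma finite_LN: "finite (LN N)"
proof -
  have "LN N \<subseteq> {- \<lceil>real N / \<theta>1\<rceil>..\<lceil>real N / \<theta>1\<rceil>} \<times> {- \<lceil>real N / \<theta>2\<rceil>..\<lceil>real N / \<theta>2\<rceil>}"
  proof
    fix n assume n: "n \<in> LN N"
    have "\<bar>fst (la n)\<bar> \<le> real N" "\<bar>snd (la n)\<bar> \<le> real N"
      using n norm_fst_le[of "fst (la n)" "snd (la n)"] norm_snd_le[of "snd (la n)" "fst (la n)"] unfolding LN_def by auto
    then have "\<theta>1 * \<bar>real_of_int (fst n)\<bar> \<le> real N" "\<theta>2 * \<bar>real_of_int (snd n)\<bar> \<le> real N"
      using \<theta>1 \<theta>2 by (auto simp: lat_def abs_mult)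
    then have "\<bar>real_of_int (fst n)\<bar> \<le> real N / \<theta>1" "\<bar>real_of_int (snd n)\<bar> \<le> real N / \<theta>2"
      using \<theta>1 \<theta>2 by (simp_all add: field_simps)
    then have "\<bar>fst n\<bar> \<le> \<lceil>real N / \<theta>1\<rceil>" "\<bar>snd n\<bar> \<le> \<lceil>real N / \<theta>2\<rceil>" by linarith+
    then show "n \<in> {- \<lceil>real N / \<theta>1\<rceil>..\<lceil>real N / \<theta>1\<rceil>} \<times> {- \<lceil>real N / \<theta>2\<rceil>..\<lceil>real N / \<theta>2\<rceil>}"
      by (cases n) auto
  qed
  then show ?thesis by (rule finite_subset) simp
qed

lemma dirac_partial_eq: "dirac_partial \<theta>1 \<theta>2 N x = (\<Sum>n\<in>LN N. cis (x \<bullet> la n)) / of_real V"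
proof -
  have "{\<eta> \<in> dual_lattice \<theta>1 \<theta>2. norm \<eta> \<le> real N} = la ` LN N"
    by (auto simp: dual_lattice_eq LN_def)
  then have "(\<Sum>\<eta>\<in>{\<eta> \<in> dual_lattice \<theta>1 \<theta>2. norm \<eta> \<le> real N}. cis (x \<bullet> \<eta>)) = (\<Sum>n\<in>LN N. cis (x \<bullet> la n))"
    by (simp add: sum.reindex inj_on_def)
  then have "dirac_partial \<theta>1 \<theta>2 N x = of_real (1 / V) * (\<Sum>n\<in>LN N. cis (x \<bullet> la n))"
    unfolding dirac_partial_def V_def by (rule arg_cong)
  then show ?thesis by simp
qed

definition ZN :: "nat \<Rightarrow> collision_index set" where
  "ZN N = UNIV \<times> LN N \<times> LN N"

lemma finite_ZN: "finite (ZN N)"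
  by (simp add: ZN_def finite_LN)

definition after :: "nat \<Rightarrow> nat \<Rightarrow> (nat \<Rightarrow> particle) \<Rightarrow> collision_index \<Rightarrow> nat \<Rightarrow> particle" where
  "after k j q z = q(j := lft (q j) z, k + 1 := rgt z)"

text \<open>The exponentials in the Dirac kernels combine with the character of order k into a
  single character of order k + 1: the j-th particle absorbs both kernel frequencies, and the new
  particle carries one of them on each side.\<close>

lemma chr_join:
  assumes j: "j \<in> {1..k}"
  shows "ch (k + 1) (after k j q z) (join k w) =
    cis ((if fst z then fst (fst w) j else snd (fst w) j) \<bullet> la (fst (snd z) + snd (snd z))
      - fst (snd w) \<bullet> la (fst (snd z)) - snd (snd w) \<bullet> la (snd (snd z))) * ch k q (fst w)"
proof -
  define r where "r = q(j := lft (q j) z)"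
  have e1: "(\<Sum>i=1..k+1. fst (join k w) i \<bullet> xi (k + 1) (after k j q z) i) =
      (\<Sum>i=1..k. fst (fst w) i \<bullet> xi k r i) + fst (snd w) \<bullet> la (fst (snd z))"
    using j by (simp add: join_def xi_def after_def rgt_def r_def)
  have e2: "(\<Sum>i=1..k+1. snd (join k w) i \<bullet> xi' (k + 1) (after k j q z) i) =
      (\<Sum>i=1..k. snd (fst w) i \<bullet> xi' k r i) - snd (snd w) \<bullet> la (snd (snd z))"
    using j by (simp add: join_def xi'_def after_def rgt_def r_def lat_minus)
  have 1: "ch (k + 1) (after k j q z) (join k w) =
     cis (- fst (snd w) \<bullet> la (fst (snd z)) - snd (snd w) \<bullet> la (snd (snd z))) * ch k r (fst w)"
    unfolding chr_def e1 e2 cis_mult by (simp add: algebra_simps)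
  have 2: "ch k r (fst w) = cis ((if fst z then fst (fst w) j else snd (fst w) j) \<bullet> la (fst (snd z) + snd (snd z))) * ch k q (fst w)"
    using chr_shift[OF j, of "fst w" "fst (snd z) + snd (snd z)" 0 q] chr_shift[OF j, of "fst w" 0 "fst (snd z) + snd (snd z)" q]
    by (auto simp: r_def lft_def)
  show ?thesis unfolding 1 2 mult.assoc[symmetric] cis_mult
    by (intro arg_cong2[of _ _ _ _ "(*)"] arg_cong[of _ _ cis] refl) simp
qed

text \<open>The truncated Dirac kernels are finite sums of exponentials, so the regularized
  collision term has coefficients that are finite combinations of those of order k + 1. Two kernels
  account for the factor 1 / V^2.\<close>

theorem fourier_collision_partial:
  assumes j: "j \<in> {1..k}" and \<gamma>: "density_matrix \<theta>1 \<theta>2 (k + 1) \<gamma>"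
  shows "coef k (collision_partial \<theta>1 \<theta>2 N k j \<gamma>) q =
    (\<Sum>z\<in>ZN N. sg z / (of_real V)\<^sup>2 * coef (k + 1) \<gamma> (after k j q z))"
proof -
  let ?g = "\<lambda>z. \<gamma> (fst z) (snd z)"
  let ?M = "PS k \<Otimes>\<^sub>M (TT \<Otimes>\<^sub>M TT)"
  have gi: "integrable (PS (k + 1)) ?g"
    using \<gamma> unfolding density_matrix_def by (simp add: case_prod_beta')
  have gch: "integrable (PS (k + 1)) (\<lambda>z. ?g z * ch (k + 1) r z)" for r by (rule integrable_chr_mult[OF gi])
  have int: "integrable ?M (\<lambda>w. ?g (join k w) * ch (k + 1) r (join k w))" for r
    using gch[of r] integrable_distr_eq[OF join_measurable, of "\<lambda>z. ?g z * ch (k + 1) r z" k] borel_measurable_integrable[OF gch[of r]]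
    unfolding distr_join by simp
  have cint: "coef (k + 1) \<gamma> r = (\<integral>w. ?g (join k w) * ch (k + 1) r (join k w) \<partial>?M)" for r
    unfolding coef_chr using integral_distr[OF join_measurable, of "\<lambda>z. ?g z * ch (k + 1) r z" k] borel_measurable_integrable[OF gch[of r]]
    unfolding distr_join by simp
  have fin: "finite_measure (TT \<Otimes>\<^sub>M TT)" by (rule finite_measure_pair_measure) (rule finite_measure_TT)+
  interpret T2: finite_measure "TT \<Otimes>\<^sub>M TT" by (rule fin)
  interpret PP: pair_sigma_finite "PS k" "TT \<Otimes>\<^sub>M TT" by standard
  define S where "S w = (\<Sum>z\<in>ZN N. sg z / (of_real V)\<^sup>2 * (?g (join k w) * ch (k + 1) (after k j q z) (join k w)))" for w
  have Sint: "integrable ?M S" unfolding S_def using int by auto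
  have S: "collision_partial \<theta>1 \<theta>2 N k j \<gamma> (fst x) (snd x) * ch k q x = (\<integral>y. S (x, y) \<partial>(TT \<Otimes>\<^sub>M TT))" for x
  proof -
    have K: "(dirac_partial \<theta>1 \<theta>2 N (a - y) * dirac_partial \<theta>1 \<theta>2 N (a - y')
        - dirac_partial \<theta>1 \<theta>2 N (b - y) * dirac_partial \<theta>1 \<theta>2 N (b - y'))
      = (\<Sum>z\<in>ZN N. sg z / (of_real V)\<^sup>2 * cis ((if fst z then a else b) \<bullet> la (fst (snd z) + snd (snd z)) - y \<bullet> la (fst (snd z)) - y' \<bullet> la (snd (snd z))))"
      for a b y y'
    proof -
      have "dirac_partial \<theta>1 \<theta>2 N (a - y) * dirac_partial \<theta>1 \<theta>2 N (a - y') =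
          (\<Sum>n\<in>LN N \<times> LN N. cis (a \<bullet> la (fst n + snd n) - y \<bullet> la (fst n) - y' \<bullet> la (snd n)) / (of_real V)\<^sup>2)" for a
        unfolding dirac_partial_eq times_divide_times_eq sum_product sum.cartesian_product case_prod_beta' cis_mult
          sum_divide_distrib power2_eq_square lat_add
        by (intro sum.cong refl) (simp add: inner_add_right inner_diff_left algebra_simps)
      moreover have "(\<Sum>z\<in>ZN N. f z) = (\<Sum>n\<in>LN N \<times> LN N. f (True, n)) + (\<Sum>n\<in>LN N \<times> LN N. f (False, n))" for f :: "collision_index \<Rightarrow> complex"
      proof -
        have "sum f (UNIV \<times> (LN N \<times> LN N)) = (\<Sum>b\<in>UNIV. \<Sum>n\<in>LN N \<times> LN N. f (b, n))"
          unfolding sum.cartesian_product by (intro sum.cong) auto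
        then show ?thesis by (simp add: ZN_def UNIV_bool add.commute)
      qed
      ultimately show ?thesis by (simp add: sg_def sum_subtractf[symmetric] sum_negf)
    qed
    have "collision_partial \<theta>1 \<theta>2 N k j \<gamma> (fst x) (snd x) * ch k q x =
      (\<integral>y. (dirac_partial \<theta>1 \<theta>2 N (fst x j - fst y) * dirac_partial \<theta>1 \<theta>2 N (fst x j - snd y)
        - dirac_partial \<theta>1 \<theta>2 N (snd x j - fst y) * dirac_partial \<theta>1 \<theta>2 N (snd x j - snd y)) * ?g (join k (x, y)) * ch k q x \<partial>(TT \<Otimes>\<^sub>M TT))"
      unfolding collision_partial_def by (simp add: case_prod_beta' join_def)
    also have "\<dots> = (\<integral>y. S (x, y) \<partial>(TT \<Otimes>\<^sub>M TT))"
      unfolding K S_def chr_join[OF j]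
      unfolding fst_conv snd_conv sum_distrib_right
      by (intro Bochner_Integration.integral_cong sum.cong refl) (simp add: mult_ac)
    finally show ?thesis .
  qed
  have "coef k (collision_partial \<theta>1 \<theta>2 N k j \<gamma>) q = (\<integral>x. (\<integral>y. S (x, y) \<partial>(TT \<Otimes>\<^sub>M TT)) \<partial>PS k)"
    unfolding coef_chr S ..
  also have "\<dots> = (\<integral>w. S w \<partial>?M)" by (rule PP.integral_fst'[OF Sint])
  also have "\<dots> = (\<Sum>z\<in>ZN N. sg z / (of_real V)\<^sup>2 * coef (k + 1) \<gamma> (after k j q z))"
    unfolding S_def cint using int by (subst Bochner_Integration.integral_sum) auto
  finally show ?thesis .
qed

end

subsection \<open>The collision operator in the interaction picture\<close>

lemma japanese_ge_1: "japanese x \<ge> 1"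
  by (simp add: japanese_def)

context torus_params
begin

definition ph :: "particle \<Rightarrow> real" where
  "ph q = (norm (la (fst q)))\<^sup>2 - (norm (la (snd q)))\<^sup>2"

text \<open>The collision coefficient in the interaction picture at time t0 + s r. With s = 1 or s =
  -1 the same local argument runs forwards and backwards from t0 in a variable r >= 0.\<close>

definition om :: "real \<Rightarrow> real \<Rightarrow> real \<Rightarrow> particle \<Rightarrow> collision_index \<Rightarrow> complex" where
  "om t0 s r q z = sg z / (of_real V)\<^sup>2 * cis ((t0 + s * r) * (ph q - ph (lft q z) - ph (rgt z)))"

definition J :: "real \<Rightarrow> int \<times> int \<Rightarrow> real" where
  "J \<alpha> n = japanese (la n) powr (2 * \<alpha>)"

lemma J_pos: "J \<alpha> n > 0"
  using japanese_ge_1[of "la n"] by (simp add: J_def)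

lemma norm_la: "(norm (la n))\<^sup>2 = \<theta>1\<^sup>2 * (real_of_int (fst n))\<^sup>2 + \<theta>2\<^sup>2 * (real_of_int (snd n))\<^sup>2"
  by (simp add: lat_def norm_Pair power_mult_distrib)

text \<open>Passes between Euclidean weights on the scaled lattice and the weights on integer
  coordinates. The constants depend only on the periods and alpha, and no relation between the
  periods is used.\<close>

lemma J_lweight:
  assumes "\<alpha> > 0"
  shows "\<exists>A>0. \<exists>B>0. \<forall>n. J \<alpha> n \<le> A / lweight \<alpha> n \<and> 1 / lweight \<alpha> n \<le> B * J \<alpha> n"
proof -
  define a where "a = 1 + \<theta>1 + \<theta>2"
  define b where "b = 1 + 1 / \<theta>1 + 1 / \<theta>2"
  have ab: "a > 0" "b > 0" using \<theta>1 \<theta>2 by (auto simp: a_def b_def add_pos_pos)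
  have inv: "1 / lweight \<alpha> n = lsize n powr (2 * \<alpha>)" for n
    by (simp add: lweight_def powr_minus divide_inverse)
  have le1: "japanese (la n) \<le> a * lsize n" for n
  proof -
    define x y where "x = \<bar>real_of_int (fst n)\<bar>" and "y = \<bar>real_of_int (snd n)\<bar>"
    have xy: "x \<ge> 0" "y \<ge> 0" by (auto simp: x_def y_def)
    have "1 + \<theta>1\<^sup>2 * x\<^sup>2 + \<theta>2\<^sup>2 * y\<^sup>2 \<le> (1 + \<theta>1 * x + \<theta>2 * y)\<^sup>2"
      using xy \<theta>1 \<theta>2 by (simp add: power2_eq_square algebra_simps)
    then have "japanese (la n) \<le> 1 + \<theta>1 * x + \<theta>2 * y"
      unfolding japanese_def norm_la using xy \<theta>1 \<theta>2 by (intro real_le_lsqrt) (auto simp: x_def y_def)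
    also have "\<dots> \<le> a * (1 + x + y)" using xy \<theta>1 \<theta>2 by (simp add: a_def algebra_simps)
    finally show ?thesis by (simp add: lsize_def x_def y_def)
  qed
  have le2: "lsize n \<le> b * japanese (la n)" for n
  proof -
    define x y where "x = \<bar>real_of_int (fst n)\<bar>" and "y = \<bar>real_of_int (snd n)\<bar>"
    have "\<theta>1 * x \<le> japanese (la n)"
      unfolding japanese_def norm_la x_def using \<theta>1 by (intro real_le_rsqrt) (simp add: power_mult_distrib)
    then have "x \<le> 1 / \<theta>1 * japanese (la n)" using \<theta>1 by (simp add: field_simps)
    moreover have "\<theta>2 * y \<le> japanese (la n)"
      unfolding japanese_def norm_la y_def using \<theta>2 by (intro real_le_rsqrt) (simp add: power_mult_distrib)
    then have "y \<le> 1 / \<theta>2 * japanese (la n)" using \<theta>2 by (simp add: field_simps)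
    ultimately have "1 + x + y \<le> japanese (la n) + 1 / \<theta>1 * japanese (la n) + 1 / \<theta>2 * japanese (la n)"
      using japanese_ge_1[of "la n"] by linarith
    then show ?thesis by (simp add: lsize_def x_def y_def b_def algebra_simps)
  qed
  have "J \<alpha> n \<le> a powr (2 * \<alpha>) / lweight \<alpha> n \<and> 1 / lweight \<alpha> n \<le> b powr (2 * \<alpha>) * J \<alpha> n" for n
  proof
    have "J \<alpha> n \<le> (a * lsize n) powr (2 * \<alpha>)"
      unfolding J_def using le1 assms japanese_ge_1[of "la n"] by (intro powr_mono2) auto
    also have "\<dots> = a powr (2 * \<alpha>) * (1 / lweight \<alpha> n)"
      unfolding inv using ab lsize_pos[of n] by (simp add: powr_mult)
    finally show "J \<alpha> n \<le> a powr (2 * \<alpha>) / lweight \<alpha> n" by simp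
    have "1 / lweight \<alpha> n \<le> (b * japanese (la n)) powr (2 * \<alpha>)"
      unfolding inv using le2 assms lsize_pos[of n] by (intro powr_mono2) auto
    also have "\<dots> = b powr (2 * \<alpha>) * J \<alpha> n"
      unfolding J_def using ab japanese_ge_1[of "la n"] by (simp add: powr_mult)
    finally show "1 / lweight \<alpha> n \<le> b powr (2 * \<alpha>) * J \<alpha> n" .
  qed
  then show ?thesis using ab by (intro exI[of _ "a powr (2 * \<alpha>)"] exI[of _ "b powr (2 * \<alpha>)"] conjI) auto
qed

abbreviation "phs \<equiv> phase (2 * \<theta>1\<^sup>2) (2 * \<theta>2\<^sup>2)"

text \<open>A collision changes only one of the two frequencies of a particle. The other one, v, is
  carried along as a parameter, with its weight on both sides.\<close>

lemma half_estimate: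
  assumes "\<alpha> > 1 / 2"
  shows "\<exists>C\<ge>0. \<forall>t0 s Z (g :: int \<times> int \<Rightarrow> int \<times> int \<Rightarrow> (int \<times> int) \<times> (int \<times> int) \<Rightarrow> complex).
    \<bar>s\<bar> = 1 \<longrightarrow> finite Z \<longrightarrow>
    (\<integral>\<^sup>+t\<in>{0..1}. csum (\<lambda>v. csum (\<lambda>x. ennreal (J \<alpha> v * J \<alpha> x *
        (cmod (\<Sum>m\<in>Z. cis ((t0 + s * t) * phs x m) * g v (x + fst m - snd m) m))\<^sup>2))) \<partial>lborel)
    \<le> ennreal C * csum (\<lambda>v. csum (\<lambda>a. csum (\<lambda>m. ennreal (J \<alpha> v * J \<alpha> a * J \<alpha> (fst m) * J \<alpha> (snd m) * (cmod (g v a m))\<^sup>2))))"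
proof -
  obtain A B where AB: "A > 0" "B > 0" "\<And>n. J \<alpha> n \<le> A / lweight \<alpha> n" "\<And>n. 1 / lweight \<alpha> n \<le> B * J \<alpha> n"
    using J_lweight[of \<alpha>] assms by auto
  obtain C where C: "C \<ge> 0" "\<And>t0 s Z (g :: int \<times> int \<Rightarrow> (int \<times> int) \<times> (int \<times> int) \<Rightarrow> complex).
    \<bar>s\<bar> = 1 \<Longrightarrow> finite Z \<Longrightarrow>
    (\<integral>\<^sup>+t\<in>{0..1}. csum (\<lambda>x. ennreal (1 / lweight \<alpha> x *
        (cmod (\<Sum>m\<in>Z. cis ((t0 + s * t) * phs x m) * g (x + fst m - snd m) m))\<^sup>2)) \<partial>lborel)
    \<le> ennreal C * csum (\<lambda>a. csum (\<lambda>m. ennreal ((cmod (g a m))\<^sup>2 / (lweight \<alpha> a * lweight \<alpha> (fst m) * lweight \<alpha> (snd m)))))"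
    using space_time_estimate[of \<alpha> "2 * \<theta>1\<^sup>2" "2 * \<theta>2\<^sup>2"] assms \<theta>1 \<theta>2 by auto
  show ?thesis
  proof (rule exI[of _ "A * C * B ^ 3"], intro conjI allI impI)
    show "0 \<le> A * C * B ^ 3" using AB C by simp
    fix t0 s :: real and Z :: "((int \<times> int) \<times> (int \<times> int)) set"
      and g :: "int \<times> int \<Rightarrow> int \<times> int \<Rightarrow> (int \<times> int) \<times> (int \<times> int) \<Rightarrow> complex"
    assume s: "\<bar>s\<bar> = 1" and Z: "finite Z"
    let ?f = "\<lambda>v x t. cmod (\<Sum>m\<in>Z. cis ((t0 + s * t) * phs x m) * g v (x + fst m - snd m) m)"
    have m1[measurable]: "(\<lambda>t. ennreal (1 / lweight \<alpha> x * (?f v x t)\<^sup>2)) \<in> borel_measurable borel" for v x by measurable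
    have m1'[measurable]: "(\<lambda>t. csum (\<lambda>x. ennreal (1 / lweight \<alpha> x * (?f v x t)\<^sup>2))) \<in> borel_measurable borel" for v
      by (intro borel_measurable_nn_integral_count_space m1) auto
    note m2 = m1'[unfolded measurable_lborel2[symmetric]]
    have "(\<integral>\<^sup>+t\<in>{0..1}. csum (\<lambda>v. csum (\<lambda>x. ennreal (J \<alpha> v * J \<alpha> x * (?f v x t)\<^sup>2))) \<partial>lborel)
      \<le> (\<integral>\<^sup>+t\<in>{0..1}. csum (\<lambda>v. csum (\<lambda>x. ennreal (J \<alpha> v * A) * ennreal (1 / lweight \<alpha> x * (?f v x t)\<^sup>2))) \<partial>lborel)"
    proof (intro nn_integral_mono mult_right_mono csum_mono)
      fix t v x
      have "J \<alpha> v * J \<alpha> x * (?f v x t)\<^sup>2 \<le> J \<alpha> v * (A / lweight \<alpha> x) * (?f v x t)\<^sup>2"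
        using AB(3)[of x] J_pos[of \<alpha> v] by (intro mult_right_mono mult_left_mono) auto
      also have "\<dots> = J \<alpha> v * A * (1 / lweight \<alpha> x * (?f v x t)\<^sup>2)" by simp
      finally show "ennreal (J \<alpha> v * J \<alpha> x * (?f v x t)\<^sup>2) \<le> ennreal (J \<alpha> v * A) * ennreal (1 / lweight \<alpha> x * (?f v x t)\<^sup>2)"
        using J_pos[of \<alpha> v] AB by (subst ennreal_mult[symmetric]) (auto intro!: ennreal_leI)
    qed simp
    also have "\<dots> = (\<integral>\<^sup>+t. csum (\<lambda>v. ennreal (J \<alpha> v * A) * (csum (\<lambda>x. ennreal (1 / lweight \<alpha> x * (?f v x t)\<^sup>2)) * indicator {0..1} t)) \<partial>lborel)"
      by (simp only: csum_cmult nn_integral_multc[OF borel_measurable_count_space, symmetric] mult.assoc)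
    also have "\<dots> = csum (\<lambda>v. \<integral>\<^sup>+t. ennreal (J \<alpha> v * A) * (csum (\<lambda>x. ennreal (1 / lweight \<alpha> x * (?f v x t)\<^sup>2)) * indicator {0..1} t) \<partial>lborel)"
      by (intro nn_integral_count_space_nn_integral borel_measurable_times_ennreal m2) auto
    also have "\<dots> = csum (\<lambda>v. ennreal (J \<alpha> v * A) * (\<integral>\<^sup>+t\<in>{0..1}. csum (\<lambda>x. ennreal (1 / lweight \<alpha> x * (?f v x t)\<^sup>2)) \<partial>lborel))"
      by (intro nn_integral_cong nn_integral_cmult borel_measurable_times_ennreal m2) auto
    also have "\<dots> \<le> csum (\<lambda>v. ennreal (J \<alpha> v * A) * (ennreal C * csum (\<lambda>a. csum (\<lambda>m. ennreal ((cmod (g v a m))\<^sup>2 / (lweight \<alpha> a * lweight \<alpha> (fst m) * lweight \<alpha> (snd m)))))))"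
      by (intro csum_mono mult_left_mono C s Z) simp
    also have "\<dots> \<le> csum (\<lambda>v. ennreal (A * C * B ^ 3) * csum (\<lambda>a. csum (\<lambda>m. ennreal (J \<alpha> v * J \<alpha> a * J \<alpha> (fst m) * J \<alpha> (snd m) * (cmod (g v a m))\<^sup>2))))"
    proof (rule csum_mono)
      fix v
      have "ennreal (J \<alpha> v * A) * (ennreal C * csum (\<lambda>a. csum (\<lambda>m. ennreal ((cmod (g v a m))\<^sup>2 / (lweight \<alpha> a * lweight \<alpha> (fst m) * lweight \<alpha> (snd m))))))
        = csum (\<lambda>a. csum (\<lambda>m. ennreal (J \<alpha> v * A) * (ennreal C * ennreal ((cmod (g v a m))\<^sup>2 / (lweight \<alpha> a * lweight \<alpha> (fst m) * lweight \<alpha> (snd m))))))"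
        by (simp only: csum_cmult)
      also have "\<dots> \<le> csum (\<lambda>a. csum (\<lambda>m. ennreal (A * C * B ^ 3) * ennreal (J \<alpha> v * J \<alpha> a * J \<alpha> (fst m) * J \<alpha> (snd m) * (cmod (g v a m))\<^sup>2)))"
      proof (intro csum_mono)
        fix a m
        let ?n = "(cmod (g v a m))\<^sup>2"
        have p: "0 \<le> 1 / lweight \<alpha> n" "0 \<le> B * J \<alpha> n" for n
          using AB J_pos[of \<alpha> n] by (auto simp: less_imp_le)
        have "?n / (lweight \<alpha> a * lweight \<alpha> (fst m) * lweight \<alpha> (snd m)) = ((1 / lweight \<alpha> a) * (1 / lweight \<alpha> (fst m)) * (1 / lweight \<alpha> (snd m))) * ?n"
          by simp
        also have "\<dots> \<le> ((B * J \<alpha> a) * (B * J \<alpha> (fst m)) * (B * J \<alpha> (snd m))) * ?n"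
          by (intro mult_right_mono mult_mono AB(4) mult_nonneg_nonneg p) simp
        finally have "(J \<alpha> v * A) * (C * (?n / (lweight \<alpha> a * lweight \<alpha> (fst m) * lweight \<alpha> (snd m))))
          \<le> (J \<alpha> v * A) * (C * (((B * J \<alpha> a) * (B * J \<alpha> (fst m)) * (B * J \<alpha> (snd m))) * ?n))"
          using AB C J_pos[of \<alpha> v] by (intro mult_left_mono) auto
        also have "\<dots> = A * C * B ^ 3 * (J \<alpha> v * J \<alpha> a * J \<alpha> (fst m) * J \<alpha> (snd m) * ?n)"
          by (simp add: power3_eq_cube)
        finally show "ennreal (J \<alpha> v * A) * (ennreal C * ennreal (?n / (lweight \<alpha> a * lweight \<alpha> (fst m) * lweight \<alpha> (snd m))))
          \<le> ennreal (A * C * B ^ 3) * ennreal (J \<alpha> v * J \<alpha> a * J \<alpha> (fst m) * J \<alpha> (snd m) * ?n)"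
          using AB C J_pos[of \<alpha> v] by (simp add: ennreal_leI flip: ennreal_mult')
      qed
      finally show "ennreal (J \<alpha> v * A) * (ennreal C * csum (\<lambda>a. csum (\<lambda>m. ennreal ((cmod (g v a m))\<^sup>2 / (lweight \<alpha> a * lweight \<alpha> (fst m) * lweight \<alpha> (snd m))))))
        \<le> ennreal (A * C * B ^ 3) * csum (\<lambda>a. csum (\<lambda>m. ennreal (J \<alpha> v * J \<alpha> a * J \<alpha> (fst m) * J \<alpha> (snd m) * (cmod (g v a m))\<^sup>2)))"
        by (simp only: csum_cmult)
    qed
    finally show "(\<integral>\<^sup>+t\<in>{0..1}. csum (\<lambda>v. csum (\<lambda>x. ennreal (J \<alpha> v * J \<alpha> x * (?f v x t)\<^sup>2))) \<partial>lborel)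
      \<le> ennreal (A * C * B ^ 3) * csum (\<lambda>v. csum (\<lambda>a. csum (\<lambda>m. ennreal (J \<alpha> v * J \<alpha> a * J \<alpha> (fst m) * J \<alpha> (snd m) * (cmod (g v a m))\<^sup>2))))"
      by (simp only: csum_cmult)
  qed
qed

definition wt :: "real \<Rightarrow> particle \<Rightarrow> real" where
  "wt \<alpha> q = japanese (la (fst q)) powr \<alpha> * japanese (la (snd q)) powr \<alpha>"

lemma wt_pos: "wt \<alpha> q > 0"
  using japanese_ge_1[of "la (fst q)"] japanese_ge_1[of "la (snd q)"] by (simp add: wt_def)

lemma wt_square: "(wt \<alpha> q)\<^sup>2 = J \<alpha> (fst q) * J \<alpha> (snd q)"
proof -
  have "(japanese x powr \<alpha>)\<^sup>2 = japanese x powr (2 * \<alpha>)" for x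
    using japanese_ge_1[of x] by (simp add: powr_power mult.commute)
  then show ?thesis by (simp add: wt_def J_def power_mult_distrib)
qed

text \<open>The frequency that the collision leaves alone cancels. For the other half the identity
  is |x|^2 - |x - u|^2 - |x - v|^2 + |x - u - v|^2 = 2 u . v, which explains the constants in
  \<open>phs\<close>; in the second term the sign is reversed because primed frequencies enter with
  a minus.\<close>

lemma phase_ph:
  "ph q - ph (lft q (True, \<eta>, \<eta>')) - ph (rgt (True, \<eta>, \<eta>')) = phs (fst q) (- \<eta>', \<eta>)"
  "ph q - ph (lft q (False, \<eta>, \<eta>')) - ph (rgt (False, \<eta>, \<eta>')) = - phs (snd q) (\<eta>, - \<eta>')"
  unfolding ph_def norm_la lft_def rgt_def phase_def
  by (simp_all add: power2_eq_square algebra_simps)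

definition collision_constant :: "real \<Rightarrow> real \<Rightarrow> bool" where
  "collision_constant \<alpha> K \<longleftrightarrow> (\<forall>t0 s T N (G :: particle \<Rightarrow> particle \<Rightarrow> complex). \<bar>s\<bar> = 1 \<longrightarrow> T \<le> 1 \<longrightarrow>
    (\<integral>\<^sup>+r. csum (\<lambda>q. ennreal ((wt \<alpha> q)\<^sup>2 * (cmod (\<Sum>z\<in>ZN N. om t0 s r q z * G (lft q z) (rgt z)))\<^sup>2)) \<partial>restrict_space lborel {0..T})
      \<le> ennreal K * csum (\<lambda>q1. csum (\<lambda>q2. ennreal ((wt \<alpha> q1 * wt \<alpha> q2)\<^sup>2 * (cmod (G q1 q2))\<^sup>2))))"

text \<open>The two signs of a collision act on different halves of the particle and are estimated
  separately. For the second one the minus sign of the phase is absorbed by reversing both t0 and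
  s.\<close>

theorem collision_estimate:
  assumes "\<alpha> > 1 / 2"
  shows "\<exists>K>0. collision_constant \<alpha> K"
proof -
  obtain C where C: "C \<ge> 0" "\<And>t0 s Z (g :: int \<times> int \<Rightarrow> int \<times> int \<Rightarrow> (int \<times> int) \<times> (int \<times> int) \<Rightarrow> complex).
    \<bar>s\<bar> = 1 \<Longrightarrow> finite Z \<Longrightarrow>
    (\<integral>\<^sup>+t\<in>{0..1}. csum (\<lambda>v. csum (\<lambda>x. ennreal (J \<alpha> v * J \<alpha> x *
        (cmod (\<Sum>m\<in>Z. cis ((t0 + s * t) * phs x m) * g v (x + fst m - snd m) m))\<^sup>2))) \<partial>lborel)
    \<le> ennreal C * csum (\<lambda>v. csum (\<lambda>a. csum (\<lambda>m. ennreal (J \<alpha> v * J \<alpha> a * J \<alpha> (fst m) * J \<alpha> (snd m) * (cmod (g v a m))\<^sup>2))))"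
    using half_estimate[OF assms] by auto
  \<comment> \<open>The 2 comes from |a - b|^2 <= 2 |a|^2 + 2 |b|^2, and V^4 from squaring the
    factor 1 / V^2.\<close>
  define c where "c = 2 / V ^ 4"
  have c0: "c > 0" using V_pos by (simp add: c_def)
  show ?thesis
    unfolding collision_constant_def
  \<comment> \<open>The summand 1 makes the constant positive, so that the step length in
    \<open>global_uniqueness\<close> may divide by it.\<close>
  proof (rule exI[of _ "c * C + c * C + 1"], intro conjI allI impI)
    show "0 < c * C + c * C + 1" using c0 C by (simp add: add_nonneg_pos)
    fix t0 s T :: real and N and G :: "particle \<Rightarrow> particle \<Rightarrow> complex"
    assume s: "\<bar>s\<bar> = 1" and T: "T \<le> 1"
    let ?R = "csum (\<lambda>q1. csum (\<lambda>q2. ennreal ((wt \<alpha> q1 * wt \<alpha> q2)\<^sup>2 * (cmod (G q1 q2))\<^sup>2)))"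
    \<comment> \<open>For the first sign the Schur variables (b, c) are (- eta', eta), whereas the
      new particle is (eta, - eta'); hence the exchange of \<open>fst m\<close> and
      \<open>snd m\<close>.\<close>
    define g1 where "g1 v a m = G (a, v) (snd m, fst m)" for v a :: "int \<times> int" and m :: "(int \<times> int) \<times> (int \<times> int)"
    define g2 where "g2 v a m = G (v, a) m" for v a :: "int \<times> int" and m :: "(int \<times> int) \<times> (int \<times> int)"
    define F1 where "F1 v x r = cmod (\<Sum>m\<in>LN N \<times> LN N. cis ((t0 + s * r) * phs x m) * g1 v (x + fst m - snd m) m)" for v x r
    define F2 where "F2 v x r = cmod (\<Sum>m\<in>LN N \<times> LN N. cis ((- t0 + (- s) * r) * phs x m) * g2 v (x + fst m - snd m) m)" for v x r
    have finZ: "finite (LN N \<times> LN N)" by (simp add: finite_LN)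
    have sum: "(\<Sum>z\<in>ZN N. om t0 s r q z * G (lft q z) (rgt z)) =
      ((\<Sum>m\<in>LN N \<times> LN N. cis ((t0 + s * r) * phs (fst q) m) * g1 (snd q) (fst q + fst m - snd m) m)
       - (\<Sum>m\<in>LN N \<times> LN N. cis ((- t0 + (- s) * r) * phs (snd q) m) * g2 (fst q) (snd q + fst m - snd m) m)) / (of_real V)\<^sup>2" for r q
    proof -
      have "(\<Sum>z\<in>ZN N. f z) = (\<Sum>n\<in>LN N \<times> LN N. f (True, n)) + (\<Sum>n\<in>LN N \<times> LN N. f (False, n))" for f :: "collision_index \<Rightarrow> complex"
      proof -
        have "sum f (UNIV \<times> (LN N \<times> LN N)) = (\<Sum>b\<in>UNIV. \<Sum>n\<in>LN N \<times> LN N. f (b, n))"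
          unfolding sum.cartesian_product by (intro sum.cong) auto
        then show ?thesis by (simp add: ZN_def UNIV_bool add.commute)
      qed
      moreover have "(\<Sum>n\<in>LN N \<times> LN N. om t0 s r q (True, n) * G (lft q (True, n)) (rgt (True, n))) =
        (\<Sum>m\<in>LN N \<times> LN N. cis ((t0 + s * r) * phs (fst q) m) * g1 (snd q) (fst q + fst m - snd m) m) / (of_real V)\<^sup>2"
      proof -
        let ?h = "\<lambda>n :: (int \<times> int) \<times> (int \<times> int). (- snd n, fst n)"
        have bij: "bij_betw ?h (LN N \<times> LN N) (LN N \<times> LN N)"
          by (rule bij_betw_byWitness[where f' = "\<lambda>m. (snd m, - fst m)"]) (simp_all add: LN_minus mem_Times_iff image_subset_iff)
        have "(\<Sum>m\<in>LN N \<times> LN N. cis ((t0 + s * r) * phs (fst q) m) * g1 (snd q) (fst q + fst m - snd m) m)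
          = (\<Sum>n\<in>LN N \<times> LN N. cis ((t0 + s * r) * phs (fst q) (?h n)) * g1 (snd q) (fst q + fst (?h n) - snd (?h n)) (?h n))"
          by (rule sum.reindex_bij_betw[OF bij, symmetric])
        moreover have "om t0 s r q (True, n) * G (lft q (True, n)) (rgt (True, n)) =
          cis ((t0 + s * r) * phs (fst q) (?h n)) * g1 (snd q) (fst q + fst (?h n) - snd (?h n)) (?h n) / (of_real V)\<^sup>2" for n
        proof -
          have "om t0 s r q (True, n) = cis ((t0 + s * r) * phs (fst q) (?h n)) / (of_real V)\<^sup>2"
            using phase_ph(1)[of q "fst n" "snd n"] by (simp add: om_def sg_def)
          moreover have "G (lft q (True, n)) (rgt (True, n)) = g1 (snd q) (fst q + fst (?h n) - snd (?h n)) (?h n)"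
            by (simp add: g1_def lft_def rgt_def diff_diff_eq add.commute)
          ultimately show ?thesis by simp
        qed
        ultimately show ?thesis by (simp add: sum_divide_distrib)
      qed
      moreover have "(\<Sum>n\<in>LN N \<times> LN N. om t0 s r q (False, n) * G (lft q (False, n)) (rgt (False, n))) =
        - (\<Sum>m\<in>LN N \<times> LN N. cis ((- t0 + (- s) * r) * phs (snd q) m) * g2 (fst q) (snd q + fst m - snd m) m) / (of_real V)\<^sup>2"
      proof -
        let ?h = "\<lambda>n :: (int \<times> int) \<times> (int \<times> int). (fst n, - snd n)"
        have bij: "bij_betw ?h (LN N \<times> LN N) (LN N \<times> LN N)"
          by (rule bij_betw_byWitness[where f' = ?h]) (simp_all add: LN_minus mem_Times_iff image_subset_iff)
        have "(\<Sum>m\<in>LN N \<times> LN N. cis ((- t0 + (- s) * r) * phs (snd q) m) * g2 (fst q) (snd q + fst m - snd m) m)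
          = (\<Sum>n\<in>LN N \<times> LN N. cis ((- t0 + (- s) * r) * phs (snd q) (?h n)) * g2 (fst q) (snd q + fst (?h n) - snd (?h n)) (?h n))"
          by (rule sum.reindex_bij_betw[OF bij, symmetric])
        moreover have "om t0 s r q (False, n) * G (lft q (False, n)) (rgt (False, n)) =
          - (cis ((- t0 + (- s) * r) * phs (snd q) (?h n)) * g2 (fst q) (snd q + fst (?h n) - snd (?h n)) (?h n)) / (of_real V)\<^sup>2" for n
        proof -
          have "(t0 + s * r) * - x = (- t0 + (- s) * r) * x" for x by (simp add: algebra_simps)
          then have "om t0 s r q (False, n) = - cis ((- t0 + (- s) * r) * phs (snd q) (?h n)) / (of_real V)\<^sup>2"
            using phase_ph(2)[of q "fst n" "snd n"] by (simp only: om_def prod.collapse sg_def fst_conv snd_conv if_False) simp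
          moreover have "G (lft q (False, n)) (rgt (False, n)) = g2 (fst q) (snd q + fst (?h n) - snd (?h n)) (?h n)"
            by (simp add: g2_def lft_def rgt_def add.assoc)
          ultimately show ?thesis by simp
        qed
        ultimately show ?thesis by (simp add: sum_divide_distrib sum_negf)
      qed
      ultimately show ?thesis by (simp add: diff_divide_distrib)
    qed
    have le: "(wt \<alpha> q)\<^sup>2 * (cmod (\<Sum>z\<in>ZN N. om t0 s r q z * G (lft q z) (rgt z)))\<^sup>2
      \<le> c * (J \<alpha> (snd q) * J \<alpha> (fst q) * (F1 (snd q) (fst q) r)\<^sup>2) + c * (J \<alpha> (fst q) * J \<alpha> (snd q) * (F2 (fst q) (snd q) r)\<^sup>2)" for q r
    proof -
      have "(cmod (a - b))\<^sup>2 \<le> 2 * (cmod a)\<^sup>2 + 2 * (cmod b)\<^sup>2" for a b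
      proof -
        have "(cmod (a - b))\<^sup>2 \<le> (cmod a + cmod b)\<^sup>2" by (intro power_mono norm_triangle_ineq4) simp
        also have "\<dots> \<le> 2 * (cmod a)\<^sup>2 + 2 * (cmod b)\<^sup>2"
          using zero_le_power2[of "cmod a - cmod b"] by (simp add: power2_eq_square algebra_simps)
        finally show ?thesis .
      qed
      then have sq: "(cmod ((a - b) / (of_real V)\<^sup>2))\<^sup>2 \<le> c * (cmod a)\<^sup>2 + c * (cmod b)\<^sup>2" for a b
      proof -
        have "(cmod ((a - b) / (of_real V)\<^sup>2))\<^sup>2 = (cmod (a - b))\<^sup>2 / V ^ 4"
          using V_pos by (simp add: norm_divide norm_power power_divide)
        also have "\<dots> \<le> (2 * (cmod a)\<^sup>2 + 2 * (cmod b)\<^sup>2) / V ^ 4"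
          using \<open>\<And>a b. (cmod (a - b))\<^sup>2 \<le> 2 * (cmod a)\<^sup>2 + 2 * (cmod b)\<^sup>2\<close> by (rule divide_right_mono) simp
        finally show ?thesis by (simp add: c_def add_divide_distrib)
      qed
      have "(cmod (\<Sum>z\<in>ZN N. om t0 s r q z * G (lft q z) (rgt z)))\<^sup>2 \<le> c * (F1 (snd q) (fst q) r)\<^sup>2 + c * (F2 (fst q) (snd q) r)\<^sup>2"
        unfolding sum F1_def F2_def by (rule sq)
      then have "(wt \<alpha> q)\<^sup>2 * (cmod (\<Sum>z\<in>ZN N. om t0 s r q z * G (lft q z) (rgt z)))\<^sup>2 \<le> (wt \<alpha> q)\<^sup>2 * (c * (F1 (snd q) (fst q) r)\<^sup>2 + c * (F2 (fst q) (snd q) r)\<^sup>2)"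
        by (intro mult_left_mono) auto
      then show ?thesis by (simp add: wt_square algebra_simps)
    qed
    have F1m[measurable]: "(\<lambda>r. F1 v x r) \<in> borel_measurable borel" for v x unfolding F1_def by measurable
    have F2m[measurable]: "(\<lambda>r. F2 v x r) \<in> borel_measurable borel" for v x unfolding F2_def by measurable
    let ?S1 = "\<lambda>r. csum (\<lambda>v. csum (\<lambda>x. ennreal (J \<alpha> v * J \<alpha> x * (F1 v x r)\<^sup>2)))"
    let ?S2 = "\<lambda>r. csum (\<lambda>v. csum (\<lambda>x. ennreal (J \<alpha> v * J \<alpha> x * (F2 v x r)\<^sup>2)))"
    have S1m[measurable]: "?S1 \<in> borel_measurable borel"
      by (intro borel_measurable_nn_integral_count_space) auto
    have S2m[measurable]: "?S2 \<in> borel_measurable borel"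
      by (intro borel_measurable_nn_integral_count_space) auto
    have "csum (\<lambda>q. ennreal ((wt \<alpha> q)\<^sup>2 * (cmod (\<Sum>z\<in>ZN N. om t0 s r q z * G (lft q z) (rgt z)))\<^sup>2)) \<le> ennreal c * ?S1 r + ennreal c * ?S2 r" for r
    proof -
      have "csum (\<lambda>q. ennreal ((wt \<alpha> q)\<^sup>2 * (cmod (\<Sum>z\<in>ZN N. om t0 s r q z * G (lft q z) (rgt z)))\<^sup>2))
        \<le> csum (\<lambda>q. ennreal c * ennreal (J \<alpha> (snd q) * J \<alpha> (fst q) * (F1 (snd q) (fst q) r)\<^sup>2) + ennreal c * ennreal (J \<alpha> (fst q) * J \<alpha> (snd q) * (F2 (fst q) (snd q) r)\<^sup>2))"
      proof (rule csum_mono)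
        fix q :: particle
        have "0 \<le> J \<alpha> n" for n using J_pos[of \<alpha> n] by simp
        then show "ennreal ((wt \<alpha> q)\<^sup>2 * (cmod (\<Sum>z\<in>ZN N. om t0 s r q z * G (lft q z) (rgt z)))\<^sup>2)
          \<le> ennreal c * ennreal (J \<alpha> (snd q) * J \<alpha> (fst q) * (F1 (snd q) (fst q) r)\<^sup>2) + ennreal c * ennreal (J \<alpha> (fst q) * J \<alpha> (snd q) * (F2 (fst q) (snd q) r)\<^sup>2)"
          using ennreal_leI[OF le[of q r]] c0 by (subst (1 2) ennreal_mult[symmetric]) (auto simp flip: ennreal_plus)
      qed
      also have "\<dots> = ennreal c * csum (\<lambda>q. ennreal (J \<alpha> (snd q) * J \<alpha> (fst q) * (F1 (snd q) (fst q) r)\<^sup>2)) + ennreal c * ?S2 r"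
        by (simp only: csum_add csum_cmult csum_prod)
      also have "csum (\<lambda>q. ennreal (J \<alpha> (snd q) * J \<alpha> (fst q) * (F1 (snd q) (fst q) r)\<^sup>2)) = ?S1 r"
        by (subst csum_swap) (simp only: csum_prod)
      finally show ?thesis .
    qed
    then have "(\<integral>\<^sup>+r. csum (\<lambda>q. ennreal ((wt \<alpha> q)\<^sup>2 * (cmod (\<Sum>z\<in>ZN N. om t0 s r q z * G (lft q z) (rgt z)))\<^sup>2)) \<partial>restrict_space lborel {0..T})
      \<le> (\<integral>\<^sup>+r. ennreal c * ?S1 r + ennreal c * ?S2 r \<partial>restrict_space lborel {0..T})"
      by (intro nn_integral_mono)
    also have "\<dots> = (\<integral>\<^sup>+r\<in>{0..T}. (ennreal c * ?S1 r + ennreal c * ?S2 r) \<partial>lborel)"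
      by (rule nn_integral_restrict_space) simp
    also have "\<dots> \<le> (\<integral>\<^sup>+r. ennreal c * (?S1 r * indicator {0..1} r) + ennreal c * (?S2 r * indicator {0..1} r) \<partial>lborel)"
      using T by (intro nn_integral_mono) (auto simp: indicator_def)
    also have "\<dots> = ennreal c * (\<integral>\<^sup>+r\<in>{0..1}. ?S1 r \<partial>lborel) + ennreal c * (\<integral>\<^sup>+r\<in>{0..1}. ?S2 r \<partial>lborel)"
      by (subst nn_integral_add) (auto simp: nn_integral_cmult)
    also have "\<dots> \<le> ennreal c * (ennreal C * ?R) + ennreal c * (ennreal C * ?R)"
    proof (intro add_mono mult_left_mono)
      have "(\<integral>\<^sup>+r\<in>{0..1}. ?S1 r \<partial>lborel) \<le> ennreal C * csum (\<lambda>v. csum (\<lambda>a. csum (\<lambda>m. ennreal (J \<alpha> v * J \<alpha> a * J \<alpha> (fst m) * J \<alpha> (snd m) * (cmod (g1 v a m))\<^sup>2))))"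
        unfolding F1_def by (rule C(2)[OF s finZ])
      also have "csum (\<lambda>v. csum (\<lambda>a. csum (\<lambda>m. ennreal (J \<alpha> v * J \<alpha> a * J \<alpha> (fst m) * J \<alpha> (snd m) * (cmod (g1 v a m))\<^sup>2)))) = ?R"
      proof -
        let ?H = "\<lambda>q1. csum (\<lambda>q2. ennreal ((wt \<alpha> q1 * wt \<alpha> q2)\<^sup>2 * (cmod (G q1 q2))\<^sup>2))"
        have "csum (\<lambda>m. ennreal (J \<alpha> v * J \<alpha> a * J \<alpha> (fst m) * J \<alpha> (snd m) * (cmod (g1 v a m))\<^sup>2)) =
          csum (\<lambda>q2. ennreal ((wt \<alpha> (a, v) * wt \<alpha> q2)\<^sup>2 * (cmod (G (a, v) q2))\<^sup>2))" for v a
          using csum_reindex[OF bij_swap, of "\<lambda>q2. ennreal ((wt \<alpha> (a, v) * wt \<alpha> q2)\<^sup>2 * (cmod (G (a, v) q2))\<^sup>2)"]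
          by (simp add: g1_def wt_square power_mult_distrib prod.swap_def mult_ac)
        then have "csum (\<lambda>v. csum (\<lambda>a. csum (\<lambda>m. ennreal (J \<alpha> v * J \<alpha> a * J \<alpha> (fst m) * J \<alpha> (snd m) * (cmod (g1 v a m))\<^sup>2)))) =
          csum (\<lambda>v. csum (\<lambda>a. ?H (a, v)))" by simp
        also have "\<dots> = csum (\<lambda>a. csum (\<lambda>v. ?H (a, v)))" by (rule csum_swap)
        also have "\<dots> = csum ?H" using csum_prod[of "\<lambda>a v. ?H (a, v)"] by (simp del: csum_prod)
        finally show ?thesis .
      qed
      finally show "(\<integral>\<^sup>+r\<in>{0..1}. ?S1 r \<partial>lborel) \<le> ennreal C * ?R" .
      have "\<bar>- s\<bar> = 1" using s by simp
      then have "(\<integral>\<^sup>+r\<in>{0..1}. ?S2 r \<partial>lborel) \<le> ennreal C * csum (\<lambda>v. csum (\<lambda>a. csum (\<lambda>m. ennreal (J \<alpha> v * J \<alpha> a * J \<alpha> (fst m) * J \<alpha> (snd m) * (cmod (g2 v a m))\<^sup>2))))"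
        unfolding F2_def by (rule C(2)[OF _ finZ])
      also have "csum (\<lambda>v. csum (\<lambda>a. csum (\<lambda>m. ennreal (J \<alpha> v * J \<alpha> a * J \<alpha> (fst m) * J \<alpha> (snd m) * (cmod (g2 v a m))\<^sup>2)))) = ?R"
      proof -
        let ?H = "\<lambda>q1. csum (\<lambda>q2. ennreal ((wt \<alpha> q1 * wt \<alpha> q2)\<^sup>2 * (cmod (G q1 q2))\<^sup>2))"
        have "csum (\<lambda>m. ennreal (J \<alpha> v * J \<alpha> a * J \<alpha> (fst m) * J \<alpha> (snd m) * (cmod (g2 v a m))\<^sup>2)) = ?H (v, a)" for v a
          by (simp add: g2_def wt_square power_mult_distrib mult_ac)
        then show ?thesis using csum_prod[of "\<lambda>v a. ?H (v, a)"] by simp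
      qed
      finally show "(\<integral>\<^sup>+r\<in>{0..1}. ?S2 r \<partial>lborel) \<le> ennreal C * ?R" .
    qed auto
    also have "\<dots> = ennreal (c * C + c * C) * ?R"
    proof -
      have "ennreal (c * C + c * C) = ennreal c * ennreal C + ennreal c * ennreal C"
        using c0 C(1) by (simp add: ennreal_plus ennreal_mult mult_2 mult.commute)
      then show ?thesis by (simp only: distrib_right mult.assoc)
    qed
    also have "\<dots> \<le> ennreal (c * C + c * C + 1) * ?R"
      by (intro mult_right_mono ennreal_leI) auto
    finally show "(\<integral>\<^sup>+r. csum (\<lambda>q. ennreal ((wt \<alpha> q)\<^sup>2 * (cmod (\<Sum>z\<in>ZN N. om t0 s r q z * G (lft q z) (rgt z)))\<^sup>2)) \<partial>restrict_space lborel {0..T})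
      \<le> ennreal (c * C + c * C + 1) * ?R" .
  qed
qed

end

subsection \<open>Solutions on the Fourier side\<close>

context torus_params
begin

definition Ph :: "nat \<Rightarrow> (nat \<Rightarrow> particle) \<Rightarrow> real" where
  "Ph k q = (\<Sum>j=1..k. ph (q j))"

definition Wt :: "real \<Rightarrow> nat \<Rightarrow> (nat \<Rightarrow> particle) \<Rightarrow> real" where
  "Wt \<alpha> k q = (\<Prod>j=1..k. (wt \<alpha> (q j))\<^sup>2)"

definition types :: "nat \<Rightarrow> (nat \<Rightarrow> particle) \<Rightarrow> particle multiset" where
  "types k q = image_mset q (mset_set {1..k})"

definition Col :: "nat \<Rightarrow> density \<Rightarrow> (nat \<Rightarrow> particle) \<Rightarrow> complex" where
  "Col k \<gamma> q = (\<Sum>j=1..k. collision \<theta>1 \<theta>2 k j \<gamma> (xi k q) (xi' k q))"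

lemma U_op_xi: "U_op k t c (xi k q) (xi' k q) = cis (- (t * Ph k q)) * c (xi k q) (xi' k q)"
proof -
  have "(\<Sum>j=1..k. (norm (xi k q j))\<^sup>2 - (norm (xi' k q j))\<^sup>2) = Ph k q"
    unfolding Ph_def ph_def by (intro sum.cong) (auto simp: xi_def xi'_def)
  then show ?thesis by (simp add: U_op_def)
qed

lemma Wt_nonneg: "0 \<le> Wt \<alpha> k q"
  by (simp add: Wt_def prod_nonneg)

lemma S_op_xi: "(cmod (S_op k \<alpha> c (xi k q) (xi' k q)))\<^sup>2 = Wt \<alpha> k q * (cmod (c (xi k q) (xi' k q)))\<^sup>2"
proof -
  have "(\<Prod>j=1..k. japanese (xi k q j) powr \<alpha>) * (\<Prod>j=1..k. japanese (xi' k q j) powr \<alpha>) = (\<Prod>j=1..k. wt \<alpha> (q j))"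
    unfolding wt_def prod.distrib[symmetric] by (intro prod.cong) (auto simp: xi_def xi'_def)
  then show ?thesis by (simp add: S_op_def norm_mult power_mult_distrib Wt_def prod_power_distrib flip: of_real_prod abs_prod)
qed

lemma wnorm_le_L2_norm:
  "wnorm (cfg {1..k}) (Wt \<alpha> k) (\<lambda>q. c (xi k q) (xi' k q)) \<le> ennreal (V ^ k) * L2_norm \<theta>1 \<theta>2 k (S_op k \<alpha> c)"
  using L2_norm_ge[where c = "S_op k \<alpha> c" and k = k] by (simp add: wnorm_def S_op_xi)

end

locale GP_class = torus_params +
  fixes b0 \<alpha> :: real and \<gamma>0 :: "nat \<Rightarrow> density" and \<gamma> :: "nat \<Rightarrow> real \<Rightarrow> density" and f g :: "real \<Rightarrow> real"
  assumes GP: "GP_solution \<theta>1 \<theta>2 b0 \<gamma>0 \<gamma>"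
    and permute: "\<And>k t x x' \<sigma>. k \<ge> 1 \<Longrightarrow> x \<in> space (TP k) \<Longrightarrow> x' \<in> space (TP k) \<Longrightarrow> \<sigma> permutes {1..k} \<Longrightarrow>
      \<gamma> k t (x \<circ> \<sigma>) (x' \<circ> \<sigma>) = \<gamma> k t x x'"
    and f_pos: "\<And>t. f t > 0"
    and bound: "\<And>t k j. k \<ge> 1 \<Longrightarrow> j \<in> {1..k} \<Longrightarrow>
      (\<integral>\<^sup>+s\<in>{t - g t..t + g t}. L2_norm \<theta>1 \<theta>2 k (S_op k \<alpha> (collision \<theta>1 \<theta>2 k j (\<gamma> (k + 1) s))) \<partial>lborel) \<le> ennreal (f t ^ (k + 1))"
begin

lemma density: "k \<ge> 1 \<Longrightarrow> density_matrix \<theta>1 \<theta>2 k (\<gamma> k t)"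
  using GP by (auto simp: GP_solution_def density_sequence_def)

lemma coef_measurable: "k \<ge> 1 \<Longrightarrow> (\<lambda>t. coef k (\<gamma> k t) q) \<in> borel_measurable borel"
  using GP xi_freq[of k q] by (auto simp: GP_solution_def density_sequence_def coef_def)

lemma coef_types:
  assumes k: "k \<ge> 1" and eq: "types k q = types k q'"
  shows "coef k (\<gamma> k t) q = coef k (\<gamma> k t) q'"
proof -
  obtain p where p: "p permutes {1..k}" "\<forall>j\<in>{1..k}. q j = q' (p j)"
    using image_mset_eq_implies_permutes[of "{1..k}" q q'] eq by (auto simp: types_def)
  have "xi k q = xi k (q' \<circ> p)" "xi' k q = xi' k (q' \<circ> p)"
    using p(2) by (auto simp: xi_def xi'_def fun_eq_iff)
  then have "coef k (\<gamma> k t) q = coef k (\<gamma> k t) (q' \<circ> p)" by (simp add: coef_def)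
  also have "\<dots> = coef k (\<gamma> k t) q'"
    using k p(1) by (intro coef_permute density permute) auto
  finally show ?thesis .
qed

lemma collision_lim:
  assumes k: "k \<ge> 1"
  shows "AE s in lborel. \<forall>q. (\<lambda>N. \<Sum>j=1..k. \<Sum>z\<in>ZN N. sg z / (of_real V)\<^sup>2 * coef (k + 1) (\<gamma> (k + 1) s) (after k j q z)) \<longlonglongrightarrow> Col k (\<gamma> (k + 1) s) q"
proof -
  have "AE s in lborel. \<forall>j\<in>{1..k}. collision_defined \<theta>1 \<theta>2 k j (\<gamma> (k + 1) s)"
    using GP k by (auto simp: GP_solution_def collisions_defined_def AE_finite_all)
  then show ?thesis
  proof eventually_elim
    case (elim s)
    show ?case
    proof
      fix q
      have "(\<lambda>N. \<Sum>z\<in>ZN N. sg z / (of_real V)\<^sup>2 * coef (k + 1) (\<gamma> (k + 1) s) (after k j q z)) \<longlonglongrightarrow> collision \<theta>1 \<theta>2 k j (\<gamma> (k + 1) s) (xi k q) (xi' k q)"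
        if j: "j \<in> {1..k}" for j
      proof -
        have "convergent (\<lambda>N. coef k (collision_partial \<theta>1 \<theta>2 N k j (\<gamma> (k + 1) s)) q)"
          using elim j xi_freq[of k q] by (auto simp: collision_defined_def coef_def)
        then have "(\<lambda>N. coef k (collision_partial \<theta>1 \<theta>2 N k j (\<gamma> (k + 1) s)) q) \<longlonglongrightarrow> collision \<theta>1 \<theta>2 k j (\<gamma> (k + 1) s) (xi k q) (xi' k q)"
          by (simp add: convergent_LIMSEQ_iff collision_def coef_def)
        then show ?thesis using j density[of "k + 1" s] by (simp add: fourier_collision_partial)
      qed
      then show "(\<lambda>N. \<Sum>j=1..k. \<Sum>z\<in>ZN N. sg z / (of_real V)\<^sup>2 * coef (k + 1) (\<gamma> (k + 1) s) (after k j q z)) \<longlonglongrightarrow> Col k (\<gamma> (k + 1) s) q"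
        unfolding Col_def by (rule tendsto_sum)
    qed
  qed
qed

lemma collision_measurable [measurable]:
  assumes "j \<in> {1..k}"
  shows "(\<lambda>s. collision \<theta>1 \<theta>2 k j (\<gamma> (k + 1) s) (xi k q) (xi' k q)) \<in> borel_measurable borel"
proof -
  have "(\<lambda>s. coef k (collision_partial \<theta>1 \<theta>2 N k j (\<gamma> (k + 1) s)) q) \<in> borel_measurable borel" for N
  proof -
    have "coef k (collision_partial \<theta>1 \<theta>2 N k j (\<gamma> (k + 1) s)) q =
      (\<Sum>z\<in>ZN N. sg z / (of_real V)\<^sup>2 * coef (k + 1) (\<gamma> (k + 1) s) (after k j q z))" for s
      by (rule fourier_collision_partial[OF assms density]) simp
    then show ?thesis using coef_measurable[of "k + 1"] by simp
  qed
  then have "(\<lambda>s. lim (\<lambda>N. coef k (collision_partial \<theta>1 \<theta>2 N k j (\<gamma> (k + 1) s)) q)) \<in> borel_measurable borel"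
    by (rule borel_measurable_lim_metric)
  then show ?thesis by (simp add: collision_def coef_def)
qed

lemma Col_measurable: "(\<lambda>s. Col k (\<gamma> (k + 1) s) q) \<in> borel_measurable borel"
  unfolding Col_def by (intro borel_measurable_sum collision_measurable)

text \<open>Multiplication by exp (i t Ph) undoes the free evolution, so the integrand no longer
  depends on t and integrals from different starting times can be subtracted.\<close>

lemma duhamel:
  assumes k: "k \<ge> 1"
  shows "interval_lebesgue_integrable lborel (ereal 0) (ereal t) (\<lambda>s. cis (s * Ph k q) * Col k (\<gamma> (k + 1) s) q)"
    and "cis (t * Ph k q) * coef k (\<gamma> k t) q = coef k (\<gamma>0 k) q
      - \<i> * of_real b0 * (LBINT s=ereal 0..ereal t. cis (s * Ph k q) * Col k (\<gamma> (k + 1) s) q)"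
proof -
  let ?U = "\<lambda>s. U_op k (t - s) (\<lambda>\<zeta> \<zeta>'. \<Sum>j=1..k. collision \<theta>1 \<theta>2 k j (\<gamma> (k + 1) s) \<zeta> \<zeta>') (xi k q) (xi' k q)"
  have D: "interval_lebesgue_integrable lborel (ereal 0) (ereal t) ?U"
    "coef k (\<gamma> k t) q = cis (- (t * Ph k q)) * coef k (\<gamma>0 k) q - \<i> * of_real b0 * (LBINT s=ereal 0..ereal t. ?U s)"
    using GP k xi_freq[of k q] unfolding GP_solution_def coef_def U_op_xi[symmetric] by blast+
  have U: "cis (s * Ph k q) * Col k (\<gamma> (k + 1) s) q = cis (t * Ph k q) * ?U s" for s
    unfolding U_op_xi by (simp add: Col_def mult.assoc[symmetric] cis_mult algebra_simps)
  show "interval_lebesgue_integrable lborel (ereal 0) (ereal t) (\<lambda>s. cis (s * Ph k q) * Col k (\<gamma> (k + 1) s) q)"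
    unfolding U using D(1) by (intro interval_lebesgue_integrable_mult_right)
  show "cis (t * Ph k q) * coef k (\<gamma> k t) q = coef k (\<gamma>0 k) q
      - \<i> * of_real b0 * (LBINT s=ereal 0..ereal t. cis (s * Ph k q) * Col k (\<gamma> (k + 1) s) q)"
    unfolding U interval_lebesgue_integral_mult_right D(2)
    by (simp add: right_diff_distrib mult.assoc[symmetric] cis_mult)
qed

lemma collision_bound:
  assumes k: "k \<ge> 1"
  shows "(\<integral>\<^sup>+s\<in>{t - g t..t + g t}. wnorm (cfg {1..k}) (Wt \<alpha> k) (Col k (\<gamma> (k + 1) s)) \<partial>lborel) \<le> ennreal (real k * V ^ k * f t ^ (k + 1))"
proof -
  let ?n = "\<lambda>j s. wnorm (cfg {1..k}) (Wt \<alpha> k) (\<lambda>q. collision \<theta>1 \<theta>2 k j (\<gamma> (k + 1) s) (xi k q) (xi' k q))"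
  let ?I = "indicator {t - g t..t + g t} :: real \<Rightarrow> ennreal"
  have cc: "countable (cfg {1..k} :: (nat \<Rightarrow> particle) set)" by (rule countable_cfg) simp
  have nm: "?n j \<in> borel_measurable borel" if "j \<in> {1..k}" for j
    by (intro wnorm_measurable cc collision_measurable that)
  have "wnorm (cfg {1..k}) (Wt \<alpha> k) (Col k (\<gamma> (k + 1) s)) \<le> (\<Sum>j=1..k. ?n j s)" for s
    unfolding Col_def by (intro wnorm_sum cc Wt_nonneg norm_sum) simp
  then have "(\<integral>\<^sup>+s. wnorm (cfg {1..k}) (Wt \<alpha> k) (Col k (\<gamma> (k + 1) s)) * ?I s \<partial>lborel) \<le> (\<integral>\<^sup>+s. (\<Sum>j=1..k. ?n j s * ?I s) \<partial>lborel)"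
    unfolding sum_distrib_right[symmetric] by (intro nn_integral_mono mult_right_mono) auto
  also have "\<dots> = (\<Sum>j=1..k. \<integral>\<^sup>+s. ?n j s * ?I s \<partial>lborel)"
    using nm by (intro nn_integral_sum) auto
  also have "\<dots> \<le> (\<Sum>j=1..k. ennreal (V ^ k * f t ^ (k + 1)))"
  proof (rule sum_mono)
    fix j assume j: "j \<in> {1..k}"
    have Vk: "V ^ k > 0" using V_pos by simp
    \<comment> \<open>Serves to pull V^k out of an integral of the measurable \<open>?n\<close>. The
      L2 norm, an infimum over candidate functions, then enters only through monotonicity of the
      integral.\<close>
    have inv: "ennreal (V ^ k) * (ennreal (1 / V ^ k) * a) = a" for a
    proof -
      have "ennreal (V ^ k) * ennreal (1 / V ^ k) = 1"
        using V_pos by (subst ennreal_mult[symmetric]) auto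
      then show ?thesis by (simp add: mult.assoc[symmetric])
    qed
    have "(\<integral>\<^sup>+s. ?n j s * ?I s \<partial>lborel) = (\<integral>\<^sup>+s. ennreal (V ^ k) * (ennreal (1 / V ^ k) * (?n j s * ?I s)) \<partial>lborel)"
      by (simp only: inv)
    also have "\<dots> = ennreal (V ^ k) * (\<integral>\<^sup>+s. ennreal (1 / V ^ k) * (?n j s * ?I s) \<partial>lborel)"
      using nm[OF j] by (intro nn_integral_cmult) auto
    also have "\<dots> \<le> ennreal (V ^ k) * (\<integral>\<^sup>+s. L2_norm \<theta>1 \<theta>2 k (S_op k \<alpha> (collision \<theta>1 \<theta>2 k j (\<gamma> (k + 1) s))) * ?I s \<partial>lborel)"
    proof (intro mult_left_mono nn_integral_mono)
      fix s
      have "ennreal (1 / V ^ k) * ?n j s \<le> ennreal (1 / V ^ k) * (ennreal (V ^ k) * L2_norm \<theta>1 \<theta>2 k (S_op k \<alpha> (collision \<theta>1 \<theta>2 k j (\<gamma> (k + 1) s))))"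
        by (intro mult_left_mono wnorm_le_L2_norm) simp
      also have "\<dots> = L2_norm \<theta>1 \<theta>2 k (S_op k \<alpha> (collision \<theta>1 \<theta>2 k j (\<gamma> (k + 1) s)))"
        by (simp only: mult.left_commute[of "ennreal (1 / V ^ k)"] inv)
      finally show "ennreal (1 / V ^ k) * (?n j s * ?I s) \<le> L2_norm \<theta>1 \<theta>2 k (S_op k \<alpha> (collision \<theta>1 \<theta>2 k j (\<gamma> (k + 1) s))) * ?I s"
        unfolding mult.assoc[symmetric] by (rule mult_right_mono) simp
    qed simp
    also have "\<dots> \<le> ennreal (V ^ k) * ennreal (f t ^ (k + 1))"
      by (intro mult_left_mono bound k j) simp
    finally show "(\<integral>\<^sup>+s. ?n j s * ?I s \<partial>lborel) \<le> ennreal (V ^ k * f t ^ (k + 1))"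
      using Vk by (simp add: ennreal_mult')
  qed
  also have "\<dots> = ennreal (real k * V ^ k * f t ^ (k + 1))"
    using V_pos f_pos[of t] by (simp add: ennreal_of_nat_eq_real_of_nat ennreal_mult' mult.assoc)
  finally show ?thesis .
qed

end

subsection \<open>Uniqueness on the Fourier side\<close>

lemma AE_affine:
  fixes s t0 :: real
  assumes "s \<noteq> 0" "AE x in lborel. P x"
  shows "AE r in lborel. P (t0 + s * r)"
proof -
  obtain N where N: "{x \<in> space lborel. \<not> P x} \<subseteq> N" "emeasure lborel N = 0" "N \<in> sets lborel"
    using AE_E[OF assms(2)] by metis
  then have "AE x in lborel. x \<notin> N" by (intro AE_not_in) (auto simp: null_sets_def)
  moreover have "Measurable.pred borel (\<lambda>x. x \<notin> N)" using N(3) by (simp add: pred_def)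
  ultimately have "AE r in lborel. t0 + s * r \<notin> N" using assms(1) by (intro AE_borel_affine)
  then show ?thesis by eventually_elim (use N(1) in auto)
qed

text \<open>Rewrites an oriented integral between t0 and t0 + s r as an unoriented one over r > 0,
  so that both directions of time share one formula.\<close>

lemma interval_integral_affine:
  fixes f :: "real \<Rightarrow> complex"
  assumes f [measurable]: "f \<in> borel_measurable borel"
    and int: "\<And>t. interval_lebesgue_integrable lborel (ereal 0) (ereal t) f"
    and s: "\<bar>s\<bar> = 1" and r: "r \<ge> 0"
  shows "(LBINT x=ereal 0..ereal (t0 + s * r). f x) - (LBINT x=ereal 0..ereal t0. f x) =
    of_real s * (LINT x|lborel. indicator {0<..<r} x *\<^sub>R f (t0 + s * x))"
proof -
  have sI: "set_integrable lborel {- M..M} f" if M: "M > 0" for M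
  proof -
    have "set_integrable lborel {0<..<M} f" "set_integrable lborel {- M<..<0} f"
      using int[of M] int[of "- M"] M by (auto simp: interval_lebesgue_integrable_def)
    then have U: "set_integrable lborel ({0<..<M} \<union> {- M<..<0}) f" by (intro set_integrable_Un) auto
    have "AE x in lborel. x \<notin> {- M, 0, M}"
      by (intro AE_not_in countable_imp_null_set_lborel) auto
    then have "AE x in lborel. indicator ({0<..<M} \<union> {- M<..<0}) x *\<^sub>R f x = indicator {- M..M} x *\<^sub>R f x"
      by eventually_elim (auto simp: indicator_def)
    then show ?thesis
      using U unfolding set_integrable_def by (rule integrable_cong_AE_imp[rotated 2]) simp
  qed
  define M where "M = \<bar>t0\<bar> + r + 1"
  have "set_integrable lborel {- M..M} f" using r by (intro sI) (simp add: M_def)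
  moreover define a b where "a = min 0 (min t0 (t0 + s * r))" and "b = max 0 (max t0 (t0 + s * r))"
  moreover have "- M \<le> a" "b \<le> M"
  proof -
    have "\<bar>s * r\<bar> = r" using s r by (simp add: abs_mult)
    then have "- M \<le> t0 + s * r" "t0 + s * r \<le> M" "- M \<le> t0" "t0 \<le> M" "0 \<le> M"
      unfolding M_def using r by linarith+
    then show "- M \<le> a" "b \<le> M" by (simp_all add: a_def b_def)
  qed
  moreover have "a \<le> b" by (simp add: a_def b_def)
  ultimately have "set_integrable lborel {a<..<b} f"
    by (elim set_integrable_subset) (simp, use \<open>- M \<le> a\<close> \<open>b \<le> M\<close> in fastforce)
  then have "interval_lebesgue_integrable lborel (min (ereal 0) (min (ereal t0) (ereal (t0 + s * r))))
    (max (ereal 0) (max (ereal t0) (ereal (t0 + s * r)))) f"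
    unfolding ereal_min[symmetric] ereal_max[symmetric] a_def[symmetric] b_def[symmetric]
    using \<open>a \<le> b\<close> by (simp add: interval_lebesgue_integrable_def)
  from interval_integral_sum[OF this]
  have "(LBINT x=ereal 0..ereal (t0 + s * r). f x) - (LBINT x=ereal 0..ereal t0. f x) = (LBINT x=ereal t0..ereal (t0 + s * r). f x)"
    by (simp add: algebra_simps)
  also have "\<dots> = of_real s * (LINT x|lborel. indicator {0<..<r} x *\<^sub>R f (t0 + s * x))"
  proof -
    have "s = 1 \<or> s = - 1" using s by auto
    then show ?thesis
    proof
      assume s: "s = 1"
      have "(LBINT x=ereal t0..ereal (t0 + s * r). f x) = (LINT x|lborel. indicator {t0<..<t0 + r} x *\<^sub>R f x)"
        using r by (simp add: s interval_lebesgue_integral_def set_lebesgue_integral_def)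
      also have "\<dots> = (LINT x|lborel. indicator {t0<..<t0 + r} (t0 + 1 * x) *\<^sub>R f (t0 + 1 * x))"
        by (subst lborel_integral_real_affine[where c = 1 and t = t0]) auto
      finally show ?thesis by (simp add: s indicator_def)
    next
      assume s: "s = - 1"
      have "(LBINT x=ereal t0..ereal (t0 + s * r). f x) = - (LINT x|lborel. indicator {t0 - r<..<t0} x *\<^sub>R f x)"
        using r by (auto simp: s interval_lebesgue_integral_def set_lebesgue_integral_def)
      also have "(LINT x|lborel. indicator {t0 - r<..<t0} x *\<^sub>R f x) = (LINT x|lborel. indicator {t0 - r<..<t0} (t0 + (- 1) * x) *\<^sub>R f (t0 + (- 1) * x))"
        by (subst lborel_integral_real_affine[where c = "- 1" and t = t0]) auto
      also have "\<dots> = (LINT x|lborel. indicator {0<..<r} x *\<^sub>R f (t0 + s * x))"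
        by (intro Bochner_Integration.integral_cong) (auto simp: s indicator_def)
      finally show ?thesis by (simp add: s)
    qed
  qed
  finally show ?thesis .
qed

locale coef_hierarchy = torus_params +
  fixes \<alpha> b0 :: real and d C :: "nat \<Rightarrow> real \<Rightarrow> (nat \<Rightarrow> particle) \<Rightarrow> complex" and F G :: "real \<Rightarrow> real"
  assumes \<alpha>: "\<alpha> > 1 / 2" and b0: "b0 \<noteq> 0"
    and d_types: "\<And>k t q q'. k \<ge> 1 \<Longrightarrow> types k q = types k q' \<Longrightarrow> d k t q = d k t q'"
    and C_measurable: "\<And>k q. (\<lambda>s. C k s q) \<in> borel_measurable borel"
    and C_lim: "\<And>k. k \<ge> 1 \<Longrightarrow> AE s in lborel. \<forall>q.
      (\<lambda>N. \<Sum>j=1..k. \<Sum>z\<in>ZN N. sg z / (of_real V)\<^sup>2 * d (k + 1) s (after k j q z)) \<longlonglongrightarrow> C k s q"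
    and C_integrable: "\<And>k t q. k \<ge> 1 \<Longrightarrow>
      interval_lebesgue_integrable lborel (ereal 0) (ereal t) (\<lambda>s. cis (s * Ph k q) * C k s q)"
    and d_duhamel: "\<And>k t q. k \<ge> 1 \<Longrightarrow>
      cis (t * Ph k q) * d k t q = - \<i> * of_real b0 * (LBINT s=ereal 0..ereal t. cis (s * Ph k q) * C k s q)"
    and F_pos: "\<And>t. F t > 0" and F_cont: "continuous_on UNIV F"
    and G_pos: "\<And>t. G t > 0" and G_cont: "continuous_on UNIV G"
    and C_bound: "\<And>k t. k \<ge> 1 \<Longrightarrow>
      (\<integral>\<^sup>+s\<in>{t - G t..t + G t}. wnorm (cfg {1..k}) (Wt \<alpha> k) (C k s) \<partial>lborel) \<le> ennreal (F t ^ (k + 1))"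
begin

text \<open>A representative configuration of each multiset. By \<open>d_types\<close> its choice
  does not affect d, and by \<open>C_types\<close> it does not affect C at almost every
  time.\<close>

definition enum :: "nat \<Rightarrow> particle multiset \<Rightarrow> nat \<Rightarrow> particle" where
  "enum k M = (SOME q. types k q = M)"

definition PhM :: "particle multiset \<Rightarrow> real" where
  "PhM M = (\<Sum>p\<in>#M. ph p)"

definition dm :: "nat \<Rightarrow> real \<Rightarrow> particle multiset \<Rightarrow> complex" where
  "dm k t M = cis (t * PhM M) * d k t (enum k M)"

definition cm :: "nat \<Rightarrow> real \<Rightarrow> particle multiset \<Rightarrow> complex" where
  "cm k t M = (if size M = k then cis (t * PhM M) * C k t (enum k M) else 0)"

lemma types_enum:
  assumes "size M = k"
  shows "types k (enum k M) = M"
proof -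
  have "\<exists>q. types k q = M" using ex_cfg_image_mset[of "{1..k}" M] assms by (auto simp: types_def)
  then show ?thesis unfolding enum_def by (rule someI_ex)
qed

lemma size_types [simp]: "size (types k q) = k"
  by (simp add: types_def)

lemma PhM_types: "PhM (types k q) = Ph k q"
  by (simp add: PhM_def types_def Ph_def multiset.map_comp comp_def sum_unfold_sum_mset[symmetric])

lemma dm_types: "k \<ge> 1 \<Longrightarrow> dm k t (types k q) = cis (t * Ph k q) * d k t q"
  using d_types[of k "enum k (types k q)" q t] types_enum[of "types k q" k] by (simp add: dm_def PhM_types)

lemma types_after:
  assumes "j \<in> {1..k}"
  shows "types (k + 1) (after k j q z) = add_mset (lft (q j) z) (add_mset (rgt z) (types k q - {#q j#}))"
proof -
  have m: "mset_set {1..k} = add_mset j (mset_set ({1..k} - {j}))"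
    by (rule mset_set.remove) (use assms in auto)
  then have 1: "types k q = add_mset (q j) (image_mset q (mset_set ({1..k} - {j})))"
    by (simp add: types_def)
  have "mset_set {1..k + 1} = add_mset (k + 1) (mset_set {1..k})"
    by (simp add: atLeastAtMostSuc_conv)
  then have "mset_set {1..k + 1} = add_mset (k + 1) (add_mset j (mset_set ({1..k} - {j})))"
    by (simp only: m)
  moreover have "image_mset (after k j q z) (mset_set ({1..k} - {j})) = image_mset q (mset_set ({1..k} - {j}))"
    by (intro image_mset_cong) (auto simp: after_def)
  ultimately have "types (k + 1) (after k j q z) = add_mset (rgt z) (add_mset (lft (q j) z) (image_mset q (mset_set ({1..k} - {j}))))"
    using assms unfolding types_def by (simp only: image_mset_add_mset) (simp add: after_def)
  then show ?thesis by (simp add: 1 add_mset_commute)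
qed

text \<open>Each collision changes the total phase by the phases of the particles it removes and
  creates, and that change is the oscillation attached to the collision. The left side thus depends
  on q only through its multiset.\<close>

lemma collision_types:
  "(\<Sum>j=1..k. \<Sum>z\<in>ZN N. sg z / (of_real V)\<^sup>2 * d (k + 1) t (after k j q z)) =
   cis (- (t * PhM (types k q))) * (\<Sum>p\<in>#types k q. \<Sum>z\<in>ZN N. sg z / (of_real V)\<^sup>2 *
     cis (t * (ph p - ph (lft p z) - ph (rgt z))) * dm (k + 1) t (add_mset (lft p z) (add_mset (rgt z) (types k q - {#p#}))))"
proof -
  let ?s = "\<lambda>p z. sg z / (of_real V)\<^sup>2 *
     cis (t * (ph p - ph (lft p z) - ph (rgt z))) * dm (k + 1) t (add_mset (lft p z) (add_mset (rgt z) (types k q - {#p#})))"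
  have "(\<Sum>p\<in>#types k q. \<Sum>z\<in>ZN N. ?s p z) = (\<Sum>j=1..k. \<Sum>z\<in>ZN N. ?s (q j) z)"
    by (simp add: types_def multiset.map_comp comp_def sum_unfold_sum_mset)
  also have "\<dots> = (\<Sum>j=1..k. \<Sum>z\<in>ZN N. cis (t * Ph k q) * (sg z / (of_real V)\<^sup>2 * d (k + 1) t (after k j q z)))"
  proof (intro sum.cong refl)
    fix j z assume j: "j \<in> {1..k}"
    have m: "q j \<in># types k q" using j by (simp add: types_def)
    have ph: "Ph (k + 1) (after k j q z) = Ph k q - ph (q j) + ph (lft (q j) z) + ph (rgt z)"
      unfolding PhM_types[symmetric] types_after[OF j] using arg_cong[OF insert_DiffM[OF m], of PhM]
      by (simp add: PhM_def)
    have "cis (t * (ph (q j) - ph (lft (q j) z) - ph (rgt z))) * cis (t * Ph (k + 1) (after k j q z)) = cis (t * Ph k q)"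
      unfolding cis_mult distrib_left[symmetric] ph by simp
    then show "?s (q j) z = cis (t * Ph k q) * (sg z / (of_real V)\<^sup>2 * d (k + 1) t (after k j q z))"
      unfolding types_after[OF j, symmetric] by (subst dm_types) (simp_all add: mult_ac)
  qed
  also have "\<dots> = cis (t * Ph k q) * (\<Sum>j=1..k. \<Sum>z\<in>ZN N. sg z / (of_real V)\<^sup>2 * d (k + 1) t (after k j q z))"
    by (simp only: sum_distrib_left)
  finally have "cis (- (t * PhM (types k q))) * (\<Sum>p\<in>#types k q. \<Sum>z\<in>ZN N. ?s p z) =
    cis (- (t * Ph k q)) * cis (t * Ph k q) * (\<Sum>j=1..k. \<Sum>z\<in>ZN N. sg z / (of_real V)\<^sup>2 * d (k + 1) t (after k j q z))"
    by (simp only: PhM_types mult.assoc)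
  then show ?thesis unfolding cis_mult by simp
qed

text \<open>At almost every time, C is a limit of expressions that see only the multiset, so it
  inherits symmetry from d.\<close>

lemma C_types:
  assumes "k \<ge> 1"
  shows "AE s in lborel. \<forall>q q'. types k q = types k q' \<longrightarrow> C k s q = C k s q'"
  using C_lim[OF assms]
proof eventually_elim
  case (elim s)
  show ?case
  proof (intro allI impI)
    fix q q' assume "types k q = types k q'"
    then show "C k s q = C k s q'"
      using LIMSEQ_unique[OF elim[rule_format, of q]] elim[rule_format, of q'] unfolding collision_types by simp
  qed
qed

lemma cm_measurable: "(\<lambda>s. cm k s M) \<in> borel_measurable borel"
  unfolding cm_def using C_measurable by simp

lemma dm_integral:
  assumes k: "k \<ge> 1" and 0: "\<And>q. d k t0 q = 0" and s: "\<bar>s\<bar> = 1" and r: "r \<ge> 0" and M: "size M = k"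
  shows "dm k (t0 + s * r) M = - \<i> * of_real b0 * of_real s * (LINT x|lborel. indicator {0<..<r} x *\<^sub>R cm k (t0 + s * x) M)"
proof -
  let ?f = "\<lambda>x. cis (x * Ph k (enum k M)) * C k x (enum k M)"
  have e: "types k (enum k M) = M" by (rule types_enum[OF M])
  have cm: "cm k x M = ?f x" for x using PhM_types[of k "enum k M"] M by (simp add: cm_def e)
  have "dm k (t0 + s * r) M = - \<i> * of_real b0 * (LBINT x=ereal 0..ereal (t0 + s * r). ?f x)"
    using dm_types[OF k, of "t0 + s * r" "enum k M"] d_duhamel[OF k] by (simp add: e)
  moreover have "0 = - \<i> * of_real b0 * (LBINT x=ereal 0..ereal t0. ?f x)"
    using d_duhamel[OF k, of t0 "enum k M"] 0 by simp
  ultimately have "dm k (t0 + s * r) M = - \<i> * of_real b0 * ((LBINT x=ereal 0..ereal (t0 + s * r). ?f x) - (LBINT x=ereal 0..ereal t0. ?f x))"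
    unfolding right_diff_distrib by simp
  also have "\<dots> = - \<i> * of_real b0 * (of_real s * (LINT x|lborel. indicator {0<..<r} x *\<^sub>R ?f (t0 + s * x)))"
    by (subst interval_integral_affine[OF _ C_integrable[OF k] s r]) (use C_measurable in simp_all)
  finally show ?thesis by (simp add: cm mult.assoc)
qed

definition RN :: "nat \<Rightarrow> particle set" where
  "RN N = {q. fst q \<in> LN N \<and> snd q \<in> LN N}"

lemma branching_intro:
  assumes K: "K > 0" "collision_constant \<alpha> K"
    and s: "\<bar>s\<bar> = 1" and T: "0 \<le> T" "T \<le> 1"
  shows "branching (wt \<alpha>) lft rgt (om t0 s) ZN RN T K"
proof
  fix N N' :: nat and z assume N: "N \<le> N'"
  have LN: "n \<in> LN N \<Longrightarrow> n \<in> LN N'" for n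
  proof -
    have "real N \<le> real N'" using N by simp
    then show "n \<in> LN N \<Longrightarrow> n \<in> LN N'" unfolding LN_def mem_Collect_eq by linarith
  qed
  show "z \<in> ZN N \<longleftrightarrow> z \<in> ZN N' \<and> rgt z \<in> RN N"
    using LN[of "fst (snd z)"] LN[of "snd (snd z)"] by (simp add: ZN_def RN_def rgt_def mem_Times_iff LN_minus) blast
next
  fix q :: particle
  have "q \<in> RN N" if "nat \<lceil>norm (la (fst q)) + norm (la (snd q))\<rceil> \<le> N" for N
  proof -
    have "norm (la (fst q)) + norm (la (snd q)) \<le> real N" using that by linarith
    then have "norm (la (fst q)) \<le> real N" "norm (la (snd q)) \<le> real N"
      using norm_ge_zero[of "la (fst q)"] norm_ge_zero[of "la (snd q)"] by linarith+
    then show ?thesis by (simp add: RN_def LN_def)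
  qed
  then show "\<exists>N0. \<forall>N\<ge>N0. q \<in> RN N" by blast
next
  show "(\<lambda>r. om t0 s r q z) \<in> borel_measurable borel" for q z
    unfolding om_def by measurable
qed (use K s T wt_pos finite_ZN in \<open>auto simp: collision_constant_def\<close>)

lemma norm_bound:
  assumes k: "k \<ge> 1" and s: "\<bar>s\<bar> = 1" and T: "0 \<le> T" "T \<le> G t0"
  shows "(\<integral>\<^sup>+r. wnorm (cfg {1..k}) (Wt \<alpha> k) (lift {1..k} (cm k (t0 + s * r))) \<partial>restrict_space lborel {0..T}) \<le> ennreal (F t0 ^ (k + 1))"
proof -
  define n where "n x = wnorm (cfg {1..k}) (Wt \<alpha> k) (C k x)" for x
  have n[measurable]: "n \<in> borel_measurable borel"
    unfolding n_def by (intro wnorm_measurable countable_cfg C_measurable) simp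
  have "AE x in lborel. wnorm (cfg {1..k}) (Wt \<alpha> k) (lift {1..k} (cm k x)) = n x"
    using C_types[OF k]
  proof eventually_elim
    case (elim x)
    have "cmod (lift {1..k} (cm k x) q) = cmod (C k x q)" for q
    proof -
      have "types k (enum k (types k q)) = types k q" by (rule types_enum) simp
      then have "C k x (enum k (types k q)) = C k x q" using elim by blast
      moreover have "lift {1..k} (cm k x) q = cm k x (types k q)" by (simp only: lift_def types_def)
      ultimately show ?thesis by (simp add: cm_def norm_mult)
    qed
    then show ?case by (simp add: wnorm_def n_def)
  qed
  then have "AE r in lborel. wnorm (cfg {1..k}) (Wt \<alpha> k) (lift {1..k} (cm k (t0 + s * r))) = n (t0 + s * r)"
    using s by (intro AE_affine) auto
  then have "AE r in restrict_space lborel {0..T}. wnorm (cfg {1..k}) (Wt \<alpha> k) (lift {1..k} (cm k (t0 + s * r))) = n (t0 + s * r)"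
    by (subst AE_restrict_space_iff) auto
  then have "(\<integral>\<^sup>+r. wnorm (cfg {1..k}) (Wt \<alpha> k) (lift {1..k} (cm k (t0 + s * r))) \<partial>restrict_space lborel {0..T}) =
    (\<integral>\<^sup>+r. n (t0 + s * r) \<partial>restrict_space lborel {0..T})"
    by (rule nn_integral_cong_AE)
  also have "\<dots> = (\<integral>\<^sup>+r\<in>{0..T}. n (t0 + s * r) \<partial>lborel)"
    by (rule nn_integral_restrict_space) simp
  also have "\<dots> \<le> (\<integral>\<^sup>+r. n (t0 + s * r) * indicator {t0 - G t0..t0 + G t0} (t0 + s * r) \<partial>lborel)"
  proof (intro nn_integral_mono mult_left_mono)
    fix r
    show "indicator {0..T} r \<le> (indicator {t0 - G t0..t0 + G t0} (t0 + s * r) :: ennreal)"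
    proof (cases "r \<in> {0..T}")
      case True
      then have "\<bar>s * r\<bar> \<le> G t0" using s T by (simp add: abs_mult)
      then have "t0 + s * r \<in> {t0 - G t0..t0 + G t0}" by (simp add: abs_le_iff)
      then show ?thesis by (simp add: indicator_def)
    qed (auto simp: indicator_def)
  qed simp
  also have "\<dots> = ennreal \<bar>s\<bar> * (\<integral>\<^sup>+r. n (t0 + s * r) * indicator {t0 - G t0..t0 + G t0} (t0 + s * r) \<partial>lborel)"
    by (simp add: s)
  also have "\<dots> = (\<integral>\<^sup>+x\<in>{t0 - G t0..t0 + G t0}. n x \<partial>lborel)"
    by (rule nn_integral_real_affine[symmetric, where c = s and t = t0]) (use s in auto)
  also have "\<dots> \<le> ennreal (F t0 ^ (k + 1))" unfolding n_def by (rule C_bound[OF k])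
  finally show ?thesis .
qed

text \<open>The hierarchy argument makes the collision terms vanish at almost every time of the
  interval. The Duhamel formula started at t0 then gives zero at every time, for all orders at once,
  as needed to restart.\<close>

lemma local_uniqueness:
  assumes K: "K > 0" "collision_constant \<alpha> K"
    and 0: "\<And>k q. k \<ge> 1 \<Longrightarrow> d k t0 q = 0" and s: "\<bar>s\<bar> = 1"
    and T: "0 \<le> T" "T \<le> 1" "T \<le> G t0" and small: "4 * \<bar>b0\<bar> * sqrt (K * T) * F t0 < 1"
    and k: "k \<ge> 1" and r: "r \<in> {0..T}"
  shows "d k (t0 + s * r) q = 0"
proof -
  let ?c = "\<lambda>k r M. cm k (t0 + s * r) M" and ?lam = "- \<i> * of_real b0 * of_real s :: complex"
  interpret B: branching "wt \<alpha>" lft rgt "om t0 s" ZN RN T K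
    by (rule branching_intro[OF K s T(1,2)])
  have dm: "dm k (t0 + s * r) M = ?lam * (LINT x|B.LT. indicator {..<r} x *\<^sub>R ?c k x M)"
    if "k \<ge> 1" "size M = k" "r \<in> {0..T}" for k M r
  proof -
    have "AE x in lborel. x \<noteq> 0" by (rule AE_lborel_singleton)
    then have "AE x in lborel. indicator {0<..<r} x *\<^sub>R ?c k x M = indicator {0..T} x *\<^sub>R indicator {..<r} x *\<^sub>R ?c k x M"
      by eventually_elim (use that in \<open>auto simp: indicator_def\<close>)
    then have "(LINT x|lborel. indicator {0<..<r} x *\<^sub>R ?c k x M) = (LINT x|lborel. indicator {0..T} x *\<^sub>R indicator {..<r} x *\<^sub>R ?c k x M)"
      using measurable_compose[OF _ cm_measurable[of k M], of "\<lambda>x. t0 + s * x"] by (intro integral_cong_AE) auto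
    then show ?thesis
      using dm_integral[OF that(1) 0[OF that(1)] s _ that(2), of r] that(3)
      by (simp add: integral_restrict_space)
  qed
  interpret H: hierarchy "wt \<alpha>" lft rgt "om t0 s" ZN RN T K ?c ?lam "F t0"
  proof
    show "(\<lambda>r. ?c k r M) \<in> borel_measurable borel" for k M
      using measurable_compose[OF _ cm_measurable[of k M], of "\<lambda>x. t0 + s * x"] by simp
    show "(\<integral>\<^sup>+r. B.nk k (?c k r) \<partial>B.LT) \<le> ennreal (F t0 ^ (k + 1))" if "k \<ge> 1" for k
    proof -
      have "B.wgt {1..k} = Wt \<alpha> k" by (simp add: B.wgt_def Wt_def fun_eq_iff)
      then have "B.nk k X = wnorm (cfg {1..k}) (Wt \<alpha> k) (lift {1..k} X)" for X
        using B.nrm_lift[of "{1..k}" k X] by (simp add: B.nrm_def)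
      then show ?thesis using norm_bound[OF that s T(1,3)] by simp
    qed
    show "0 \<le> F t0" using F_pos[of t0] by simp
    show "4 * cmod ?lam * sqrt (K * T) * F t0 < 1" using small s by (simp add: norm_mult)
    fix k :: nat assume k: "k \<ge> 1"
    have "AE r in B.LT. \<forall>q. (\<lambda>N. \<Sum>j=1..k. \<Sum>z\<in>ZN N. sg z / (of_real V)\<^sup>2 * d (k + 1) (t0 + s * r) (after k j q z)) \<longlonglongrightarrow> C k (t0 + s * r) q"
    proof (subst AE_restrict_space_iff)
      have "s \<noteq> 0" using s by auto
      from AE_affine[OF this C_lim[OF k], of t0]
      show "AE r in lborel. r \<in> {0..T} \<longrightarrow> (\<forall>q. (\<lambda>N. \<Sum>j=1..k. \<Sum>z\<in>ZN N. sg z / (of_real V)\<^sup>2 * d (k + 1) (t0 + s * r) (after k j q z)) \<longlonglongrightarrow> C k (t0 + s * r) q)"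
        by eventually_elim blast
    qed simp
    moreover have "AE r in B.LT. r \<in> space B.LT" by (rule AE_space)
    ultimately show "AE r in B.LT. \<forall>M. size M = k \<longrightarrow>
      (\<lambda>N. ?lam * B.Bop N r (\<lambda>M'. LINT s|B.LT. indicator {..<r} s *\<^sub>R ?c (k + 1) s M') M) \<longlonglongrightarrow> ?c k r M"
    proof eventually_elim
      case (elim r)
      then have r: "r \<in> {0..T}" by (simp add: space_restrict_space)
      let ?t = "t0 + s * r"
      show ?case
      proof (intro allI impI)
        fix M :: "particle multiset" assume M: "size M = k"
        have e: "types k (enum k M) = M" by (rule types_enum[OF M])
        have "?lam * B.Bop N r (\<lambda>M'. LINT s|B.LT. indicator {..<r} s *\<^sub>R ?c (k + 1) s M') M =
          cis (?t * PhM M) * (\<Sum>j=1..k. \<Sum>z\<in>ZN N. sg z / (of_real V)\<^sup>2 * d (k + 1) ?t (after k j (enum k M) z))" for N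
        proof -
          have "?lam * B.Bop N r (\<lambda>M'. LINT s|B.LT. indicator {..<r} s *\<^sub>R ?c (k + 1) s M') M =
            (\<Sum>p\<in>#M. \<Sum>z\<in>ZN N. om t0 s r p z * (?lam * (LINT x|B.LT. indicator {..<r} x *\<^sub>R ?c (k + 1) x (add_mset (lft p z) (add_mset (rgt z) (M - {#p#}))))))"
            unfolding B.Bop_def sum_mset_distrib_left sum_distrib_left by (simp only: mult.left_commute)
          also have "\<dots> = (\<Sum>p\<in>#M. \<Sum>z\<in>ZN N. om t0 s r p z * dm (k + 1) ?t (add_mset (lft p z) (add_mset (rgt z) (M - {#p#}))))"
          proof (intro arg_cong[where f = sum_mset] image_mset_cong sum.cong refl arg_cong2[where f = "(*)"])
            fix p z assume "p \<in># M"
            then have "size (add_mset (lft p z) (add_mset (rgt z) (M - {#p#}))) = k + 1"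
              using M size_Suc_Diff1[of p M] by simp
            then show "?lam * (LINT x|B.LT. indicator {..<r} x *\<^sub>R ?c (k + 1) x (add_mset (lft p z) (add_mset (rgt z) (M - {#p#})))) =
              dm (k + 1) ?t (add_mset (lft p z) (add_mset (rgt z) (M - {#p#})))"
              using dm[of "k + 1" _ r] r by simp
          qed
          also have "\<dots> = cis (?t * PhM M) * (\<Sum>j=1..k. \<Sum>z\<in>ZN N. sg z / (of_real V)\<^sup>2 * d (k + 1) ?t (after k j (enum k M) z))"
            unfolding collision_types e mult.assoc[symmetric] cis_mult by (simp add: om_def)
          finally show ?thesis .
        qed
        moreover have "?c k r M = cis (?t * PhM M) * C k ?t (enum k M)" using M by (simp add: cm_def)
        ultimately show "(\<lambda>N. ?lam * B.Bop N r (\<lambda>M'. LINT s|B.LT. indicator {..<r} s *\<^sub>R ?c (k + 1) s M') M) \<longlonglongrightarrow> ?c k r M"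
          using elim(1) by (simp only:) (intro tendsto_mult_left, blast)
      qed
    qed
  qed
  have "AE x in B.LT. indicator {..<r} x *\<^sub>R ?c k x (types k q) = 0"
    using H.hierarchy_zero[OF size_types k, of q] by eventually_elim simp
  then have "(LINT x|B.LT. indicator {..<r} x *\<^sub>R ?c k x (types k q)) = 0" by (rule integral_eq_zero_AE)
  then have "dm k (t0 + s * r) (types k q) = 0" using dm[OF k _ r, of "types k q"] by simp
  then show ?thesis using dm_types[OF k] by simp
qed

text \<open>The set of times at which all orders vanish contains 0. It is open by local uniqueness,
  and closed because the admissible step length is continuous and positive.\<close>

theorem global_uniqueness:
  assumes k: "k \<ge> 1"
  shows "d k t q = 0"
proof -
  obtain K where K: "K > 0" "collision_constant \<alpha> K"
    using collision_estimate[OF \<alpha>] by blast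
  \<comment> \<open>The bounds 1 and \<open>G x\<close> are the range of the space-time estimate and
    of the class bound. The third makes the squared smallness quantity at most 16 / 32 = 1 /
    2.\<close>
  define T where "T x = min 1 (min (G x) (1 / (32 * b0\<^sup>2 * K * (F x)\<^sup>2)))" for x
  have T_pos: "T x > 0" for x using G_pos[of x] F_pos[of x] K b0 by (simp add: T_def)
  have T_cont: "continuous_on UNIV T"
  proof -
    have "F x \<noteq> 0" for x using F_pos[of x] by simp
    then show ?thesis unfolding T_def using G_cont F_cont K(1) b0 by (intro continuous_intros) auto
  qed
  have small: "4 * \<bar>b0\<bar> * sqrt (K * T x) * F x < 1" for x
  proof -
    have "K * T x \<le> K * (1 / (32 * b0\<^sup>2 * K * (F x)\<^sup>2))" using K by (intro mult_left_mono) (auto simp: T_def)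
    also have "\<dots> = 1 / (32 * (b0 * F x)\<^sup>2)" using K by (simp add: power_mult_distrib)
    finally have "(4 * \<bar>b0\<bar> * F x)\<^sup>2 * (K * T x) \<le> (4 * \<bar>b0\<bar> * F x)\<^sup>2 * (1 / (32 * (b0 * F x)\<^sup>2))"
      by (intro mult_left_mono) auto
    also have "\<dots> = 1 / 2" using b0 F_pos[of x] by (simp add: power_mult_distrib)
    finally have "(4 * \<bar>b0\<bar> * sqrt (K * T x) * F x)\<^sup>2 \<le> 1 / 2"
      using K T_pos[of x] by (simp add: power_mult_distrib mult_ac)
    then have "(4 * \<bar>b0\<bar> * sqrt (K * T x) * F x)\<^sup>2 < 1\<^sup>2" by simp
    then show ?thesis by (rule power2_less_imp_less) simp
  qed
  define A where "A = {t. \<forall>k\<ge>1. \<forall>q. d k t q = 0}"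
  have near: "y \<in> A" if x: "x \<in> A" "\<bar>y - x\<bar> \<le> T x" for x y
  proof -
    define s where "s = (if y \<ge> x then 1 else - 1 :: real)"
    have y: "y = x + s * \<bar>y - x\<bar>" by (simp add: s_def)
    have "d k (x + s * \<bar>y - x\<bar>) q = 0" if "k \<ge> 1" for k q
    proof (rule local_uniqueness[OF K, where T = "T x"])
      show "\<bar>s\<bar> = 1" by (simp add: s_def)
      show "4 * \<bar>b0\<bar> * sqrt (K * T x) * F x < 1" by (rule small)
    qed (use x T_pos[of x] that in \<open>auto simp: A_def T_def\<close>)
    then show ?thesis unfolding A_def using y by simp
  qed
  have "d k 0 q = 0" if "k \<ge> 1" for k q
    using d_duhamel[OF that, of 0 q] by (simp add: interval_lebesgue_integral_def set_lebesgue_integral_def)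
  then have "0 \<in> A" by (simp add: A_def)
  moreover have "open A"
    unfolding open_dist
  proof
    fix x assume "x \<in> A"
    then show "\<exists>e>0. \<forall>y. dist y x < e \<longrightarrow> y \<in> A"
      using near T_pos[of x] by (intro exI[of _ "T x"]) (auto simp: dist_real_def)
  qed
  moreover have "closed A"
    unfolding closed_sequential_limits
  proof (intro allI impI)
    fix x l assume x: "(\<forall>n. x n \<in> A) \<and> x \<longlonglongrightarrow> l"
    \<comment> \<open>The step lengths at x n tend to T l > 0 while the distances to l tend to 0, so
      one step from some x n reaches l.\<close>
    have "isCont T l" using T_cont by (simp add: continuous_on_eq_continuous_at)
    then have "(\<lambda>n. T (x n)) \<longlonglongrightarrow> T l" by (rule isCont_tendsto_compose) (use x in simp)
    moreover have "(\<lambda>n. \<bar>l - x n\<bar>) \<longlonglongrightarrow> \<bar>l - l\<bar>" using x by (intro tendsto_intros) auto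
    ultimately have "(\<lambda>n. T (x n) - \<bar>l - x n\<bar>) \<longlonglongrightarrow> T l - \<bar>l - l\<bar>" by (rule tendsto_diff)
    then have "eventually (\<lambda>n. T (x n) - \<bar>l - x n\<bar> > 0) sequentially"
      using T_pos[of l] by (intro order_tendstoD) auto
    then obtain n where "T (x n) - \<bar>l - x n\<bar> > 0" by (auto simp: eventually_sequentially)
    then show "l \<in> A" using near[of "x n" l] x by simp
  qed
  ultimately have "A = UNIV" using clopen[of A] by blast
  then show ?thesis using k by (auto simp: A_def)
qed

end

lemma (in torus_params) uniqueness:
  assumes \<gamma>: "GP_class \<theta>1 \<theta>2 b0 \<alpha> \<gamma>0 \<gamma> f1 g1" and \<sigma>: "GP_class \<theta>1 \<theta>2 b0 \<alpha> \<gamma>0 \<sigma> f2 g2"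
    and f1: "continuous_on UNIV f1" and f2: "continuous_on UNIV f2"
    and g1: "continuous_on UNIV g1" "\<And>t. g1 t > 0" and g2: "continuous_on UNIV g2" "\<And>t. g2 t > 0"
    and \<alpha>: "\<alpha> > 1 / 2" and b0: "b0 \<noteq> 0" and k: "k \<ge> 1"
  shows "AE z in PS k. \<gamma> k t (fst z) (snd z) = \<sigma> k t (fst z) (snd z)"
proof -
  interpret A: GP_class \<theta>1 \<theta>2 b0 \<alpha> \<gamma>0 \<gamma> f1 g1 by (rule \<gamma>)
  interpret B: GP_class \<theta>1 \<theta>2 b0 \<alpha> \<gamma>0 \<sigma> f2 g2 by (rule \<sigma>)
  define d where "d k t q = coef k (\<gamma> k t) q - coef k (\<sigma> k t) q" for k t q
  define C where "C k s q = Col k (\<gamma> (k + 1) s) q - Col k (\<sigma> (k + 1) s) q" for k s q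
  \<comment> \<open>Absorbs k V^k (f1^(k+1) + f2^(k+1)) into one power k + 1, using k <= 2^k, V^k <=
    (1 + V)^(k+1), and one further factor 2 for the two solutions.\<close>
  define F where "F t = 2 * (1 + V) * (f1 t + f2 t)" for t
  define G where "G t = min (g1 t) (g2 t)" for t
  interpret H: coef_hierarchy \<theta>1 \<theta>2 \<alpha> b0 d C F G
  proof
    show "d k t q = d k t q'" if "k \<ge> 1" "types k q = types k q'" for k t q q'
      using A.coef_types[OF that] B.coef_types[OF that] by (simp add: d_def)
    show "(\<lambda>s. C k s q) \<in> borel_measurable borel" for k q
      unfolding C_def by (intro borel_measurable_diff A.Col_measurable B.Col_measurable)
    show "F t > 0" for t using V_pos A.f_pos[of t] B.f_pos[of t] by (simp add: F_def)
    show "continuous_on UNIV F" unfolding F_def by (intro continuous_intros f1 f2)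
    show "G t > 0" for t using g1 g2 by (simp add: G_def)
    show "continuous_on UNIV G" unfolding G_def by (intro continuous_intros g1 g2)
  next
    fix k :: nat assume k: "k \<ge> 1"
    show "AE s in lborel. \<forall>q. (\<lambda>N. \<Sum>j=1..k. \<Sum>z\<in>ZN N. sg z / (of_real V)\<^sup>2 * d (k + 1) s (after k j q z)) \<longlonglongrightarrow> C k s q"
      using A.collision_lim[OF k] B.collision_lim[OF k]
    proof eventually_elim
      case (elim s)
      show ?case
        unfolding d_def C_def right_diff_distrib sum_subtractf using elim by (intro allI tendsto_diff) auto
    qed
    fix t q
    have C: "cis (s * Ph k q) * C k s q = cis (s * Ph k q) * Col k (\<gamma> (k + 1) s) q - cis (s * Ph k q) * Col k (\<sigma> (k + 1) s) q" for s
      by (simp add: C_def right_diff_distrib)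
    note I = interval_lebesgue_integral_diff[OF A.duhamel(1)[OF k, of t q] B.duhamel(1)[OF k, of t q]]
    show "interval_lebesgue_integrable lborel (ereal 0) (ereal t) (\<lambda>s. cis (s * Ph k q) * C k s q)"
      unfolding C by (rule I(1))
    show "cis (t * Ph k q) * d k t q = - \<i> * of_real b0 * (LBINT s=ereal 0..ereal t. cis (s * Ph k q) * C k s q)"
      unfolding C I(2) d_def right_diff_distrib A.duhamel(2)[OF k] B.duhamel(2)[OF k] by simp
  next
    fix k :: nat and t assume k: "k \<ge> 1"
    have cc: "countable (cfg {1..k} :: (nat \<Rightarrow> particle) set)" by (rule countable_cfg) simp
    let ?n = "\<lambda>\<gamma> s. wnorm (cfg {1..k}) (Wt \<alpha> k) (Col k (\<gamma> (k + 1) s))"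
    have [measurable]: "?n \<gamma> \<in> borel_measurable borel" "?n \<sigma> \<in> borel_measurable borel"
      using cc A.Col_measurable B.Col_measurable by (auto intro!: wnorm_measurable)
    have n: "wnorm (cfg {1..k}) (Wt \<alpha> k) (C k s) \<le> ?n \<gamma> s + ?n \<sigma> s" for s
    proof -
      let ?H = "\<lambda>b. if b then Col k (\<gamma> (k + 1) s) else Col k (\<sigma> (k + 1) s)"
      have "wnorm (cfg {1..k}) (Wt \<alpha> k) (C k s) \<le> (\<Sum>b\<in>UNIV. wnorm (cfg {1..k}) (Wt \<alpha> k) (?H b))"
        by (rule wnorm_sum[OF cc Wt_nonneg]) (simp_all add: UNIV_bool C_def norm_triangle_ineq4 add.commute)
      then show ?thesis by (simp add: UNIV_bool add.commute)
    qed
    have "(\<integral>\<^sup>+s\<in>{t - G t..t + G t}. wnorm (cfg {1..k}) (Wt \<alpha> k) (C k s) \<partial>lborel)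
      \<le> (\<integral>\<^sup>+s. ?n \<gamma> s * indicator {t - g1 t..t + g1 t} s + ?n \<sigma> s * indicator {t - g2 t..t + g2 t} s \<partial>lborel)"
      using n by (intro nn_integral_mono) (auto simp: indicator_def G_def)
    also have "\<dots> = (\<integral>\<^sup>+s\<in>{t - g1 t..t + g1 t}. ?n \<gamma> s \<partial>lborel) + (\<integral>\<^sup>+s\<in>{t - g2 t..t + g2 t}. ?n \<sigma> s \<partial>lborel)"
      by (rule nn_integral_add; measurable)
    also have "\<dots> \<le> ennreal (real k * V ^ k * f1 t ^ (k + 1)) + ennreal (real k * V ^ k * f2 t ^ (k + 1))"
      by (intro add_mono A.collision_bound B.collision_bound k)
    also have "\<dots> = ennreal (real k * V ^ k * (f1 t ^ (k + 1) + f2 t ^ (k + 1)))"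
      using V_pos A.f_pos[of t] B.f_pos[of t] by (simp add: ennreal_plus[symmetric] distrib_left del: ennreal_plus)
    also have "\<dots> \<le> ennreal (F t ^ (k + 1))"
    proof (rule ennreal_leI)
      have p: "0 < f1 t" "0 < f2 t" "0 < V" using V_pos A.f_pos B.f_pos by auto
      have "real k \<le> 2 ^ k" using of_nat_mono[OF less_imp_le[OF less_exp[of k]], where 'a = real] by simp
      moreover have "V ^ k \<le> (1 + V) ^ (k + 1)"
      proof -
        have "V ^ k \<le> (1 + V) ^ k" using p by (intro power_mono) auto
        also have "\<dots> \<le> (1 + V) ^ (k + 1)" using p by (intro power_increasing) auto
        finally show ?thesis .
      qed
      moreover have "f1 t ^ (k + 1) + f2 t ^ (k + 1) \<le> 2 * (f1 t + f2 t) ^ (k + 1)"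
        using power_mono[of "f1 t" "f1 t + f2 t" "k + 1"] power_mono[of "f2 t" "f1 t + f2 t" "k + 1"] p by linarith
      ultimately have "real k * V ^ k * (f1 t ^ (k + 1) + f2 t ^ (k + 1)) \<le> 2 ^ k * (1 + V) ^ (k + 1) * (2 * (f1 t + f2 t) ^ (k + 1))"
        using p by (intro mult_mono) (auto intro!: add_nonneg_nonneg)
      also have "\<dots> = F t ^ (k + 1)" unfolding F_def power_mult_distrib by simp
      finally show "real k * V ^ k * (f1 t ^ (k + 1) + f2 t ^ (k + 1)) \<le> F t ^ (k + 1)" .
    qed
    finally show "(\<integral>\<^sup>+s\<in>{t - G t..t + G t}. wnorm (cfg {1..k}) (Wt \<alpha> k) (C k s) \<partial>lborel) \<le> ennreal (F t ^ (k + 1))" .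
  qed (use \<alpha> b0 in auto)
  let ?h = "\<lambda>z. \<gamma> k t (fst z) (snd z) - \<sigma> k t (fst z) (snd z)"
  have i: "integrable (PS k) (\<lambda>z. \<gamma> k t (fst z) (snd z))" "integrable (PS k) (\<lambda>z. \<sigma> k t (fst z) (snd z))"
    using A.density[OF k, of t] B.density[OF k, of t] by (simp_all add: density_matrix_def case_prod_beta')
  interpret N: null_coefficients \<theta>1 \<theta>2 k ?h
  proof
    show "integrable (PS k) ?h" using i by simp
    show "(\<integral>z. ?h z * ch k q z \<partial>PS k) = 0" for q
      using H.global_uniqueness[OF k, of t q] integrable_chr_mult[OF i(1)] integrable_chr_mult[OF i(2)]
      by (simp add: d_def coef_chr left_diff_distrib)
  qed
  show ?thesis using N.null_AE by eventually_elim simp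
qed

lemma class_A_GP_class:
  assumes "torus_params \<theta>1 \<theta>2" "GP_solution \<theta>1 \<theta>2 b0 \<gamma>0 \<gamma>" "\<gamma> \<in> class_A \<theta>1 \<theta>2 \<alpha>"
  obtains f g where "GP_class \<theta>1 \<theta>2 b0 \<alpha> \<gamma>0 \<gamma> f g" "continuous_on UNIV f" "continuous_on UNIV g" "\<And>t. g t > 0"
proof -
  obtain f g :: "real \<Rightarrow> real" where fg: "continuous_on UNIV f" "continuous_on UNIV g" "\<And>t. f t > 0" "\<And>t. g t > 0"
    and bound: "\<And>t k j. k \<ge> 1 \<Longrightarrow> j \<in> {1..k} \<Longrightarrow>
      (\<integral>\<^sup>+s\<in>{t - g t..t + g t}. L2_norm \<theta>1 \<theta>2 k (S_op k \<alpha> (collision \<theta>1 \<theta>2 k j (\<gamma> (k + 1) s))) \<partial>lborel) \<le> ennreal (f t ^ (k + 1))"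
    using assms(3) unfolding class_A_def by blast
  have sym: "\<gamma> k t (x \<circ> \<sigma>) (x' \<circ> \<sigma>) = \<gamma> k t x x'"
    if "k \<ge> 1" "x \<in> space (torus_power \<theta>1 \<theta>2 k)" "x' \<in> space (torus_power \<theta>1 \<theta>2 k)" "\<sigma> permutes {1..k}" for k t x x' \<sigma>
    using assms(3) that unfolding class_A_def by blast
  have "GP_class \<theta>1 \<theta>2 b0 \<alpha> \<gamma>0 \<gamma> f g"
    using assms(1,2) fg(3) sym bound by (intro GP_class.intro GP_class_axioms.intro)
  then show thesis using fg that by blast
qed

theorem theorem1:
  fixes \<theta>1 \<theta>2 b0 \<alpha> :: real
    and \<gamma>0 :: "nat \<Rightarrow> density"
    and \<gamma> \<sigma> :: "nat \<Rightarrow> real \<Rightarrow> density"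
  assumes "\<theta>1 > 0" and "\<theta>2 > 0" and "b0 \<noteq> 0" and "\<alpha> > 1 / 2"
    and "GP_solution \<theta>1 \<theta>2 b0 \<gamma>0 \<gamma>" and "\<gamma> \<in> class_A \<theta>1 \<theta>2 \<alpha>"
    and "GP_solution \<theta>1 \<theta>2 b0 \<gamma>0 \<sigma>" and "\<sigma> \<in> class_A \<theta>1 \<theta>2 \<alpha>"
  shows "\<forall>k\<ge>1. \<forall>t. AE z in phase_space \<theta>1 \<theta>2 k. \<gamma> k t (fst z) (snd z) = \<sigma> k t (fst z) (snd z)"
proof -
  interpret torus_params \<theta>1 \<theta>2 using assms by unfold_locales
  obtain f1 g1 where 1: "GP_class \<theta>1 \<theta>2 b0 \<alpha> \<gamma>0 \<gamma> f1 g1" "continuous_on UNIV f1" "continuous_on UNIV g1" "\<And>t. g1 t > 0"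
    using class_A_GP_class[OF torus_params_axioms assms(5,6)] by blast
  obtain f2 g2 where 2: "GP_class \<theta>1 \<theta>2 b0 \<alpha> \<gamma>0 \<sigma> f2 g2" "continuous_on UNIV f2" "continuous_on UNIV g2" "\<And>t. g2 t > 0"
    using class_A_GP_class[OF torus_params_axioms assms(7,8)] by blast
  show ?thesis
    using uniqueness[OF 1(1) 2(1) 1(2) 2(2) 1(3,4) 2(3,4) assms(4,3)] by blast
qed

end
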